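(* Let $u=u(x,t)$ be a smooth solution of the incompressible Euler equations in the exterior domain $\Omega^c$ (as described in the context) with compactly supported vorticity, let $\alpha$ be the coefficient of its harmonic part, and let $v(x,t)=u(x,t)-\alpha H_{\Omega^c}(x)$. Then the generalized energy $$E=\int_{\Omega^c}\bigl(|v|^2+2\alpha H_{\Omega^c}\cdot v\bigr)\,dx$$ is a constant of motion, i.e. it does not depend on $t\ge 0$.
   Context: Let $\Gamma\subset\mathbb{R}^2$ be a smooth Jordan curve, $\Omega$ the bounded and $\Omega^c$ the unbounded connected component of $\mathbb{R}^2\setminus\Gamma$ (both open), and $\hat n$ the unit normal on $\Gamma$ exterior to $\Omega^c$. The Euler equations in $\Omega^c$ are: $u_t+u\cdot\nabla u=-\nabla p$ in $\Omega^c\times(0,\infty)$, $\operatorname{div}u=0$ in $\Omega^c\times[0,\infty)$, $u\cdot\hat n=0$ on $\Gamma\times[0,\infty)$, $\lim_{|x|\to\infty}u(x,t)=0$ for all $t\ge0$, $u(\cdot,0)=u_0$, where $p$ is the scalar pressure. The vorticity is $\omega=\operatorname{curl}u=\partial_1u_2-\partial_2u_1$. Identify $\mathbb{R}^2$ with $\mathbb{C}$. There is a conformal (biholomorphic) map $T:\Omega^c\to\{|z|>1\}$, extending continuously to the boundary and mapping $\Gamma$ to the unit circle, with $T(z)=\beta z+h(z)$, $\beta>0$, $h$ bounded holomorphic on $\Omega^c$; it satisfies $|h'(z)|\le C/|z|^2$, $|h''(z)|\le C/|z|^3$, and $DT$, $DT^{-1}$ are bounded. With $z^*=z/|z|^2$,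 $\nabla^\perp=(-\partial_2,\partial_1)$, the Green's function of $\Omega^c$ is $G_{\Omega^c}(x,y)=\frac1{2\pi}\log\frac{|T(x)-T(y)|}{|T(x)-T(y)^*||T(y)|}$, and $H_{\Omega^c}(x)=\frac1{2\pi}\nabla^\perp\log|T(x)|$ is the unique divergence-free, curl-free vector field tangent to $\Gamma$, vanishing at infinity, with counterclockwise circulation $1$ around $\Gamma$. The velocity decomposes as $u=\nabla^\perp\psi+\alpha H_{\Omega^c}$ with $\psi(x,t)=\int_{\Omega^c}G_{\Omega^c}(x,y)\omega(y,t)\,dy$ and $\alpha=\int_\Gamma u_0\cdot ds+\int_{\Omega^c}\omega(x,0)\,dx$ (counterclockwise circulation), which is constant in time. Thus $v=\nabla^\perp\psi$; one has $v=O(|x|^{-2})$ and $H_{\Omega^c}=O(|x|^{-1})$ as $|x|\to\infty$ for each $t$, so $E$ is finite. *)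

theory Defs
  imports "HOL-Complex_Analysis.Complex_Analysis"
begin

text \<open>The plane \<open>\<real>\<^sup>2\<close> is identified with the type \<^typ>\<open>complex\<close> (with its real inner product and with
  \<^const>\<open>lborel\<close> as two-dimensional Lebesgue measure). A time-dependent field \<open>u\<close> is curried as
  \<open>u t x\<close>.\<close>

subsection \<open>Smoothness\<close>

text \<open>\<open>C\<^sup>k\<close> and \<open>C\<^sup>\<infinity>\<close> on an open subset of a finite-dimensional space, through iterated directional
  derivatives.\<close>

primrec Ck_on :: "nat \<Rightarrow> ('a::euclidean_space \<Rightarrow> 'b::euclidean_space) \<Rightarrow> 'a set \<Rightarrow> bool" where
  "Ck_on 0 f S \<longleftrightarrow> continuous_on S f"
| "Ck_on (Suc k) f S \<longleftrightarrow> (\<forall>x\<in>S. f differentiable (at x)) \<and>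
     (\<forall>v. Ck_on k (\<lambda>x. frechet_derivative f (at x) v) S)"

definition smooth_on :: "('a::euclidean_space \<Rightarrow> 'b::euclidean_space) \<Rightarrow> 'a set \<Rightarrow> bool" where
  "smooth_on f S \<longleftrightarrow> (\<forall>k. Ck_on k f S)"

text \<open>Smoothness on a set that need not be open (here: up to the boundary and up to \<open>t = 0\<close>) means that
  there is a smooth extension to an open neighbourhood.\<close>

definition smooth_up_to :: "('a::euclidean_space \<Rightarrow> 'b::euclidean_space) \<Rightarrow> 'a set \<Rightarrow> bool" where
  "smooth_up_to f K \<longleftrightarrow>
     (\<exists>U g. open U \<and> K \<subseteq> U \<and> smooth_on g U \<and> (\<forall>x\<in>K. g x = f x))"


subsection \<open>Planar differential operators\<close>

definition partial1 :: "(complex \<Rightarrow> 'b::real_normed_vector) \<Rightarrow> complex \<Rightarrow> 'b" where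
  "partial1 f x = frechet_derivative f (at x) 1"

definition partial2 :: "(complex \<Rightarrow> 'b::real_normed_vector) \<Rightarrow> complex \<Rightarrow> 'b" where
  "partial2 f x = frechet_derivative f (at x) \<i>"

definition grad :: "(complex \<Rightarrow> real) \<Rightarrow> complex \<Rightarrow> complex" where
  "grad f x = Complex (partial1 f x) (partial2 f x)"

definition perp_grad :: "(complex \<Rightarrow> real) \<Rightarrow> complex \<Rightarrow> complex" where
  "perp_grad f x = Complex (- partial2 f x) (partial1 f x)"

definition divergence :: "(complex \<Rightarrow> complex) \<Rightarrow> complex \<Rightarrow> real" where
  "divergence w x = Re (partial1 w x) + Im (partial2 w x)"

definition curl :: "(complex \<Rightarrow> complex) \<Rightarrow> complex \<Rightarrow> real" where
  "curl w x = Im (partial1 w x) - Re (partial2 w x)"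


subsection \<open>The exterior domain\<close>

text \<open>A smooth Jordan curve is given by a regular, 1-periodic parametrization, traversed
  counterclockwise.\<close>

definition smooth_jordan_curve :: "(real \<Rightarrow> complex) \<Rightarrow> bool" where
  "smooth_jordan_curve \<gamma> \<longleftrightarrow>
     simple_path \<gamma> \<and> (\<forall>s. \<gamma> (s + 1) = \<gamma> s) \<and>
     smooth_on \<gamma> UNIV \<and> (\<forall>s. vector_derivative \<gamma> (at s) \<noteq> 0) \<and>
     (\<forall>z\<in>inside (path_image \<gamma>). winding_number \<gamma> z = 1)"

abbreviation exterior :: "(real \<Rightarrow> complex) \<Rightarrow> complex set" where
  "exterior \<gamma> \<equiv> outside (path_image \<gamma>)"

text \<open>For a counterclockwise curve the left normal points into the bounded component, that is, out of
  \<^term>\<open>exterior \<gamma>\<close>.\<close>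

definition unit_normal :: "(real \<Rightarrow> complex) \<Rightarrow> real \<Rightarrow> complex" where
  "unit_normal \<gamma> s = sgn (\<i> * vector_derivative \<gamma> (at s))"

text \<open>The decay conditions on \<open>h'\<close> and \<open>h''\<close> are written multiplicatively because the origin may belong to
  \<^term>\<open>exterior \<gamma>\<close>, where division by \<open>0\<close> would make them too strong.\<close>

definition exterior_conformal_map :: "(real \<Rightarrow> complex) \<Rightarrow> (complex \<Rightarrow> complex) \<Rightarrow> bool" where
  "exterior_conformal_map \<gamma> T \<longleftrightarrow>
     T holomorphic_on exterior \<gamma> \<and>
     bij_betw T (exterior \<gamma>) {z. cmod z > 1} \<and>
     inv_into (exterior \<gamma>) T holomorphic_on {z. cmod z > 1} \<and>
     continuous_on (closure (exterior \<gamma>)) T \<and>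
     T ` path_image \<gamma> = sphere 0 1 \<and>
     (\<exists>\<beta>>0. \<exists>h. h holomorphic_on exterior \<gamma> \<and> bounded (h ` exterior \<gamma>) \<and>
        (\<forall>z\<in>exterior \<gamma>. T z = complex_of_real \<beta> * z + h z) \<and>
        (\<exists>C. \<forall>z\<in>exterior \<gamma>. cmod z ^ 2 * cmod (deriv h z) \<le> C \<and>
                            cmod z ^ 3 * cmod (deriv (deriv h) z) \<le> C)) \<and>
     bounded (deriv T ` exterior \<gamma>) \<and>
     bounded (deriv (inv_into (exterior \<gamma>) T) ` {z. cmod z > 1})"

definition harmonic_field :: "(complex \<Rightarrow> complex) \<Rightarrow> complex \<Rightarrow> complex" where
  "harmonic_field T x = (1 / (2 * pi)) *\<^sub>R perp_grad (\<lambda>y. ln (cmod (T y))) x"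


subsection \<open>Euler flows in the exterior domain\<close>

definition smooth_euler_solution ::
    "(real \<Rightarrow> complex) \<Rightarrow> (real \<Rightarrow> complex \<Rightarrow> complex) \<Rightarrow> (real \<Rightarrow> complex \<Rightarrow> real) \<Rightarrow> bool" where
  "smooth_euler_solution \<gamma> u p \<longleftrightarrow>
     smooth_up_to (\<lambda>(x, t). u t x) (closure (exterior \<gamma>) \<times> {0..}) \<and>
     smooth_on (\<lambda>(x, t). p t x) (exterior \<gamma> \<times> {0<..}) \<and>
     (\<forall>t>0. \<forall>x\<in>exterior \<gamma>.
        vector_derivative (\<lambda>\<tau>. u \<tau> x) (at t) + frechet_derivative (u t) (at x) (u t x)
          = - grad (p t) x) \<and>
     (\<forall>t\<ge>0. \<forall>x\<in>exterior \<gamma>. divergence (u t) x = 0) \<and>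
     (\<forall>t\<ge>0. \<forall>s. u t (\<gamma> s) \<bullet> unit_normal \<gamma> s = 0) \<and>
     (\<forall>t\<ge>0. (u t \<longlongrightarrow> 0) at_infinity)"

text \<open>The support may touch the boundary curve; only its boundedness matters.\<close>

definition compactly_supported_vorticity ::
    "(real \<Rightarrow> complex) \<Rightarrow> (real \<Rightarrow> complex \<Rightarrow> complex) \<Rightarrow> bool" where
  "compactly_supported_vorticity \<gamma> u \<longleftrightarrow>
     (\<forall>t\<ge>0. compact (closure {x \<in> exterior \<gamma>. curl (u t) x \<noteq> 0}))"

definition circulation :: "(real \<Rightarrow> complex) \<Rightarrow> (complex \<Rightarrow> complex) \<Rightarrow> real" where
  "circulation \<gamma> w = integral {0..1} (\<lambda>s. w (\<gamma> s) \<bullet> vector_derivative \<gamma> (at s))"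

definition harmonic_coeff :: "(real \<Rightarrow> complex) \<Rightarrow> (real \<Rightarrow> complex \<Rightarrow> complex) \<Rightarrow> real" where
  "harmonic_coeff \<gamma> u = circulation \<gamma> (u 0) + (LINT x:exterior \<gamma>|lborel. curl (u 0) x)"

definition energy_density ::
    "(real \<Rightarrow> complex) \<Rightarrow> (complex \<Rightarrow> complex) \<Rightarrow> (real \<Rightarrow> complex \<Rightarrow> complex) \<Rightarrow> real \<Rightarrow> complex \<Rightarrow> real" where
  "energy_density \<gamma> T u t x =
     (let \<alpha> = harmonic_coeff \<gamma> u; v = u t x - \<alpha> *\<^sub>R harmonic_field T x
      in (norm v)\<^sup>2 + 2 * \<alpha> * (harmonic_field T x \<bullet> v))"

definition generalized_energy ::
    "(real \<Rightarrow> complex) \<Rightarrow> (complex \<Rightarrow> complex) \<Rightarrow> (real \<Rightarrow> complex \<Rightarrow> complex) \<Rightarrow> real \<Rightarrow> real" where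
  "generalized_energy \<gamma> T u t = (LINT x:exterior \<gamma>|lborel. energy_density \<gamma> T u t x)"

end

theory Submission
  imports Defs "HOL-Real_Asymp.Real_Asymp"
begin

text \<open>Write \<open>u = v + \<alpha> H\<close>. Since \<open>|v|\<^sup>2 + 2 \<alpha> H \<bullet> v = |u|\<^sup>2 - \<alpha>\<^sup>2 |H|\<^sup>2\<close> and \<open>H\<close> does not depend on time,
  formally \<open>dE/dt\<close> is the integral of \<open>2 u \<bullet> u\<^sub>t\<close>. In terms of the Bernoulli function
  \<open>B = p + |u|\<^sup>2 / 2\<close> the Euler equations say that \<open>u\<^sub>t + \<nabla>B\<close> is \<open>\<omega>\<close> times a field orthogonal to \<open>u\<close>;
  hence \<open>u \<bullet> u\<^sub>t = - u \<bullet> \<nabla>B\<close>. As \<open>u\<close> is divergence-free and tangent to the curve, only a flux through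
  infinity can contribute to the integral. It is controlled by cutting off: let \<open>E\<^sub>\<rho>\<close> be the energy
  weighted with a radial bump that is 1 for \<open>|x| \<le> \<rho>\<close> and 0 for \<open>|x| \<ge> 2 \<rho>\<close>. Its time derivative is
  twice the integral of \<open>(B - const) u \<bullet> \<nabla>bump\<close> over the annulus between. Beyond the vorticity
  \<open>\<nabla>B = - u\<^sub>t = O(1/|x|)\<close>, so \<open>B\<close> oscillates there by \<open>O(1)\<close>; the radial velocity is \<open>O(1/|x|\<^sup>2)\<close>, the
  slope of the bump \<open>O(1/\<rho>)\<close> and the area \<open>O(\<rho>\<^sup>2)\<close>. So \<open>E\<^sub>\<rho>\<close> changes by \<open>O(1/\<rho>)\<close> on a bounded time
  interval (\<open>E_loc_derivative_bound\<close>), and \<open>\<rho> \<rightarrow> \<infinity>\<close> gives the claim.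

  Boundary. The pressure is smooth only in the open domain, so the flux through the curve is not an
  integral over the curve of known functions. \<open>tangential_integral\<close> avoids it: the potential
  \<open>\<Theta>(x) = \<integral> |x - \<gamma>(s)|\<^sup>-\<^sup>2 ds\<close> blows up on the curve, while for a Lipschitz field \<open>u\<close> that is tangent
  to the curve \<open>|u \<bullet> \<nabla>\<Theta>| \<le> C \<Theta>\<close>. A cutoff that is a function of \<open>\<Theta> / n\<close> thus vanishes near the curve,
  but has \<open>u\<close>-derivative bounded independently of \<open>n\<close>, and dominated convergence applies.

  Far field. Outside the support of the vorticity \<open>cnj u\<close> is holomorphic, and it vanishes at infinity,
  so that it has an expansion \<open>c / z + O(1/|z|\<^sup>2)\<close> in which all constants are bounded by the values on
  one circle (\<open>exterior_expansion\<close>). Green's theorem (\<open>Green_winding\<close>) identifies \<open>2 \<pi> i c\<close> with the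
  circulation around the curve plus the total vorticity (\<open>far_circulation\<close>); this is constant in time
  because \<open>u\<^sub>t = - \<nabla>B\<close> integrates to 0 over a large circle (\<open>circulation_conserved\<close>). The field \<open>\<alpha> H\<close>
  has the same coefficient, and \<open>far_field_estimates\<close> follows.

  Uniformity in time. For these bounds the vorticity must stay in one disc during \<open>0 \<le> t \<le> T\<^sub>0\<close>,
  whereas the hypothesis bounds its support at each time separately. The missing uniformity is
  \<open>vorticity_support_locally_bounded\<close>. By a maximum principle along characteristics and by the
  Cauchy--Pompeiu formula the speed grows at most linearly with the radius of the support, so a bound
  at one time propagates, with a constant that does not depend on the bound assumed in between
  (\<open>support_a_priori\<close>). Baire's theorem, applied to the closed set of times near which the support is
  not locally bounded, supplies a starting point for this propagation and empties the set.\<close>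

section \<open>Continuously differentiable functions and the divergence theorem on the whole space\<close>

text \<open>The derivative is carried as an explicit argument, so that product and chain rules give it in closed
  form and integrands need no differentiation operator.\<close>
definition C1_on :: "('a::euclidean_space \<Rightarrow> 'b::euclidean_space) \<Rightarrow> ('a \<Rightarrow> 'a \<Rightarrow> 'b) \<Rightarrow> 'a set \<Rightarrow> bool" where
  "C1_on f D S \<longleftrightarrow> (\<forall>x\<in>S. (f has_derivative D x) (at x)) \<and> (\<forall>v. continuous_on S (\<lambda>x. D x v))"

lemma C1_onD: "C1_on f D S \<Longrightarrow> x \<in> S \<Longrightarrow> (f has_derivative D x) (at x)"
  by (simp add: C1_on_def)

lemma C1_on_cont_deriv: "C1_on f D S \<Longrightarrow> continuous_on S (\<lambda>x. D x v)"
  by (simp add: C1_on_def)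

lemma C1_on_continuous: "C1_on f D S \<Longrightarrow> continuous_on S f"
  by (meson C1_onD continuous_at_imp_continuous_on has_derivative_continuous)

lemma C1_on_subset: "C1_on f D S \<Longrightarrow> T \<subseteq> S \<Longrightarrow> C1_on f D T"
  by (auto simp: C1_on_def intro: continuous_on_subset)

lemma C1_on_const [intro]: "C1_on (\<lambda>x. c) (\<lambda>x v. 0) S"
  by (auto simp: C1_on_def)

lemma C1_on_linear: "bounded_linear L \<Longrightarrow> C1_on L (\<lambda>x. L) S"
  by (auto simp: C1_on_def bounded_linear_imp_has_derivative)

lemma C1_on_linear_comp:
  assumes "bounded_linear L" "C1_on f D S"
  shows "C1_on (\<lambda>x. L (f x)) (\<lambda>x v. L (D x v)) S"
  using assms unfolding C1_on_def
  by (metis bounded_linear.has_derivative bounded_linear.continuous_on)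

lemma C1_on_add:
  "C1_on f D S \<Longrightarrow> C1_on g E S \<Longrightarrow> C1_on (\<lambda>x. f x + g x) (\<lambda>x v. D x v + E x v) S"
  by (auto simp: C1_on_def intro!: has_derivative_add continuous_intros)

lemma C1_on_diff:
  "C1_on f D S \<Longrightarrow> C1_on g E S \<Longrightarrow> C1_on (\<lambda>x. f x - g x) (\<lambda>x v. D x v - E x v) S"
  by (auto simp: C1_on_def intro!: has_derivative_diff continuous_intros)

lemma C1_on_bilinear:
  assumes "bounded_bilinear B" "C1_on f D S" "C1_on g E S"
  shows "C1_on (\<lambda>x. B (f x) (g x)) (\<lambda>x v. B (f x) (E x v) + B (D x v) (g x)) S"
  unfolding C1_on_def
proof (intro conjI ballI allI)
  fix x assume "x \<in> S"
  then show "((\<lambda>x. B (f x) (g x)) has_derivative (\<lambda>v. B (f x) (E x v) + B (D x v) (g x))) (at x)"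
    by (intro bounded_bilinear.FDERIV[OF assms(1)] C1_onD[OF assms(2)] C1_onD[OF assms(3)])
next
  fix v
  show "continuous_on S (\<lambda>x. B (f x) (E x v) + B (D x v) (g x))"
    by (intro continuous_on_add bounded_bilinear.continuous_on[OF assms(1)]
        C1_on_continuous[OF assms(2)] C1_on_continuous[OF assms(3)]
        C1_on_cont_deriv[OF assms(2)] C1_on_cont_deriv[OF assms(3)])
qed

lemmas C1_on_scaleR = C1_on_bilinear[OF bounded_bilinear_scaleR]
lemmas C1_on_mult = C1_on_bilinear[OF bounded_bilinear_mult]
lemmas C1_on_inner = C1_on_bilinear[OF bounded_bilinear_inner]

lemma C1_on_real_comp:
  fixes f :: "'a::euclidean_space \<Rightarrow> real"
  assumes f: "C1_on f D S"
    and h: "\<And>x. x \<in> S \<Longrightarrow> (h has_real_derivative h' (f x)) (at (f x))"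
    and c: "continuous_on (f ` S) h'"
  shows "C1_on (\<lambda>x. h (f x)) (\<lambda>x v. h' (f x) * D x v) S"
  unfolding C1_on_def
proof (intro conjI ballI allI)
  fix x assume x: "x \<in> S"
  show "((\<lambda>x. h (f x)) has_derivative (\<lambda>v. h' (f x) * D x v)) (at x)"
    using has_derivative_compose[OF C1_onD[OF f x], of h "(*) (h' (f x))"] h[OF x]
    by (simp add: has_field_derivative_def)
next
  fix v
  have "continuous_on S (\<lambda>x. h' (f x))"
    using continuous_on_compose[OF C1_on_continuous[OF f] c] by (simp add: o_def)
  then show "continuous_on S (\<lambda>x. h' (f x) * D x v)"
    by (intro continuous_on_mult C1_on_cont_deriv[OF f])
qed

text \<open>Differentiability at a point outside \<open>S\<close> holds because the closed set \<open>K\<close> stays away from it, so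
  that the extension vanishes in a neighbourhood.\<close>
lemma C1_on_extend_zero:
  assumes f: "C1_on f D S" and S: "open S" and K: "closed K" "K \<subseteq> S"
    and z: "\<And>x. x \<in> S - K \<Longrightarrow> f x = 0"
  shows "C1_on (\<lambda>x. if x \<in> S then f x else 0) (\<lambda>x v. if x \<in> S then D x v else 0) UNIV"
proof -
  let ?f = "\<lambda>x. if x \<in> S then f x else 0"
  let ?D = "\<lambda>x v. if x \<in> S then D x v else 0"
  have d1: "(?f has_derivative ?D x) (at x)" if "x \<in> S" for x
    using has_derivative_transform_within_open[OF C1_onD[OF f that] S that, of ?f] that by simp
  have oK: "open (-K)" using K by auto
  have d2: "(?f has_derivative (\<lambda>v. 0)) (at x)" if "x \<in> -K" for x
    by (rule has_derivative_transform_within_open[OF has_derivative_const[of 0] oK that])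
      (use z in auto)
  have D0: "?D x = (\<lambda>v. 0)" if "x \<in> -K" for x
  proof (cases "x \<in> S")
    case True
    then show ?thesis using has_derivative_unique[OF d1 d2, of x] that by simp
  qed auto
  have "(?f has_derivative ?D x) (at x)" for x
    using d1[of x] d2[of x] D0[of x] K by (cases "x \<in> S") auto
  moreover have "continuous_on UNIV (\<lambda>x. ?D x v)" for v
  proof -
    have "continuous_on S (\<lambda>x. ?D x v)"
      using C1_on_cont_deriv[OF f, of v] by (rule continuous_on_eq) auto
    moreover have "continuous_on (-K) (\<lambda>x. ?D x v)"
      by (rule continuous_on_eq[where f="\<lambda>x. 0"]) (use D0[THEN fun_cong, of _ v] in auto)
    ultimately have "continuous_on (S \<union> -K) (\<lambda>x. ?D x v)"
      using S oK by (intro continuous_on_open_Un)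
    moreover have "S \<union> -K = UNIV" using K by auto
    ultimately show ?thesis by simp
  qed
  ultimately show ?thesis by (simp add: C1_on_def)
qed

lemma integrable_continuous_bounded_support:
  fixes g :: "'a::euclidean_space \<Rightarrow> 'b::euclidean_space"
  assumes "continuous_on UNIV g" "\<And>x. norm x > r \<Longrightarrow> g x = 0"
  shows "integrable lborel g"
proof -
  have "integrable lborel (\<lambda>x. indicator (cball 0 r) x *\<^sub>R g x)"
    using borel_integrable_compact[of "cball 0 r" g] assms(1)
    by (auto intro: continuous_on_subset)
  moreover have "(\<lambda>x. indicator (cball 0 r) x *\<^sub>R g x) = g"
    using assms(2) by (auto simp: fun_eq_iff indicator_def)
  ultimately show ?thesis by simp
qed

lemma bounded_continuous_bounded_support:
  fixes g :: "'a::euclidean_space \<Rightarrow> 'b::real_normed_vector"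
  assumes "continuous_on UNIV g" "\<And>x. norm x > r \<Longrightarrow> g x = 0"
  obtains B where "B \<ge> 0" "\<And>x. norm (g x) \<le> B"
proof -
  have "bounded (g ` cball 0 r)"
    by (intro compact_imp_bounded compact_continuous_image continuous_on_subset[OF assms(1)]) auto
  then obtain B where B: "\<And>x. x \<in> cball 0 r \<Longrightarrow> norm (g x) \<le> B"
    unfolding bounded_iff by blast
  have "norm (g x) \<le> max B 0" for x
    using B[of x] assms(2)[of x] by (cases "norm x \<le> r") auto
  then show ?thesis by (intro that[of "max B 0"]) auto
qed

lemma integral_lborel_shift:
  fixes g :: "'a::euclidean_space \<Rightarrow> 'b::{banach, second_countable_topology}"
  assumes "g \<in> borel_measurable borel"
  shows "(LINT x|lborel. g (v + x)) = (LINT x|lborel. g x)"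
proof -
  have "(lborel :: 'a measure) = distr lborel borel ((+) v)"
    using lborel_affine[of 1 v] by (simp add: density_1)
  then have "(LINT x|lborel. g x) = (LINT x|distr lborel borel ((+) v). g x)"
    by simp
  also have "\<dots> = (LINT x|lborel. g (v + x))"
    using assms by (subst integral_distr) auto
  finally show ?thesis by simp
qed

lemma C1_on_deriv_zero_outside:
  assumes "C1_on f D UNIV" "\<And>x. norm x > r \<Longrightarrow> f x = 0" "norm x > r"
  shows "D x v = 0"
proof -
  have "open {x::'a. norm x > r}"
    using open_Collect_less[of "\<lambda>x. r" norm] by (simp add: continuous_on_norm)
  then have "(f has_derivative (\<lambda>v. 0)) (at x)"
    by (rule has_derivative_transform_within_open[OF has_derivative_const[of 0]])
       (use assms in auto)
  then show ?thesis
    using has_derivative_unique[OF C1_onD[OF assms(1)], of x] by (metis UNIV_I)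
qed

lemma C1_on_diff_bound:
  fixes f :: "'a::euclidean_space \<Rightarrow> 'b::euclidean_space"
  assumes f: "C1_on f D UNIV" and B: "\<And>x. norm (D x v) \<le> B"
  shows "norm (f (x + h *\<^sub>R v) - f x) \<le> B * \<bar>h\<bar>"
proof -
  have "((\<lambda>t. f (x + t *\<^sub>R v)) has_derivative (\<lambda>t. t *\<^sub>R D (x + s *\<^sub>R v) v)) (at s within UNIV)" for s
  proof -
    have d: "(f has_derivative D (x + s *\<^sub>R v)) (at (x + s *\<^sub>R v))" using C1_onD[OF f] by auto
    have "((\<lambda>t. x + t *\<^sub>R v) has_derivative (\<lambda>t. t *\<^sub>R v)) (at s)"
      by (auto intro!: derivative_eq_intros)
    from has_derivative_compose[OF this d]
    show ?thesis using linear_scale[OF has_derivative_linear[OF d]] by simp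
  qed
  from differentiable_bound[OF convex_UNIV this, of B h 0]
  show ?thesis using B by (auto simp: onorm_scaleR_left onorm_id bounded_linear_ident)
qed

text \<open>The only form of the divergence theorem used below. It is a consequence of translation invariance:
  the difference quotients of \<open>f\<close> in direction \<open>v\<close> have integral 0, and they converge boundedly to
  \<open>D x v\<close>.\<close>
lemma integral_derivative_bounded_support:
  fixes f :: "'a::euclidean_space \<Rightarrow> 'b::euclidean_space"
  assumes f: "C1_on f D UNIV" and r: "\<And>x. norm x > r \<Longrightarrow> f x = 0"
  shows "integrable lborel (\<lambda>x. D x v)" "(LINT x|lborel. D x v) = 0"
proof -
  have D0: "D x v = 0" if "norm x > r" for x using C1_on_deriv_zero_outside[OF f r that] .
  show int: "integrable lborel (\<lambda>x. D x v)"
    by (rule integrable_continuous_bounded_support[OF C1_on_cont_deriv[OF f] D0])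
  obtain B where B: "B \<ge> 0" "\<And>x. norm (D x v) \<le> B"
    using bounded_continuous_bounded_support[OF C1_on_cont_deriv[OF f] D0] by metis
  have meas: "f \<in> borel_measurable borel"
    by (intro borel_measurable_continuous_onI C1_on_continuous[OF f])
  define h where "h k = 1 / real (Suc k)" for k
  have h: "0 < h k" "h k \<le> 1" for k by (auto simp: h_def)
  have h0: "h \<longlonglongrightarrow> 0" unfolding h_def by (rule LIMSEQ_Suc[OF lim_inverse_n'])
  define q where "q k x = (1 / h k) *\<^sub>R (f (x + h k *\<^sub>R v) - f x)" for k and x :: 'a
  have fi: "integrable lborel f"
    by (rule integrable_continuous_bounded_support[OF C1_on_continuous[OF f] r])
  have q0: "(LINT x|lborel. q k x) = 0" for k
  proof -
    have sh: "(LINT x|lborel. f (x + h k *\<^sub>R v)) = (LINT x|lborel. f x)"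
      using integral_lborel_shift[OF meas, of "h k *\<^sub>R v"] by (simp add: add.commute)
    have "integrable lborel (\<lambda>x. f (x + h k *\<^sub>R v))"
    proof (rule integrable_continuous_bounded_support[where r="r + norm v"])
      show "continuous_on UNIV (\<lambda>x. f (x + h k *\<^sub>R v))"
        by (rule continuous_on_compose2[OF C1_on_continuous[OF f]]) (auto intro!: continuous_intros)
      fix x :: 'a assume "norm x > r + norm v"
      moreover have "norm (h k *\<^sub>R v) \<le> norm v" using h[of k] by (auto simp: mult_left_le_one_le)
      ultimately show "f (x + h k *\<^sub>R v) = 0"
        using norm_triangle_ineq4[of "x + h k *\<^sub>R v" "h k *\<^sub>R v"] by (intro r) simp
    qed
    then show ?thesis unfolding q_def using fi sh by simp
  qed
  have "(\<lambda>k. LINT x|lborel. q k x) \<longlonglongrightarrow> (LINT x|lborel. D x v)"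
  proof (rule integral_dominated_convergence[where w="\<lambda>x. B * indicator (cball 0 (r + norm v)) x"])
    show "integrable lborel (\<lambda>x. B * indicator (cball (0::'a) (r + norm v)) x)"
      by (intro integrable_mult_right integrable_real_indicator) (auto intro!: emeasure_bounded_finite[unfolded infinity_ennreal_def])
    show "AE x in lborel. (\<lambda>k. q k x) \<longlonglongrightarrow> D x v"
    proof (rule AE_I2)
      fix x
      show "(\<lambda>k. q k x) \<longlonglongrightarrow> D x v"
      proof (cases "v = 0")
        case True
        then show ?thesis using has_derivative_zero_unique[of 0] linear_0[OF has_derivative_linear[OF C1_onD[OF f UNIV_I]]]
          by (simp add: q_def)
      next
        case False
        have hd: "((\<lambda>t. f (x + t *\<^sub>R v)) has_derivative (\<lambda>t. t *\<^sub>R D x v)) (at 0)"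
        proof -
          have d: "(f has_derivative D x) (at (x + 0 *\<^sub>R v))" using C1_onD[OF f, of x] by auto
          have "((\<lambda>t. x + t *\<^sub>R v) has_derivative (\<lambda>t. t *\<^sub>R v)) (at 0)"
            by (auto intro!: derivative_eq_intros)
          from has_derivative_compose[OF this d]
          show ?thesis using linear_scale[OF has_derivative_linear[OF d]]
            by simp
        qed
        have lim: "((\<lambda>t. (1/t) *\<^sub>R (f (x + t *\<^sub>R v) - f x)) \<longlongrightarrow> D x v) (at 0)"
        proof -
          have "((\<lambda>t. norm (f (x + t *\<^sub>R v) - f x - t *\<^sub>R D x v) / norm t) \<longlongrightarrow> 0) (at 0)"
            using hd by (simp add: has_derivative_at)
          moreover have "\<forall>\<^sub>F t in at 0. norm (f (x + t *\<^sub>R v) - f x - t *\<^sub>R D x v) / norm t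
              = norm ((1/t) *\<^sub>R (f (x + t *\<^sub>R v) - f x) - D x v)"
          proof -
            have "norm (f (x + t *\<^sub>R v) - f x - t *\<^sub>R D x v) / norm t
              = norm ((1/t) *\<^sub>R (f (x + t *\<^sub>R v) - f x) - D x v)" if "t \<noteq> 0" for t
            proof -
              have "(1/t) *\<^sub>R (f (x + t *\<^sub>R v) - f x) - D x v = (1/t) *\<^sub>R (f (x + t *\<^sub>R v) - f x - t *\<^sub>R D x v)"
                using that by (simp add: scaleR_right_diff_distrib)
              then show ?thesis by simp
            qed
            then show ?thesis by (auto simp: eventually_at intro!: exI[of _ 1])
          qed
          ultimately have "((\<lambda>t. norm ((1/t) *\<^sub>R (f (x + t *\<^sub>R v) - f x) - D x v)) \<longlongrightarrow> 0) (at 0)"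
            by (rule Lim_transform_eventually)
          then show ?thesis by (simp add: tendsto_norm_zero_iff LIM_zero_iff)
        qed
        have "filterlim h (at 0) sequentially"
          using h0 h(1) by (simp add: filterlim_at) (metis (mono_tags) eventuallyI less_irrefl)
        from filterlim_compose[OF lim this] show ?thesis by (simp add: q_def)
      qed
    qed
    fix k
    show "AE x in lborel. norm (q k x) \<le> B * indicator (cball 0 (r + norm v)) x"
    proof (rule AE_I2)
      fix x
      show "norm (q k x) \<le> B * indicator (cball 0 (r + norm v)) x"
      proof (cases "norm x \<le> r + norm v")
        case True
        then show ?thesis
          using C1_on_diff_bound[OF f B(2), of x "h k"] h[of k] by (simp add: q_def pos_divide_le_eq)
      next
        case False
        moreover have "norm (h k *\<^sub>R v) \<le> norm v" using h[of k] by (auto simp: mult_left_le_one_le)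
        moreover have "norm x > r" using False norm_ge_zero[of v] by linarith
        ultimately have "norm (x + h k *\<^sub>R v) > r" "norm x > r"
          using norm_triangle_ineq4[of "x + h k *\<^sub>R v" "h k *\<^sub>R v"] by simp_all
        then show ?thesis using B(1) by (simp add: q_def r)
      qed
    qed
  qed (use int meas in \<open>auto simp: q_def\<close>)
  then show "(LINT x|lborel. D x v) = 0" by (simp add: q0 LIMSEQ_const_iff)
qed

section \<open>Cutoff functions\<close>

lemma has_real_derivative_max0_sq: "((\<lambda>s::real. (max 0 s)\<^sup>2) has_real_derivative 2 * max 0 s) (at s)"
proof -
  consider "s > 0" | "s < 0" | "s = 0" by linarith
  then show ?thesis
  proof cases
    case 1
    have "((\<lambda>s::real. s\<^sup>2) has_real_derivative 2 * max 0 s) (at s)"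
      using 1 by (auto intro!: derivative_eq_intros)
    then show ?thesis
      by (rule has_field_derivative_transform_within_open[where S="{0<..}"]) (use 1 in auto)
  next
    case 2
    have "((\<lambda>s::real. 0) has_real_derivative 2 * max 0 s) (at s)"
      using 2 by (auto intro!: derivative_eq_intros)
    then show ?thesis
      by (rule has_field_derivative_transform_within_open[where S="{..<0}"]) (use 2 in auto)
  next
    case 3
    have "((\<lambda>h::real. (max 0 h)\<^sup>2 / h) \<longlongrightarrow> 0) (at 0)"
      by (rule Lim_null_comparison[where g="\<lambda>h. \<bar>h\<bar>"])
         (auto intro!: always_eventually tendsto_eq_intros simp: power2_eq_square max_def)
    then show ?thesis using 3 by (simp add: DERIV_def)
  qed
qed

text \<open>A transition from 1 to 0 on the unit interval. Squaring positive parts makes it \<open>C\<^sup>1\<close>, which is all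
  the regularity that one integration by parts needs, and keeps the derivative explicit.\<close>
definition step :: "real \<Rightarrow> real" where
  "step s = (max 0 (1 - (max 0 s)\<^sup>2))\<^sup>2"

definition step' :: "real \<Rightarrow> real" where
  "step' s = - 4 * max 0 (1 - (max 0 s)\<^sup>2) * max 0 s"

lemma step_deriv: "(step has_real_derivative step' s) (at s)"
proof -
  have "((\<lambda>s. 1 - (max 0 s)\<^sup>2) has_real_derivative - (2 * max 0 s)) (at s)"
    using DERIV_diff[OF DERIV_const has_real_derivative_max0_sq, of 1] by simp
  from DERIV_chain2[OF has_real_derivative_max0_sq this]
  show ?thesis by (simp add: step_def[abs_def] step'_def algebra_simps)
qed

lemma continuous_on_step': "continuous_on A step'"
  unfolding step'_def[abs_def] by (intro continuous_intros)

lemma step_le0 [simp]: "s \<le> 0 \<Longrightarrow> step s = 1" by (simp add: step_def)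
lemma step_ge1 [simp]: "s \<ge> 1 \<Longrightarrow> step s = 0"
  using power_mono[of 1 s 2] by (simp add: step_def max_absorb1)
lemma step_bounds: "0 \<le> step s" "step s \<le> 1"
proof -
  have "max 0 (1 - (max 0 s)\<^sup>2) \<le> 1" by simp
  then show "step s \<le> 1" unfolding step_def by (intro power_le_one) auto
qed (simp add: step_def)
lemma step'_zero [simp]: "s \<le> 0 \<Longrightarrow> step' s = 0" "s \<ge> 1 \<Longrightarrow> step' s = 0"
proof -
  show "step' s = 0" if "s \<le> 0" using that by (simp add: step'_def)
  show "step' s = 0" if "s \<ge> 1" using power_mono[of 1 s 2] that by (simp add: step'_def max_absorb1)
qed
lemma abs_step'_le: "\<bar>step' s\<bar> \<le> 4"
proof (cases "0 < s \<and> s < 1")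
  case True
  then have "\<bar>max 0 (1 - (max 0 s)\<^sup>2)\<bar> \<le> 1" "\<bar>max 0 s\<bar> \<le> 1" by auto
  then have "\<bar>max 0 (1 - (max 0 s)\<^sup>2)\<bar> * \<bar>max 0 s\<bar> \<le> 1 * 1" by (intro mult_mono) auto
  then show ?thesis by (simp add: step'_def abs_mult)
next
  case False
  then have "s \<le> 0 \<or> s \<ge> 1" by auto
  then show ?thesis by auto
qed

lemma C1_on_sqdist: "C1_on (\<lambda>x. (norm (x - a))\<^sup>2) (\<lambda>x v. 2 * ((x - a) \<bullet> v)) S"
proof -
  have "C1_on (\<lambda>x. x - a) (\<lambda>x v. v) S"
    using C1_on_diff[OF C1_on_linear[OF bounded_linear_ident] C1_on_const] by simp
  from C1_on_inner[OF this this]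
  have "C1_on (\<lambda>x. (x - a) \<bullet> (x - a)) (\<lambda>x v. (x - a) \<bullet> v + v \<bullet> (x - a)) S" .
  then show ?thesis by (simp add: power2_norm_eq_inner inner_commute)
qed

text \<open>The argument of \<open>step\<close> runs from 0 to 1 while \<open>|x - a|\<close> runs from \<open>r\<close> to \<open>2 r\<close>; being a function of
  the squared distance it is differentiable at the centre too.\<close>
definition bump :: "'a::euclidean_space \<Rightarrow> real \<Rightarrow> 'a \<Rightarrow> real" where
  "bump a r x = step (((norm (x - a))\<^sup>2 - r\<^sup>2) / (3 * r\<^sup>2))"

definition bump' :: "'a::euclidean_space \<Rightarrow> real \<Rightarrow> 'a \<Rightarrow> 'a \<Rightarrow> real" where
  "bump' a r x v = step' (((norm (x - a))\<^sup>2 - r\<^sup>2) / (3 * r\<^sup>2)) * (2 * ((x - a) \<bullet> v) / (3 * r\<^sup>2))"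

lemma C1_on_bump: "C1_on (bump a r) (bump' a r) S"
proof -
  have "C1_on (\<lambda>x. ((norm (x - a))\<^sup>2 - r\<^sup>2) / (3 * r\<^sup>2)) (\<lambda>x v. (2 * ((x - a) \<bullet> v) - 0) / (3 * r\<^sup>2)) S"
    using C1_on_linear_comp[OF bounded_linear_divide[of "3 * r\<^sup>2"] C1_on_diff[OF C1_on_sqdist[of a] C1_on_const[of "r\<^sup>2"]]]
    by simp
  from C1_on_real_comp[OF this step_deriv continuous_on_step']
  show ?thesis by (simp add: bump_def[abs_def] bump'_def[abs_def])
qed

lemma bump_arg:
  assumes "r > 0"
  shows "norm (x - a) \<le> r \<Longrightarrow> ((norm (x - a))\<^sup>2 - r\<^sup>2) / (3 * r\<^sup>2) \<le> 0"
    and "norm (x - a) \<ge> 2 * r \<Longrightarrow> ((norm (x - a))\<^sup>2 - r\<^sup>2) / (3 * r\<^sup>2) \<ge> 1"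
proof -
  show "((norm (x - a))\<^sup>2 - r\<^sup>2) / (3 * r\<^sup>2) \<le> 0" if "norm (x - a) \<le> r"
    using power_mono[of "norm (x - a)" r 2] that assms by (intro divide_nonpos_pos) auto
  show "((norm (x - a))\<^sup>2 - r\<^sup>2) / (3 * r\<^sup>2) \<ge> 1" if "norm (x - a) \<ge> 2 * r"
    using power_mono[of "2 * r" "norm (x - a)" 2] that assms by (simp add: pos_le_divide_eq power_mult_distrib)
qed

lemma bump_eq1: "r > 0 \<Longrightarrow> norm (x - a) \<le> r \<Longrightarrow> bump a r x = 1"
  unfolding bump_def by (intro step_le0 bump_arg)

lemma bump_eq0: "r > 0 \<Longrightarrow> norm (x - a) \<ge> 2 * r \<Longrightarrow> bump a r x = 0"
  unfolding bump_def by (intro step_ge1 bump_arg)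

lemma bump_bounds: "0 \<le> bump a r x" "bump a r x \<le> 1"
  by (simp_all add: bump_def step_bounds)

lemma bump'_zero:
  assumes "r > 0" "norm (x - a) \<le> r \<or> norm (x - a) \<ge> 2 * r"
  shows "bump' a r x v = 0"
  using assms(2) step'_zero(1)[OF bump_arg(1)[OF assms(1), of x a]]
    step'_zero(2)[OF bump_arg(2)[OF assms(1), of x a]]
  unfolding bump'_def by auto

lemma bump'_bound:
  assumes "r > 0"
  shows "\<bar>bump' a r x v\<bar> \<le> 6 * norm v / r"
proof (cases "norm (x - a) < 2 * r")
  case True
  define q where "q = 2 * ((x - a) \<bullet> v) / (3 * r\<^sup>2)"
  have "\<bar>(x - a) \<bullet> v\<bar> \<le> norm (x - a) * norm v" by (rule Cauchy_Schwarz_ineq2)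
  also have "\<dots> \<le> 2 * r * norm v" using True by (intro mult_right_mono) auto
  finally have q: "\<bar>q\<bar> \<le> 4 * r * norm v / (3 * r\<^sup>2)"
    by (simp add: q_def abs_mult divide_right_mono)
  have "\<bar>bump' a r x v\<bar> = \<bar>step' (((norm (x - a))\<^sup>2 - r\<^sup>2) / (3 * r\<^sup>2))\<bar> * \<bar>q\<bar>"
    by (simp add: bump'_def q_def abs_mult)
  also have "\<dots> \<le> 4 * (4 * r * norm v / (3 * r\<^sup>2))"
    by (rule mult_mono[OF abs_step'_le q]) auto
  also have "\<dots> = 16 / 3 * (norm v / r)" using assms by (simp add: power2_eq_square)
  also have "\<dots> \<le> 6 * (norm v / r)" using assms by (intro mult_right_mono) auto
  finally show ?thesis by simp
next
  case False
  then show ?thesis using bump'_zero[of r x a v] assms by simp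
qed

text \<open>Cover \<open>K\<close> by finitely many balls whose doubles lie in \<open>U\<close>; then \<open>1 - \<Prod> (1 - bump)\<close> is the cutoff.\<close>
lemma exists_C1_cutoff:
  fixes K U :: "'a::euclidean_space set"
  assumes K: "compact K" and U: "open U" "K \<subseteq> U"
  obtains \<eta> \<eta>' L where "C1_on \<eta> \<eta>' UNIV" "\<And>x. x \<in> K \<Longrightarrow> \<eta> x = (1::real)"
    "compact L" "L \<subseteq> U" "\<And>x. x \<notin> L \<Longrightarrow> \<eta> x = 0"
proof -
  have "\<exists>r>0. cball x (2 * r) \<subseteq> U" if xK: "x \<in> K" for x
  proof -
    obtain e where "e > 0" "cball x e \<subseteq> U" using open_contains_cball[THEN iffD1, OF U(1)] xK U(2) by (meson subsetD)
    then show ?thesis by (intro exI[of _ "e/2"]) simp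
  qed
  then obtain r where r: "\<And>x. x \<in> K \<Longrightarrow> r x > 0" "\<And>x. x \<in> K \<Longrightarrow> cball x (2 * r x) \<subseteq> U" by metis
  have cov: "K \<subseteq> (\<Union>x\<in>K. ball x (r x))" using r(1) by force
  obtain F where F: "F \<subseteq> K" "finite F" "K \<subseteq> (\<Union>x\<in>F. ball x (r x))"
    by (rule compactE_image[OF K _ cov]) simp_all
  have ind: "\<exists>\<phi> \<phi>'. C1_on \<phi> \<phi>' UNIV \<and> (\<forall>x. \<phi> x = (\<Prod>a\<in>F. 1 - bump a (r a) x))"
    using F(2)
  proof (induction F)
    case empty
    show ?case using C1_on_const[of 1 "UNIV::'a set"] by fastforce
  next
    case (insert a F)
    then obtain \<phi> \<phi>' where \<phi>: "C1_on \<phi> \<phi>' UNIV" "\<forall>x. \<phi> x = (\<Prod>a\<in>F. 1 - bump a (r a) x)" by blast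
    have "C1_on (\<lambda>x. (1 - bump a (r a) x) * \<phi> x) (\<lambda>x v. (1 - bump a (r a) x) * \<phi>' x v + (0 - bump' a (r a) x v) * \<phi> x) UNIV"
      by (rule C1_on_mult[OF C1_on_diff[OF C1_on_const C1_on_bump] \<phi>(1)])
    moreover have "\<forall>x. (1 - bump a (r a) x) * \<phi> x = (\<Prod>a\<in>insert a F. 1 - bump a (r a) x)"
      using insert(1,2) \<phi>(2) by simp
    ultimately show ?case by blast
  qed
  then obtain \<phi> \<phi>' where \<phi>: "C1_on \<phi> \<phi>' UNIV" "(\<forall>x. \<phi> x = (\<Prod>a\<in>F. 1 - bump a (r a) x))" by blast
  show ?thesis
  proof (rule that[of "\<lambda>x. 1 - \<phi> x" _ "\<Union>a\<in>F. cball a (2 * r a)"])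
    show "C1_on (\<lambda>x. 1 - \<phi> x) (\<lambda>x v. 0 - \<phi>' x v) UNIV" by (rule C1_on_diff[OF C1_on_const \<phi>(1)])
    show "1 - \<phi> x = 1" if xK: "x \<in> K" for x
    proof -
      obtain a where "a \<in> F" "x \<in> ball a (r a)" using F xK by blast
      then have "bump a (r a) x = 1"
        using r(1)[of a] F(1) by (intro bump_eq1) (auto simp: dist_norm norm_minus_commute)
      then have "(\<Prod>a\<in>F. 1 - bump a (r a) x) = 0"
        using \<open>a \<in> F\<close> by (intro prod_zero[OF F(2)] bexI[of _ a]) simp_all
      then show ?thesis using \<phi>(2) by simp
    qed
    show "compact (\<Union>a\<in>F. cball a (2 * r a))" using F(2) by (intro compact_UN) auto
    show "(\<Union>a\<in>F. cball a (2 * r a)) \<subseteq> U" using F(1) r(2) by blast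
    show "1 - \<phi> x = 0" if nx: "x \<notin> (\<Union>a\<in>F. cball a (2 * r a))" for x
    proof -
      have "bump a (r a) x = 0" if aF: "a \<in> F" for a
      proof (rule bump_eq0)
        show "r a > 0" using r(1) F(1) aF by blast
        show "2 * r a \<le> norm (x - a)"
          using nx aF by (force simp: dist_norm norm_minus_commute)
      qed
      then show ?thesis using \<phi>(2) by simp
    qed
  qed
qed

section \<open>Integrals of the Cauchy kernel\<close>

lemma emeasure_ball_complex: "r \<ge> 0 \<Longrightarrow> emeasure lborel (ball (c::complex) r) = ennreal (pi * r\<^sup>2)"
  by (simp add: emeasure_ball unit_ball_vol_2)

lemma dyadic_shell:
  assumes "0 < x" "x < (a::real)"
  obtains k where "a / 2 ^ Suc k \<le> x" "x < a / 2 ^ k"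
proof -
  have "\<exists>n. a / 2 ^ n \<le> x"
  proof -
    obtain n where "a / x < 2 ^ n" using real_arch_pow[of 2 "a / x"] by auto
    then show ?thesis using assms by (intro exI[of _ n]) (simp add: field_simps)
  qed
  then have L: "a / 2 ^ (LEAST n. a / 2 ^ n \<le> x) \<le> x" by (rule LeastI_ex)
  define m where "m = (LEAST n. a / 2 ^ n \<le> x)"
  have "m \<noteq> 0" using L assms by (metis m_def div_by_1 linorder_not_le power_0)
  then obtain k where k: "m = Suc k" using not0_implies_Suc by blast
  have "\<not> a / 2 ^ k \<le> x" using not_less_Least[of k "\<lambda>n. a / 2 ^ n \<le> x"] k m_def by simp
  then show ?thesis using that[of k] L k m_def by simp
qed

text \<open>On the dyadic shell at radius about \<open>a / 2^k\<close> the integrand is at most \<open>2^(k+1) / a\<close>, while the area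
  is at most \<open>\<pi> a\<^sup>2 / 4^k\<close>; the contributions form a geometric series.\<close>
lemma nn_integral_inverse_norm_ball:
  assumes a: "a > 0"
  shows "(\<integral>\<^sup>+w. ennreal (indicator (ball (0::complex) a) w / cmod w) \<partial>lborel) \<le> ennreal (4 * pi * a)"
proof -
  define g where "g k w = ennreal (2 ^ Suc k / a) * indicator (ball (0::complex) (a / 2 ^ k)) w" for k w
  have "ennreal (indicator (ball (0::complex) a) w / cmod w) \<le> (\<Sum>k. g k w)" for w
  proof (cases "w = 0 \<or> cmod w \<ge> a")
    case True
    then show ?thesis by auto
  next
    case False
    then obtain k where k: "a / 2 ^ Suc k \<le> cmod w" "cmod w < a / 2 ^ k"
      using dyadic_shell[of "cmod w" a] by auto
    have "1 / cmod w \<le> 2 ^ Suc k / a"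
      using k(1) False a by (simp add: field_simps)
    then have "ennreal (indicator (ball (0::complex) a) w / cmod w) \<le> g k w"
      using False k(2) by (simp add: g_def ennreal_leI)
    also have "\<dots> \<le> (\<Sum>k. g k w)"
      using sum_le_suminf[of "\<lambda>k. g k w" "{k}"] by simp
    finally show ?thesis .
  qed
  then have "(\<integral>\<^sup>+w. ennreal (indicator (ball (0::complex) a) w / cmod w) \<partial>lborel) \<le> (\<integral>\<^sup>+w. (\<Sum>k. g k w) \<partial>lborel)"
    by (intro nn_integral_mono) auto
  also have "\<dots> = (\<Sum>k. \<integral>\<^sup>+w. g k w \<partial>lborel)"
    by (intro nn_integral_suminf) (auto simp: g_def intro!: borel_measurable_times_ennreal borel_measurable_indicator)
  also have "(\<lambda>k. \<integral>\<^sup>+w. g k w \<partial>lborel) = (\<lambda>k. ennreal (2 * pi * a * (1/2) ^ k))"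
  proof
    fix k
    have "(\<integral>\<^sup>+w. g k w \<partial>lborel) = ennreal (2 ^ Suc k / a) * ennreal (pi * (a / 2 ^ k)\<^sup>2)"
      unfolding g_def using a by (subst nn_integral_cmult_indicator) (auto simp: emeasure_ball_complex)
    also have "\<dots> = ennreal (2 ^ Suc k / a * (pi * (a / 2 ^ k)\<^sup>2))"
      using a by (intro ennreal_mult[symmetric]) auto
    also have "2 ^ Suc k / a * (pi * (a / 2 ^ k)\<^sup>2) = 2 * pi * a * (1/2) ^ k"
      using a by (simp add: power2_eq_square power_divide)
    finally show "(\<integral>\<^sup>+w. g k w \<partial>lborel) = ennreal (2 * pi * a * (1/2) ^ k)" .
  qed
  also have "(\<Sum>k. ennreal (2 * pi * a * (1/2) ^ k)) = ennreal (\<Sum>k. 2 * pi * a * (1/2) ^ k)"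
    using a by (intro suminf_ennreal2) (auto intro!: summable_mult)
  also have "(\<Sum>k. 2 * pi * a * (1/2) ^ k) = 4 * pi * a"
    by (subst suminf_mult) (auto simp: suminf_geometric)
  finally show ?thesis .
qed

lemma nn_integral_lborel_shift:
  fixes g :: "'a::euclidean_space \<Rightarrow> ennreal"
  assumes "g \<in> borel_measurable borel"
  shows "(\<integral>\<^sup>+x. g (x - v) \<partial>lborel) = (\<integral>\<^sup>+x. g x \<partial>lborel)"
proof -
  have "(lborel :: 'a measure) = distr lborel borel ((+) (-v))"
    using lborel_affine[of 1 "-v"] by (simp add: density_1 del: uminus_add_conv_diff add_uminus_conv_diff)
  then have "(\<integral>\<^sup>+x. g x \<partial>lborel) = (\<integral>\<^sup>+x. g x \<partial>distr lborel borel ((+) (-v)))"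
    by simp
  also have "\<dots> = (\<integral>\<^sup>+x. g (x - v) \<partial>lborel)"
    using assms by (subst nn_integral_distr) auto
  finally show ?thesis by simp
qed

text \<open>The bound does not depend on the position of the pole \<open>z\<close>: within distance \<open>a\<close> of \<open>z\<close> the kernel is
  integrated over a translated ball, and elsewhere it is at most \<open>1 / a\<close>.\<close>
lemma Cauchy_kernel_ball:
  assumes a: "a > 0"
  shows integrable_Cauchy_kernel_ball: "integrable lborel (\<lambda>w. indicator (ball (0::complex) a) w / cmod (w - z))"
    and integral_Cauchy_kernel_ball: "(LINT w|lborel. indicator (ball (0::complex) a) w / cmod (w - z)) \<le> 5 * pi * a"
proof -
  have m1: "(\<lambda>w. indicator (ball (0::complex) a) w / cmod w) \<in> borel_measurable borel"
    by (intro borel_measurable_divide borel_measurable_indicator borel_measurable_continuous_onI) (auto intro!: continuous_intros)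
  have m2: "(\<lambda>w. indicator (ball (0::complex) a) w / cmod (w - z)) \<in> borel_measurable borel"
    by (intro borel_measurable_divide borel_measurable_indicator borel_measurable_continuous_onI) (auto intro!: continuous_intros)
  have "(\<integral>\<^sup>+w. ennreal (indicator (ball (0::complex) a) w / cmod (w - z)) \<partial>lborel) \<le>
    (\<integral>\<^sup>+w. (ennreal (indicator (ball (0::complex) a) (w - z) / cmod (w - z)) + ennreal (1 / a) * indicator (ball (0::complex) a) w) \<partial>lborel)"
  proof (intro nn_integral_mono)
    fix w
    have "indicator (ball (0::complex) a) w / cmod (w - z) \<le>
      indicator (ball (0::complex) a) (w - z) / cmod (w - z) + 1 / a * indicator (ball (0::complex) a) w"
    proof (cases "w - z \<in> ball 0 a")
      case True
      then show ?thesis using a by (auto simp: indicator_def)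
    next
      case False
      then have "1 / cmod (w - z) \<le> 1 / a" using a by (intro divide_left_mono) (auto simp: dist_norm norm_minus_commute intro!: mult_pos_pos)
      then show ?thesis using False a by (auto simp: indicator_def)
    qed
    then show "ennreal (indicator (ball (0::complex) a) w / cmod (w - z)) \<le>
      ennreal (indicator (ball (0::complex) a) (w - z) / cmod (w - z)) + ennreal (1 / a) * indicator (ball (0::complex) a) w"
      using a by (auto simp: indicator_def simp flip: ennreal_plus intro!: ennreal_leI)
  qed
  also have "\<dots> = (\<integral>\<^sup>+w. ennreal (indicator (ball (0::complex) a) (w - z) / cmod (w - z)) \<partial>lborel)
      + ennreal (1 / a) * ennreal (pi * a\<^sup>2)"
  proof (subst nn_integral_add)
    show "(\<lambda>w. ennreal (indicator (ball (0::complex) a) (w - z) / cmod (w - z))) \<in> borel_measurable lborel"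
      using measurable_compose[OF _ m1, of "\<lambda>w. w - z" borel] by simp
    show "(\<lambda>w. ennreal (1 / a) * indicator (ball (0::complex) a) w) \<in> borel_measurable lborel"
      by (auto intro!: borel_measurable_times_ennreal borel_measurable_indicator)
    have "(\<integral>\<^sup>+w. ennreal (1 / a) * indicator (ball (0::complex) a) w \<partial>lborel) = ennreal (1 / a) * ennreal (pi * a\<^sup>2)"
      using a by (subst nn_integral_cmult_indicator) (auto simp: emeasure_ball_complex)
    then show "(\<integral>\<^sup>+w. ennreal (indicator (ball (0::complex) a) (w - z) / cmod (w - z)) \<partial>lborel) +
       (\<integral>\<^sup>+w. ennreal (1 / a) * indicator (ball (0::complex) a) w \<partial>lborel) =
       (\<integral>\<^sup>+w. ennreal (indicator (ball (0::complex) a) (w - z) / cmod (w - z)) \<partial>lborel) + ennreal (1 / a) * ennreal (pi * a\<^sup>2)"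
      by simp
  qed
  also have "(\<integral>\<^sup>+w. ennreal (indicator (ball (0::complex) a) (w - z) / cmod (w - z)) \<partial>lborel)
     = (\<integral>\<^sup>+w. ennreal (indicator (ball (0::complex) a) w / cmod w) \<partial>lborel)"
    by (rule nn_integral_lborel_shift[where g="\<lambda>w. ennreal (indicator (ball (0::complex) a) w / cmod w)"]) (use m1 in simp)
  also have "\<dots> + ennreal (1 / a) * ennreal (pi * a\<^sup>2) \<le> ennreal (4 * pi * a) + ennreal (1 / a) * ennreal (pi * a\<^sup>2)"
    by (intro add_right_mono nn_integral_inverse_norm_ball a)
  also have "\<dots> = ennreal (4 * pi * a) + ennreal (pi * a)"
    using a by (simp add: power2_eq_square flip: ennreal_mult)
  also have "\<dots> = ennreal (5 * pi * a)"
    using a by (simp flip: ennreal_plus)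
  finally have *: "(\<integral>\<^sup>+w. ennreal (indicator (ball (0::complex) a) w / cmod (w - z)) \<partial>lborel) \<le> ennreal (5 * pi * a)" .
  show "integrable lborel (\<lambda>w. indicator (ball (0::complex) a) w / cmod (w - z))"
    by (rule integrableI_bounded) (use * m2 in \<open>auto intro: order_le_less_trans\<close>)
  show "(LINT w|lborel. indicator (ball (0::complex) a) w / cmod (w - z)) \<le> 5 * pi * a"
    by (rule integral_real_bounded) (use * a in auto)
qed

text \<open>Dyadic shells again: the shell between \<open>2^k\<close> and \<open>2^(k+1)\<close> contributes \<open>O(2^(-k))\<close>.\<close>
lemma integrable_inverse_cube:
  "integrable lborel (\<lambda>w::complex. indicator {w. 1 \<le> cmod w} w / cmod w ^ 3)"
proof (rule integrableI_bounded)
  define g where "g k w = ennreal (1 / 2 ^ (3 * k)) * indicator (ball (0::complex) (2 ^ Suc k)) w" for k w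
  have meas[measurable]: "{w::complex. 1 \<le> cmod w} \<in> sets borel" by measurable
  have "ennreal (norm (indicator {w. 1 \<le> cmod w} w / cmod w ^ 3)) \<le> (\<Sum>k. g k w)" for w
  proof (cases "cmod w \<ge> 1")
    case False
    then show ?thesis by auto
  next
    case True
    have "1 / cmod w > 0" "1 / cmod w < 2" using True by (auto simp: divide_less_eq)
    then obtain k where k: "2 / 2 ^ Suc k \<le> 1 / cmod w" "1 / cmod w < 2 / 2 ^ k"
      using dyadic_shell[of "1 / cmod w" 2] by metis
    have k1: "cmod w \<le> 2 ^ k" using k(1) True by (auto simp: le_divide_eq divide_le_eq split: if_splits)
    have "\<exists>k. 2 ^ k \<le> cmod w \<and> cmod w < 2 ^ Suc k"
    proof -
      have "2 ^ k < 2 * cmod w" using k(2) True by (simp add: less_divide_eq divide_less_eq split: if_splits)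
      then show ?thesis
      proof (cases "cmod w = 2 ^ k")
        case True
        then show ?thesis by (intro exI[of _ k]) simp
      next
        case False
        then obtain j where "k = Suc j" using k1 True by (cases k) auto
        then show ?thesis using False k1 \<open>2 ^ k < 2 * cmod w\<close> by (intro exI[of _ j]) auto
      qed
    qed
    then obtain k where k: "2 ^ k \<le> cmod w" "cmod w < 2 ^ Suc k" by blast
    have "1 / cmod w ^ 3 \<le> 1 / 2 ^ (3 * k)"
      using power_mono[OF k(1), of 3] True by (intro divide_left_mono mult_pos_pos zero_less_power) (auto simp: power_mult[symmetric] mult.commute)
    then have "ennreal (norm (indicator {w. 1 \<le> cmod w} w / cmod w ^ 3)) \<le> g k w"
      using True k(2) by (simp add: g_def ennreal_leI norm_divide norm_power)
    also have "\<dots> \<le> (\<Sum>k. g k w)"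
      using sum_le_suminf[of "\<lambda>k. g k w" "{k}"] by simp
    finally show ?thesis .
  qed
  then have "(\<integral>\<^sup>+w. ennreal (norm (indicator {w. 1 \<le> cmod w} w / cmod w ^ 3)) \<partial>lborel) \<le> (\<integral>\<^sup>+w. (\<Sum>k. g k w) \<partial>lborel)"
    by (intro nn_integral_mono) auto
  also have "\<dots> = (\<Sum>k. \<integral>\<^sup>+w. g k w \<partial>lborel)"
    by (intro nn_integral_suminf) (auto simp: g_def intro!: borel_measurable_times_ennreal borel_measurable_indicator)
  also have "(\<lambda>k. \<integral>\<^sup>+w. g k w \<partial>lborel) = (\<lambda>k. ennreal (4 * pi * (1/2) ^ k))"
  proof
    fix k
    have "(\<integral>\<^sup>+w. g k w \<partial>lborel) = ennreal (1 / 2 ^ (3 * k)) * ennreal (pi * (2 ^ Suc k)\<^sup>2)"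
      unfolding g_def by (subst nn_integral_cmult_indicator) (auto simp: emeasure_ball_complex simp del: power_Suc)
    also have "\<dots> = ennreal (1 / 2 ^ (3 * k) * (pi * (2 ^ Suc k)\<^sup>2))"
      by (simp flip: ennreal_mult)
    also have "1 / 2 ^ (3 * k) * (pi * (2 ^ Suc k)\<^sup>2) = 4 * pi * (1/2) ^ k"
    proof -
      have "(2::real) ^ (3 * k) = 2 ^ k * (2 ^ k)\<^sup>2"
        by (simp add: power2_eq_square flip: power_add)
      then show ?thesis by (simp add: power_divide power_mult_distrib power2_eq_square)
    qed
    finally show "(\<integral>\<^sup>+w. g k w \<partial>lborel) = ennreal (4 * pi * (1/2) ^ k)" .
  qed
  also have "(\<Sum>k. ennreal (4 * pi * (1/2) ^ k)) = ennreal (\<Sum>k. 4 * pi * (1/2) ^ k)"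
    by (intro suminf_ennreal2) (auto intro!: summable_mult)
  finally show "(\<integral>\<^sup>+w. ennreal (norm (indicator {w. 1 \<le> cmod w} w / cmod w ^ 3)) \<partial>lborel) < \<infinity>"
    by (rule order_le_less_trans) simp
qed measurable

section \<open>The Cauchy--Pompeiu formula and Green's theorem\<close>

text \<open>The Cauchy--Riemann operator \<open>\<partial>/\<partial>(cnj w)\<close>, as a function of the derivative \<open>D\<close>. If \<open>D\<close> is the
  derivative of \<open>cnj u\<close> it is half of \<open>div u - i curl u\<close>.\<close>
definition dbar :: "(complex \<Rightarrow> complex \<Rightarrow> complex) \<Rightarrow> complex \<Rightarrow> complex" where
  "dbar D w = (D w 1 + \<i> * D w \<i>) / 2"

lemma continuous_on_dbar: "C1_on f D S \<Longrightarrow> continuous_on S (dbar D)"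
  unfolding dbar_def[abs_def] by (intro continuous_intros C1_on_cont_deriv) auto

lemma integrable_Cauchy_kernel:
  fixes f :: "complex \<Rightarrow> complex"
  assumes "continuous_on UNIV f" "\<And>x. norm x > r \<Longrightarrow> f x = 0"
  shows "integrable lborel (\<lambda>w. f w / (z - w))"
proof -
  obtain B where B: "B \<ge> 0" "\<And>x. norm (f x) \<le> B"
    using bounded_continuous_bounded_support[OF assms] by metis
  have [measurable]: "f \<in> borel_measurable borel" using assms(1) by (rule borel_measurable_continuous_onI)
  define a where "a = max r 0 + 1"
  show ?thesis
  proof (rule Bochner_Integration.integrable_bound)
    show "integrable lborel (\<lambda>w. B * (indicator (ball (0::complex) a) w / cmod (w - z)))"
      by (intro integrable_mult_right integrable_Cauchy_kernel_ball) (simp add: a_def)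
    show "AE w in lborel. norm (f w / (z - w)) \<le> norm (B * (indicator (ball (0::complex) a) w / cmod (w - z)))"
    proof (rule AE_I2)
      fix w
      show "norm (f w / (z - w)) \<le> norm (B * (indicator (ball (0::complex) a) w / cmod (w - z)))"
      proof (cases "cmod w < a")
        case True
        then show ?thesis using B by (simp add: norm_divide norm_minus_commute divide_right_mono)
      next
        case False
        then have "f w = 0" by (intro assms(2)) (auto simp: a_def)
        then show ?thesis by simp
      qed
    qed
  qed measurable
qed

lemma integral_lborel_affine:
  fixes g :: "'a::euclidean_space \<Rightarrow> 'b::{banach, second_countable_topology}"
  assumes [measurable]: "g \<in> borel_measurable borel" and c: "c \<noteq> 0"
  shows "(LINT x|lborel. g x) = \<bar>c\<bar> ^ DIM('a) *\<^sub>R (LINT x|lborel. g (t + c *\<^sub>R x))"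
proof -
  have "(LINT x|lborel. g x) = (LINT x|density (distr lborel borel (\<lambda>x. t + c *\<^sub>R x)) (\<lambda>_. ennreal (\<bar>c\<bar> ^ DIM('a))). g x)"
    using lborel_affine[OF c, of t] by simp
  also have "\<dots> = \<bar>c\<bar> ^ DIM('a) *\<^sub>R (LINT x|lborel. g (t + c *\<^sub>R x))"
    by (subst integral_density) (auto simp: integral_distr)
  finally show ?thesis .
qed

text \<open>The Cauchy kernel \<open>1 / \<zeta>\<close> with its pole smoothed at scale \<open>e\<close>. It is dominated by \<open>1 / |\<zeta>|\<close>, and its
  \<open>dbar\<close>-derivative is an approximate identity, namely the rescaled function \<open>(|w|\<^sup>2 + 1)\<^sup>-\<^sup>2\<close>.\<close>
definition reg_kernel :: "real \<Rightarrow> complex \<Rightarrow> complex" where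
  "reg_kernel e \<zeta> = cnj \<zeta> / complex_of_real ((cmod \<zeta>)\<^sup>2 + e\<^sup>2)"

lemma C1_on_reg_kernel:
  assumes e: "e > 0"
  shows "\<exists>K. C1_on (\<lambda>w. reg_kernel e (z - w)) K UNIV \<and>
    (\<forall>w. dbar K w = - complex_of_real (e\<^sup>2 / ((cmod (z - w))\<^sup>2 + e\<^sup>2)\<^sup>2))"
proof -
  define N where "N w = (cmod (w - z))\<^sup>2 + e\<^sup>2" for w
  have Npos: "N w > 0" for w using e by (auto simp: N_def intro: add_nonneg_pos)
  have "C1_on N (\<lambda>w v. 2 * ((w - z) \<bullet> v) + 0) UNIV"
    unfolding N_def[abs_def] by (rule C1_on_add[OF C1_on_sqdist C1_on_const])
  then have N: "C1_on N (\<lambda>w v. 2 * ((w - z) \<bullet> v)) UNIV" by simp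
  have "C1_on (\<lambda>w. inverse (N w)) (\<lambda>w v. - (inverse (N w))\<^sup>2 * (2 * ((w - z) \<bullet> v))) UNIV"
  proof (rule C1_on_real_comp[OF N])
    show "(inverse has_real_derivative - (inverse (N x))\<^sup>2) (at (N x))" for x
      using Npos[of x] by (auto intro!: derivative_eq_intros simp: power2_eq_square)
    show "continuous_on (range N) (\<lambda>a. - (inverse a)\<^sup>2)"
      using Npos by (intro continuous_intros) (metis imageE less_irrefl)
  qed
  moreover have "C1_on (\<lambda>w. cnj (z - w)) (\<lambda>w v. cnj (0 - v)) UNIV"
    by (rule C1_on_linear_comp[OF bounded_linear_cnj C1_on_diff[OF C1_on_const C1_on_linear[OF bounded_linear_ident]]])
  ultimately have "C1_on (\<lambda>w. inverse (N w) *\<^sub>R cnj (z - w))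
     (\<lambda>w v. inverse (N w) *\<^sub>R cnj (0 - v) + (- (inverse (N w))\<^sup>2 * (2 * ((w - z) \<bullet> v))) *\<^sub>R cnj (z - w)) UNIV" (is "C1_on _ ?K _")
    by (rule C1_on_scaleR)
  moreover have "(\<lambda>w. inverse (N w) *\<^sub>R cnj (z - w)) = (\<lambda>w. reg_kernel e (z - w))"
    by (auto simp: reg_kernel_def N_def norm_minus_commute scaleR_conv_of_real field_simps fun_eq_iff)
  moreover have "dbar ?K w = - complex_of_real (e\<^sup>2 / ((cmod (z - w))\<^sup>2 + e\<^sup>2)\<^sup>2)" for w
  proof -
    define n where "n = complex_of_real (N w)"
    have n: "n \<noteq> 0" using Npos[of w] by (simp add: n_def)
    have ne: "n = (z - w) * cnj (z - w) + of_real (e\<^sup>2)"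
      unfolding n_def N_def norm_minus_commute[of w z] of_real_add complex_norm_square by simp
    define A where "A = complex_of_real (2 * ((w - z) \<bullet> 1))"
    define A' where "A' = complex_of_real (2 * ((w - z) \<bullet> \<i>))"
    define c where "c = cnj (z - w)"
    have K1: "?K w 1 = - 1 / n - A * c / n\<^sup>2" "?K w \<i> = \<i> / n - A' * c / n\<^sup>2"
      by (simp_all only: scaleR_conv_of_real of_real_mult of_real_inverse of_real_power of_real_minus A_def A'_def c_def n_def)
         (simp_all add: field_simps)
    have s: "complex_of_real (2 * ((w - z) \<bullet> 1)) + \<i> * complex_of_real (2 * ((w - z) \<bullet> \<i>)) = - 2 * (z - w)"
      by (simp add: complex_eq_iff inner_complex_def)
    have "2 * dbar ?K w = - 2 / n - (complex_of_real (2 * ((w - z) \<bullet> 1)) + \<i> * complex_of_real (2 * ((w - z) \<bullet> \<i>))) * cnj (z - w) / n\<^sup>2"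
    proof -
      have "2 * dbar F w = F w 1 + \<i> * F w \<i>" for F by (simp add: dbar_def)
      from this[of ?K] have "2 * dbar ?K w = (- 1 / n - A * c / n\<^sup>2) + \<i> * (\<i> / n - A' * c / n\<^sup>2)"
        by (simp only: K1)
      also have "\<dots> = - 2 / n - (A + \<i> * A') * c / n\<^sup>2"
        by (simp add: algebra_simps add_divide_distrib)
      finally show ?thesis unfolding A_def A'_def c_def .
    qed
    also have "\<dots> = (- 2 * n + 2 * ((z - w) * cnj (z - w))) / n\<^sup>2"
      unfolding s using n by (simp add: field_simps power2_eq_square)
    also have "\<dots> = - 2 * of_real (e\<^sup>2) / n\<^sup>2" by (simp add: ne)
    finally have "dbar ?K w = - of_real (e\<^sup>2) / n\<^sup>2"
      by (metis (no_types, lifting) mult_cancel_left mult_minus_left mult_minus_right times_divide_eq_right zero_neq_numeral)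
    then show ?thesis by (simp add: n_def N_def norm_minus_commute)
  qed
  ultimately show ?thesis by auto
qed

lemma dbar_mult:
  "dbar (\<lambda>x v. f x * E x v + D x v * g x) w = f w * dbar E w + dbar D w * g w"
  by (simp add: dbar_def field_simps)

lemma integral_dbar_zero:
  fixes f :: "complex \<Rightarrow> complex"
  assumes f: "C1_on f D UNIV" and r: "\<And>x. norm x > r \<Longrightarrow> f x = 0"
  shows "(LINT x|lborel. dbar D x) = 0"
  using integral_derivative_bounded_support[OF f r, where v=1] integral_derivative_bounded_support[OF f r, where v="\<i>"]
  unfolding dbar_def[abs_def] by simp

lemma norm_reg_kernel_le: "e > 0 \<Longrightarrow> cmod (reg_kernel e \<zeta>) \<le> 1 / cmod \<zeta>"
proof (cases "\<zeta> = 0")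
  case False
  assume "e > 0"
  have "cmod (reg_kernel e \<zeta>) = cmod \<zeta> / ((cmod \<zeta>)\<^sup>2 + e\<^sup>2)"
    unfolding reg_kernel_def norm_divide norm_of_real by simp
  also have "\<dots> \<le> cmod \<zeta> / (cmod \<zeta>)\<^sup>2"
    using False by (intro divide_left_mono) (auto intro!: mult_pos_pos add_pos_nonneg)
  finally show ?thesis using False by (simp add: power2_eq_square)
qed (simp add: reg_kernel_def)

text \<open>The mass of that approximate identity. Instead of evaluating it in polar coordinates, the formulas
  below are first proved with this unknown constant, and the unit circle then determines it.\<close>
definition plummer_mass :: real where
  "plummer_mass = (LINT w|(lborel::complex measure). 1 / ((cmod w)\<^sup>2 + 1)\<^sup>2)"

lemma integrable_plummer: "integrable lborel (\<lambda>w::complex. 1 / ((cmod w)\<^sup>2 + 1)\<^sup>2)"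
proof (rule Bochner_Integration.integrable_bound)
  show "integrable lborel (\<lambda>w::complex. indicator (ball 0 1) w + indicator {w. 1 \<le> cmod w} w / cmod w ^ 3 :: real)"
    by (intro Bochner_Integration.integrable_add integrable_inverse_cube integrable_real_indicator)
       (auto intro!: emeasure_bounded_finite[unfolded infinity_ennreal_def])
  show "AE w in lborel. norm (1 / ((cmod w)\<^sup>2 + 1)\<^sup>2) \<le> norm (indicator (ball 0 1) w + indicator {w. 1 \<le> cmod w} w / cmod w ^ 3 :: real)"
  proof (rule AE_I2)
    fix w :: complex
    have p: "((cmod w)\<^sup>2 + 1)\<^sup>2 \<ge> 1" by (intro one_le_power) simp
    show "norm (1 / ((cmod w)\<^sup>2 + 1)\<^sup>2) \<le> norm (indicator (ball 0 1) w + indicator {w. 1 \<le> cmod w} w / cmod w ^ 3 :: real)"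
    proof (cases "cmod w < 1")
      case True
      then show ?thesis using p by (simp add: indicator_def divide_le_eq)
    next
      case False
      have "cmod w ^ 3 \<le> cmod w ^ 4" using False by (intro power_increasing) auto
      also have "\<dots> = ((cmod w)\<^sup>2)\<^sup>2" by simp
      also have "\<dots> \<le> ((cmod w)\<^sup>2 + 1)\<^sup>2" by (intro power_mono) auto
      finally have "1 / ((cmod w)\<^sup>2 + 1)\<^sup>2 \<le> 1 / cmod w ^ 3"
        using False p by (intro divide_left_mono mult_pos_pos zero_less_power add_nonneg_pos) auto
      then show ?thesis using False by (simp add: indicator_def)
    qed
  qed
qed measurable

text \<open>Integrate \<open>dbar (f * reg_kernel)\<close>, whose integral is 0: the derivative falls either on \<open>f\<close>, giving
  the left side as the smoothing tends to 0, or on the kernel, giving an average of \<open>f\<close> that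
  concentrates at \<open>z\<close>.\<close>
lemma Cauchy_Pompeiu_aux:
  fixes f :: "complex \<Rightarrow> complex"
  assumes f: "C1_on f D UNIV" and r: "\<And>x. norm x > r \<Longrightarrow> f x = 0"
  shows "(LINT w|lborel. dbar D w / (z - w)) = complex_of_real plummer_mass * f z"
proof -
  have d0: "dbar D w = 0" if "norm w > r" for w
    using C1_on_deriv_zero_outside[OF f r that] by (simp add: dbar_def)
  note fc = C1_on_continuous[OF f] note dc = continuous_on_dbar[OF f]
  have [measurable]: "f \<in> borel_measurable borel" "dbar D \<in> borel_measurable borel"
    using fc dc by (auto intro: borel_measurable_continuous_onI)
  define h where "h k = 1 / real (Suc k)" for k
  have h: "0 < h k" for k by (auto simp: h_def)
  have h0: "h \<longlonglongrightarrow> 0" unfolding h_def by (rule LIMSEQ_Suc[OF lim_inverse_n'])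
  obtain B where B: "B \<ge> 0" "\<And>x. norm (f x) \<le> B"
    using bounded_continuous_bounded_support[OF fc r] by metis
  have eq: "(LINT w|lborel. dbar D w * reg_kernel (h k) (z - w)) =
      (LINT w|lborel. f (z + h k *\<^sub>R w) * complex_of_real (1 / ((cmod w)\<^sup>2 + 1)\<^sup>2))" for k
  proof -
    obtain K where K: "C1_on (\<lambda>w. reg_kernel (h k) (z - w)) K UNIV"
      "\<And>w. dbar K w = - complex_of_real ((h k)\<^sup>2 / ((cmod (z - w))\<^sup>2 + (h k)\<^sup>2)\<^sup>2)"
      using C1_on_reg_kernel[OF h[of k], of z] by blast
    note Kc = C1_on_continuous[OF K(1)] note Kdc = continuous_on_dbar[OF K(1)]
    have "(LINT w|lborel. dbar (\<lambda>x v. f x * K x v + D x v * reg_kernel (h k) (z - x)) w) = 0"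
      by (rule integral_dbar_zero[OF C1_on_mult[OF f K(1)], of r]) (simp add: r)
    then have "(LINT w|lborel. f w * dbar K w + dbar D w * reg_kernel (h k) (z - w)) = 0"
      by (simp add: dbar_mult)
    moreover have "integrable lborel (\<lambda>w. f w * dbar K w)"
      by (rule integrable_continuous_bounded_support[where r=r]) (auto intro!: continuous_intros fc Kdc simp: r)
    moreover have "integrable lborel (\<lambda>w. dbar D w * reg_kernel (h k) (z - w))"
      by (rule integrable_continuous_bounded_support[where r=r]) (auto intro!: continuous_intros dc Kc simp: d0)
    ultimately have "(LINT w|lborel. dbar D w * reg_kernel (h k) (z - w)) = - (LINT w|lborel. f w * dbar K w)"
      by (simp add: add_eq_0_iff)
    also have "\<dots> = (LINT w|lborel. f w * complex_of_real ((h k)\<^sup>2 / ((cmod (z - w))\<^sup>2 + (h k)\<^sup>2)\<^sup>2))"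
      by (simp add: K(2))
    also have "\<dots> = \<bar>h k\<bar> ^ DIM(complex) *\<^sub>R (LINT w|lborel. f (z + h k *\<^sub>R w) *
        complex_of_real ((h k)\<^sup>2 / ((cmod (z - (z + h k *\<^sub>R w)))\<^sup>2 + (h k)\<^sup>2)\<^sup>2))"
      by (rule integral_lborel_affine) (use h[of k] in auto)
    also have "\<dots> = (LINT w|lborel. (h k)\<^sup>2 *\<^sub>R (f (z + h k *\<^sub>R w) *
        complex_of_real ((h k)\<^sup>2 / ((cmod (z - (z + h k *\<^sub>R w)))\<^sup>2 + (h k)\<^sup>2)\<^sup>2)))"
      by simp
    also have "\<dots> = (LINT w|lborel. f (z + h k *\<^sub>R w) * complex_of_real (1 / ((cmod w)\<^sup>2 + 1)\<^sup>2))"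
    proof (rule Bochner_Integration.integral_cong[OF refl])
      fix w
      have cancel: "(h k)\<^sup>2 * ((h k)\<^sup>2 / ((cmod (z - (z + h k *\<^sub>R w)))\<^sup>2 + (h k)\<^sup>2)\<^sup>2) = ((h k)\<^sup>2 * (h k)\<^sup>2) / ((h k)\<^sup>2 * ((cmod w)\<^sup>2 + 1))\<^sup>2"
        by (simp add: power_mult_distrib algebra_simps)
      also have "\<dots> = 1 / ((cmod w)\<^sup>2 + 1)\<^sup>2"
        using h[of k] by (simp add: power2_eq_square)
      finally have cancel: "(h k)\<^sup>2 * ((h k)\<^sup>2 / ((cmod (z - (z + h k *\<^sub>R w)))\<^sup>2 + (h k)\<^sup>2)\<^sup>2) = 1 / ((cmod w)\<^sup>2 + 1)\<^sup>2" .
      have "a *\<^sub>R (F * complex_of_real b) = F * complex_of_real (a * b)" for a b F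
        by (simp add: scaleR_conv_of_real)
      from this[of "(h k)\<^sup>2" "f (z + h k *\<^sub>R w)"] show "(h k)\<^sup>2 *\<^sub>R (f (z + h k *\<^sub>R w) * complex_of_real ((h k)\<^sup>2 / ((cmod (z - (z + h k *\<^sub>R w)))\<^sup>2 + (h k)\<^sup>2)\<^sup>2))
         = f (z + h k *\<^sub>R w) * complex_of_real (1 / ((cmod w)\<^sup>2 + 1)\<^sup>2)"
        unfolding cancel[symmetric] .
    qed
    finally show ?thesis .
  qed
  have [measurable]: "(\<lambda>w. reg_kernel (h k) (z - w)) \<in> borel_measurable borel" for k
    using C1_on_reg_kernel[OF h[of k], of z] by (auto intro: borel_measurable_continuous_onI C1_on_continuous)
  have "(\<lambda>k. LINT w|lborel. dbar D w * reg_kernel (h k) (z - w)) \<longlonglongrightarrow> (LINT w|lborel. dbar D w / (z - w))"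
  proof (rule integral_dominated_convergence[where w="\<lambda>w. norm (dbar D w / (z - w))"])
    show "integrable lborel (\<lambda>w. norm (dbar D w / (z - w)))"
      by (intro integrable_norm integrable_Cauchy_kernel[OF dc d0])
    show "AE w in lborel. (\<lambda>k. dbar D w * reg_kernel (h k) (z - w)) \<longlonglongrightarrow> dbar D w / (z - w)"
    proof (rule AE_I2)
      fix w
      show "(\<lambda>k. dbar D w * reg_kernel (h k) (z - w)) \<longlonglongrightarrow> dbar D w / (z - w)"
      proof (cases "z = w")
        case True
        then show ?thesis by (simp add: reg_kernel_def)
      next
        case False
        have "(\<lambda>k. cnj (z - w) / complex_of_real ((cmod (z - w))\<^sup>2 + (h k)\<^sup>2)) \<longlonglongrightarrow> cnj (z - w) / complex_of_real ((cmod (z - w))\<^sup>2 + 0\<^sup>2)"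
          using False by (intro tendsto_intros h0) auto
        also have "cnj (z - w) / complex_of_real ((cmod (z - w))\<^sup>2 + 0\<^sup>2) = 1 / (z - w)"
        proof -
          have "complex_of_real ((cmod (z - w))\<^sup>2 + 0\<^sup>2) = (z - w) * cnj (z - w)"
            using complex_norm_square[of "z - w"] by simp
          moreover have "cnj (z - w) \<noteq> 0" using False by (metis complex_cnj_zero_iff eq_iff_diff_eq_0)
          ultimately show ?thesis by simp
        qed
        finally have "(\<lambda>k. reg_kernel (h k) (z - w)) \<longlonglongrightarrow> 1 / (z - w)" by (simp add: reg_kernel_def)
        from tendsto_mult[OF tendsto_const this, of "dbar D w"] show ?thesis by simp
      qed
    qed
    show "AE w in lborel. norm (dbar D w * reg_kernel (h k) (z - w)) \<le> norm (dbar D w / (z - w))" for k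
    proof (rule AE_I2)
      fix w
      have "norm (dbar D w) * cmod (reg_kernel (h k) (z - w)) \<le> norm (dbar D w) * (1 / cmod (z - w))"
        by (intro mult_left_mono norm_reg_kernel_le h) auto
      then show "norm (dbar D w * reg_kernel (h k) (z - w)) \<le> norm (dbar D w / (z - w))"
        by (simp add: norm_mult norm_divide)
    qed
  qed measurable
  moreover have "(\<lambda>k. LINT w|lborel. f (z + h k *\<^sub>R w) * complex_of_real (1 / ((cmod w)\<^sup>2 + 1)\<^sup>2)) \<longlonglongrightarrow>
    (LINT w|lborel. f z * complex_of_real (1 / ((cmod w)\<^sup>2 + 1)\<^sup>2))"
  proof (rule integral_dominated_convergence[where w="\<lambda>w. B * (1 / ((cmod w)\<^sup>2 + 1)\<^sup>2)"])
    show "integrable lborel (\<lambda>w::complex. B * (1 / ((cmod w)\<^sup>2 + 1)\<^sup>2))"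
      by (intro integrable_mult_right integrable_plummer)
    show "AE w in lborel. (\<lambda>k. f (z + h k *\<^sub>R w) * complex_of_real (1 / ((cmod w)\<^sup>2 + 1)\<^sup>2)) \<longlonglongrightarrow> f z * complex_of_real (1 / ((cmod w)\<^sup>2 + 1)\<^sup>2)"
    proof (rule AE_I2)
      fix w
      have "(\<lambda>k. z + h k *\<^sub>R w) \<longlonglongrightarrow> z + 0 *\<^sub>R w" by (intro tendsto_intros h0)
      then have "(\<lambda>k. f (z + h k *\<^sub>R w)) \<longlonglongrightarrow> f (z + 0 *\<^sub>R w)"
        using fc by (intro continuous_on_tendsto_compose[OF fc]) auto
      then show "(\<lambda>k. f (z + h k *\<^sub>R w) * complex_of_real (1 / ((cmod w)\<^sup>2 + 1)\<^sup>2)) \<longlonglongrightarrow> f z * complex_of_real (1 / ((cmod w)\<^sup>2 + 1)\<^sup>2)"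
        by (intro tendsto_intros) simp
    qed
    show "AE w in lborel. norm (f (z + h k *\<^sub>R w) * complex_of_real (1 / ((cmod w)\<^sup>2 + 1)\<^sup>2)) \<le> B * (1 / ((cmod w)\<^sup>2 + 1)\<^sup>2)" for k
      by (intro AE_I2) (simp only: norm_mult norm_of_real, intro mult_mono B, auto)
  qed measurable
  ultimately have "(LINT w|lborel. dbar D w / (z - w)) = (LINT w|lborel. f z * complex_of_real (1 / ((cmod w)\<^sup>2 + 1)\<^sup>2))"
    unfolding eq by (rule LIMSEQ_unique)
  also have "\<dots> = f z * complex_of_real plummer_mass"
    unfolding plummer_mass_def by (simp only: integral_mult_right_zero integral_complex_of_real)
  finally show ?thesis by (simp add: mult.commute)
qed

lemma negligible_C1_curve:
  fixes \<gamma> :: "real \<Rightarrow> complex"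
  assumes "\<And>s. (\<gamma> has_vector_derivative \<gamma>' s) (at s)"
  shows "\<gamma> ` {0..1} \<in> null_sets lborel"
proof -
  have c: "continuous_on {0..1} \<gamma>"
    using assms by (meson continuous_at_imp_continuous_on has_vector_derivative_continuous)
  have "\<gamma> differentiable_on {0..1}"
    using assms by (meson differentiable_at_imp_differentiable_on differentiableI_vector)
  then have "negligible (\<gamma> ` {0..1})"
    by (intro negligible_differentiable_image_lowdim) auto
  moreover have "\<gamma> ` {0..1} \<in> sets borel"
    using compact_continuous_image[OF c] by (intro borel_closed compact_imp_closed) auto
  ultimately show ?thesis
    by (simp add: negligible_iff_null_sets null_sets_completion_iff)
qed

text \<open>To derive Green's theorem from the formula above, represent \<open>f (\<gamma> s)\<close> by Cauchy--Pompeiu,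
  integrate along the loop and exchange the integrals. The inner integral becomes \<open>\<integral> d\<gamma> / (\<gamma> - w)\<close>,
  that is, the winding number \<open>n w\<close>. Fubini applies because the kernel is integrable uniformly in the
  position of its pole.\<close>
lemma Green_aux:
  fixes f :: "complex \<Rightarrow> complex" and \<gamma> \<gamma>' :: "real \<Rightarrow> complex" and n :: "complex \<Rightarrow> complex"
  assumes f: "C1_on f D UNIV" and r: "\<And>x. norm x > r \<Longrightarrow> f x = 0"
    and \<gamma>: "\<And>s. (\<gamma> has_vector_derivative \<gamma>' s) (at s)" "continuous_on UNIV \<gamma>'"
    and n: "n \<in> borel_measurable borel"
      "\<And>w. w \<notin> \<gamma> ` {0..1} \<Longrightarrow> integral {0..1} (\<lambda>s. \<gamma>' s / (\<gamma> s - w)) = 2 * pi * \<i> * n w"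
  shows "complex_of_real plummer_mass * integral {0..1} (\<lambda>s. f (\<gamma> s) * \<gamma>' s) = 2 * pi * \<i> * (LINT w|lborel. dbar D w * n w)"
proof -
  have d0: "dbar D w = 0" if "norm w > r" for w
    using C1_on_deriv_zero_outside[OF f r that] by (simp add: dbar_def)
  note fc = C1_on_continuous[OF f] note dc = continuous_on_dbar[OF f]
  have gc: "continuous_on S \<gamma>" for S
    using \<gamma>(1) by (meson continuous_at_imp_continuous_on has_vector_derivative_continuous)
  note g'c = continuous_on_subset[OF \<gamma>(2) subset_UNIV]
  have [measurable]: "f \<in> borel_measurable borel" "dbar D \<in> borel_measurable borel" "\<gamma> \<in> borel_measurable borel"
    "\<gamma>' \<in> borel_measurable borel"
    using fc dc gc \<gamma>(2) by (auto intro: borel_measurable_continuous_onI)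
  note n(1)[measurable]
  define G where "G = (\<lambda>(s::real, w). indicator {0..1} s *\<^sub>R (dbar D w / (\<gamma> s - w) * \<gamma>' s))"
  have Gm[measurable]: "G \<in> borel_measurable (lborel \<Otimes>\<^sub>M lborel)"
    unfolding G_def by measurable
  obtain B where B: "B \<ge> 0" "\<And>x. norm (dbar D x) \<le> B"
    using bounded_continuous_bounded_support[OF dc d0] by metis
  have "bounded (\<gamma>' ` {0..1})"
    by (intro compact_imp_bounded compact_continuous_image g'c) auto
  then obtain M where M: "\<And>s. s \<in> {0..1} \<Longrightarrow> norm (\<gamma>' s) \<le> M" unfolding bounded_iff by blast
  have M0: "M \<ge> 0" using M[of 0] norm_ge_zero[of "\<gamma>' 0"] by (simp del: norm_ge_zero)
  define a where "a = max r 0 + 1"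
  have a: "a > 0" by (simp add: a_def)
  have bd: "(LINT w|lborel. norm (G (s, w))) \<le> M * (B * (5 * pi * a)) * indicator {0..1} s" for s
  proof (cases "s \<in> {0..1}")
    case True
    have "(LINT w|lborel. norm (G (s, w))) \<le> (LINT w|lborel. M * (B * (indicator (ball (0::complex) a) w / cmod (w - \<gamma> s))))"
    proof (rule integral_mono')
      show "integrable lborel (\<lambda>w. M * (B * (indicator (ball (0::complex) a) w / cmod (w - \<gamma> s))))"
        by (intro integrable_mult_right integrable_Cauchy_kernel_ball a)
      fix w
      show "norm (G (s, w)) \<le> M * (B * (indicator (ball (0::complex) a) w / cmod (w - \<gamma> s)))"
      proof (cases "cmod w < a")
        case wa: True
        have "norm (G (s, w)) = norm (\<gamma>' s) * (norm (dbar D w) * (1 / cmod (w - \<gamma> s)))"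
          using True by (simp add: G_def norm_mult norm_divide norm_minus_commute)
        also have "\<dots> \<le> M * (B * (1 / cmod (w - \<gamma> s)))"
          by (intro mult_mono M True B) (auto simp: B M0)
        finally show ?thesis using wa by simp
      next
        case False
        then have "dbar D w = 0" by (intro d0) (auto simp: a_def)
        then show ?thesis using B M0 by (simp add: G_def)
      qed
    qed (use B M0 in auto)
    also have "\<dots> \<le> M * (B * (5 * pi * a))"
      using integral_Cauchy_kernel_ball[OF a, of "\<gamma> s"] B M0
      by (simp only: integral_mult_right_zero) (intro mult_left_mono, auto)
    finally show ?thesis using True by simp
  qed (simp add: G_def)
  have int1: "integrable lborel (\<lambda>s. LINT w|lborel. norm (G (s, w)))"
  proof (rule Bochner_Integration.integrable_bound)
    show "integrable lborel (\<lambda>s. M * (B * (5 * pi * a)) * indicator {0..1::real} s)"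
      by (intro integrable_mult_right integrable_real_indicator) auto
    show "AE s in lborel. norm (LINT w|lborel. norm (G (s, w))) \<le> norm (M * (B * (5 * pi * a)) * indicator {0..1::real} s)"
    proof (rule AE_I2)
      fix s
      have "0 \<le> (LINT w|lborel. norm (G (s, w)))" by (intro integral_nonneg_AE) auto
      then show "norm (LINT w|lborel. norm (G (s, w))) \<le> norm (M * (B * (5 * pi * a)) * indicator {0..1::real} s)"
        using bd[of s] by simp
    qed
  qed measurable
  have int2: "integrable lborel (\<lambda>w. G (s, w))" for s
    unfolding G_def prod.case
    by (intro integrable_scaleR_right integrable_mult_left integrable_Cauchy_kernel[OF dc d0])
  have intG: "integrable (lborel \<Otimes>\<^sub>M lborel) G"
    by (rule lborel_pair.Fubini_integrable[OF Gm int1]) (use int2 in auto)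
  have "(LINT w|lborel. LINT s|lborel. G (s, w)) = (LINT s|lborel. LINT w|lborel. G (s, w))"
    using intG by (intro lborel_pair.Fubini_integral) simp
  also have "\<dots> = (LINT s|lborel. indicator {0..1} s *\<^sub>R (complex_of_real plummer_mass * (f (\<gamma> s) * \<gamma>' s)))"
  proof (rule Bochner_Integration.integral_cong[OF refl])
    fix s
    have "(LINT w|lborel. G (s, w)) = indicator {0..1} s *\<^sub>R ((LINT w|lborel. dbar D w / (\<gamma> s - w)) * \<gamma>' s)"
      unfolding G_def prod.case by (simp only: integral_scaleR_right integral_mult_left_zero)
    then show "(LINT w|lborel. G (s, w)) = indicator {0..1} s *\<^sub>R (complex_of_real plummer_mass * (f (\<gamma> s) * \<gamma>' s))"
      by (simp add: Cauchy_Pompeiu_aux[OF f r])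
  qed
  also have "\<dots> = integral {0..1} (\<lambda>s. complex_of_real plummer_mass * (f (\<gamma> s) * \<gamma>' s))"
  proof -
    have "set_integrable lborel {0..1} (\<lambda>s. complex_of_real plummer_mass * (f (\<gamma> s) * \<gamma>' s))"
      unfolding set_integrable_def
      by (rule borel_integrable_compact) (auto intro!: continuous_intros g'c continuous_on_compose2[OF fc gc])
    from set_borel_integral_eq_integral(2)[OF this] show ?thesis unfolding set_lebesgue_integral_def .
  qed
  also have "\<dots> = complex_of_real plummer_mass * integral {0..1} (\<lambda>s. f (\<gamma> s) * \<gamma>' s)"
    by simp
  finally have L: "complex_of_real plummer_mass * integral {0..1} (\<lambda>s. f (\<gamma> s) * \<gamma>' s) = (LINT w|lborel. LINT s|lborel. G (s, w))" by simp
  have "(LINT w|lborel. LINT s|lborel. G (s, w)) = (LINT w|lborel. 2 * pi * \<i> * (dbar D w * n w))"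
  proof (rule integral_cong_AE)
    have "(\<lambda>(w, s). G (s, w)) \<in> borel_measurable (lborel \<Otimes>\<^sub>M lborel)" by measurable
    then show "(\<lambda>w. LINT s|lborel. G (s, w)) \<in> borel_measurable lborel" by measurable
    show "AE w in lborel. (LINT s|lborel. G (s, w)) = 2 * pi * \<i> * (dbar D w * n w)"
      using AE_not_in[OF negligible_C1_curve[OF \<gamma>(1)]]
    proof eventually_elim
      case (elim w)
      have "set_integrable lborel {0..1} (\<lambda>s. \<gamma>' s / (\<gamma> s - w))"
        unfolding set_integrable_def
        using elim by (intro borel_integrable_compact continuous_intros g'c gc) auto
      from set_borel_integral_eq_integral(2)[OF this]
      have "(LINT s|lborel. indicator {0..1} s *\<^sub>R (\<gamma>' s / (\<gamma> s - w))) = 2 * pi * \<i> * n w"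
        using n(2)[OF elim] by (simp add: set_lebesgue_integral_def)
      moreover have "(LINT s|lborel. G (s, w)) = (LINT s|lborel. dbar D w * (indicator {0..1} s *\<^sub>R (\<gamma>' s / (\<gamma> s - w))))"
        unfolding G_def by (intro Bochner_Integration.integral_cong) auto
      ultimately show ?case by (simp only: integral_mult_right_zero mult_ac)
    qed
  qed measurable
  with L show ?thesis by simp
qed

definition circ_deriv :: "real \<Rightarrow> real \<Rightarrow> complex" where
  "circ_deriv \<rho> s = 2 * of_real pi * \<i> * of_real \<rho> * exp (2 * of_real pi * \<i> * of_real s)"

lemma circlepath_has_vector_derivative:
  "(circlepath 0 \<rho> has_vector_derivative circ_deriv \<rho> s) (at s)"
  using has_vector_derivative_circlepath[of 0 \<rho> s UNIV] by (simp add: circ_deriv_def)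

lemma continuous_on_circ_deriv: "continuous_on S (circ_deriv \<rho>)"
  unfolding circ_deriv_def[abs_def] by (intro continuous_intros)

lemma integral_circlepath:
  "integral {0..1} (\<lambda>s. g (circlepath 0 \<rho> s) * circ_deriv \<rho> s) = contour_integral (circlepath 0 \<rho>) g"
  unfolding contour_integral_integral
  by (simp add: vector_derivative_at[OF circlepath_has_vector_derivative])

lemma circle_winding:
  assumes "\<rho> > 0" "w \<notin> circlepath 0 \<rho> ` {0..1}"
  shows "integral {0..1} (\<lambda>s. circ_deriv \<rho> s / (circlepath 0 \<rho> s - w)) = 2 * pi * \<i> * indicator (ball 0 \<rho>) w"
proof -
  have w: "w \<notin> path_image (circlepath 0 \<rho>)" using assms by (simp add: path_image_def)
  have "integral {0..1} (\<lambda>s. circ_deriv \<rho> s / (circlepath 0 \<rho> s - w)) = contour_integral (circlepath 0 \<rho>) (\<lambda>z. 1 / (z - w))"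
    using integral_circlepath[of "\<lambda>z. 1 / (z - w)" \<rho>] by simp
  also have "\<dots> = 2 * pi * \<i> * winding_number (circlepath 0 \<rho>) w"
    using winding_number_valid_path[OF valid_path_circlepath w] by simp
  also have "winding_number (circlepath 0 \<rho>) w = indicator (ball 0 \<rho>) w"
  proof (cases "cmod w < \<rho>")
    case True
    then show ?thesis using winding_number_circlepath[of w 0 \<rho>] by simp
  next
    case False
    then have "cmod w > \<rho>" using w assms(1) by (auto simp: path_image_circlepath)
    then have "winding_number (circlepath 0 \<rho>) w = 0"
      using assms(1) by (intro winding_number_zero_outside[of _ "cball 0 \<rho>"]) auto
    then show ?thesis using False by simp
  qed
  finally show ?thesis .
qed

text \<open>Apply \<open>Green_aux\<close> to the unit circle and a compactly supported function equal to \<open>cnj w\<close> on the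
  disc. On the circle \<open>cnj w = 1 / w\<close>, so the line integral is \<open>2 \<pi> i\<close>; on the disc \<open>dbar\<close> of it is 1,
  so the area integral is \<open>\<pi>\<close>.\<close>
lemma plummer_mass_eq: "plummer_mass = pi"
proof -
  let ?f = "\<lambda>w. bump 0 2 w *\<^sub>R cnj w" and ?D = "\<lambda>w v. bump 0 2 w *\<^sub>R cnj v + bump' 0 2 w v *\<^sub>R cnj w"
  have f: "C1_on ?f ?D UNIV"
    by (rule C1_on_scaleR[OF C1_on_bump C1_on_linear[OF bounded_linear_cnj]])
  have f0: "?f w = 0" if "norm w > 4" for w using bump_eq0[of 2 w 0] that by simp
  have [measurable]: "indicator (ball 0 1) \<in> borel_measurable (borel :: complex measure)"
    by (intro borel_measurable_indicator) simp
  have "complex_of_real plummer_mass * integral {0..1} (\<lambda>s. ?f (circlepath 0 1 s) * circ_deriv 1 s) =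
    2 * pi * \<i> * (LINT w|lborel. dbar ?D w * indicator (ball 0 1) w)"
    by (rule Green_aux[OF f f0 circlepath_has_vector_derivative continuous_on_circ_deriv])
       (auto simp: circle_winding simp del: zero_less_one intro!: borel_measurable_indicator circle_winding)
  also have "integral {0..1} (\<lambda>s. ?f (circlepath 0 1 s) * circ_deriv 1 s) = integral {0..1} (\<lambda>s. (1 / circlepath 0 1 s) * circ_deriv 1 s)"
  proof (rule integral_cong)
    fix s :: real assume "s \<in> {0..1}"
    have n1: "cmod (circlepath 0 1 s) = 1" by (simp add: circlepath norm_mult)
    then have "circlepath 0 1 s * cnj (circlepath 0 1 s) = 1" using complex_norm_square[of "circlepath 0 1 s"] by simp
    then have "cnj (circlepath 0 1 s) = 1 / circlepath 0 1 s" by (metis div_by_0 divide_eq_eq mult.commute mult_zero_left zero_neq_one)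
    then show "?f (circlepath 0 1 s) * circ_deriv 1 s = (1 / circlepath 0 1 s) * circ_deriv 1 s"
      using n1 bump_eq1[of 2 "circlepath 0 1 s" 0] by simp
  qed
  also have "\<dots> = 2 * pi * \<i>"
  proof -
    have "0 \<notin> circlepath 0 1 ` {0..1}" by (auto simp: circlepath)
    from circle_winding[OF zero_less_one this] show ?thesis by simp
  qed
  also have "(\<lambda>w. dbar ?D w * indicator (ball 0 1) w) = indicator (ball 0 1)"
  proof
    fix w :: complex
    show "dbar ?D w * indicator (ball 0 1) w = indicator (ball 0 1) w"
      using bump_eq1[of 2 w 0] bump'_zero[of 2 w 0] by (auto simp: indicator_def dbar_def)
  qed
  also have "integral\<^sup>L lborel (indicator (ball 0 1) :: complex \<Rightarrow> complex) = complex_of_real pi"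
  proof -
    have "(indicator (ball 0 1) :: complex \<Rightarrow> complex) = (\<lambda>w. complex_of_real (indicator (ball 0 1) w))"
      by (auto simp: indicator_def)
    then have "integral\<^sup>L lborel (indicator (ball 0 1) :: complex \<Rightarrow> complex) = complex_of_real (integral\<^sup>L lborel (indicator (ball (0::complex) 1)))"
      by (simp only: integral_complex_of_real)
    also have "integral\<^sup>L lborel (indicator (ball (0::complex) 1)) = pi"
      using emeasure_ball_complex[of 1 0] by (simp add: measure_def)
    finally show ?thesis .
  qed
  finally show ?thesis by simp
qed

lemma Cauchy_Pompeiu:
  fixes f :: "complex \<Rightarrow> complex"
  assumes "C1_on f D UNIV" "\<And>x. norm x > r \<Longrightarrow> f x = 0"
  shows "(LINT w|lborel. dbar D w / (z - w)) = pi * f z"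
  using Cauchy_Pompeiu_aux[OF assms] by (simp add: plummer_mass_eq)

lemma Green_winding:
  fixes f :: "complex \<Rightarrow> complex" and \<gamma> \<gamma>' :: "real \<Rightarrow> complex" and n :: "complex \<Rightarrow> complex"
  assumes f: "C1_on f D UNIV" and r: "\<And>x. norm x > r \<Longrightarrow> f x = 0"
    and \<gamma>: "\<And>s. (\<gamma> has_vector_derivative \<gamma>' s) (at s)" "continuous_on UNIV \<gamma>'"
    and n: "n \<in> borel_measurable borel"
      "\<And>w. w \<notin> \<gamma> ` {0..1} \<Longrightarrow> integral {0..1} (\<lambda>s. \<gamma>' s / (\<gamma> s - w)) = 2 * pi * \<i> * n w"
  shows "integral {0..1} (\<lambda>s. f (\<gamma> s) * \<gamma>' s) = 2 * \<i> * (LINT w|lborel. dbar D w * n w)"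
proof -
  have "complex_of_real pi * integral {0..1} (\<lambda>s. f (\<gamma> s) * \<gamma>' s) = complex_of_real pi * (2 * \<i> * (LINT w|lborel. dbar D w * n w))"
    using Green_aux[OF assms] by (simp add: plummer_mass_eq mult_ac)
  then show ?thesis by simp
qed

section \<open>Integration by parts for fields tangent to a loop\<close>

text \<open>Closedness is required of \<open>\<gamma>\<close> and \<open>\<gamma>'\<close>, so that integration by parts over one period leaves no
  boundary terms.\<close>
locale C2_loop =
  fixes \<gamma> \<gamma>' \<gamma>'' :: "real \<Rightarrow> complex"
  assumes loop_deriv: "\<And>s. (\<gamma> has_vector_derivative \<gamma>' s) (at s)"
    and loop_deriv': "\<And>s. (\<gamma>' has_vector_derivative \<gamma>'' s) (at s)"
    and loop_cont'': "continuous_on UNIV \<gamma>''"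
    and loop_closed: "\<gamma> 1 = \<gamma> 0" "\<gamma>' 1 = \<gamma>' 0"
    and loop_regular: "\<And>s. \<gamma>' s \<noteq> 0"
begin

abbreviation "\<Gamma> \<equiv> \<gamma> ` {0..1}"

lemma loop_cont: "continuous_on S \<gamma>" "continuous_on S \<gamma>'" "continuous_on S \<gamma>''"
  using loop_deriv loop_deriv' loop_cont''
  by (meson continuous_at_imp_continuous_on has_vector_derivative_continuous continuous_on_subset subset_UNIV)+

lemma compact_Gamma: "compact \<Gamma>"
  by (intro compact_continuous_image loop_cont) auto

text \<open>A smooth substitute for the inverse distance to the curve. In contrast to functions of the distance
  it is differentiable on the whole complement, and tangential integration by parts applies to it.\<close>
definition Theta :: "complex \<Rightarrow> real" where
  "Theta x = integral {0..1} (\<lambda>s. inverse ((norm (x - \<gamma> s))\<^sup>2))"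

definition Theta' :: "complex \<Rightarrow> complex \<Rightarrow> real" where
  "Theta' x v = integral {0..1} (\<lambda>s. - (inverse ((norm (x - \<gamma> s))\<^sup>2))\<^sup>2 * (2 * ((x - \<gamma> s) \<bullet> v)))"

lemma norm_diff_loop_pos: "x \<notin> \<Gamma> \<Longrightarrow> s \<in> {0..1} \<Longrightarrow> norm (x - \<gamma> s) > 0"
  by auto

lemma C1_on_Theta: "C1_on Theta Theta' (- \<Gamma>)"
proof -
  have op: "open (- \<Gamma>)" using compact_Gamma by (simp add: compact_imp_closed open_Compl)
  have cont: "continuous_on ((- \<Gamma>) \<times> {0..1}) (\<lambda>(x, s). - (inverse ((norm (x - \<gamma> s))\<^sup>2))\<^sup>2 * (2 * ((x - \<gamma> s) \<bullet> v)))" for v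
    unfolding split_beta
    by (intro continuous_intros continuous_on_compose2[OF loop_cont(1)]) auto
  show ?thesis
    unfolding C1_on_def
  proof (intro conjI ballI allI)
    fix x0 assume x0G: "x0 \<in> - \<Gamma>"
    then obtain r where r: "r > 0" "ball x0 r \<subseteq> - \<Gamma>" using op openE by blast
    define fx where "fx x s = (- (inverse ((norm (x - \<gamma> s))\<^sup>2))\<^sup>2 * 2) *\<^sub>R blinfun_inner_right (x - \<gamma> s)" for x s
    have "((\<lambda>x. integral (cbox 0 1) (\<lambda>s. inverse ((norm (x - \<gamma> s))\<^sup>2))) has_derivative
        integral (cbox 0 1) (fx x0)) (at x0 within ball x0 r)"
    proof (rule leibniz_rule)
      fix x s assume xs: "x \<in> ball x0 r" "s \<in> cbox 0 (1::real)"
      then have nz: "(norm (x - \<gamma> s))\<^sup>2 \<noteq> 0" using r by auto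
      have "((\<lambda>x. (norm (x - \<gamma> s))\<^sup>2) has_derivative (\<lambda>v. 2 * ((x - \<gamma> s) \<bullet> v))) (at x)"
        using C1_onD[OF C1_on_sqdist[of "\<gamma> s" UNIV]] by auto
      from Deriv.has_derivative_inverse[OF nz this]
      have "((\<lambda>x. inverse ((norm (x - \<gamma> s))\<^sup>2)) has_derivative blinfun_apply (fx x s)) (at x)"
        by (rule has_derivative_eq_rhs) (simp add: fx_def fun_eq_iff blinfun.scaleR_left blinfun.minus_left power2_eq_square)
      then show "((\<lambda>x. inverse ((norm (x - \<gamma> s))\<^sup>2)) has_derivative blinfun_apply (fx x s)) (at x within ball x0 r)"
        by (rule has_derivative_at_withinI)
    next
      show "(\<lambda>s. inverse ((norm (x - \<gamma> s))\<^sup>2)) integrable_on cbox 0 1" if "x \<in> ball x0 r" for x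
        using that r by (intro integrable_continuous continuous_intros loop_cont) auto
      show "continuous_on (ball x0 r \<times> cbox 0 1) (\<lambda>(x, s). fx x s)"
      proof -
        have "fst p - \<gamma> (snd p) \<noteq> 0" if "p \<in> ball x0 r \<times> cbox 0 1" for p
          using that r(2) by (cases p) auto
        then show ?thesis
          unfolding split_beta fx_def
          by (intro continuous_intros continuous_on_compose2[OF loop_cont(1)]
             bounded_linear.continuous_on[OF bounded_linear_blinfun_inner_right]) auto
      qed
    qed (use r in auto)
    moreover have "blinfun_apply (integral (cbox 0 1) (fx x0)) = Theta' x0"
    proof
      fix v
      have "fx x0 integrable_on cbox 0 1"
        unfolding fx_def using x0G
        by (intro integrable_continuous continuous_intros loop_cont
             bounded_linear.continuous_on[OF bounded_linear_blinfun_inner_right]) auto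
      then show "blinfun_apply (integral (cbox 0 1) (fx x0)) v = Theta' x0 v"
        by (simp add: blinfun_apply_integral Theta'_def fx_def blinfun.scaleR_left blinfun.minus_left mult.assoc)
    qed
    ultimately have "(Theta has_derivative Theta' x0) (at x0 within ball x0 r)"
      by (simp add: Theta_def[abs_def])
    then show "(Theta has_derivative Theta' x0) (at x0)"
      using r by (simp add: at_within_open[of x0 "ball x0 r"])
  next
    fix v
    show "continuous_on (- \<Gamma>) (\<lambda>x. Theta' x v)"
      unfolding Theta'_def using integral_continuous_on_param[OF cont[of v, unfolded cbox_interval[symmetric]]]
      by (simp add: cbox_interval)
  qed
qed

text \<open>Near \<open>\<gamma> s0\<close> the parameters within \<open>d / L\<close> of \<open>s0\<close> contribute about \<open>(d / L) (2 d)\<^sup>-\<^sup>2\<close> to the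
  integral, which is large for small \<open>d\<close>.\<close>
lemma Theta_blowup:
  assumes x0: "x0 \<in> \<Gamma>"
  obtains d where "d > 0" "\<And>x. x \<in> ball x0 d - \<Gamma> \<Longrightarrow> Theta x \<ge> N"
proof -
  obtain s0 where s0: "s0 \<in> {0..1}" "x0 = \<gamma> s0" using x0 by auto
  have "bounded (\<gamma>' ` {0..1})"
    by (intro compact_imp_bounded compact_continuous_image loop_cont) auto
  then obtain L0 where L0: "\<And>s. s \<in> {0..1} \<Longrightarrow> norm (\<gamma>' s) \<le> L0" unfolding bounded_iff by blast
  define L where "L = max L0 1"
  have L: "L \<ge> 1" "\<And>s. s \<in> {0..1} \<Longrightarrow> norm (\<gamma>' s) \<le> L" using L0 by (force simp: L_def)+
  have lip: "norm (\<gamma> s - x0) \<le> L * \<bar>s - s0\<bar>" if "s \<in> {0..1}" for s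
  proof -
    have "norm (\<gamma> s - \<gamma> s0) \<le> L * norm (s - s0)"
    proof (rule differentiable_bound)
      fix t :: real assume "t \<in> {0..1}"
      then show "onorm (\<lambda>h. h *\<^sub>R \<gamma>' t) \<le> L"
        using L(2) by (simp add: onorm_scaleR_left onorm_id bounded_linear_ident)
      show "(\<gamma> has_derivative (\<lambda>h. h *\<^sub>R \<gamma>' t)) (at t within {0..1})"
        using loop_deriv[of t] by (simp add: has_vector_derivative_def has_derivative_at_withinI)
    qed (use that s0 in auto)
    then show ?thesis by (simp add: s0(2))
  qed
  define d where "d = min (1/2) (1 / (4 * L * (\<bar>N\<bar> + 1)))"
  have d: "d > 0" "d \<le> 1/2" "d \<le> 1 / (4 * L * (\<bar>N\<bar> + 1))" using L by (auto simp: d_def)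
  show ?thesis
  proof (rule that[OF d(1)])
    fix x assume x: "x \<in> ball x0 d - \<Gamma>"
    define h where "h = d / L"
    have h: "0 < h" "h \<le> 1/2" using d L by (auto simp: h_def divide_le_eq)
    \<comment> \<open>an interval of length \<open>h\<close> next to \<open>s0\<close> that does not leave the unit interval\<close>
    define a where "a = (if s0 \<le> 1/2 then s0 else s0 - h)"
    have sub: "{a..a + h} \<subseteq> {0..1}" "\<And>s. s \<in> {a..a+h} \<Longrightarrow> \<bar>s - s0\<bar> \<le> h"
      using h s0(1) by (auto simp: a_def split: if_splits)
    let ?g = "\<lambda>s. inverse ((norm (x - \<gamma> s))\<^sup>2)"
    have gc: "continuous_on {0..1} ?g"
      using x by (intro continuous_intros loop_cont) auto
    have "inverse ((2 * d)\<^sup>2) \<le> ?g s" if s: "s \<in> {a..a+h}" for s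
    proof -
      have "norm (x - \<gamma> s) \<le> norm (x - x0) + norm (\<gamma> s - x0)"
        using norm_triangle_ineq4[of "x - x0" "\<gamma> s - x0"] by simp
      also have "\<dots> \<le> d + L * h"
      proof (rule add_mono)
        show "norm (x - x0) \<le> d" using x by (simp add: dist_norm norm_minus_commute)
        have "s \<in> {0..1}" using sub(1) s by blast
        moreover have "L * \<bar>s - s0\<bar> \<le> L * h" using sub(2)[OF s] L(1) by (intro mult_left_mono) auto
        ultimately show "norm (\<gamma> s - x0) \<le> L * h" using lip[of s] by linarith
      qed
      also have "\<dots> = 2 * d" using L by (simp add: h_def)
      finally have "(norm (x - \<gamma> s))\<^sup>2 \<le> (2 * d)\<^sup>2" by (intro power_mono) auto
      moreover have "norm (x - \<gamma> s) > 0" using x sub s by (intro norm_diff_loop_pos) auto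
      ultimately show ?thesis by (intro le_imp_inverse_le) auto
    qed
    then have "integral {a..a+h} (\<lambda>s. inverse ((2 * d)\<^sup>2)) \<le> integral {a..a+h} ?g"
      using gc sub by (intro integral_le integrable_continuous_interval continuous_on_subset[OF gc]) auto
    also have "\<dots> \<le> Theta x"
      unfolding Theta_def using gc sub
      by (intro integral_subset_le integrable_continuous_interval continuous_on_subset[OF gc]) auto
    finally have "h * inverse ((2 * d)\<^sup>2) \<le> Theta x" using h by simp
    moreover have "h * inverse ((2 * d)\<^sup>2) = 1 / (4 * L * d)"
      using d L by (simp add: h_def field_simps power2_eq_square)
    moreover have "\<bar>N\<bar> + 1 \<le> 1 / (4 * L * d)"
    proof -
      have "d * (4 * L * (\<bar>N\<bar> + 1)) \<le> 1"
        using d(3) L(1) by (simp add: pos_le_divide_eq)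
      then show ?thesis using d(1) L(1) by (simp add: pos_le_divide_eq mult_ac)
    qed
    ultimately show "Theta x \<ge> N" by linarith
  qed
qed

text \<open>Split \<open>V x = (V x - V (\<gamma> s)) + V (\<gamma> s)\<close> under the integral. The first part gains a factor
  \<open>|x - \<gamma> s|\<close> by the Lipschitz bound, which compensates the loss from differentiating the kernel. The
  second part is tangent to the curve, so it acts on the kernel as \<open>- l d/ds\<close> and integration by parts
  moves the derivative to \<open>l\<close>.\<close>
lemma Theta'_tangent_bound:
  assumes Vc: "continuous_on UNIV V" and V: "\<And>x y. norm (V x - V y) \<le> L * norm (x - y)"
    and tan: "\<And>s. s \<in> {0..1} \<Longrightarrow> V (\<gamma> s) = l s *\<^sub>R \<gamma>' s"
    and l: "\<And>s. s \<in> {0..1} \<Longrightarrow> (l has_real_derivative l' s) (at s)" "continuous_on {0..1} l'"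
      "\<And>s. s \<in> {0..1} \<Longrightarrow> \<bar>l' s\<bar> \<le> \<Lambda>" "l 0 = l 1"
    and x: "x \<notin> \<Gamma>"
  shows "\<bar>Theta' x (V x)\<bar> \<le> (2 * L + \<Lambda>) * Theta x"
proof -
  let ?p = "\<lambda>s. inverse ((norm (x - \<gamma> s))\<^sup>2)"
  define p' where "p' s = (?p s)\<^sup>2 * (2 * ((x - \<gamma> s) \<bullet> \<gamma>' s))" for s
  have pos: "norm (x - \<gamma> s) > 0" if "s \<in> {0..1}" for s using norm_diff_loop_pos[OF x that] .
  have lc: "continuous_on {0..1} l" using l(1) by (meson DERIV_continuous continuous_at_imp_continuous_on)
  have pc: "continuous_on {0..1} ?p" using x by (intro continuous_intros loop_cont) auto
  have p'c: "continuous_on {0..1} p'" unfolding p'_def using x by (intro continuous_intros loop_cont) auto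
  have pd: "(?p has_real_derivative p' s) (at s)" if s: "s \<in> {0..1}" for s
  proof -
    have "((\<lambda>s. (norm (\<gamma> s - x))\<^sup>2) has_derivative (\<lambda>h. 2 * ((\<gamma> s - x) \<bullet> (h *\<^sub>R \<gamma>' s)))) (at s)"
      using has_derivative_compose[OF loop_deriv[of s, unfolded has_vector_derivative_def] C1_onD[OF C1_on_sqdist[of x UNIV]]] by simp
    then have "((\<lambda>s. (norm (x - \<gamma> s))\<^sup>2) has_real_derivative - (2 * ((x - \<gamma> s) \<bullet> \<gamma>' s))) (at s)"
      unfolding has_field_derivative_def norm_minus_commute[of x]
      by (rule has_derivative_eq_rhs) (auto simp: fun_eq_iff inner_diff_left algebra_simps)
    from DERIV_inverse_fun[OF this] pos[OF s] show ?thesis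
      by (simp add: p'_def power2_eq_square mult_ac)
  qed
  have "((\<lambda>s. l s * p' s + l' s * ?p s) has_integral (l 1 * ?p 1 - l 0 * ?p 0)) {0..1}"
  proof (rule fundamental_theorem_of_calculus)
    fix s :: real assume s: "s \<in> {0..1}"
    have "((\<lambda>s. l s * ?p s) has_real_derivative (l s * p' s + l' s * ?p s)) (at s)"
      using DERIV_mult[OF l(1)[OF s] pd[OF s]] by (simp add: algebra_simps)
    then show "((\<lambda>s. l s * ?p s) has_vector_derivative (l s * p' s + l' s * ?p s)) (at s within {0..1})"
      by (simp add: has_real_derivative_iff_has_vector_derivative has_vector_derivative_at_within)
  qed simp
  then have parts: "integral {0..1} (\<lambda>s. l s * p' s) = - integral {0..1} (\<lambda>s. l' s * ?p s)"
    using l(4) loop_closed(1) lc pc p'c l(2)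
    by (subst (asm) has_integral_iff)
       (auto simp: integral_add integrable_continuous_interval continuous_on_mult add_eq_0_iff)
  have "Theta' x (V x) = integral {0..1} (\<lambda>s. - (?p s)\<^sup>2 * (2 * ((x - \<gamma> s) \<bullet> (V x - V (\<gamma> s)))) - l s * p' s)"
    unfolding Theta'_def
    by (intro integral_cong) (simp add: tan p'_def inner_diff_right algebra_simps)
  also have "\<dots> = integral {0..1} (\<lambda>s. - (?p s)\<^sup>2 * (2 * ((x - \<gamma> s) \<bullet> (V x - V (\<gamma> s))))) + integral {0..1} (\<lambda>s. l' s * ?p s)"
  proof -
    have "continuous_on {0..1} (\<lambda>s. V (\<gamma> s))"
      by (rule continuous_on_compose2[OF Vc]) (auto intro: loop_cont)
    then have "(\<lambda>s. - (?p s)\<^sup>2 * (2 * ((x - \<gamma> s) \<bullet> (V x - V (\<gamma> s))))) integrable_on {0..1}"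
      using x by (intro integrable_continuous_interval continuous_intros loop_cont) auto
    moreover have "(\<lambda>s. l s * p' s) integrable_on {0..1}"
      by (intro integrable_continuous_interval continuous_intros lc p'c)
    ultimately show ?thesis using parts by (simp add: integral_diff)
  qed
  also have "\<bar>\<dots>\<bar> \<le> 2 * L * Theta x + \<Lambda> * Theta x"
  proof (intro order_trans[OF abs_triangle_ineq] add_mono)
    have "norm (integral {0..1} (\<lambda>s. - (?p s)\<^sup>2 * (2 * ((x - \<gamma> s) \<bullet> (V x - V (\<gamma> s)))))) \<le> integral {0..1} (\<lambda>s. 2 * L * ?p s)"
    proof (rule integral_norm_bound_integral)
      have "continuous_on {0..1} (\<lambda>s. V (\<gamma> s))"
        by (rule continuous_on_compose2[OF Vc]) (auto intro: loop_cont)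
      then show "(\<lambda>s. - (?p s)\<^sup>2 * (2 * ((x - \<gamma> s) \<bullet> (V x - V (\<gamma> s))))) integrable_on {0..1}"
        using x by (intro integrable_continuous_interval continuous_intros loop_cont) auto
      show "(\<lambda>s. 2 * L * ?p s) integrable_on {0..1}"
        by (intro integrable_continuous_interval continuous_intros pc)
      fix s :: real assume s: "s \<in> {0..1}"
      let ?n = "norm (x - \<gamma> s)"
      have "\<bar>(x - \<gamma> s) \<bullet> (V x - V (\<gamma> s))\<bar> \<le> ?n * (L * ?n)"
        by (intro order_trans[OF Cauchy_Schwarz_ineq2] mult_left_mono V) auto
      then have "(?p s)\<^sup>2 * (2 * \<bar>(x - \<gamma> s) \<bullet> (V x - V (\<gamma> s))\<bar>) \<le> (?p s)\<^sup>2 * (2 * (?n * (L * ?n)))"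
        by (intro mult_left_mono) auto
      also have "\<dots> = 2 * L * ?p s"
      proof -
        have "(inverse (n\<^sup>2))\<^sup>2 * (2 * (n * (L * n))) = 2 * L * inverse (n\<^sup>2)" if "n > 0" for n :: real
          using that by (simp add: field_simps power2_eq_square)
        then show ?thesis using pos[OF s] .
      qed
      finally show "norm (- (?p s)\<^sup>2 * (2 * ((x - \<gamma> s) \<bullet> (V x - V (\<gamma> s))))) \<le> 2 * L * ?p s"
        by (simp add: abs_mult)
    qed
    then show "\<bar>integral {0..1} (\<lambda>s. - (?p s)\<^sup>2 * (2 * ((x - \<gamma> s) \<bullet> (V x - V (\<gamma> s)))))\<bar> \<le> 2 * L * Theta x"
      by (simp add: Theta_def)
    have "norm (integral {0..1} (\<lambda>s. l' s * ?p s)) \<le> integral {0..1} (\<lambda>s. \<Lambda> * ?p s)"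
      using l(3) by (intro integral_norm_bound_integral integrable_continuous_interval continuous_intros l(2) pc)
         (auto simp: abs_mult intro!: mult_right_mono)
    then show "\<bar>integral {0..1} (\<lambda>s. l' s * ?p s)\<bar> \<le> \<Lambda> * Theta x"
      by (simp add: Theta_def)
  qed
  finally show ?thesis by (simp add: algebra_simps)
qed

lemma linear_complex_expand:
  fixes D :: "complex \<Rightarrow> 'b::real_vector"
  assumes "linear D"
  shows "D v = Re v *\<^sub>R D 1 + Im v *\<^sub>R D \<i>"
proof -
  have "v = Re v *\<^sub>R 1 + Im v *\<^sub>R \<i>" by (simp add: complex_eq_iff)
  then have "D v = D (Re v *\<^sub>R 1 + Im v *\<^sub>R \<i>)" by simp
  then show ?thesis by (simp only: linear_add[OF assms] linear_scale[OF assms])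
qed

lemma continuous_on_C1_apply:
  fixes D :: "complex \<Rightarrow> complex \<Rightarrow> 'b::euclidean_space"
  assumes f: "C1_on f D S" and g: "continuous_on T g" "g ` T \<subseteq> S" and v: "continuous_on T v"
  shows "continuous_on T (\<lambda>x. D (g x) (v x))"
proof -
  have "continuous_on T (\<lambda>x. Re (v x) *\<^sub>R D (g x) 1 + Im (v x) *\<^sub>R D (g x) \<i>)"
    by (intro continuous_intros v continuous_on_compose2[OF C1_on_cont_deriv[OF f] g])
  moreover have "D (g x) (v x) = Re (v x) *\<^sub>R D (g x) 1 + Im (v x) *\<^sub>R D (g x) \<i>" if "x \<in> T" for x
    using linear_complex_expand[OF has_derivative_linear[OF C1_onD[OF f]], of "g x"] g(2) that by blast
  ultimately show ?thesis by (simp cong: continuous_on_cong)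
qed

text \<open>Tangency makes \<open>V (\<gamma> s)\<close> a real multiple of \<open>\<gamma>' s\<close>; the multiple is the projection
  \<open>(V \<bullet> \<gamma>') / |\<gamma>'|\<^sup>2\<close>.\<close>
lemma tangent_coefficient:
  assumes V: "C1_on V DV UNIV" and tan: "\<And>s. V (\<gamma> s) \<bullet> (\<i> * \<gamma>' s) = 0"
  obtains l l' where "\<And>s. V (\<gamma> s) = l s *\<^sub>R \<gamma>' s" "\<And>s. (l has_real_derivative l' s) (at s)"
    "continuous_on {0..1} l'" "l 0 = l 1"
proof -
  define a where "a s = V (\<gamma> s) \<bullet> \<gamma>' s" for s
  define b where "b s = \<gamma>' s \<bullet> \<gamma>' s" for s
  define a' where "a' s = V (\<gamma> s) \<bullet> \<gamma>'' s + DV (\<gamma> s) (\<gamma>' s) \<bullet> \<gamma>' s" for s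
  define b' where "b' s = 2 * (\<gamma>' s \<bullet> \<gamma>'' s)" for s
  have b0: "b s \<noteq> 0" for s using loop_regular by (simp add: b_def)
  have Vd: "((\<lambda>s. V (\<gamma> s)) has_derivative (\<lambda>h. h *\<^sub>R DV (\<gamma> s) (\<gamma>' s))) (at s)" for s
  proof -
    have d: "(V has_derivative DV (\<gamma> s)) (at (\<gamma> s))" using C1_onD[OF V] by auto
    show ?thesis
      using has_derivative_compose[OF loop_deriv[of s, unfolded has_vector_derivative_def] d]
      by (simp add: linear_scale[OF has_derivative_linear[OF d]])
  qed
  have "(a has_real_derivative a' s) (at s)" for s
    unfolding has_field_derivative_def a_def[abs_def]
    using has_derivative_inner[OF Vd[of s] loop_deriv'[of s, unfolded has_vector_derivative_def]]
    by (rule has_derivative_eq_rhs) (simp add: a'_def fun_eq_iff algebra_simps)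
  moreover have "(b has_real_derivative b' s) (at s)" for s
    unfolding has_field_derivative_def b_def[abs_def]
    using has_derivative_inner[OF loop_deriv'[of s, unfolded has_vector_derivative_def] loop_deriv'[of s, unfolded has_vector_derivative_def]]
    by (rule has_derivative_eq_rhs) (simp add: b'_def fun_eq_iff algebra_simps inner_commute)
  ultimately have "((\<lambda>s. a s / b s) has_real_derivative (a' s * b s - a s * b' s) / (b s * b s)) (at s)" for s
    using b0 by (intro DERIV_divide) auto
  moreover have "continuous_on {0..1} (\<lambda>s. (a' s * b s - a s * b' s) / (b s * b s))"
    unfolding a_def b_def a'_def b'_def using loop_regular
    by (intro continuous_intros loop_cont continuous_on_compose2[OF C1_on_continuous[OF V]]
        continuous_on_C1_apply[OF V]) auto
  moreover have "V (\<gamma> s) = (a s / b s) *\<^sub>R \<gamma>' s" for s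
  proof -
    define z where "z = V (\<gamma> s)" define g where "g = \<gamma>' s"
    have t: "Im z * Re g = Re z * Im g" using tan[of s] by (simp add: z_def g_def inner_complex_def)
    have "b s *\<^sub>R z = a s *\<^sub>R g"
      using t unfolding a_def b_def z_def[symmetric] g_def[symmetric]
      by (simp add: complex_eq_iff inner_complex_def) (simp add: algebra_simps power2_eq_square; algebra)
    then have "(1 / b s) *\<^sub>R (b s *\<^sub>R z) = (1 / b s) *\<^sub>R (a s *\<^sub>R g)" by simp
    then show ?thesis using b0 by (simp add: z_def g_def)
  qed
  moreover have "a 0 / b 0 = a 1 / b 1" by (simp add: a_def b_def loop_closed)
  ultimately show ?thesis
    using that[of "\<lambda>s. a s / b s" "\<lambda>s. (a' s * b s - a s * b' s) / (b s * b s)"] by blast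
qed

lemma C1_on_Lipschitz:
  assumes V: "C1_on V DV (UNIV :: complex set)" and r: "\<And>x. norm x > r \<Longrightarrow> V x = 0"
  obtains L where "L \<ge> 0" "\<And>x y. norm (V x - V y) \<le> L * norm (x - y)"
proof -
  have D0: "DV x v = 0" if "norm x > r" for x v using C1_on_deriv_zero_outside[OF V r that] .
  obtain B1 where B1: "B1 \<ge> 0" "\<And>x. norm (DV x 1) \<le> B1"
    using bounded_continuous_bounded_support[OF C1_on_cont_deriv[OF V] D0] by metis
  obtain B2 where B2: "B2 \<ge> 0" "\<And>x. norm (DV x \<i>) \<le> B2"
    using bounded_continuous_bounded_support[OF C1_on_cont_deriv[OF V] D0] by metis
  have "norm (V x - V y) \<le> (B1 + B2) * norm (x - y)" for x y
  proof (rule differentiable_bound[of UNIV V DV])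
    fix z :: complex
    show "(V has_derivative DV z) (at z within UNIV)" using C1_onD[OF V] by auto
    then have lin: "linear (DV z)" by (rule has_derivative_linear)
    show "onorm (DV z) \<le> B1 + B2"
    proof (rule onorm_le)
      fix v
      have "norm (DV z v) \<le> \<bar>Re v\<bar> * norm (DV z 1) + \<bar>Im v\<bar> * norm (DV z \<i>)"
        using norm_triangle_ineq[of "Re v *\<^sub>R DV z 1" "Im v *\<^sub>R DV z \<i>"]
        by (simp add: linear_complex_expand[OF lin, of v])
      also have "\<dots> \<le> norm v * B1 + norm v * B2"
        by (intro add_mono mult_mono B1 B2 abs_Re_le_cmod abs_Im_le_cmod) auto
      finally show "norm (DV z v) \<le> (B1 + B2) * norm v" by (simp add: algebra_simps)
    qed
  qed auto
  then show ?thesis using B1 B2 by (intro that[of "B1 + B2"]) auto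
qed

text \<open>The integrand is the divergence of \<open>\<eta> q V\<close>. Multiplied by the cutoff \<open>step (\<Theta> / (n + 1) - 1)\<close> the
  field vanishes near the curve and extends by 0 to the plane, so its divergence has integral 0. Where
  the cutoff varies \<open>\<Theta> \<le> 2 (n + 1)\<close>, hence its derivative along \<open>V\<close> is at most
  \<open>4 C \<Theta> / (n + 1) \<le> 8 C\<close>. Dominated convergence as \<open>n \<rightarrow> \<infinity>\<close> removes the cutoff.\<close>
lemma tangential_integral_bounded:
  fixes V :: "complex \<Rightarrow> complex" and \<eta> q :: "complex \<Rightarrow> real"
  assumes Om: "open Om" "Om \<inter> \<Gamma> = {}" "closed (Om \<union> \<Gamma>)"
    and V: "C1_on V DV UNIV" "\<And>x. norm x > RV \<Longrightarrow> V x = 0"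
    and div: "\<And>x. x \<in> Om \<Longrightarrow> norm x \<le> \<rho> \<Longrightarrow> Re (DV x 1) + Im (DV x \<i>) = 0"
    and tan: "\<And>s. V (\<gamma> s) \<bullet> (\<i> * \<gamma>' s) = 0"
    and eta: "C1_on \<eta> D\<eta> UNIV" "\<And>x. norm x > \<rho> \<Longrightarrow> \<eta> x = 0"
    and q: "C1_on q Dq Om"
      "\<And>x. x \<in> Om \<Longrightarrow> norm x \<le> \<rho> \<Longrightarrow> \<bar>q x\<bar> \<le> B"
      "\<And>x. x \<in> Om \<Longrightarrow> norm x \<le> \<rho> \<Longrightarrow> \<bar>Dq x (V x)\<bar> \<le> B" and B0: "B \<ge> 0"
  shows "(LINT x:Om|lborel. \<eta> x * Dq x (V x) + q x * D\<eta> x (V x)) = 0"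
proof -
  have D\<eta>0: "D\<eta> x v = 0" if "norm x > \<rho>" for x v using C1_on_deriv_zero_outside[OF eta that] .
  note Vc = C1_on_continuous[OF V(1)]
  obtain l l' where l: "\<And>s. V (\<gamma> s) = l s *\<^sub>R \<gamma>' s" "\<And>s. (l has_real_derivative l' s) (at s)"
    "continuous_on {0..1} l'" "l 0 = l 1"
    using tangent_coefficient[OF V(1) tan] by metis
  have "bounded (l' ` {0..1})"
    by (intro compact_imp_bounded compact_continuous_image l) auto
  then obtain \<Lambda> where "\<forall>y\<in>l' ` {0..1}. norm y \<le> \<Lambda>" unfolding bounded_iff by blast
  then have \<Lambda>: "\<And>s. s \<in> {0..1} \<Longrightarrow> \<bar>l' s\<bar> \<le> \<Lambda>" by auto
  obtain L where L: "L \<ge> 0" "\<And>x y. norm (V x - V y) \<le> L * norm (x - y)"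
    using C1_on_Lipschitz[OF V] by metis
  define C where "C = 2 * L + \<Lambda>"
  have C0: "C \<ge> 0" using L \<Lambda>[of 0] by (auto simp: C_def)
  have Th: "\<bar>Theta' x (V x)\<bar> \<le> C * Theta x" if "x \<notin> \<Gamma>" for x
    unfolding C_def by (rule Theta'_tangent_bound[OF Vc L(2) l(1) l(2) l(3) \<Lambda> l(4) that])
  obtain E where "E \<ge> 0" "\<And>x. norm (\<eta> x) \<le> E"
    using bounded_continuous_bounded_support[where r=\<rho>, OF C1_on_continuous[OF eta(1)] eta(2)] by blast
  then have E: "E \<ge> 0" "\<And>x. \<bar>\<eta> x\<bar> \<le> E" by auto
  have D\<eta>c: "continuous_on UNIV (\<lambda>x. D\<eta> x (V x))"
    by (rule continuous_on_C1_apply[OF eta(1) continuous_on_id _ Vc]) auto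
  obtain E' where "E' \<ge> 0" "\<And>x. norm (D\<eta> x (V x)) \<le> E'"
    using bounded_continuous_bounded_support[where r=\<rho>, OF D\<eta>c D\<eta>0] by blast
  then have E': "E' \<ge> 0" "\<And>x. \<bar>D\<eta> x (V x)\<bar> \<le> E'" by auto
  have bnn: "0 \<le> (E * B + B * E') + 4 * (C * 2) * (E * B)"
    using B0 E E' C0 by simp
  have OmG: "Om \<subseteq> - \<Gamma>" using Om(2) by auto
  define k where "k n x = Theta x * (1 / real (Suc n)) - 1" for n x
  define g where "g n x = indicator Om x * (step (k n x) * (\<eta> x * Dq x (V x) + q x * D\<eta> x (V x)) +
      step' (k n x) * (Theta' x (V x) * (1 / real (Suc n))) * (\<eta> x * q x))" for n x
  have F: "C1_on (\<lambda>x. step (k n x) * (\<eta> x * q x))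
      (\<lambda>x v. step (k n x) * (\<eta> x * Dq x v + D\<eta> x v * q x) + (step' (k n x) * (Theta' x v * (1 / real (Suc n)) - 0)) * (\<eta> x * q x)) Om" for n
    unfolding k_def
    by (intro C1_on_mult C1_on_real_comp[OF _ step_deriv continuous_on_step'] C1_on_diff C1_on_const
       C1_on_linear_comp[OF bounded_linear_mult_left] C1_on_subset[OF C1_on_Theta OmG] C1_on_subset[OF eta(1)] q(1)) auto
  have zero: "(LINT x|lborel. g n x) = 0" for n
  proof -
    have "\<forall>x0\<in>\<Gamma>. \<exists>d>0. \<forall>x \<in> ball x0 d - \<Gamma>. Theta x \<ge> 2 * real (Suc n)"
      using Theta_blowup by metis
    then obtain d where d: "\<And>x0. x0 \<in> \<Gamma> \<Longrightarrow> d x0 > 0"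
      "\<And>x0 x. x0 \<in> \<Gamma> \<Longrightarrow> x \<in> ball x0 (d x0) - \<Gamma> \<Longrightarrow> Theta x \<ge> 2 * real (Suc n)" by metis
    \<comment> \<open>on this open set, which contains the curve, the cutoff is 0; its complement in the truncated domain is closed\<close>
    define W where "W = (\<Union>x0\<in>\<Gamma>. ball x0 (d x0)) \<union> {x\<in>Om. Theta x > 2 * real (Suc n)}"
    have "open {x\<in>Om. Theta x > 2 * real (Suc n)}"
    proof -
      have "{x\<in>Om. Theta x > 2 * real (Suc n)} = Om \<inter> Theta -` {2 * real (Suc n)<..}" by auto
      then show ?thesis
        using continuous_open_preimage[OF continuous_on_subset[OF C1_on_continuous[OF C1_on_Theta] OmG] Om(1)] by simp
    qed
    then have W: "open W" unfolding W_def by auto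
    define K where "K = (Om \<union> \<Gamma>) \<inter> cball 0 \<rho> - W"
    have K: "closed K" unfolding K_def using Om(3) W by (intro closed_Diff closed_Int) auto
    have KO: "K \<subseteq> Om" unfolding K_def W_def using d(1) by force
    have Th2: "step (k n x) = 0" if "x \<in> W" "x \<in> Om" for x
    proof -
      have "Theta x \<ge> 2 * real (Suc n)" using that d(2) OmG unfolding W_def by force
      then have "k n x \<ge> 1" by (simp add: k_def field_simps del: of_nat_Suc)
      then show ?thesis by simp
    qed
    define F where "F = (\<lambda>x. if x \<in> Om then step (k n x) * (\<eta> x * q x) else 0)"
    define DF where "DF = (\<lambda>x v. if x \<in> Om then step (k n x) * (\<eta> x * Dq x v + D\<eta> x v * q x)
        + (step' (k n x) * (Theta' x v * (1 / real (Suc n)) - 0)) * (\<eta> x * q x) else 0)"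
    have CF: "C1_on F DF UNIV"
      unfolding F_def DF_def
    proof (rule C1_on_extend_zero[OF F Om(1) K KO])
      fix x assume "x \<in> Om - K"
      then have "x \<in> Om" "x \<in> W \<or> norm x > \<rho>" by (auto simp: K_def)
      then show "step (k n x) * (\<eta> x * q x) = 0" using Th2 eta(2) by auto
    qed
    define G where "G = (\<lambda>x v. F x *\<^sub>R DV x v + DF x v *\<^sub>R V x)"
    have CG: "C1_on (\<lambda>x. F x *\<^sub>R V x) G UNIV" unfolding G_def by (rule C1_on_scaleR[OF CF V(1)])
    have G0: "F x *\<^sub>R V x = 0" if "norm x > \<rho>" for x using eta(2)[OF that] by (simp add: F_def)
    note int = integral_derivative_bounded_support[OF CG G0]
    have "(LINT x|lborel. Re (G x 1) + Im (G x \<i>)) = 0"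
      using int by (subst Bochner_Integration.integral_add) (auto simp: integrable_Re integrable_Im)
    moreover have "Re (G x 1) + Im (G x \<i>) = g n x" for x
    proof -
      have "linear (DF x)" using C1_onD[OF CF UNIV_I] by (rule has_derivative_linear)
      from linear_complex_expand[OF this, of "V x"]
      have "Re (G x 1) + Im (G x \<i>) = F x * (Re (DV x 1) + Im (DV x \<i>)) + DF x (V x)"
        by (simp add: G_def algebra_simps)
      also have "F x * (Re (DV x 1) + Im (DV x \<i>)) = 0"
        using div[of x] eta(2)[of x] by (cases "x \<in> Om"; cases "norm x \<le> \<rho>") (auto simp: F_def)
      also have "0 + DF x (V x) = g n x" by (simp add: DF_def g_def algebra_simps)
      finally show ?thesis .
    qed
    ultimately show ?thesis by simp
  qed
  have Dqc: "continuous_on Om (\<lambda>x. Dq x (V x))"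
    by (rule continuous_on_C1_apply[OF q(1) continuous_on_id _ continuous_on_subset[OF Vc]]) auto
  have Thc: "continuous_on Om (\<lambda>x. Theta' x (V x))" "continuous_on Om Theta"
    using OmG continuous_on_C1_apply[OF C1_on_Theta continuous_on_id _ continuous_on_subset[OF Vc], of Om]
      continuous_on_subset[OF C1_on_continuous[OF C1_on_Theta]] by auto
  have qc: "continuous_on Om q" and \<eta>c: "continuous_on Om \<eta>"
    using C1_on_continuous[OF q(1)] C1_on_continuous[OF eta(1)] by (auto intro: continuous_on_subset)
  have sc: "continuous_on S step" for S using step_deriv by (meson DERIV_continuous continuous_at_imp_continuous_on)
  have mg: "(\<lambda>x. indicator Om x *\<^sub>R (step (k n x) * (\<eta> x * Dq x (V x) + q x * D\<eta> x (V x)) +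
      step' (k n x) * (Theta' x (V x) * (1 / real (Suc n))) * (\<eta> x * q x))) \<in> borel_measurable borel" for n
    unfolding k_def using Om(1)
    by (intro borel_measurable_continuous_on_indicator continuous_intros Dqc Thc qc \<eta>c continuous_on_subset[OF D\<eta>c]
        continuous_on_compose2[OF sc] continuous_on_compose2[OF continuous_on_step']) auto
  have "(\<lambda>n. LINT x|lborel. g n x) \<longlonglongrightarrow> (LINT x|lborel. indicator Om x *\<^sub>R (\<eta> x * Dq x (V x) + q x * D\<eta> x (V x)))"
  proof (rule integral_dominated_convergence[where w="\<lambda>x. ((E * B + B * E') + 4 * (C * 2) * (E * B)) * indicator (cball 0 \<rho>) x"])
    show "integrable lborel (\<lambda>x::complex. ((E * B + B * E') + 4 * (C * 2) * (E * B)) * indicator (cball 0 \<rho>) x)"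
      by (intro integrable_mult_right integrable_real_indicator) (auto intro!: emeasure_bounded_finite[unfolded infinity_ennreal_def])
    have "(\<lambda>x. indicator Om x *\<^sub>R (\<eta> x * Dq x (V x) + q x * D\<eta> x (V x))) \<in> borel_measurable borel"
      using Om(1)
      by (intro borel_measurable_continuous_on_indicator continuous_intros Dqc qc \<eta>c continuous_on_subset[OF D\<eta>c]) auto
    then show "(\<lambda>x. indicator Om x *\<^sub>R (\<eta> x * Dq x (V x) + q x * D\<eta> x (V x))) \<in> borel_measurable lborel"
      by simp
    show "g n \<in> borel_measurable lborel" for n
      using mg[of n] unfolding g_def by simp
    show "AE x in lborel. (\<lambda>n. g n x) \<longlonglongrightarrow> indicator Om x *\<^sub>R (\<eta> x * Dq x (V x) + q x * D\<eta> x (V x))"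
    proof (rule AE_I2)
      fix x
      obtain N where N: "Theta x < real N" using reals_Archimedean2 by blast
      have "g n x = indicator Om x *\<^sub>R (\<eta> x * Dq x (V x) + q x * D\<eta> x (V x))" if "n \<ge> N" for n
      proof -
        have "k n x \<le> 0" using N that by (simp add: k_def field_simps)
        then show ?thesis by (simp add: g_def)
      qed
      then show "(\<lambda>n. g n x) \<longlonglongrightarrow> indicator Om x *\<^sub>R (\<eta> x * Dq x (V x) + q x * D\<eta> x (V x))"
        by (intro tendsto_eventually) (auto simp: eventually_sequentially)
    qed
    fix n
    show "AE x in lborel. norm (g n x) \<le> ((E * B + B * E') + 4 * (C * 2) * (E * B)) * indicator (cball 0 \<rho>) x"
    proof (rule AE_I2)
      fix x
      show "norm (g n x) \<le> ((E * B + B * E') + 4 * (C * 2) * (E * B)) * indicator (cball 0 \<rho>) x"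
      proof (cases "x \<in> Om \<and> norm x \<le> \<rho>")
        case False
        then have "g n x = 0" using eta(2)[of x] D\<eta>0[of x "V x"] by (cases "x \<in> Om") (auto simp: g_def)
        then show ?thesis using bnn by (simp add: indicator_def)
      next
        case True
        then have B: "\<bar>q x\<bar> \<le> B" "\<bar>Dq x (V x)\<bar> \<le> B" using q(2,3)[of x] by auto
        have i1: "\<bar>step (k n x) * (\<eta> x * Dq x (V x) + q x * D\<eta> x (V x))\<bar> \<le> 1 * (E * B + B * E')"
          unfolding abs_mult
        proof (rule mult_mono)
          show "\<bar>\<eta> x * Dq x (V x) + q x * D\<eta> x (V x)\<bar> \<le> E * B + B * E'"
            by (rule order_trans[OF abs_triangle_ineq]) (auto simp: abs_mult intro!: add_mono mult_mono E E' B B0)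
        qed (use step_bounds[of "k n x"] in auto)
        have i2: "\<bar>step' (k n x) * (Theta' x (V x) * (1 / real (Suc n))) * (\<eta> x * q x)\<bar> \<le> 4 * (C * 2) * (E * B)"
        proof (cases "k n x < 1")
          case k: True
          have "\<bar>Theta' x (V x) * (1 / real (Suc n))\<bar> \<le> C * Theta x / real (Suc n)"
            using Th[of x] True Om(2) by (auto simp: abs_mult intro!: divide_right_mono)
          also have "\<dots> \<le> C * (2 * real (Suc n)) / real (Suc n)"
            using k C0 by (intro divide_right_mono mult_left_mono) (auto simp: k_def field_simps)
          also have "\<dots> = C * 2" by (simp del: of_nat_Suc)
          finally show ?thesis
            unfolding abs_mult[of "step' (k n x) * _"] abs_mult[of "step' (k n x)"] abs_mult[of "\<eta> x"]
            by (intro mult_mono abs_step'_le E B) (use E B0 C0 in auto)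
        qed (use E B0 C0 in auto)
        have gx: "g n x = step (k n x) * (\<eta> x * Dq x (V x) + q x * D\<eta> x (V x)) +
            step' (k n x) * (Theta' x (V x) * (1 / real (Suc n))) * (\<eta> x * q x)"
          unfolding g_def using True by (simp only: indicator_simps mult_1_left)
        have "\<bar>g n x\<bar> \<le> 1 * (E * B + B * E') + 4 * (C * 2) * (E * B)"
          unfolding gx by (rule order_trans[OF abs_triangle_ineq add_mono[OF i1 i2]])
        then show ?thesis using True by simp
      qed
    qed
  qed
  then have "(\<lambda>n. 0) \<longlonglongrightarrow> (LINT x|lborel. indicator Om x *\<^sub>R (\<eta> x * Dq x (V x) + q x * D\<eta> x (V x)))"
    by (simp only: zero)
  then show ?thesis by (simp add: set_lebesgue_integral_def LIMSEQ_const_iff)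
qed

text \<open>Here \<open>q\<close> may be unbounded near the curve, as is a priori the case for a pressure, as long as its
  derivative along \<open>V\<close> is bounded. It is replaced by \<open>h (q)\<close> with the truncation
  \<open>h s = s / (1 + (e s)\<^sup>2)\<close>, which is bounded by \<open>1 / e\<close>, satisfies \<open>|h s| \<le> |s|\<close> and \<open>|h'| \<le> 1\<close>, and
  tends to the identity as \<open>e \<rightarrow> 0\<close>.\<close>
lemma tangential_integral:
  fixes V :: "complex \<Rightarrow> complex" and \<eta> q :: "complex \<Rightarrow> real"
  assumes Om: "open Om" "Om \<inter> \<Gamma> = {}" "closed (Om \<union> \<Gamma>)"
    and V: "C1_on V DV UNIV" "\<And>x. norm x > RV \<Longrightarrow> V x = 0"
    and div: "\<And>x. x \<in> Om \<Longrightarrow> norm x \<le> \<rho> \<Longrightarrow> Re (DV x 1) + Im (DV x \<i>) = 0"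
    and tan: "\<And>s. V (\<gamma> s) \<bullet> (\<i> * \<gamma>' s) = 0"
    and eta: "C1_on \<eta> D\<eta> UNIV" "\<And>x. norm x > \<rho> \<Longrightarrow> \<eta> x = 0"
    and q: "C1_on q Dq Om"
      "\<And>x. x \<in> Om \<Longrightarrow> norm x \<le> \<rho> \<Longrightarrow> D\<eta> x (V x) \<noteq> 0 \<Longrightarrow> \<bar>q x\<bar> \<le> B"
      "\<And>x. x \<in> Om \<Longrightarrow> norm x \<le> \<rho> \<Longrightarrow> \<bar>Dq x (V x)\<bar> \<le> B" and B0: "B \<ge> 0"
  shows "(LINT x:Om|lborel. \<eta> x * Dq x (V x) + q x * D\<eta> x (V x)) = 0"
proof -
  have D\<eta>0: "D\<eta> x v = 0" if "norm x > \<rho>" for x v using C1_on_deriv_zero_outside[OF eta that] .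
  note Vc = C1_on_continuous[OF V(1)]
  define e where "e n = 1 / real (Suc n)" for n
  have e: "e n > 0" for n by (simp add: e_def)
  have e0: "e \<longlonglongrightarrow> 0" unfolding e_def by (rule LIMSEQ_Suc[OF lim_inverse_n'])
  define h where "h n s = s / (1 + (e n * s)\<^sup>2)" for n s
  define h' where "h' n s = (1 - (e n * s)\<^sup>2) / (1 + (e n * s)\<^sup>2)\<^sup>2" for n s
  have pos: "1 + (e n * s)\<^sup>2 > 0" for n s by (intro add_pos_nonneg) auto
  have hd: "(h n has_real_derivative h' n s) (at s)" for n s
  proof -
    have "((\<lambda>s. s / (1 + (e n * s)\<^sup>2)) has_real_derivative
      (1 * (1 + (e n * s)\<^sup>2) - s * (2 * (e n * s) * e n)) / ((1 + (e n * s)\<^sup>2) * (1 + (e n * s)\<^sup>2))) (at s)"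
      using pos[of n s] by (intro DERIV_divide) (auto intro!: derivative_eq_intros)
    moreover have "1 * (1 + (e n * s)\<^sup>2) - s * (2 * (e n * s) * e n) = 1 - (e n * s)\<^sup>2"
      by (simp add: power2_eq_square algebra_simps)
    ultimately show ?thesis
      unfolding h_def[abs_def] h'_def power2_eq_square[of "1 + (e n * s)\<^sup>2"] by (simp only:)
  qed
  have h'c: "continuous_on S (h' n)" for S n
    unfolding h'_def[abs_def] using pos by (intro continuous_intros) (metis less_irrefl zero_neq_one power_eq_0_iff)
  have h_le: "\<bar>h n s\<bar> \<le> \<bar>s\<bar>" for n s
    unfolding h_def using pos[of n s] by (simp add: divide_le_eq abs_mult mult_left_mono)
      (simp add: abs_of_pos distrib_left)
  have h_bd: "\<bar>h n s\<bar> \<le> 1 / e n" for n s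
  proof -
    have "e n * \<bar>s\<bar> \<le> 1 + (e n * s)\<^sup>2"
      using sum_squares_bound[of 1 "e n * \<bar>s\<bar>"] e[of n] by (simp add: power_mult_distrib)
        (smt (verit) mult_nonneg_nonneg abs_ge_zero)
    then show ?thesis unfolding h_def using pos[of n s] e[of n] by (simp add: field_simps abs_of_pos)
  qed
  have h'_bd: "\<bar>h' n s\<bar> \<le> 1" for n s
  proof -
    have "\<bar>1 - (e n * s)\<^sup>2\<bar> \<le> 1 + (e n * s)\<^sup>2" by (smt (verit) zero_le_power2)
    also have "\<dots> \<le> (1 + (e n * s)\<^sup>2)\<^sup>2"
      using self_le_power[of "1 + (e n * s)\<^sup>2" 2] by simp
    finally show ?thesis using pos[of n s] by (simp add: h'_def divide_le_eq)
  qed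
  have zero: "(LINT x:Om|lborel. \<eta> x * (h' n (q x) * Dq x (V x)) + h n (q x) * D\<eta> x (V x)) = 0" for n
  proof (rule tangential_integral_bounded[OF Om V div tan eta])
    show "C1_on (\<lambda>x. h n (q x)) (\<lambda>x v. h' n (q x) * Dq x v) Om"
      by (rule C1_on_real_comp[OF q(1) hd h'c])
    fix x assume x: "x \<in> Om" "norm x \<le> \<rho>"
    show "\<bar>h n (q x)\<bar> \<le> max B (1 / e n)" using h_bd by (simp add: max.coboundedI2)
    have "\<bar>h' n (q x) * Dq x (V x)\<bar> \<le> 1 * B"
      unfolding abs_mult by (intro mult_mono h'_bd q(3) x) auto
    then show "\<bar>h' n (q x) * Dq x (V x)\<bar> \<le> max B (1 / e n)" by simp
  qed (use B0 in auto)
  obtain E where "E \<ge> 0" "\<And>x. norm (\<eta> x) \<le> E"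
    using bounded_continuous_bounded_support[where r=\<rho>, OF C1_on_continuous[OF eta(1)] eta(2)] by blast
  then have E: "E \<ge> 0" "\<And>x. \<bar>\<eta> x\<bar> \<le> E" by auto
  have D\<eta>c: "continuous_on UNIV (\<lambda>x. D\<eta> x (V x))"
    by (rule continuous_on_C1_apply[OF eta(1) continuous_on_id _ Vc]) auto
  obtain E' where "E' \<ge> 0" "\<And>x. norm (D\<eta> x (V x)) \<le> E'"
    using bounded_continuous_bounded_support[where r=\<rho>, OF D\<eta>c D\<eta>0] by blast
  then have E': "E' \<ge> 0" "\<And>x. \<bar>D\<eta> x (V x)\<bar> \<le> E'" by auto
  have Dqc: "continuous_on Om (\<lambda>x. Dq x (V x))"
    by (rule continuous_on_C1_apply[OF q(1) continuous_on_id _ continuous_on_subset[OF Vc]]) auto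
  have qc: "continuous_on Om q" and \<eta>c: "continuous_on Om \<eta>"
    using C1_on_continuous[OF q(1)] C1_on_continuous[OF eta(1)] by (auto intro: continuous_on_subset)
  have hc: "continuous_on S (h n)" for S n using hd by (meson DERIV_continuous continuous_at_imp_continuous_on)
  have "(\<lambda>n. LINT x|lborel. indicator Om x *\<^sub>R (\<eta> x * (h' n (q x) * Dq x (V x)) + h n (q x) * D\<eta> x (V x))) \<longlonglongrightarrow>
        (LINT x|lborel. indicator Om x *\<^sub>R (\<eta> x * Dq x (V x) + q x * D\<eta> x (V x)))"
  proof (rule integral_dominated_convergence[where w="\<lambda>x. (E * B + B * E') * indicator (cball 0 \<rho>) x"])
    show "integrable lborel (\<lambda>x::complex. (E * B + B * E') * indicator (cball 0 \<rho>) x)"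
      by (intro integrable_mult_right integrable_real_indicator) (auto intro!: emeasure_bounded_finite[unfolded infinity_ennreal_def])
    have "(\<lambda>x. indicator Om x *\<^sub>R (\<eta> x * Dq x (V x) + q x * D\<eta> x (V x))) \<in> borel_measurable borel"
      using Om(1)
      by (intro borel_measurable_continuous_on_indicator continuous_intros Dqc qc \<eta>c continuous_on_subset[OF D\<eta>c]) auto
    then show "(\<lambda>x. indicator Om x *\<^sub>R (\<eta> x * Dq x (V x) + q x * D\<eta> x (V x))) \<in> borel_measurable lborel"
      by simp
    fix n
    have "(\<lambda>x. indicator Om x *\<^sub>R (\<eta> x * (h' n (q x) * Dq x (V x)) + h n (q x) * D\<eta> x (V x))) \<in> borel_measurable borel"
      using Om(1)
      by (intro borel_measurable_continuous_on_indicator continuous_intros Dqc qc \<eta>c continuous_on_subset[OF D\<eta>c]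
         continuous_on_compose2[OF hc] continuous_on_compose2[OF h'c]) auto
    then show "(\<lambda>x. indicator Om x *\<^sub>R (\<eta> x * (h' n (q x) * Dq x (V x)) + h n (q x) * D\<eta> x (V x))) \<in> borel_measurable lborel"
      by simp
    show "AE x in lborel. norm (indicator Om x *\<^sub>R (\<eta> x * (h' n (q x) * Dq x (V x)) + h n (q x) * D\<eta> x (V x)))
       \<le> (E * B + B * E') * indicator (cball 0 \<rho>) x"
    proof (rule AE_I2)
      fix x
      show "norm (indicator Om x *\<^sub>R (\<eta> x * (h' n (q x) * Dq x (V x)) + h n (q x) * D\<eta> x (V x)))
       \<le> (E * B + B * E') * indicator (cball 0 \<rho>) x"
      proof (cases "x \<in> Om \<and> norm x \<le> \<rho>")
        case False
        then show ?thesis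
          using eta(2)[of x] D\<eta>0[of x "V x"] E(1) E'(1) B0 by (cases "x \<in> Om") (auto simp: indicator_def)
      next
        case True
        have "\<bar>\<eta> x * (h' n (q x) * Dq x (V x))\<bar> \<le> E * (1 * B)"
          unfolding abs_mult by (intro mult_mono E h'_bd q(3)) (use True B0 in auto)
        moreover have "\<bar>h n (q x) * D\<eta> x (V x)\<bar> \<le> B * E'"
        proof (cases "D\<eta> x (V x) = 0")
          case False
          then have "\<bar>h n (q x)\<bar> \<le> B" using h_le[of n "q x"] q(2)[of x] True by auto
          then show ?thesis unfolding abs_mult by (intro mult_mono E') (use B0 in auto)
        qed (use B0 E' in auto)
        ultimately have "\<bar>\<eta> x * (h' n (q x) * Dq x (V x)) + h n (q x) * D\<eta> x (V x)\<bar> \<le> E * B + B * E'"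
          by linarith
        then show ?thesis using True by simp
      qed
    qed
  next
    show "AE x in lborel. (\<lambda>n. indicator Om x *\<^sub>R (\<eta> x * (h' n (q x) * Dq x (V x)) + h n (q x) * D\<eta> x (V x))) \<longlonglongrightarrow>
       indicator Om x *\<^sub>R (\<eta> x * Dq x (V x) + q x * D\<eta> x (V x))"
    proof (rule AE_I2)
      fix x
      have "(\<lambda>n. h n (q x)) \<longlonglongrightarrow> q x / (1 + (0 * q x)\<^sup>2)" unfolding h_def by (intro tendsto_intros e0) auto
      moreover have "(\<lambda>n. h' n (q x)) \<longlonglongrightarrow> (1 - (0 * q x)\<^sup>2) / (1 + (0 * q x)\<^sup>2)\<^sup>2" unfolding h'_def by (intro tendsto_intros e0) auto
      ultimately have "(\<lambda>n. h n (q x)) \<longlonglongrightarrow> q x" "(\<lambda>n. h' n (q x)) \<longlonglongrightarrow> 1" by simp_all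
      then have "(\<lambda>n. indicator Om x *\<^sub>R (\<eta> x * (h' n (q x) * Dq x (V x)) + h n (q x) * D\<eta> x (V x))) \<longlonglongrightarrow>
       indicator Om x *\<^sub>R (\<eta> x * (1 * Dq x (V x)) + q x * D\<eta> x (V x))"
        by (intro tendsto_intros)
      then show "(\<lambda>n. indicator Om x *\<^sub>R (\<eta> x * (h' n (q x) * Dq x (V x)) + h n (q x) * D\<eta> x (V x))) \<longlonglongrightarrow>
       indicator Om x *\<^sub>R (\<eta> x * Dq x (V x) + q x * D\<eta> x (V x))" by simp
    qed
  qed
  then show ?thesis using zero by (simp add: set_lebesgue_integral_def LIMSEQ_const_iff)
qed

end

section \<open>Smooth functions and symmetry of second derivatives\<close>

lemma smooth_on_C1:
  assumes "smooth_on f S"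
  shows "C1_on f (\<lambda>x. frechet_derivative f (at x)) S"
proof -
  have "Ck_on (Suc 0) f S" using assms unfolding smooth_on_def by blast
  then show ?thesis
    by (auto simp: C1_on_def frechet_derivative_works[symmetric])
qed

lemma smooth_on_derivative:
  assumes "smooth_on f S"
  shows "smooth_on (\<lambda>x. frechet_derivative f (at x) v) S"
  unfolding smooth_on_def
proof
  fix k
  have "Ck_on (Suc k) f S" using assms unfolding smooth_on_def by blast
  then show "Ck_on k (\<lambda>x. frechet_derivative f (at x) v) S" by simp
qed

lemma C1_on_line_deriv:
  assumes "C1_on f D S" "x + s *\<^sub>R v \<in> S"
  shows "((\<lambda>s. f (x + s *\<^sub>R v)) has_vector_derivative D (x + s *\<^sub>R v) v) (at s)"
proof -
  have d: "(f has_derivative D (x + s *\<^sub>R v)) (at (x + s *\<^sub>R v))" using C1_onD[OF assms] .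
  have "((\<lambda>t. x + t *\<^sub>R v) has_derivative (\<lambda>t. t *\<^sub>R v)) (at s)"
    by (auto intro!: derivative_eq_intros)
  from has_derivative_compose[OF this d] show ?thesis
    by (simp add: has_vector_derivative_def linear_scale[OF has_derivative_linear[OF d]])
qed

text \<open>The mean value theorem in \<open>s\<close>, applied to the increment in direction \<open>w\<close>, and then in \<open>t\<close>.\<close>
lemma second_difference_mvt:
  fixes f :: "'a::euclidean_space \<Rightarrow> real"
  assumes f: "C1_on f D S" and v: "C1_on (\<lambda>x. D x v) Dv S"
    and h: "h > 0" and sub: "\<And>s t. 0 \<le> s \<Longrightarrow> s \<le> h \<Longrightarrow> 0 \<le> t \<Longrightarrow> t \<le> h \<Longrightarrow> x + s *\<^sub>R v + t *\<^sub>R w \<in> S"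
  obtains s t where "0 < s" "s < h" "0 < t" "t < h"
    "f (x + h *\<^sub>R v + h *\<^sub>R w) - f (x + h *\<^sub>R v) - f (x + h *\<^sub>R w) + f x = h * h * Dv (x + s *\<^sub>R v + t *\<^sub>R w) w"
proof -
  define \<phi> where "\<phi> s = f ((x + h *\<^sub>R w) + s *\<^sub>R v) - f (x + s *\<^sub>R v)" for s
  have "\<exists>s. 0 < s \<and> s < h \<and> \<phi> h - \<phi> 0 = (h - 0) * (D ((x + h *\<^sub>R w) + s *\<^sub>R v) v - D (x + s *\<^sub>R v) v)"
  proof (rule MVT2[OF h])
    fix s assume s: "0 \<le> s" "s \<le> h"
    have "(x + h *\<^sub>R w) + s *\<^sub>R v \<in> S" "x + s *\<^sub>R v \<in> S"
      using sub[of s h] sub[of s 0] s h by (auto simp: algebra_simps)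
    then show "(\<phi> has_real_derivative D ((x + h *\<^sub>R w) + s *\<^sub>R v) v - D (x + s *\<^sub>R v) v) (at s)"
      unfolding \<phi>_def[abs_def] has_real_derivative_iff_has_vector_derivative
      by (intro has_vector_derivative_diff C1_on_line_deriv[OF f])
  qed
  then obtain s where s: "0 < s" "s < h" "\<phi> h - \<phi> 0 = h * (D ((x + h *\<^sub>R w) + s *\<^sub>R v) v - D (x + s *\<^sub>R v) v)" by auto
  have "\<exists>t. 0 < t \<and> t < h \<and> D ((x + s *\<^sub>R v) + h *\<^sub>R w) v - D ((x + s *\<^sub>R v) + 0 *\<^sub>R w) v = (h - 0) * Dv ((x + s *\<^sub>R v) + t *\<^sub>R w) w"
  proof (rule MVT2[OF h])
    fix t assume t: "0 \<le> t" "t \<le> h"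
    then have "(x + s *\<^sub>R v) + t *\<^sub>R w \<in> S" using sub[of s t] s by auto
    then show "((\<lambda>t. D ((x + s *\<^sub>R v) + t *\<^sub>R w) v) has_real_derivative Dv ((x + s *\<^sub>R v) + t *\<^sub>R w) w) (at t)"
      unfolding has_real_derivative_iff_has_vector_derivative
      by (rule C1_on_line_deriv[OF v])
  qed
  then obtain t where t: "0 < t" "t < h" "D ((x + s *\<^sub>R v) + h *\<^sub>R w) v - D (x + s *\<^sub>R v) v = h * Dv ((x + s *\<^sub>R v) + t *\<^sub>R w) w" by auto
  have "f (x + h *\<^sub>R v + h *\<^sub>R w) - f (x + h *\<^sub>R v) - f (x + h *\<^sub>R w) + f x = \<phi> h - \<phi> 0"
    by (simp add: \<phi>_def algebra_simps)
  also have "\<dots> = h * (h * Dv ((x + s *\<^sub>R v) + t *\<^sub>R w) w)"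
    using s(3) t(3) by (simp add: algebra_simps)
  finally show ?thesis using that[of s t] s t by (simp add: mult.assoc)
qed

lemma half_cancel: "y \<noteq> 0 \<Longrightarrow> a / (2 * y) * y = a / (2 :: real)"
  by simp

text \<open>The second difference is symmetric in \<open>v\<close> and \<open>w\<close>, and divided by \<open>h\<^sup>2\<close> it tends to either mixed
  derivative.\<close>
lemma symmetric_second_derivative_real:
  fixes f :: "'a::euclidean_space \<Rightarrow> real"
  assumes S: "open S" "x \<in> S" and f: "C1_on f D S"
    and v: "C1_on (\<lambda>x. D x v) Dv S" and w: "C1_on (\<lambda>x. D x w) Dw S"
  shows "Dv x w = Dw x v"
proof (rule ccontr)
  assume ne: "Dv x w \<noteq> Dw x v"
  define e where "e = \<bar>Dv x w - Dw x v\<bar> / 2"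
  have e: "e > 0" using ne by (simp add: e_def)
  obtain d0 where d0: "d0 > 0" "ball x d0 \<subseteq> S" using S openE by blast
  have "continuous (at x) (\<lambda>y. Dv y w)" "continuous (at x) (\<lambda>y. Dw y v)"
    using C1_on_cont_deriv[OF v] C1_on_cont_deriv[OF w] S continuous_on_eq_continuous_at by blast+
  then obtain d1 d2 where d1: "d1 > 0" "\<And>y. dist y x < d1 \<Longrightarrow> dist (Dv y w) (Dv x w) < e"
    and d2: "d2 > 0" "\<And>y. dist y x < d2 \<Longrightarrow> dist (Dw y v) (Dw x v) < e"
    using e unfolding continuous_at_eps_delta by metis
  define d where "d = min d0 (min d1 d2)"
  have d: "d > 0" "d \<le> d0" "d \<le> d1" "d \<le> d2" using d0 d1 d2 by (auto simp: d_def)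
  define h where "h = d / (2 * (norm v + norm w + 1))"
  have nvw: "norm v + norm w + 1 > 0" using norm_ge_zero[of v] norm_ge_zero[of w] by linarith
  have h: "h > 0" using d nvw by (simp add: h_def)
  have close: "norm (s *\<^sub>R v + t *\<^sub>R w) < d" if "0 \<le> s" "s \<le> h" "0 \<le> t" "t \<le> h" for s t
  proof -
    have "norm (s *\<^sub>R v + t *\<^sub>R w) \<le> s * norm v + t * norm w"
      using norm_triangle_ineq[of "s *\<^sub>R v" "t *\<^sub>R w"] that by simp
    also have "\<dots> \<le> h * norm v + h * norm w" using that by (intro add_mono mult_right_mono) auto
    also have "\<dots> \<le> h * (norm v + norm w + 1)" using h by (simp add: algebra_simps)
    also have "\<dots> = d / 2" using half_cancel[OF less_imp_neq[OF nvw, symmetric], of d] by (simp only: h_def)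
    finally show ?thesis using d by simp
  qed
  have sub: "x + s *\<^sub>R v + t *\<^sub>R w \<in> S" if "0 \<le> s" "s \<le> h" "0 \<le> t" "t \<le> h" for s t
  proof (rule subsetD[OF d0(2)])
    have "dist (x + s *\<^sub>R v + t *\<^sub>R w) x < d0" using close[OF that] d by (simp add: dist_norm add.assoc)
    then show "x + s *\<^sub>R v + t *\<^sub>R w \<in> ball x d0" by (simp add: dist_commute)
  qed
  obtain s t where st: "0 < s" "s < h" "0 < t" "t < h"
    "f (x + h *\<^sub>R v + h *\<^sub>R w) - f (x + h *\<^sub>R v) - f (x + h *\<^sub>R w) + f x = h * h * Dv (x + s *\<^sub>R v + t *\<^sub>R w) w"
    using second_difference_mvt[OF f v h, of x w] sub by metis
  have sub': "x + s *\<^sub>R w + t *\<^sub>R v \<in> S" if "0 \<le> s" "s \<le> h" "0 \<le> t" "t \<le> h" for s t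
    using sub[OF that(3,4,1,2)] by (simp add: algebra_simps)
  obtain s' t' where st': "0 < s'" "s' < h" "0 < t'" "t' < h"
    "f (x + h *\<^sub>R w + h *\<^sub>R v) - f (x + h *\<^sub>R w) - f (x + h *\<^sub>R v) + f x = h * h * Dw (x + s' *\<^sub>R w + t' *\<^sub>R v) v"
    using second_difference_mvt[OF f w h, of x v] sub' by metis
  have "h * h * Dv (x + s *\<^sub>R v + t *\<^sub>R w) w = h * h * Dw (x + s' *\<^sub>R w + t' *\<^sub>R v) v"
    unfolding st(5)[symmetric] st'(5)[symmetric] by (simp add: algebra_simps)
  then have eq: "Dv (x + s *\<^sub>R v + t *\<^sub>R w) w = Dw (x + s' *\<^sub>R w + t' *\<^sub>R v) v" using h by simp
  have "dist (Dv (x + s *\<^sub>R v + t *\<^sub>R w) w) (Dv x w) < e"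
    using close[of s t] st d by (intro d1) (simp add: dist_norm add.assoc)
  moreover have "dist (Dw (x + s' *\<^sub>R w + t' *\<^sub>R v) v) (Dw x v) < e"
    using close[of t' s'] st' d by (intro d2) (simp add: dist_norm add_ac)
  ultimately show False
    unfolding eq e_def dist_real_def by (auto simp: abs_if split: if_splits)
qed

lemma symmetric_second_derivative:
  fixes f :: "'a::euclidean_space \<Rightarrow> 'b::euclidean_space"
  assumes S: "open S" "x \<in> S" and f: "C1_on f D S"
    and v: "C1_on (\<lambda>x. D x v) Dv S" and w: "C1_on (\<lambda>x. D x w) Dw S"
  shows "Dv x w = Dw x v"
proof (rule euclidean_eqI)
  fix b :: 'b
  note L = C1_on_linear_comp[OF bounded_linear_inner_left[of b]]
  show "Dv x w \<bullet> b = Dw x v \<bullet> b"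
    by (rule symmetric_second_derivative_real[OF S L[OF f] L[OF v] L[OF w]])
qed

section \<open>A maximum principle along characteristics\<close>

text \<open>The hypothesis on \<open>Dh\<close> says that \<open>h\<close> does not increase along the characteristics of \<open>b\<close>, followed
  forward (\<open>\<kappa> = 1\<close>) or backward (\<open>\<kappa> = -1\<close>) in time from \<open>s\<close>. If \<open>h\<close> were positive somewhere, then
  \<open>h - \<epsilon> \<kappa> (\<tau> - s)\<close> would have a positive maximum, off the initial and lateral boundary; a small step
  back along the characteristic direction stays in the region and strictly increases this function. In
  this way no flow map has to be constructed.\<close>
lemma transport_maximum_principle:
  fixes h :: "complex \<times> real \<Rightarrow> real" and b :: "complex \<times> real \<Rightarrow> complex"
  assumes \<kappa>: "\<kappa> = 1 \<or> \<kappa> = - 1"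
    and cont: "continuous_on {(x, \<tau>). R0 \<le> norm x \<and> norm x \<le> N \<and> 0 \<le> \<kappa> * (\<tau> - s) \<and> \<kappa> * (\<tau> - s) \<le> \<delta>} h"
    and deriv: "\<And>x \<tau>. R0 < norm x \<Longrightarrow> norm x < N \<Longrightarrow> 0 < \<kappa> * (\<tau> - s) \<Longrightarrow> \<kappa> * (\<tau> - s) \<le> \<delta> \<Longrightarrow>
        (h has_derivative Dh (x, \<tau>)) (at (x, \<tau>)) \<and> Dh (x, \<tau>) (\<kappa> *\<^sub>R b (x, \<tau>), \<kappa>) \<le> 0"
    and init: "\<And>x. R0 \<le> norm x \<Longrightarrow> norm x \<le> N \<Longrightarrow> h (x, s) \<le> 0"
    and bdry: "\<And>x \<tau>. norm x = R0 \<or> norm x = N \<Longrightarrow> 0 \<le> \<kappa> * (\<tau> - s) \<Longrightarrow> \<kappa> * (\<tau> - s) \<le> \<delta> \<Longrightarrow> h (x, \<tau>) \<le> 0"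
    and pt: "R0 \<le> norm x" "norm x \<le> N" "0 \<le> \<kappa> * (\<tau> - s)" "\<kappa> * (\<tau> - s) \<le> \<delta>"
  shows "h (x, \<tau>) \<le> 0"
proof (rule ccontr)
  assume "\<not> h (x, \<tau>) \<le> 0"
  then have m: "h (x, \<tau>) > 0" by simp
  define Q where "Q = {(x::complex, \<tau>). R0 \<le> norm x \<and> norm x \<le> N \<and> 0 \<le> \<kappa> * (\<tau> - s) \<and> \<kappa> * (\<tau> - s) \<le> \<delta>}"
  have k2: "\<kappa> * \<kappa> = 1" using \<kappa> by auto
  have dl: "\<delta> \<ge> 0" using pt by linarith
  define \<epsilon> where "\<epsilon> = h (x, \<tau>) / (2 * (\<delta> + 1))"
  have \<epsilon>: "\<epsilon> > 0" using m dl by (simp add: \<epsilon>_def)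
  have ed: "\<epsilon> * \<delta> < h (x, \<tau>)"
  proof -
    have "\<epsilon> * \<delta> \<le> \<epsilon> * (\<delta> + 1)" using \<epsilon> by simp
    also have "\<dots> = h (x, \<tau>) / 2"
      using half_cancel[of "\<delta> + 1" "h (x, \<tau>)"] dl unfolding \<epsilon>_def by linarith
    finally show ?thesis using m by simp
  qed
  define H where "H y = h y - \<epsilon> * (\<kappa> * (snd y - s))" for y
  have Qe: "Q = {y. R0 \<le> norm (fst y) \<and> norm (fst y) \<le> N \<and> 0 \<le> \<kappa> * (snd y - s) \<and> \<kappa> * (snd y - s) \<le> \<delta>}"
    by (auto simp: Q_def)
  have Qcl: "closed Q" unfolding Qe
    by (intro closed_Collect_conj closed_Collect_le continuous_intros)
  have Qs: "Q \<subseteq> cball 0 N \<times> {s - \<delta>..s + \<delta>}"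
    using \<kappa> by (auto simp: Q_def)
  have Qc: "compact Q"
    unfolding compact_eq_bounded_closed
    using bounded_subset[OF compact_imp_bounded[OF compact_Times[OF compact_cball compact_Icc]] Qs] Qcl by blast
  have xQ: "(x, \<tau>) \<in> Q" using pt by (simp add: Q_def)
  have "continuous_on Q H" unfolding H_def using cont by (intro continuous_intros) (simp add: Q_def)
  from continuous_attains_sup[OF Qc _ this] xQ obtain y where y: "y \<in> Q" "\<And>z. z \<in> Q \<Longrightarrow> H z \<le> H y" by blast
  obtain x1 t1 where x1: "y = (x1, t1)" by (cases y)
  have Hpos: "H y > 0"
  proof -
    have "\<epsilon> * (\<kappa> * (\<tau> - s)) \<le> \<epsilon> * \<delta>" using \<epsilon> pt by (intro mult_left_mono) auto
    then have "H (x, \<tau>) > 0" using ed by (simp add: H_def)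
    then show ?thesis using y(2)[OF xQ] by simp
  qed
  have Hle: "H y \<le> h y" using y(1) \<epsilon> by (auto simp: H_def Q_def)
  then have hy: "h (x1, t1) > 0" using Hpos x1 by simp
  have r: "R0 < norm x1" "norm x1 < N"
    using bdry[of x1 t1] hy y(1) x1 by (force simp: Q_def)+
  have "t1 \<noteq> s" using init[of x1] hy y(1) x1 by (force simp: Q_def)
  then have t1: "0 < \<kappa> * (t1 - s)" "\<kappa> * (t1 - s) \<le> \<delta>" using y(1) x1 \<kappa> by (auto simp: Q_def)
  \<comment> \<open>the space-time direction of the characteristic through the maximum point\<close>
  define w where "w = (\<kappa> *\<^sub>R b (x1, t1), \<kappa>)"
  have dh: "(h has_derivative Dh (x1, t1)) (at (x1, t1))" "Dh (x1, t1) w \<le> 0"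
    using deriv[OF r t1] by (auto simp: w_def)
  have lin: "((\<lambda>\<sigma>. (x1, t1) - \<sigma> *\<^sub>R w) has_derivative (\<lambda>\<sigma>. - \<sigma> *\<^sub>R w)) (at 0)"
    by (auto intro!: derivative_eq_intros)
  have "((\<lambda>\<sigma>. h ((x1, t1) - \<sigma> *\<^sub>R w)) has_derivative (\<lambda>\<sigma>. Dh (x1, t1) (- \<sigma> *\<^sub>R w))) (at 0)"
    using has_derivative_compose[OF lin, of h "Dh (x1, t1)"] dh(1) by simp
  then have "((\<lambda>\<sigma>. h ((x1, t1) - \<sigma> *\<^sub>R w)) has_real_derivative - Dh (x1, t1) w) (at 0)"
    unfolding has_field_derivative_def
    by (rule has_derivative_eq_rhs) (simp add: fun_eq_iff linear_scale[OF has_derivative_linear[OF dh(1)], of "- _", simplified])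
  then have "((\<lambda>\<sigma>. h ((x1, t1) - \<sigma> *\<^sub>R w) - \<epsilon> * (\<kappa> * ((t1 - \<sigma> * \<kappa>) - s))) has_real_derivative - Dh (x1, t1) w - \<epsilon> * (\<kappa> * (- \<kappa>))) (at 0)"
    by (rule DERIV_diff) (auto intro!: derivative_eq_intros)
  moreover have "(\<lambda>\<sigma>. h ((x1, t1) - \<sigma> *\<^sub>R w) - \<epsilon> * (\<kappa> * ((t1 - \<sigma> * \<kappa>) - s))) = (\<lambda>\<sigma>. H ((x1, t1) - \<sigma> *\<^sub>R w))"
    by (simp add: H_def w_def fun_eq_iff)
  ultimately have "((\<lambda>\<sigma>. H ((x1, t1) - \<sigma> *\<^sub>R w)) has_real_derivative - Dh (x1, t1) w + \<epsilon>) (at 0)"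
    using k2 by simp
  from DERIV_pos_inc_right[OF this] dh(2) \<epsilon> obtain d where d: "d > 0"
    "\<And>k. 0 < k \<Longrightarrow> k < d \<Longrightarrow> H (x1, t1) < H ((x1, t1) - k *\<^sub>R w)" by auto
  define \<mu> where "\<mu> = min (norm x1 - R0) (N - norm x1)"
  have \<mu>: "\<mu> > 0" using r by (simp add: \<mu>_def)
  \<comment> \<open>small enough to decrease neither the modulus below \<open>R0\<close> nor the elapsed time below 0, and to keep the modulus below \<open>N\<close>\<close>
  define k where "k = min (d / 2) (min (\<kappa> * (t1 - s)) (\<mu> / (norm (b (x1, t1)) + 1)))"
  have nb: "norm (b (x1, t1)) + 1 > 0" using norm_ge_zero[of "b (x1, t1)"] by linarith
  have k: "k > 0" "k < d" "k \<le> \<kappa> * (t1 - s)" "k \<le> \<mu> / (norm (b (x1, t1)) + 1)"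
    using d t1 \<mu> nb by (auto simp: k_def)
  have "k * norm (b (x1, t1)) \<le> k * (norm (b (x1, t1)) + 1)" using k by simp
  also have "\<dots> \<le> \<mu>" using k(4) nb by (simp add: pos_le_divide_eq)
  finally have kb: "norm (k *\<^sub>R \<kappa> *\<^sub>R b (x1, t1)) \<le> \<mu>" using k \<kappa> by auto
  have "norm x1 - \<mu> \<le> norm (x1 - k *\<^sub>R \<kappa> *\<^sub>R b (x1, t1))" "norm (x1 - k *\<^sub>R \<kappa> *\<^sub>R b (x1, t1)) \<le> norm x1 + \<mu>"
    using norm_triangle_ineq2[of x1 "k *\<^sub>R \<kappa> *\<^sub>R b (x1, t1)"] norm_triangle_ineq4[of x1 "k *\<^sub>R \<kappa> *\<^sub>R b (x1, t1)"] kb by linarith+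
  then have "R0 \<le> norm (x1 - k *\<^sub>R \<kappa> *\<^sub>R b (x1, t1))" "norm (x1 - k *\<^sub>R \<kappa> *\<^sub>R b (x1, t1)) \<le> N"
    by (auto simp: \<mu>_def)
  moreover have "\<kappa> * (t1 - k * \<kappa> - s) = \<kappa> * (t1 - s) - k" using k2 by (simp add: algebra_simps)
  ultimately have "(x1, t1) - k *\<^sub>R w \<in> Q"
    using k t1 by (simp add: Q_def w_def)
  from y(2)[OF this] d(2)[OF k(1,2)] x1 show False by simp
qed

section \<open>Bounding a field by its vorticity\<close>

text \<open>Cut \<open>F\<close> off inside \<open>R0\<close> and outside a large \<open>n\<close>, and apply Cauchy--Pompeiu at \<open>z\<close>. The term with
  \<open>dbar DF\<close> is integrated over a disc of radius \<open>R + 1\<close> and gives \<open>5 K (R + 1)\<close>; this linear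
  dependence on \<open>R\<close> is the point of the lemma. The inner cutoff costs the multiple of \<open>M\<close>. The outer
  one has slope \<open>6 / n\<close> over a region on which the kernel integrates to \<open>O(n)\<close>, and \<open>F\<close> is small
  there.\<close>
lemma far_field_bound:
  fixes F :: "complex \<Rightarrow> complex"
  assumes F: "C1_on F DF {x. norm x > r}" and r: "0 < r" "r < R0"
    and K: "K \<ge> 0" "\<And>w. norm w \<ge> R0 \<Longrightarrow> norm (dbar DF w) \<le> K"
    and R: "R \<ge> 0" "\<And>w. norm w \<ge> R0 \<Longrightarrow> norm w > R \<Longrightarrow> dbar DF w = 0"
    and M: "\<And>w. norm w \<ge> R0 \<Longrightarrow> norm w \<le> 2 * R0 \<Longrightarrow> norm (F w) \<le> M"
    and lim: "(F \<longlongrightarrow> 0) at_infinity"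
    and z: "norm z \<ge> 2 * R0"
  shows "norm (F z) \<le> 5 * K * (R + 1) + 30 * M * (2 * R0 + 1) / R0"
proof -
  have R0: "R0 > 0" using r by simp
  have M0: "M \<ge> 0" using M[of "of_real R0"] R0 norm_ge_zero order_trans by (smt (verit) norm_of_real)
  define S where "S = {x::complex. norm x > r}"
  have S: "open S" unfolding S_def by (intro open_Collect_less continuous_intros)
  have est: "pi * norm (F z) \<le> K * (5 * pi * (R + 1)) + 6 * M / R0 * (5 * pi * (2 * R0 + 1)) + 90 * pi * \<epsilon>"
    if e: "\<epsilon> > 0" for \<epsilon>
  proof -
    obtain n0 where n0: "\<And>w. norm w \<ge> n0 \<Longrightarrow> norm (F w) < \<epsilon>"
      using lim e unfolding tendsto_iff eventually_at_infinity by (auto simp: dist_norm)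
    \<comment> \<open>the outer cutoff must exceed \<open>|z|\<close> and lie where \<open>F\<close> is smaller than \<open>\<epsilon>\<close>\<close>
    define n where "n = max n0 (norm z + 1)"
    have n: "n \<ge> n0" "n > norm z" "n \<ge> 1" using norm_ge_zero[of z] by (auto simp: n_def simp del: norm_ge_zero)
    have n2: "n > 2 * R0" using n z by linarith
    define c where "c w = (1 - bump 0 R0 w) * bump 0 n w" for w :: complex
    define c' where "c' w v = (1 - bump 0 R0 w) * bump' 0 n w v + (0 - bump' 0 R0 w v) * bump 0 n w" for w v :: complex
    have c: "C1_on c c' UNIV" unfolding c_def[abs_def] c'_def[abs_def]
      by (intro C1_on_mult C1_on_diff C1_on_const C1_on_bump)
    define W where "W w = (if w \<in> S then c w *\<^sub>R F w else 0)" for w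
    define DW where "DW w v = (if w \<in> S then c w *\<^sub>R DF w v + c' w v *\<^sub>R F w else 0)" for w v
    have CW: "C1_on W DW UNIV"
      unfolding W_def[abs_def] DW_def[abs_def]
    proof (rule C1_on_extend_zero[OF _ S])
      show "C1_on (\<lambda>w. c w *\<^sub>R F w) (\<lambda>w v. c w *\<^sub>R DF w v + c' w v *\<^sub>R F w) S"
        using F by (intro C1_on_scaleR C1_on_subset[OF c]) (auto simp: S_def)
      show "closed {w::complex. norm w \<ge> R0}" by (intro closed_Collect_le continuous_intros)
      show "{w. norm w \<ge> R0} \<subseteq> S" using r by (auto simp: S_def)
      show "c w *\<^sub>R F w = 0" if "w \<in> S - {w. norm w \<ge> R0}" for w
        using that bump_eq1[OF R0, of w 0] by (simp add: c_def)
    qed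
    have W0: "W w = 0" if "norm w > 2 * n" for w
      using that bump_eq0[of n w 0] n by (simp add: W_def c_def)
    have zS: "z \<in> S" "W z = F z"
    proof -
      show "z \<in> S" using z r by (simp add: S_def)
      then show "W z = F z" using bump_eq0[OF R0, of z 0] bump_eq1[of n z 0] z n by (simp add: W_def c_def)
    qed
    define g where "g w = K * (indicator (ball (0::complex) (R + 1)) w / cmod (w - z)) +
       (6 * M / R0 * (indicator (ball 0 (2 * R0 + 1)) w / cmod (w - z)) +
       6 * \<epsilon> / n * (indicator (ball 0 (2 * n + 1)) w / cmod (w - z)))" for w
    have a: "R + 1 > 0" "2 * R0 + 1 > 0" "2 * n + 1 > 0" using R R0 n by auto
    have gi: "integrable lborel g"
      unfolding g_def[abs_def]
      by (intro Bochner_Integration.integrable_add integrable_mult_right integrable_Cauchy_kernel_ball a)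
    have pw: "norm (dbar DW w / (z - w)) \<le> g w" for w
    proof (cases "norm w \<ge> R0 \<and> norm w \<le> 2 * n")
      case False
      have "dbar DW w = 0"
      proof (cases "norm w > 2 * n")
        case True
        then show ?thesis using C1_on_deriv_zero_outside[OF CW W0 True] by (simp add: dbar_def)
      next
        case f: False
        then have wR: "norm w \<le> R0" using False by auto
        then show ?thesis
          using bump_eq1[OF R0, of w 0] bump'_zero[OF R0, of w 0] by (simp add: dbar_def DW_def c_def c'_def)
      qed
      moreover have "g w \<ge> 0" unfolding g_def using K M0 R0 e n by (intro add_nonneg_nonneg mult_nonneg_nonneg divide_nonneg_nonneg) auto
      ultimately show ?thesis by simp
    next
      case True
      then have wS: "w \<in> S" using r by (simp add: S_def)
      have c01: "\<bar>c w\<bar> \<le> 1"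
        unfolding c_def abs_mult using bump_bounds[of 0 R0 w] bump_bounds[of 0 n w] by (intro mult_le_one) auto
      have "2 * dbar DW w = 2 * (of_real (c w) * dbar DF w) + (of_real (c' w 1) + \<i> * of_real (c' w \<i>)) * F w"
        using wS by (simp add: dbar_def DW_def scaleR_conv_of_real algebra_simps)
      then have "2 * norm (dbar DW w) \<le> norm (2 * (of_real (c w) * dbar DF w)) + norm ((of_real (c' w 1) + \<i> * of_real (c' w \<i>)) * F w)"
        by (metis norm_triangle_ineq norm_mult norm_numeral)
      also have "norm (2 * (of_real (c w) * dbar DF w)) \<le> 2 * norm (dbar DF w)"
        using mult_right_mono[OF c01 norm_ge_zero[of "dbar DF w"]] by (simp add: norm_mult)
      also have "norm ((of_real (c' w 1) + \<i> * of_real (c' w \<i>)) * F w) \<le> (\<bar>c' w 1\<bar> + \<bar>c' w \<i>\<bar>) * norm (F w)"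
        unfolding norm_mult by (intro mult_right_mono order_trans[OF norm_triangle_ineq]) (auto simp: norm_mult)
      finally have dW: "norm (dbar DW w) \<le> norm (dbar DF w) + (\<bar>c' w 1\<bar> + \<bar>c' w \<i>\<bar>) / 2 * norm (F w)" by simp
      have c'1: "\<bar>c' w v\<bar> \<le> \<bar>bump' 0 n w v\<bar> + \<bar>bump' 0 R0 w v\<bar>" for v
      proof -
        have "\<bar>1 - bump 0 R0 w\<bar> \<le> 1" "\<bar>bump 0 n w\<bar> \<le> 1" using bump_bounds[of 0 R0 w] bump_bounds[of 0 n w] by auto
        then have "\<bar>1 - bump 0 R0 w\<bar> * \<bar>bump' 0 n w v\<bar> \<le> 1 * \<bar>bump' 0 n w v\<bar>" "\<bar>bump' 0 R0 w v\<bar> * \<bar>bump 0 n w\<bar> \<le> \<bar>bump' 0 R0 w v\<bar> * 1"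
          by (intro mult_right_mono mult_left_mono; simp)+
        then show ?thesis unfolding c'_def
          by (intro order_trans[OF abs_triangle_ineq]) (simp add: abs_mult)
      qed
      have p1: "norm (dbar DF w) \<le> K * indicator (ball (0::complex) (R + 1)) w"
        using K(2)[of w] R(2)[of w] True by (cases "norm w < R + 1") auto
      have p2: "\<bar>bump' 0 R0 w v\<bar> * norm (F w) \<le> 6 * M / R0 * indicator (ball (0::complex) (2 * R0 + 1)) w" if "norm v = 1" for v
      proof (cases "norm w < 2 * R0")
        case wl: True
        have "\<bar>bump' 0 R0 w v\<bar> * norm (F w) \<le> 6 * norm v / R0 * M"
          using M[of w] True wl by (intro mult_mono bump'_bound R0) (use R0 in auto)
        then show ?thesis using that wl by simp
      next
        case False
        then have "bump' 0 R0 w v = 0" using bump'_zero[OF R0, of w 0 v] by simp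
        then show ?thesis using M0 R0 by simp
      qed
      have p3: "\<bar>bump' 0 n w v\<bar> * norm (F w) \<le> 6 * \<epsilon> / n * indicator (ball (0::complex) (2 * n + 1)) w" if "norm v = 1" for v
      proof (cases "norm w > n")
        case wl: True
        have "\<bar>bump' 0 n w v\<bar> * norm (F w) \<le> 6 * norm v / n * \<epsilon>"
          using n0[of w] n wl by (intro mult_mono bump'_bound less_imp_le[OF n0]) auto
        then show ?thesis using that True by simp
      next
        case False
        then have "bump' 0 n w v = 0" using bump'_zero[of n w 0 v] n by simp
        then show ?thesis using e n by simp
      qed
      have "(\<bar>c' w 1\<bar> + \<bar>c' w \<i>\<bar>) / 2 * norm (F w) \<le>
         ((\<bar>bump' 0 n w 1\<bar> + \<bar>bump' 0 R0 w 1\<bar>) + (\<bar>bump' 0 n w \<i>\<bar> + \<bar>bump' 0 R0 w \<i>\<bar>)) / 2 * norm (F w)"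
        by (intro mult_right_mono divide_right_mono add_mono c'1) auto
      also have "\<dots> = (\<bar>bump' 0 n w 1\<bar> * norm (F w) + \<bar>bump' 0 R0 w 1\<bar> * norm (F w) + \<bar>bump' 0 n w \<i>\<bar> * norm (F w) + \<bar>bump' 0 R0 w \<i>\<bar> * norm (F w)) / 2"
        by (simp add: algebra_simps)
      also have "\<dots> \<le> 6 * M / R0 * indicator (ball (0::complex) (2 * R0 + 1)) w + 6 * \<epsilon> / n * indicator (ball (0::complex) (2 * n + 1)) w"
        using p2[of 1] p2[of \<i>] p3[of 1] p3[of \<i>] by simp
      finally have "norm (dbar DW w) \<le> K * indicator (ball (0::complex) (R + 1)) w +
         (6 * M / R0 * indicator (ball (0::complex) (2 * R0 + 1)) w + 6 * \<epsilon> / n * indicator (ball (0::complex) (2 * n + 1)) w)"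
        using dW p1 by linarith
      then have "norm (dbar DW w) / cmod (w - z) \<le> (K * indicator (ball (0::complex) (R + 1)) w +
         (6 * M / R0 * indicator (ball (0::complex) (2 * R0 + 1)) w + 6 * \<epsilon> / n * indicator (ball (0::complex) (2 * n + 1)) w)) / cmod (w - z)"
        by (rule divide_right_mono) simp
      then show ?thesis by (simp add: g_def norm_divide norm_minus_commute add_divide_distrib)
    qed
    have "pi * norm (F z) = norm (LINT w|lborel. dbar DW w / (z - w))"
      using Cauchy_Pompeiu[OF CW, where z=z and r="2 * n"] W0 zS by (simp add: norm_mult)
    also have "\<dots> \<le> (LINT w|lborel. norm (dbar DW w / (z - w)))" by (rule integral_norm_bound)
    also have "\<dots> \<le> (LINT w|lborel. g w)"
      by (rule integral_mono'[OF gi pw order_trans[OF norm_ge_zero pw]])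
    also have "\<dots> = K * (LINT w|lborel. indicator (ball (0::complex) (R + 1)) w / cmod (w - z)) +
       (6 * M / R0 * (LINT w|lborel. indicator (ball 0 (2 * R0 + 1)) w / cmod (w - z)) +
       6 * \<epsilon> / n * (LINT w|lborel. indicator (ball 0 (2 * n + 1)) w / cmod (w - z)))"
    proof -
      have I: "integrable lborel (\<lambda>w. c * (indicator (ball (0::complex) \<rho>) w / cmod (w - z)))" if "\<rho> > 0" for c \<rho>
        by (intro integrable_mult_right integrable_Cauchy_kernel_ball that)
      show ?thesis
        unfolding g_def Bochner_Integration.integral_add[OF I[OF a(1)] Bochner_Integration.integrable_add[OF I[OF a(2)] I[OF a(3)]]]
          Bochner_Integration.integral_add[OF I[OF a(2)] I[OF a(3)]] integral_mult_right_zero ..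
    qed
    also have "\<dots> \<le> K * (5 * pi * (R + 1)) + (6 * M / R0 * (5 * pi * (2 * R0 + 1)) + 6 * \<epsilon> / n * (5 * pi * (2 * n + 1)))"
      by (intro add_mono mult_left_mono integral_Cauchy_kernel_ball a) (use K M0 R0 e n in auto)
    also have "6 * \<epsilon> / n * (5 * pi * (2 * n + 1)) = 30 * pi * \<epsilon> * ((2 * n + 1) / n)" by simp
    also have "\<dots> \<le> 30 * pi * \<epsilon> * 3"
      using n e by (intro mult_left_mono) (auto simp: divide_le_eq)
    finally show ?thesis by simp
  qed
  have "pi * norm (F z) \<le> K * (5 * pi * (R + 1)) + 6 * M / R0 * (5 * pi * (2 * R0 + 1))"
  proof (rule field_le_epsilon)
    fix \<epsilon> :: real assume "\<epsilon> > 0"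
    then show "pi * norm (F z) \<le> K * (5 * pi * (R + 1)) + 6 * M / R0 * (5 * pi * (2 * R0 + 1)) + \<epsilon>"
      using est[of "\<epsilon> / (90 * pi)"] by simp
  qed
  also have "\<dots> = pi * (5 * K * (R + 1) + 30 * M * (2 * R0 + 1) / R0)"
    using R0 by (simp add: field_simps)
  finally show ?thesis by simp
qed

section \<open>The flow and its vorticity equation\<close>

lemma C1_on_slice:
  assumes "C1_on f D U"
  shows "C1_on (\<lambda>x. f (x, t)) (\<lambda>x v. D (x, t) (v, 0)) {x. (x, t) \<in> U}"
  unfolding C1_on_def
proof (intro conjI ballI allI)
  fix x assume "x \<in> {x. (x, t) \<in> U}"
  then have d: "(f has_derivative D (x, t)) (at (x, t))" using C1_onD[OF assms] by auto
  have "((\<lambda>x. (x, t)) has_derivative (\<lambda>v. (v, 0))) (at x)"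
    by (auto intro!: derivative_eq_intros)
  from has_derivative_compose[OF this d] show "((\<lambda>x. f (x, t)) has_derivative (\<lambda>v. D (x, t) (v, 0))) (at x)" .
next
  fix v
  show "continuous_on {x. (x, t) \<in> U} (\<lambda>x. D (x, t) (v, 0))"
    by (rule continuous_on_compose2[OF C1_on_cont_deriv[OF assms, of "(v, 0)"]]) (auto intro!: continuous_intros)
qed

lemma C1_on_derivative_eqI:
  assumes "C1_on f D V" "C1_on g E V" "open V" "\<And>y. y \<in> V \<Longrightarrow> f y = g y" "y \<in> V"
  shows "D y v = E y v"
proof -
  have "(g has_derivative D y) (at y)"
    by (rule has_derivative_transform_within_open[OF C1_onD[OF assms(1,5)] assms(3,5)]) (use assms(4) in auto)
  then show ?thesis using has_derivative_unique[OF _ C1_onD[OF assms(2,5)]] by metis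
qed

locale euler_exterior =
  fixes \<gamma> :: "real \<Rightarrow> complex" and T :: "complex \<Rightarrow> complex"
    and u :: "real \<Rightarrow> complex \<Rightarrow> complex" and p :: "real \<Rightarrow> complex \<Rightarrow> real"
  assumes jordan: "smooth_jordan_curve \<gamma>"
    and conformal: "exterior_conformal_map \<gamma> T"
    and euler: "smooth_euler_solution \<gamma> u p"
    and vorticity_support: "compactly_supported_vorticity \<gamma> u"
begin

abbreviation "\<Omega> \<equiv> exterior \<gamma>"

lemma simple: "simple_path \<gamma>" and periodic: "\<gamma> (s + 1) = \<gamma> s" and smooth: "smooth_on \<gamma> UNIV"
  and regular: "vector_derivative \<gamma> (at s) \<noteq> 0"
  and winding: "z \<in> inside (path_image \<gamma>) \<Longrightarrow> winding_number \<gamma> z = 1"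
  using jordan unfolding smooth_jordan_curve_def by auto

lemma closed_loop: "pathfinish \<gamma> = pathstart \<gamma>"
  using periodic[of 0] by (simp add: pathfinish_def pathstart_def)

definition "dloop s = vector_derivative \<gamma> (at s)"
definition "ddloop s = vector_derivative dloop (at s)"

lemma loop_C2: "C2_loop \<gamma> dloop ddloop"
proof -
  let ?D = "\<lambda>s. frechet_derivative \<gamma> (at s) 1"
  have sm: "smooth_on ?D UNIV" by (rule smooth_on_derivative[OF smooth])
  have vd: "(f has_vector_derivative frechet_derivative f (at s) 1) (at s)" if "smooth_on f UNIV" for f :: "real \<Rightarrow> complex" and s
  proof -
    have d: "(f has_derivative frechet_derivative f (at s)) (at s)"
      using C1_onD[OF smooth_on_C1[OF that]] by auto
    have "frechet_derivative f (at s) h = h *\<^sub>R frechet_derivative f (at s) 1" for h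
      using linear_scale[OF has_derivative_linear[OF d], of h 1] by simp
    then show ?thesis
      unfolding has_vector_derivative_def by (intro has_derivative_eq_rhs[OF d] ext)
  qed
  have dl: "dloop = ?D" unfolding dloop_def[abs_def] using vector_derivative_at[OF vd[OF smooth]] by auto
  have ddl: "ddloop = (\<lambda>s. frechet_derivative ?D (at s) 1)"
    unfolding ddloop_def[abs_def] dl using vector_derivative_at[OF vd[OF sm]] by auto
  have g1: "\<gamma> 1 = \<gamma> 0" using periodic[of 0] by simp
  have "dloop 1 = dloop 0"
  proof -
    have "(\<gamma> has_vector_derivative dloop 1) (at (0 + 1))" using vd[OF smooth] by (simp add: dl)
    then have "((\<lambda>s. \<gamma> (s + 1)) has_vector_derivative dloop 1) (at 0)"
    proof -
      have "((\<lambda>s::real. s + 1) has_derivative (\<lambda>x. x)) (at 0)" by (auto intro!: derivative_eq_intros)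
      from has_derivative_compose[OF this] \<open>(\<gamma> has_vector_derivative dloop 1) (at (0 + 1))\<close>
      show ?thesis by (simp add: has_vector_derivative_def)
    qed
    then have "(\<gamma> has_vector_derivative dloop 1) (at 0)" by (simp add: periodic)
    then show ?thesis using vector_derivative_at dloop_def by metis
  qed
  moreover have "(\<gamma> has_vector_derivative dloop s) (at s)" for s unfolding dl by (rule vd[OF smooth])
  moreover have "(dloop has_vector_derivative ddloop s) (at s)" for s unfolding dl ddl by (rule vd[OF sm])
  moreover have "continuous_on UNIV ddloop"
    unfolding ddl by (rule C1_on_continuous[OF smooth_on_C1[OF smooth_on_derivative[OF sm]]])
  moreover have "dloop s \<noteq> 0" for s unfolding dloop_def by (rule regular)
  ultimately show ?thesis using g1 by unfold_locales
qed

sublocale C2_loop \<gamma> dloop ddloop by (rule loop_C2)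

lemma path_image_Gamma: "path_image \<gamma> = \<Gamma>" by (simp add: path_image_def)

lemma open_Omega: "open \<Omega>"
  using compact_Gamma by (simp add: open_outside compact_imp_closed path_image_Gamma)

lemma Omega_Gamma: "\<Omega> \<inter> \<Gamma> = {}"
  using outside_no_overlap[of "path_image \<gamma>"] by (auto simp: path_image_Gamma)

lemma closure_Omega: "closure \<Omega> = \<Omega> \<union> \<Gamma>"
  using Jordan_inside_outside[OF simple closed_loop] closure_Un_frontier[of \<Omega>] by (simp add: path_image_Gamma)

lemma closed_Omega_Gamma: "closed (\<Omega> \<union> \<Gamma>)"
  using closure_Omega closed_closure by metis

lemma exists_radius: "\<exists>r>0. \<forall>x. norm x \<ge> r \<longrightarrow> x \<in> \<Omega>"
proof -
  have "bounded (- \<Omega>)" using compact_imp_bounded[OF compact_Gamma] by (simp add: cobounded_outside path_image_Gamma)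
  then obtain r where r: "r > 0" "\<And>x. x \<in> - \<Omega> \<Longrightarrow> norm x \<le> r" unfolding bounded_pos by blast
  have "x \<in> \<Omega>" if "norm x \<ge> r + 1" for x
    using r(2)[of x] that by (cases "x \<in> \<Omega>") auto
  then show ?thesis using r(1) by (intro exI[of _ "r + 1"]) auto
qed

definition "r0 = (SOME r. r > 0 \<and> (\<forall>x. norm x \<ge> r \<longrightarrow> x \<in> \<Omega>))"

lemma r0: "r0 > 0" "norm x \<ge> r0 \<Longrightarrow> x \<in> \<Omega>"
  using someI_ex[OF exists_radius] unfolding r0_def by auto

lemma exists_extension: "\<exists>Ug. open (fst Ug) \<and> closure \<Omega> \<times> {0..} \<subseteq> fst Ug \<and> smooth_on (snd Ug) (fst Ug) \<and>
    (\<forall>y\<in>closure \<Omega> \<times> {0..}. snd Ug y = u (snd y) (fst y))"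
proof -
  obtain U g where Ug: "open U" "closure \<Omega> \<times> {0..} \<subseteq> U" "smooth_on g U"
    "\<forall>y\<in>closure \<Omega> \<times> {0..}. g y = (case y of (x, t) \<Rightarrow> u t x)"
    using euler unfolding smooth_euler_solution_def smooth_up_to_def by blast
  then show ?thesis by (intro exI[of _ "(U, g)"]) (auto simp: split_beta)
qed

text \<open>A smooth extension \<open>g\<close> of the velocity to a neighbourhood \<open>U\<close> of the closed space-time domain is
  fixed once and for all. Its derivatives are continuous up to the curve and up to time 0, and agree
  with those of \<open>u\<close> in the domain.\<close>
definition "Ug = (SOME Ug. open (fst Ug) \<and> closure \<Omega> \<times> {0..} \<subseteq> fst Ug \<and> smooth_on (snd Ug) (fst Ug) \<and>
    (\<forall>y\<in>closure \<Omega> \<times> {0..}. snd Ug y = u (snd y) (fst y)))"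
definition U :: "(complex \<times> real) set" where "U = fst Ug"
definition g :: "complex \<times> real \<Rightarrow> complex" where "g = snd Ug"

lemma open_U: "open U" and U_sup: "closure \<Omega> \<times> {0..} \<subseteq> U" and g_smooth: "smooth_on g U"
  and g_eq: "x \<in> closure \<Omega> \<Longrightarrow> t \<ge> 0 \<Longrightarrow> g (x, t) = u t x"
  using someI_ex[OF exists_extension] unfolding Ug_def[symmetric] U_def[symmetric] g_def[symmetric] by auto

lemma U_I: "x \<in> \<Omega> \<Longrightarrow> t \<ge> 0 \<Longrightarrow> (x, t) \<in> U"
  using U_sup closure_subset[of \<Omega>] by auto

definition "Dg y = frechet_derivative g (at y)"
definition "G1 y = Dg y (1, 0)"
definition "G2 y = Dg y (\<i>, 0)"
definition "Gt y = Dg y (0, 1)"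
definition "D1 y = frechet_derivative G1 (at y)"
definition "D2 y = frechet_derivative G2 (at y)"
definition "Dt y = frechet_derivative Gt (at y)"

lemma C1_g: "C1_on g Dg U"
  using smooth_on_C1[OF g_smooth] by (simp add: Dg_def[abs_def])
lemma C1_G: "C1_on G1 D1 U" "C1_on G2 D2 U" "C1_on Gt Dt U"
  using smooth_on_C1[OF smooth_on_derivative[OF g_smooth, of "(1, 0)"]]
    smooth_on_C1[OF smooth_on_derivative[OF g_smooth, of "(\<i>, 0)"]]
    smooth_on_C1[OF smooth_on_derivative[OF g_smooth, of "(0, 1)"]]
  by (simp_all add: G1_def[abs_def] G2_def[abs_def] Gt_def[abs_def] Dg_def[abs_def] D1_def[abs_def] D2_def[abs_def] Dt_def[abs_def])

text \<open>The vorticity, as a function on space-time.\<close>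
definition om :: "complex \<times> real \<Rightarrow> real" where "om y = Im (G1 y) - Re (G2 y)"
definition "Dom y v = Im (D1 y v) - Re (D2 y v)"

lemma C1_om: "C1_on om Dom U"
  unfolding om_def[abs_def] Dom_def[abs_def]
  by (intro C1_on_diff C1_on_linear_comp[OF bounded_linear_Im] C1_on_linear_comp[OF bounded_linear_Re] C1_G)

lemma Dg_expand: "y \<in> U \<Longrightarrow> Dg y (v, s) = Re v *\<^sub>R G1 y + Im v *\<^sub>R G2 y + s *\<^sub>R Gt y"
proof -
  assume "y \<in> U"
  then have l: "linear (Dg y)" using C1_onD[OF C1_g] has_derivative_linear by blast
  have "(v, s) = Re v *\<^sub>R (1, 0) + Im v *\<^sub>R (\<i>, 0) + s *\<^sub>R (0, 1)" by (simp add: complex_eq_iff)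
  then show ?thesis unfolding G1_def G2_def Gt_def
    by (simp only: linear_add[OF l] linear_scale[OF l])
qed

lemma slice_has_derivative:
  assumes x: "x \<in> \<Omega>" and t: "t \<ge> 0"
  shows "(u t has_derivative (\<lambda>v. Dg (x, t) (v, 0))) (at x)"
proof (rule has_derivative_transform_within_open[OF C1_onD[OF C1_on_slice[OF C1_g]] open_Omega x])
  show "x \<in> {x. (x, t) \<in> U}" using U_I[OF x t] by simp
  show "g (y, t) = u t y" if "y \<in> \<Omega>" for y using g_eq[of y t] that t closure_subset by blast
qed

lemma C1_u: "t \<ge> 0 \<Longrightarrow> C1_on (u t) (\<lambda>x v. Dg (x, t) (v, 0)) \<Omega>"
  unfolding C1_on_def
proof (intro conjI ballI allI slice_has_derivative)
  fix v assume t: "0 \<le> t"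
  show "continuous_on \<Omega> (\<lambda>x. Dg (x, t) (v, 0))"
    by (rule continuous_on_subset[OF C1_on_cont_deriv[OF C1_on_slice[OF C1_g, where t=t], where v=v]]) (use U_I t in auto)
qed auto

lemma partials_u:
  assumes "x \<in> \<Omega>" "t \<ge> 0"
  shows "partial1 (u t) x = G1 (x, t)" "partial2 (u t) x = G2 (x, t)" "curl (u t) x = om (x, t)"
    "divergence (u t) x = Re (G1 (x, t)) + Im (G2 (x, t))"
  using frechet_derivative_at[OF slice_has_derivative[OF assms], symmetric]
  by (simp_all add: partial1_def partial2_def curl_def divergence_def om_def G1_def G2_def)

lemma div_zero: "x \<in> \<Omega> \<Longrightarrow> t \<ge> 0 \<Longrightarrow> Re (G1 (x, t)) + Im (G2 (x, t)) = 0"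
  using euler partials_u(4) unfolding smooth_euler_solution_def by metis

lemma time_derivative:
  assumes x: "x \<in> closure \<Omega>" and t: "t > 0"
  shows "((\<lambda>\<tau>. u \<tau> x) has_vector_derivative Gt (x, t)) (at t)"
proof -
  have y: "(x, t) \<in> U" using U_sup x t by auto
  have "((\<lambda>\<tau>. g ((x, 0) + \<tau> *\<^sub>R (0, 1))) has_vector_derivative Dg ((x, 0) + t *\<^sub>R (0, 1)) (0, 1)) (at t)"
    by (rule C1_on_line_deriv[OF C1_g]) (use y in simp)
  then have "((\<lambda>\<tau>. g (x, \<tau>)) has_vector_derivative Gt (x, t)) (at t)" by (simp add: Gt_def)
  then show ?thesis
    by (rule has_vector_derivative_transform_within_open[of _ _ _ "{0<..}"]) (use t x g_eq in auto)
qed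

definition "pp = (\<lambda>(x, t). p t x)"
definition "Dp y = frechet_derivative pp (at y)"
definition "P1 y = Dp y (1, 0)"
definition "P2 y = Dp y (\<i>, 0)"
definition "DP1 y = frechet_derivative P1 (at y)"
definition "DP2 y = frechet_derivative P2 (at y)"

abbreviation "V \<equiv> \<Omega> \<times> {0::real<..}"

lemma open_V: "open V" by (intro open_Times open_Omega) auto

lemma pp_smooth: "smooth_on pp V" using euler unfolding smooth_euler_solution_def pp_def by blast

lemma C1_p: "C1_on pp Dp V" "C1_on P1 DP1 V" "C1_on P2 DP2 V"
  using smooth_on_C1[OF pp_smooth] smooth_on_C1[OF smooth_on_derivative[OF pp_smooth, of "(1, 0)"]]
    smooth_on_C1[OF smooth_on_derivative[OF pp_smooth, of "(\<i>, 0)"]]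
  by (simp_all add: P1_def[abs_def] P2_def[abs_def] Dp_def[abs_def] DP1_def[abs_def] DP2_def[abs_def])

lemma C1_p_slice: "t > 0 \<Longrightarrow> C1_on (p t) (\<lambda>x v. Dp (x, t) (v, 0)) \<Omega>"
  using C1_on_subset[OF C1_on_slice[OF C1_p(1), of t], of \<Omega>] by (auto simp: pp_def)

lemma V_U: "V \<subseteq> U" using U_I by auto

lemma momentum:
  assumes "y \<in> V"
  shows "Gt y + Re (g y) *\<^sub>R G1 y + Im (g y) *\<^sub>R G2 y = - Complex (P1 y) (P2 y)"
proof -
  obtain x t where y: "y = (x, t)" by (cases y)
  then have xt: "x \<in> \<Omega>" "t > 0" using assms by auto
  have c: "x \<in> closure \<Omega>" using xt closure_subset by blast
  have "vector_derivative (\<lambda>\<tau>. u \<tau> x) (at t) + frechet_derivative (u t) (at x) (u t x) = - grad (p t) x"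
    using euler xt unfolding smooth_euler_solution_def by blast
  moreover have "vector_derivative (\<lambda>\<tau>. u \<tau> x) (at t) = Gt (x, t)"
    by (rule vector_derivative_at[OF time_derivative[OF c xt(2)]])
  moreover have "frechet_derivative (u t) (at x) (u t x) = Dg (x, t) (u t x, 0)"
    using frechet_derivative_at[OF slice_has_derivative[of x t], symmetric] xt by simp
  moreover have "grad (p t) x = Complex (P1 (x, t)) (P2 (x, t))"
    using frechet_derivative_at[OF C1_onD[OF C1_p_slice[OF xt(2)] xt(1)], symmetric]
    by (simp add: grad_def partial1_def partial2_def P1_def P2_def)
  ultimately show ?thesis
    using xt g_eq[OF c, of t] U_I[of x t] by (simp add: y Dg_expand add.assoc)
qed

text \<open>The curl of the momentum equation. The pressure drops out by symmetry of its second derivatives;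
  differentiating the convective term also produces the curl times the divergence, which is 0.\<close>
lemma vorticity_equation_pos:
  assumes y: "y \<in> V"
  shows "Dom y (g y, 1) = 0"
proof -
  have yU: "y \<in> U" using y V_U by auto
  have sub: "C1_on f D V" if "C1_on f D U" for f :: "complex \<times> real \<Rightarrow> complex" and D
    using C1_on_subset[OF that V_U] .
  note Re = C1_on_linear_comp[OF bounded_linear_Re] and Im = C1_on_linear_comp[OF bounded_linear_Im]
  have mom: "Re (Gt y) + Re (g y) * Re (G1 y) + Im (g y) * Re (G2 y) = 0 - P1 y"
    "Im (Gt y) + Re (g y) * Im (G1 y) + Im (g y) * Im (G2 y) = 0 - P2 y" if "y \<in> V" for y
    using arg_cong[OF momentum[OF that], of Re] arg_cong[OF momentum[OF that], of Im] by simp_all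
  note c = sub[OF C1_g] sub[OF C1_G(1)] sub[OF C1_G(2)] sub[OF C1_G(3)]
  have e1: "Im (Dt y (1, 0)) + (Re (g y) * Im (D1 y (1, 0)) + Re (Dg y (1, 0)) * Im (G1 y)) +
      (Im (g y) * Im (D2 y (1, 0)) + Im (Dg y (1, 0)) * Im (G2 y)) = 0 - DP2 y (1, 0)"
    by (rule C1_on_derivative_eqI[OF C1_on_add[OF C1_on_add[OF Im[OF c(4)] C1_on_mult[OF Re[OF c(1)] Im[OF c(2)]]] C1_on_mult[OF Im[OF c(1)] Im[OF c(3)]]]
        C1_on_diff[OF C1_on_const[of 0] C1_p(3)] open_V mom(2) y])
  have e2: "Re (Dt y (\<i>, 0)) + (Re (g y) * Re (D1 y (\<i>, 0)) + Re (Dg y (\<i>, 0)) * Re (G1 y)) +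
      (Im (g y) * Re (D2 y (\<i>, 0)) + Im (Dg y (\<i>, 0)) * Re (G2 y)) = 0 - DP1 y (\<i>, 0)"
    by (rule C1_on_derivative_eqI[OF C1_on_add[OF C1_on_add[OF Re[OF c(4)] C1_on_mult[OF Re[OF c(1)] Re[OF c(2)]]] C1_on_mult[OF Im[OF c(1)] Re[OF c(3)]]]
        C1_on_diff[OF C1_on_const[of 0] C1_p(2)] open_V mom(1) y])
  have sp: "DP2 y (1, 0) = DP1 y (\<i>, 0)"
    using symmetric_second_derivative[OF open_V y C1_p(1), of "(\<i>, 0)" DP2 "(1, 0)" DP1] C1_p(2,3)
    by (simp add: P1_def[abs_def] P2_def[abs_def])
  have s12: "D1 y (\<i>, 0) = D2 y (1, 0)"
    using symmetric_second_derivative[OF open_U yU C1_g, of "(1, 0)" D1 "(\<i>, 0)" D2] C1_G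
    by (simp add: G1_def[abs_def] G2_def[abs_def])
  have s1t: "Dt y (1, 0) = D1 y (0, 1)"
    using symmetric_second_derivative[OF open_U yU C1_g, of "(0, 1)" Dt "(1, 0)" D1] C1_G
    by (simp add: G1_def[abs_def] Gt_def[abs_def])
  have s2t: "Dt y (\<i>, 0) = D2 y (0, 1)"
    using symmetric_second_derivative[OF open_U yU C1_g, of "(0, 1)" Dt "(\<i>, 0)" D2] C1_G
    by (simp add: G2_def[abs_def] Gt_def[abs_def])
  have lin: "linear (D1 y)" "linear (D2 y)" using C1_onD[OF C1_G(1) yU] C1_onD[OF C1_G(2) yU] has_derivative_linear by blast+
  have ex: "(g y, 1) = Re (g y) *\<^sub>R (1, 0) + Im (g y) *\<^sub>R (\<i>, 0) + (0, 1::real)" by (simp add: complex_eq_iff)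
  have d: "Re (G1 y) + Im (G2 y) = 0" using y div_zero[of "fst y" "snd y"] by auto
  have "Dom y (g y, 1) = Im (D1 y (0, 1)) - Re (D2 y (0, 1)) + Re (g y) * (Im (D1 y (1, 0)) - Re (D2 y (1, 0)))
     + Im (g y) * (Im (D1 y (\<i>, 0)) - Re (D2 y (\<i>, 0)))"
    unfolding Dom_def ex linear_add[OF lin(1)] linear_add[OF lin(2)] linear_scale[OF lin(1)] linear_scale[OF lin(2)]
    by (simp add: algebra_simps)
  also have "\<dots> = - ((Re (G1 y) + Im (G2 y)) * (Im (G1 y) - Re (G2 y)))"
    using e1 e2 unfolding sp s12[symmetric] s1t s2t G1_def[symmetric] G2_def[symmetric] by (simp add: algebra_simps)
  finally show ?thesis using d by simp
qed

text \<open>At time 0 the equation holds by continuity, since all terms extend to \<open>U\<close>.\<close>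
lemma vorticity_equation:
  assumes x: "x \<in> \<Omega>" and t: "t \<ge> 0"
  shows "Dom (x, t) (g (x, t), 1) = 0"
proof -
  have "continuous_on U (\<lambda>y. Re (g y) *\<^sub>R Dom y (1, 0) + Im (g y) *\<^sub>R Dom y (\<i>, 0) + Dom y (0, 1))"
    by (intro continuous_intros C1_on_continuous[OF C1_g] C1_on_cont_deriv[OF C1_om])
  moreover have "Re (g y) *\<^sub>R Dom y (1, 0) + Im (g y) *\<^sub>R Dom y (\<i>, 0) + Dom y (0, 1) = Dom y (g y, 1)" if "y \<in> U" for y
  proof -
    have lin: "linear (Dom y)" using C1_onD[OF C1_om that] has_derivative_linear by blast
    have ex: "(g y, 1) = Re (g y) *\<^sub>R (1, 0) + Im (g y) *\<^sub>R (\<i>, 0) + (0, 1::real)" by (simp add: complex_eq_iff)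
    show ?thesis unfolding ex linear_add[OF lin] linear_scale[OF lin] ..
  qed
  ultimately have c: "continuous_on U (\<lambda>y. Dom y (g y, 1))" by (simp cong: continuous_on_cong)
  define s where "s n = t + 1 / real (Suc n)" for n
  have "(\<lambda>n. 1 / real (Suc n)) \<longlonglongrightarrow> 0" by (rule LIMSEQ_Suc[OF lim_inverse_n'])
  then have "(\<lambda>n. (x, s n)) \<longlonglongrightarrow> (x, t + 0)" unfolding s_def by (intro tendsto_intros)
  then have "(\<lambda>n. Dom (x, s n) (g (x, s n), 1)) \<longlonglongrightarrow> Dom (x, t) (g (x, t), 1)"
    using U_I[OF x] t by (intro continuous_on_tendsto_compose[OF c]) (auto simp: s_def)
  moreover have "Dom (x, s n) (g (x, s n), 1) = 0" for n
    using x t by (intro vorticity_equation_pos) (auto simp: s_def intro: add_nonneg_pos)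
  ultimately show ?thesis by (simp add: LIMSEQ_const_iff)
qed

end

section \<open>Bounding the vorticity support uniformly in time\<close>

context euler_exterior begin

definition vort_within :: "real \<Rightarrow> real \<Rightarrow> bool" where
  "vort_within n t \<longleftrightarrow> (\<forall>x\<in>\<Omega>. norm x > n \<longrightarrow> om (x, t) = 0)"

lemma vort_within_mono: "vort_within n t \<Longrightarrow> n \<le> m \<Longrightarrow> vort_within m t"
  by (auto simp: vort_within_def)

lemma vort_within_exists: "t \<ge> 0 \<Longrightarrow> \<exists>n. vort_within n t"
proof -
  assume t: "t \<ge> 0"
  then have "compact (closure {x \<in> \<Omega>. curl (u t) x \<noteq> 0})"
    using vorticity_support unfolding compactly_supported_vorticity_def by blast
  then have "bounded {x \<in> \<Omega>. curl (u t) x \<noteq> 0}" using compact_imp_bounded bounded_subset closure_subset by metis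
  then obtain n where "\<And>x. x \<in> \<Omega> \<Longrightarrow> curl (u t) x \<noteq> 0 \<Longrightarrow> norm x \<le> n" unfolding bounded_iff by auto
  then show ?thesis using partials_u(3) t unfolding vort_within_def by (metis not_le)
qed

lemma om_continuous: "continuous_on U om" and g_continuous: "continuous_on U g"
  by (rule C1_on_continuous[OF C1_om] C1_on_continuous[OF C1_g])+

lemma bounded_on_annulus:
  fixes f :: "complex \<times> real \<Rightarrow> 'b::real_normed_vector"
  assumes "continuous_on U f" "a \<ge> r0"
  obtains M where "M \<ge> 0" "\<And>x t. a \<le> norm x \<Longrightarrow> norm x \<le> b \<Longrightarrow> 0 \<le> t \<Longrightarrow> t \<le> T0 \<Longrightarrow> norm (f (x, t)) \<le> M"
proof -
  define Q where "Q = {x::complex. a \<le> norm x \<and> norm x \<le> b}"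
  have "Q = cball 0 b - ball 0 a" by (auto simp: Q_def)
  then have "compact Q" by (simp add: compact_diff)
  then have "compact (Q \<times> {0..T0})" by (intro compact_Times) auto
  moreover have "Q \<times> {0..T0} \<subseteq> U" using assms(2) r0(2) U_I by (force simp: Q_def)
  ultimately have "bounded (f ` (Q \<times> {0..T0}))"
    by (intro compact_imp_bounded compact_continuous_image continuous_on_subset[OF assms(1)])
  then obtain M where M: "\<forall>y\<in>f ` (Q \<times> {0..T0}). norm y \<le> M" unfolding bounded_iff by blast
  have "norm (f (x, t)) \<le> max M 0" if "a \<le> norm x" "norm x \<le> b" "0 \<le> t" "t \<le> T0" for x t
    using M that by (force simp: Q_def)
  then show ?thesis by (intro that[of "max M 0"]) auto
qed

text \<open>Beyond \<open>RA\<close> the flow is far enough from the curve for cutoffs; the velocity is estimated beyond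
  \<open>RB\<close>.\<close>
definition "RA = r0 + 1"
definition "RB = 2 * RA"

lemma RAB: "r0 < RA" "RA > 0" "RA < RB" "RB > 0" using r0(1) by (auto simp: RA_def RB_def)

lemma C1_cnj_u: "t \<ge> 0 \<Longrightarrow> C1_on (\<lambda>x. cnj (u t x)) (\<lambda>x v. cnj (Dg (x, t) (v, 0))) \<Omega>"
  by (rule C1_on_linear_comp[OF bounded_linear_cnj C1_u])

lemma dbar_cnj_u:
  assumes "x \<in> \<Omega>" "t \<ge> 0"
  shows "dbar (\<lambda>x v. cnj (Dg (x, t) (v, 0))) x = - \<i> * of_real (om (x, t)) / 2"
  using div_zero[OF assms] unfolding dbar_def om_def G1_def G2_def by (auto simp: complex_eq_iff field_simps)

text \<open>\<open>far_field_bound\<close> for \<open>F = cnj u\<close>, where \<open>dbar\<close> is \<open>- i \<omega> / 2\<close>. The constant \<open>c\<close> stems from the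
  velocity in the annulus between \<open>RA\<close> and \<open>RB\<close>, which is bounded by continuity.\<close>
lemma far_velocity_bound:
  obtains c where "c \<ge> 0"
    "\<And>K R t z. 0 \<le> K \<Longrightarrow> 0 \<le> R \<Longrightarrow> 0 \<le> t \<Longrightarrow> t \<le> T0 \<Longrightarrow> vort_within R t \<Longrightarrow>
       (\<And>w. norm w \<ge> RA \<Longrightarrow> \<bar>om (w, t)\<bar> \<le> K) \<Longrightarrow> norm z \<ge> RB \<Longrightarrow> norm (u t z) \<le> 5 * K * (R + 1) + c"
proof -
  obtain M where M: "M \<ge> 0" "\<And>x t. RA \<le> norm x \<Longrightarrow> norm x \<le> RB \<Longrightarrow> 0 \<le> t \<Longrightarrow> t \<le> T0 \<Longrightarrow> norm (g (x, t)) \<le> M"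
    using bounded_on_annulus[OF g_continuous, of RA RB T0] RAB by auto
  show ?thesis
  proof (rule that[of "30 * M * (2 * RA + 1) / RA"])
    fix K R t and z :: complex
    assume a: "0 \<le> K" "0 \<le> R" "0 \<le> t" "t \<le> T0" "vort_within R t" "\<And>w. norm w \<ge> RA \<Longrightarrow> \<bar>om (w, t)\<bar> \<le> K" "norm z \<ge> RB"
    have lim: "(u t \<longlongrightarrow> 0) at_infinity" using euler a(3) unfolding smooth_euler_solution_def by blast
    have Om: "x \<in> \<Omega>" if "norm x \<ge> RA" for x using that RAB r0(2) by simp
    have "norm (cnj (u t z)) \<le> 5 * K * (R + 1) + 30 * M * (2 * RA + 1) / RA"
    proof (rule far_field_bound[where F="\<lambda>x. cnj (u t x)" and z=z and DF="\<lambda>x v. cnj (Dg (x, t) (v, 0))" and r=r0])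
      show "C1_on (\<lambda>x. cnj (u t x)) (\<lambda>x v. cnj (Dg (x, t) (v, 0))) {x. r0 < norm x}"
        using C1_cnj_u[OF a(3)] by (rule C1_on_subset) (auto intro: r0)
      show "norm (dbar (\<lambda>x v. cnj (Dg (x, t) (v, 0))) w) \<le> K" if "RA \<le> norm w" for w
        using a(1) a(6)[OF that] Om[OF that] a(3) by (simp add: dbar_cnj_u norm_mult)
      show "dbar (\<lambda>x v. cnj (Dg (x, t) (v, 0))) w = 0" if "RA \<le> norm w" "R < norm w" for w
        using a(5) Om[OF that(1)] that a(3) by (simp add: dbar_cnj_u vort_within_def)
      show "norm (cnj (u t w)) \<le> M" if "RA \<le> norm w" "norm w \<le> 2 * RA" for w
      proof -
        have "w \<in> closure \<Omega>" using Om[OF that(1)] closure_subset by blast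
        then show ?thesis using M(2)[of w t] that a(3,4) g_eq[of w t] by (simp add: RB_def)
      qed
      show "((\<lambda>x. cnj (u t x)) \<longlongrightarrow> 0) at_infinity" using tendsto_cnj[OF lim] by simp
    qed (use a RAB r0(1) in \<open>auto simp: RB_def\<close>)
    then show "norm (u t z) \<le> 5 * K * (R + 1) + 30 * M * (2 * RA + 1) / RA" by simp
  qed (use M RAB in auto)
qed

text \<open>\<open>transport_maximum_principle\<close> for \<open>\<omega>\<^sup>2 f\<close>: as \<open>\<omega>\<close> is transported, the derivative of this product
  along the flow is \<open>\<omega>\<^sup>2\<close> times that of \<open>f\<close>, so \<open>f\<close> needs to be controlled on the support of the
  vorticity only. The outer boundary is harmless because some (arbitrarily bad) bound \<open>N\<close> on that
  support is assumed.\<close>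
lemma om_max_principle:
  fixes f :: "complex \<times> real \<Rightarrow> real" and \<kappa> s \<sigma> :: real
  assumes \<kappa>: "\<kappa> = 1 \<or> \<kappa> = - 1"
    and J: "\<And>\<sigma>. 0 \<le> \<sigma> \<Longrightarrow> \<sigma> \<le> \<delta> \<Longrightarrow> 0 \<le> s + \<kappa> * \<sigma>"
    and N: "\<And>\<sigma>. 0 \<le> \<sigma> \<Longrightarrow> \<sigma> \<le> \<delta> \<Longrightarrow> vort_within N (s + \<kappa> * \<sigma>)"
    and f: "\<And>y. y \<in> U \<Longrightarrow> norm (fst y) > 0 \<Longrightarrow> (f has_derivative Df y) (at y)"
    and fsgn: "\<And>x \<tau>. norm x \<ge> RB \<Longrightarrow> 0 < \<kappa> * (\<tau> - s) \<Longrightarrow> \<kappa> * (\<tau> - s) \<le> \<delta> \<Longrightarrow>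
         om (x, \<tau>) \<noteq> 0 \<Longrightarrow> Df (x, \<tau>) (\<kappa> *\<^sub>R g (x, \<tau>), \<kappa>) \<le> 0"
    and init: "\<And>x. norm x \<ge> RB \<Longrightarrow> om (x, s) \<noteq> 0 \<Longrightarrow> f (x, s) \<le> 0"
    and bdry: "\<And>x \<tau>. norm x = RB \<Longrightarrow> 0 \<le> \<kappa> * (\<tau> - s) \<Longrightarrow> \<kappa> * (\<tau> - s) \<le> \<delta> \<Longrightarrow> om (x, \<tau>) \<noteq> 0 \<Longrightarrow> f (x, \<tau>) \<le> 0"
    and pt: "norm x \<ge> RB" "0 \<le> \<sigma>" "\<sigma> \<le> \<delta>" "om (x, s + \<kappa> * \<sigma>) \<noteq> 0"
  shows "f (x, s + \<kappa> * \<sigma>) \<le> 0"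
proof -
  define N1 where "N1 = max N (norm x) + 1"
  have k2: "\<kappa> * \<kappa> = 1" using \<kappa> by auto
  have tau: "s + \<kappa> * (\<kappa> * (\<tau> - s)) = \<tau>" for \<tau> using k2 by (simp add: mult.assoc[symmetric])
  have tpos: "\<tau> \<ge> 0" "vort_within N \<tau>" if "0 \<le> \<kappa> * (\<tau> - s)" "\<kappa> * (\<tau> - s) \<le> \<delta>" for \<tau>
    using J[OF that] N[OF that] tau by auto
  have Om: "x \<in> \<Omega>" if "norm x \<ge> RB" for x using that RAB r0(2) by simp
  define h where "h y = (om y)\<^sup>2 * f y" for y
  define Dh where "Dh y v = (om y)\<^sup>2 * Df y v + (2 * om y * Dom y v) * f y" for y v
  have hd: "(h has_derivative Dh y) (at y)" if "y \<in> U" "norm (fst y) > 0" for y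
  proof -
    have "(om has_derivative Dom y) (at y)" using C1_onD[OF C1_om that(1)] .
    from has_derivative_mult[OF has_derivative_power[OF this, of 2] f[OF that]]
    show ?thesis unfolding h_def[abs_def] Dh_def[abs_def] by (rule has_derivative_eq_rhs) (simp add: fun_eq_iff)
  qed
  have "h (x, s + \<kappa> * \<sigma>) \<le> 0"
  proof (rule transport_maximum_principle[where b=g and ?R0.0=RB and N=N1 and s=s and \<delta>=\<delta> and Dh=Dh, OF \<kappa>])
    have "continuous (at y) h" if "y \<in> {(x, \<tau>). RB \<le> norm x \<and> norm x \<le> N1 \<and> 0 \<le> \<kappa> * (\<tau> - s) \<and> \<kappa> * (\<tau> - s) \<le> \<delta>}" for y
    proof (rule has_derivative_continuous[OF hd])
      obtain x \<tau> where y: "y = (x, \<tau>)" by (cases y)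
      have a: "RB \<le> norm x" "0 \<le> \<kappa> * (\<tau> - s)" "\<kappa> * (\<tau> - s) \<le> \<delta>" using that by (auto simp: y)
      show "y \<in> U" unfolding y by (rule U_I[OF Om[OF a(1)] tpos(1)[OF a(2,3)]])
      show "norm (fst y) > 0" unfolding y fst_conv using a(1) RAB by linarith
    qed
    then show "continuous_on {(x, \<tau>). RB \<le> norm x \<and> norm x \<le> N1 \<and> 0 \<le> \<kappa> * (\<tau> - s) \<and> \<kappa> * (\<tau> - s) \<le> \<delta>} h"
      by (intro continuous_at_imp_continuous_on ballI)
  next
    fix x :: complex and \<tau> assume a: "RB < norm x" "norm x < N1" "0 < \<kappa> * (\<tau> - s)" "\<kappa> * (\<tau> - s) \<le> \<delta>"
    have t: "\<tau> \<ge> 0" using tpos(1)[of \<tau>] a by simp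
    have x: "x \<in> \<Omega>" using Om a by simp
    have y: "(x, \<tau>) \<in> U" using U_I x t by simp
    have "norm (fst (x, \<tau>)) > 0" unfolding fst_conv using a RAB by linarith
    then have 1: "(h has_derivative Dh (x, \<tau>)) (at (x, \<tau>))" by (rule hd[OF y])
    have "Dom (x, \<tau>) (\<kappa> *\<^sub>R g (x, \<tau>), \<kappa>) = \<kappa> * Dom (x, \<tau>) (g (x, \<tau>), 1)"
      using linear_scale[OF has_derivative_linear[OF C1_onD[OF C1_om y]], of \<kappa> "(g (x, \<tau>), 1)"] by simp
    also have "\<dots> = 0" using vorticity_equation[OF x t] by simp
    finally have "Dh (x, \<tau>) (\<kappa> *\<^sub>R g (x, \<tau>), \<kappa>) = (om (x, \<tau>))\<^sup>2 * Df (x, \<tau>) (\<kappa> *\<^sub>R g (x, \<tau>), \<kappa>)"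
      by (simp add: Dh_def)
    also have "\<dots> \<le> 0" using fsgn[of x \<tau>] a by (cases "om (x, \<tau>) = 0") (auto simp: mult_nonneg_nonpos)
    finally show "(h has_derivative Dh (x, \<tau>)) (at (x, \<tau>)) \<and> Dh (x, \<tau>) (\<kappa> *\<^sub>R g (x, \<tau>), \<kappa>) \<le> 0" using 1 by blast
  next
    fix x :: complex assume "RB \<le> norm x"
    then show "h (x, s) \<le> 0" using init[of x] by (cases "om (x, s) = 0") (auto simp: h_def mult_nonneg_nonpos)
  next
    fix x :: complex and \<tau> assume a: "norm x = RB \<or> norm x = N1" "0 \<le> \<kappa> * (\<tau> - s)" "\<kappa> * (\<tau> - s) \<le> \<delta>"
    show "h (x, \<tau>) \<le> 0"
    proof (cases "norm x = RB")
      case True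
      then show ?thesis using bdry[of x \<tau>] a by (cases "om (x, \<tau>) = 0") (auto simp: h_def mult_nonneg_nonpos)
    next
      case False
      then have "norm x = N1" using a by simp
      then have "norm x > N" "norm x \<ge> RB" using pt(1) by (auto simp: N1_def)
      then have "om (x, \<tau>) = 0" using tpos(2)[OF a(2,3)] Om by (simp add: vort_within_def)
      then show ?thesis by (simp add: h_def)
    qed
  next
    show "0 \<le> \<kappa> * (s + \<kappa> * \<sigma> - s)" "\<kappa> * (s + \<kappa> * \<sigma> - s) \<le> \<delta>" using pt k2 by (auto simp: mult.assoc[symmetric])
  qed (use pt in \<open>auto simp: N1_def\<close>)
  then show ?thesis using pt(4) by (auto simp: h_def mult_le_0_iff)
qed

text \<open>From time \<open>s\<close>, where the support has radius \<open>n\<close>, follow the flow in either direction. Two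
  applications of \<open>om_max_principle\<close>: with \<open>f = \<omega>\<^sup>2 - K\<^sup>2\<close> they bound the vorticity by its maximum \<open>K\<close>
  over a fixed compact set, and with \<open>f = |x| - rho\<close> they bound the radius of the support by any \<open>rho\<close>
  whose speed dominates that of the fluid. The fluid speed is at most \<open>a + 5 K R\<close> for support radius
  \<open>R\<close>. If \<open>R \<le> Q exp (L \<sigma>)\<close>, with \<open>L\<close> larger than \<open>10 K\<close>, integrating this speed gives
  \<open>R \<le> (C + Q / 2) exp (L \<sigma>)\<close>. Iterating \<open>Q \<mapsto> C + Q / 2\<close> from \<open>Q = N\<close> converges to \<open>2 C\<close>, so the final
  bound does not depend on \<open>N\<close>. This independence is what the theorem below exploits.\<close>
lemma support_a_priori:
  obtains n' where
    "\<And>\<kappa> s \<delta> N. \<kappa> = 1 \<or> \<kappa> = - 1 \<Longrightarrow> 0 \<le> \<delta> \<Longrightarrow>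
      (\<And>\<sigma>. 0 \<le> \<sigma> \<Longrightarrow> \<sigma> \<le> \<delta> \<Longrightarrow> 0 \<le> s + \<kappa> * \<sigma> \<and> s + \<kappa> * \<sigma> \<le> T0 \<and> vort_within N (s + \<kappa> * \<sigma>)) \<Longrightarrow>
      vort_within n s \<Longrightarrow> vort_within n' (s + \<kappa> * \<delta>)"
proof -
  define A where "A = max n RB"
  obtain K where K: "K \<ge> 0" "\<And>x t. RA \<le> norm x \<Longrightarrow> norm x \<le> A \<Longrightarrow> 0 \<le> t \<Longrightarrow> t \<le> T0 \<Longrightarrow> norm (om (x, t)) \<le> K"
    using bounded_on_annulus[OF om_continuous, of RA A T0] RAB by auto
  obtain c where c: "c \<ge> 0"
    "\<And>K R t z. 0 \<le> K \<Longrightarrow> 0 \<le> R \<Longrightarrow> 0 \<le> t \<Longrightarrow> t \<le> T0 \<Longrightarrow> vort_within R t \<Longrightarrow>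
       (\<And>w. norm w \<ge> RA \<Longrightarrow> \<bar>om (w, t)\<bar> \<le> K) \<Longrightarrow> norm z \<ge> RB \<Longrightarrow> norm (u t z) \<le> 5 * K * (R + 1) + c"
    using far_velocity_bound[of T0] by metis
  define a where "a = 5 * K + c"
  define L where "L = 10 * K + 1"
  define C where "C = A + a * max T0 0"
  have pos: "a \<ge> 0" "L > 0" "A \<ge> RB" "C \<ge> 0" "A > 0" using K c RAB by (auto simp: a_def L_def A_def C_def)
  have Om: "x \<in> \<Omega>" if "norm x \<ge> RA" for x using that RAB r0(2) by simp
  show ?thesis
  proof (rule that[of "2 * C * exp (L * max T0 0)"])
    fix \<kappa> s \<delta> N :: real
    assume \<kappa>: "\<kappa> = 1 \<or> \<kappa> = - (1::real)" and \<delta>: "0 \<le> \<delta>"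
      and J: "\<And>\<sigma>. 0 \<le> \<sigma> \<Longrightarrow> \<sigma> \<le> \<delta> \<Longrightarrow> 0 \<le> s + \<kappa> * \<sigma> \<and> s + \<kappa> * \<sigma> \<le> T0 \<and> vort_within N (s + \<kappa> * \<sigma>)"
      and n: "vort_within n s"
    have k2: "\<kappa> * \<kappa> = 1" using \<kappa> by auto
    have tau: "s + \<kappa> * (\<kappa> * (\<tau> - s)) = \<tau>" for \<tau> using k2 by (simp add: mult.assoc[symmetric])
    have tJ: "0 \<le> \<tau>" "\<tau> \<le> T0" if "0 \<le> \<kappa> * (\<tau> - s)" "\<kappa> * (\<tau> - s) \<le> \<delta>" for \<tau>
      using J[OF that] tau by auto
    have s0: "0 \<le> s" "s \<le> T0" using J[of 0] \<delta> by auto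
    have dT: "\<delta> \<le> T0"
      using J[of \<delta>] J[of 0] \<delta> \<kappa> by auto
    have nA: "vort_within A s" by (rule vort_within_mono[OF n]) (simp add: A_def)
    have bK: "\<bar>om (x, s + \<kappa> * \<sigma>)\<bar> \<le> K" if x: "norm x \<ge> RA" and \<sigma>: "0 \<le> \<sigma>" "\<sigma> \<le> \<delta>" for x \<sigma>
    proof (cases "norm x \<le> A")
      case True
      then show ?thesis using K(2)[of x "s + \<kappa> * \<sigma>"] x J[OF \<sigma>] by simp
    next
      case False
      show ?thesis
      proof (cases "om (x, s + \<kappa> * \<sigma>) = 0")
        case nz: False
        have "(\<lambda>y. (om y)\<^sup>2 - K\<^sup>2) (x, s + \<kappa> * \<sigma>) \<le> 0"
        proof (rule om_max_principle[OF \<kappa>, where Df="\<lambda>y v. 2 * om y * Dom y v - 0" and N=N and \<delta>=\<delta>])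
          fix y assume "y \<in> U"
          then show "((\<lambda>y. (om y)\<^sup>2 - K\<^sup>2) has_derivative (\<lambda>v. 2 * om y * Dom y v - 0)) (at y)"
            using has_derivative_power[OF C1_onD[OF C1_om], of y 2] by (intro has_derivative_diff) (auto simp: mult_ac)
        next
          fix x :: complex and \<tau> assume a: "RB \<le> norm x" "0 < \<kappa> * (\<tau> - s)" "\<kappa> * (\<tau> - s) \<le> \<delta>"
          have x: "x \<in> \<Omega>" using a(1) Om RAB by simp
          have t: "0 \<le> \<tau>" using tJ(1)[of \<tau>] a by simp
          have "Dom (x, \<tau>) (\<kappa> *\<^sub>R g (x, \<tau>), \<kappa>) = \<kappa> * Dom (x, \<tau>) (g (x, \<tau>), 1)"
            using linear_scale[OF has_derivative_linear[OF C1_onD[OF C1_om U_I[OF x t]]], of \<kappa> "(g (x, \<tau>), 1)"] by simp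
          then show "2 * om (x, \<tau>) * Dom (x, \<tau>) (\<kappa> *\<^sub>R g (x, \<tau>), \<kappa>) - 0 \<le> 0"
            using vorticity_equation[OF x t] by simp
        next
          fix x :: complex assume a: "RB \<le> norm x" "om (x, s) \<noteq> 0"
          then have "norm x \<le> A" using nA Om[of x] RAB by (force simp: vort_within_def)
          then have "\<bar>om (x, s)\<bar> \<le> \<bar>K\<bar>" using K(2)[of x s] K(1) a s0 RAB by simp
          then show "(om (x, s))\<^sup>2 - K\<^sup>2 \<le> 0" by (simp add: abs_le_square_iff)
        next
          fix x :: complex and \<tau> assume a: "norm x = RB" "0 \<le> \<kappa> * (\<tau> - s)" "\<kappa> * (\<tau> - s) \<le> \<delta>"
          then have "\<bar>om (x, \<tau>)\<bar> \<le> \<bar>K\<bar>" using K(2)[of x \<tau>] K(1) RAB pos tJ[of \<tau>] by simp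
          then show "(om (x, \<tau>))\<^sup>2 - K\<^sup>2 \<le> 0" by (simp add: abs_le_square_iff)
        qed (use J False pos \<sigma> nz in auto)
        then show ?thesis using K(1) by (simp add: abs_le_square_iff[symmetric])
      qed (use K in simp)
    qed
    have vel: "norm (g (x, s + \<kappa> * \<sigma>)) \<le> a + 5 * K * R"
      if "0 \<le> R" "vort_within R (s + \<kappa> * \<sigma>)" "0 \<le> \<sigma>" "\<sigma> \<le> \<delta>" "norm x \<ge> RB" for x \<sigma> R
    proof -
      have "x \<in> closure \<Omega>" using that(5) Om[of x] RAB closure_subset by force
      then have "g (x, s + \<kappa> * \<sigma>) = u (s + \<kappa> * \<sigma>) x" using g_eq J[OF that(3,4)] by blast
      then show ?thesis using c(2)[OF K(1) that(1) _ _ that(2) bK[OF _ that(3,4)] that(5)] J[OF that(3,4)]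
        by (simp add: a_def algebra_simps)
    qed
    have stepQ: "vort_within ((C + Q / 2) * exp (L * \<sigma>)) (s + \<kappa> * \<sigma>)"
      if Q: "Q \<ge> 0" "\<And>\<sigma>. 0 \<le> \<sigma> \<Longrightarrow> \<sigma> \<le> \<delta> \<Longrightarrow> vort_within (Q * exp (L * \<sigma>)) (s + \<kappa> * \<sigma>)" and \<sigma>: "0 \<le> \<sigma>" "\<sigma> \<le> \<delta>" for Q \<sigma>
    proof -
      \<comment> \<open>the radius of a circle that expands at the maximal speed \<open>a + 5 K Q exp (L \<sigma>)\<close>\<close>
      define rho where "rho \<sigma> = A + a * \<sigma> + 5 * K * Q / L * (exp (L * \<sigma>) - 1)" for \<sigma>
      have rho_d: "(rho has_real_derivative a + 5 * K * Q * exp (L * \<sigma>)) (at \<sigma>)" for \<sigma>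
        unfolding rho_def[abs_def] using pos by (auto intro!: derivative_eq_intros)
      have rhoA: "rho \<sigma> \<ge> A" if "\<sigma> \<ge> 0" for \<sigma>
        using that pos K Q by (simp add: rho_def)
      have rho_le: "rho \<sigma> \<le> (C + Q / 2) * exp (L * \<sigma>)"
      proof -
        have e1: "exp (L * \<sigma>) \<ge> 1" using pos \<sigma> by simp
        have "A + a * \<sigma> \<le> C"
          unfolding C_def using \<sigma> dT pos by (intro add_left_mono mult_left_mono) auto
        also have "\<dots> \<le> C * exp (L * \<sigma>)" using e1 pos by (simp add: mult_le_cancel_left1)
        finally have 1: "A + a * \<sigma> \<le> C * exp (L * \<sigma>)" .
        have "5 * K / L \<le> 1 / 2" using K by (simp add: L_def divide_le_eq)
        then have "5 * K / L * (Q * exp (L * \<sigma>)) \<le> 1 / 2 * (Q * exp (L * \<sigma>))" using Q by (intro mult_right_mono) auto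
        moreover have "5 * K * Q / L * (exp (L * \<sigma>) - 1) \<le> 5 * K / L * (Q * exp (L * \<sigma>))"
        proof -
          have "5 * K * Q / L \<ge> 0" using K Q pos by simp
          then have "5 * K * Q / L * (exp (L * \<sigma>) - 1) \<le> 5 * K * Q / L * exp (L * \<sigma>)" by (intro mult_left_mono) auto
          then show ?thesis by simp
        qed
        ultimately show ?thesis using 1 by (simp add: rho_def distrib_right)
      qed
      have "vort_within (rho \<sigma>) (s + \<kappa> * \<sigma>)"
        unfolding vort_within_def
      proof (intro ballI impI)
        fix x assume x: "x \<in> \<Omega>" "rho \<sigma> < norm x"
        show "om (x, s + \<kappa> * \<sigma>) = 0"
        proof (rule ccontr)
          assume nz: "om (x, s + \<kappa> * \<sigma>) \<noteq> 0"
          have "(\<lambda>y. norm (fst y) - rho (\<kappa> * (snd y - s))) (x, s + \<kappa> * \<sigma>) \<le> 0"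
          proof (rule om_max_principle[OF \<kappa>, where N=N and \<delta>=\<delta> and
              Df="\<lambda>y v. sgn (fst y) \<bullet> fst v - (a + 5 * K * Q * exp (L * (\<kappa> * (snd y - s)))) * (\<kappa> * snd v)"])
            fix y :: "complex \<times> real" assume y: "norm (fst y) > 0"
            have "((\<lambda>y. norm (fst y)) has_derivative (\<lambda>v. sgn (fst y) \<bullet> fst v)) (at y)"
            proof -
              have 1: "((\<lambda>y::complex \<times> real. fst y) has_derivative (\<lambda>v. fst v)) (at y)" by (auto intro!: derivative_eq_intros)
              have 2: "(cmod has_derivative (\<lambda>h. h \<bullet> sgn (fst y))) (at (fst y))" using y by (intro has_derivative_norm) simp
              show ?thesis using has_derivative_compose[OF 1 2] by (simp add: inner_commute)
            qed
            moreover have "((\<lambda>y::complex \<times> real. rho (\<kappa> * (snd y - s))) has_derivative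
                (\<lambda>v. (a + 5 * K * Q * exp (L * (\<kappa> * (snd y - s)))) * (\<kappa> * snd v))) (at y)"
            proof -
              have "((\<lambda>y::complex \<times> real. \<kappa> * (snd y - s)) has_derivative (\<lambda>v. \<kappa> * snd v)) (at y)"
                by (auto intro!: derivative_eq_intros)
              from has_derivative_compose[OF this rho_d[of "\<kappa> * (snd y - s)", unfolded has_field_derivative_def]]
              show ?thesis .
            qed
            ultimately show "((\<lambda>y. norm (fst y) - rho (\<kappa> * (snd y - s))) has_derivative
              (\<lambda>v. sgn (fst y) \<bullet> fst v - (a + 5 * K * Q * exp (L * (\<kappa> * (snd y - s)))) * (\<kappa> * snd v))) (at y)"
              by (rule has_derivative_diff)
          next
            fix x :: complex and \<tau> assume b: "RB \<le> norm x" "0 < \<kappa> * (\<tau> - s)" "\<kappa> * (\<tau> - s) \<le> \<delta>"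
            have "norm (g (x, s + \<kappa> * (\<kappa> * (\<tau> - s)))) \<le> a + 5 * K * (Q * exp (L * (\<kappa> * (\<tau> - s))))"
              by (rule vel) (use b Q in auto)
            then have v: "norm (g (x, \<tau>)) \<le> a + 5 * K * Q * exp (L * (\<kappa> * (\<tau> - s)))"
              unfolding tau by (simp add: mult_ac)
            have "sgn x \<bullet> (\<kappa> *\<^sub>R g (x, \<tau>)) \<le> norm (sgn x) * norm (\<kappa> *\<^sub>R g (x, \<tau>))"
              by (rule norm_cauchy_schwarz)
            also have "\<dots> \<le> 1 * norm (g (x, \<tau>))"
              using \<kappa> by (intro mult_mono) (auto simp: norm_sgn)
            finally show "sgn (fst (x, \<tau>)) \<bullet> fst (\<kappa> *\<^sub>R g (x, \<tau>), \<kappa>) -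
               (a + 5 * K * Q * exp (L * (\<kappa> * (snd (x, \<tau>) - s)))) * (\<kappa> * snd (\<kappa> *\<^sub>R g (x, \<tau>), \<kappa>)) \<le> 0"
              using v k2 by simp
          next
            fix x :: complex assume b: "RB \<le> norm x" "om (x, s) \<noteq> 0"
            then have "norm x \<le> A" using nA Om[of x] RAB by (force simp: vort_within_def)
            then show "norm (fst (x, s)) - rho (\<kappa> * (snd (x, s) - s)) \<le> 0" using rhoA[of 0] by simp
          next
            fix x :: complex and \<tau> assume "norm x = RB" "0 \<le> \<kappa> * (\<tau> - s)"
            then show "norm (fst (x, \<tau>)) - rho (\<kappa> * (snd (x, \<tau>) - s)) \<le> 0" using rhoA[of "\<kappa> * (\<tau> - s)"] pos by simp
          qed (use J \<sigma> nz x rhoA[of \<sigma>] pos in auto)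
          then show False using x k2 by (simp add: mult.assoc[symmetric])
        qed
      qed
      then show ?thesis using rho_le by (rule vort_within_mono)
    qed
    have "\<forall>\<sigma>. 0 \<le> \<sigma> \<longrightarrow> \<sigma> \<le> \<delta> \<longrightarrow> vort_within ((2 * C + max N 0 / 2 ^ k) * exp (L * \<sigma>)) (s + \<kappa> * \<sigma>)" for k
    proof (induction k)
      case 0
      have "N \<le> (2 * C + max N 0 / 2 ^ 0) * exp (L * \<sigma>)" if "0 \<le> \<sigma>" for \<sigma>
      proof -
        have "max N 0 * 1 \<le> (2 * C + max N 0 / 2 ^ 0) * exp (L * \<sigma>)"
          using pos that by (intro mult_mono) auto
        then show ?thesis by simp
      qed
      then show ?case using J vort_within_mono by blast
    next
      case (Suc k)
      have eq: "C + (2 * C + max N 0 / 2 ^ k) / 2 = 2 * C + max N 0 / 2 ^ Suc k" by (simp add: field_simps)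
      have "vort_within ((C + (2 * C + max N 0 / 2 ^ k) / 2) * exp (L * \<sigma>)) (s + \<kappa> * \<sigma>)" if "0 \<le> \<sigma>" "\<sigma> \<le> \<delta>" for \<sigma>
        using that pos Suc by (intro stepQ) auto
      then show ?case unfolding eq by blast
    qed
    then have k: "vort_within ((2 * C + max N 0 / 2 ^ k) * exp (L * \<delta>)) (s + \<kappa> * \<delta>)" for k using \<delta> by blast
    have "vort_within (2 * C * exp (L * \<delta>)) (s + \<kappa> * \<delta>)"
      unfolding vort_within_def
    proof (intro ballI impI)
      fix x assume x: "x \<in> \<Omega>" "2 * C * exp (L * \<delta>) < norm x"
      have "(\<lambda>k. (2 * C + max N 0 * (1/2) ^ k) * exp (L * \<delta>)) \<longlonglongrightarrow> (2 * C + max N 0 * 0) * exp (L * \<delta>)"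
        by (intro tendsto_intros) auto
      then have "\<forall>\<^sub>F k in sequentially. (2 * C + max N 0 * (1/2) ^ k) * exp (L * \<delta>) < norm x"
        using x(2) by (intro order_tendstoD(2)) auto
      then obtain k0 where "(2 * C + max N 0 * (1/2) ^ k0) * exp (L * \<delta>) < norm x"
        unfolding eventually_sequentially by blast
      then show "om (x, s + \<kappa> * \<delta>) = 0" using k[of k0] x(1) by (simp add: vort_within_def power_divide)
    qed
    moreover have "2 * C * exp (L * \<delta>) \<le> 2 * C * exp (L * max T0 0)"
      using pos dT \<delta> by (intro mult_left_mono) auto
    ultimately show "vort_within (2 * C * exp (L * max T0 0)) (s + \<kappa> * \<delta>)" by (rule vort_within_mono)
  qed
qed

definition locally_within :: "real \<Rightarrow> real \<Rightarrow> bool" where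
  "locally_within T0 t \<longleftrightarrow> (\<exists>d>0. \<exists>n. \<forall>\<tau>. 0 \<le> \<tau> \<longrightarrow> \<tau> \<le> T0 \<longrightarrow> \<bar>\<tau> - t\<bar> < d \<longrightarrow> vort_within n \<tau>)"

lemma compact_within:
  assumes J: "compact J" "J \<subseteq> {0..T0}" and loc: "\<And>t. t \<in> J \<Longrightarrow> locally_within T0 t"
  obtains N where "\<And>t. t \<in> J \<Longrightarrow> vort_within N t"
proof -
  have "\<forall>t\<in>J. \<exists>d n. d > 0 \<and> (\<forall>\<tau>. 0 \<le> \<tau> \<longrightarrow> \<tau> \<le> T0 \<longrightarrow> \<bar>\<tau> - t\<bar> < d \<longrightarrow> vort_within n \<tau>)"
    using loc unfolding locally_within_def by blast
  then obtain d n where dn: "\<And>t. t \<in> J \<Longrightarrow> d t > 0"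
    "\<And>t \<tau>. t \<in> J \<Longrightarrow> 0 \<le> \<tau> \<Longrightarrow> \<tau> \<le> T0 \<Longrightarrow> \<bar>\<tau> - t\<bar> < d t \<Longrightarrow> vort_within (n t) \<tau>" by metis
  have cov: "J \<subseteq> (\<Union>t\<in>J. ball t (d t))" using dn(1) by force
  obtain F where F: "F \<subseteq> J" "finite F" "J \<subseteq> (\<Union>t\<in>F. ball t (d t))"
    by (rule compactE_image[OF J(1) _ cov]) simp_all
  show ?thesis
  proof (rule that)
    fix t assume t: "t \<in> J"
    then obtain t' where t': "t' \<in> F" "\<bar>t - t'\<bar> < d t'" using F(3) by (force simp: dist_real_def abs_minus_commute)
    have "t' \<in> J" "0 \<le> t" "t \<le> T0" using t' F(1) J(2) t by auto
    then have "vort_within (n t') t" using dn(2)[of t' t] t'(2) by blast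
    moreover have "n t' \<le> Max (n ` F)" using t' F(2) by simp
    ultimately show "vort_within (Max (n ` F)) t" by (rule vort_within_mono)
  qed
qed

text \<open>Suppose that the closed set \<open>Bad\<close> of times near which the support is not locally bounded is not
  empty. It is the union of its closed subsets where the support has radius at most \<open>k\<close>, so by Baire's
  theorem the support has radius at most some \<open>k\<close> at all bad times \<open>t\<close> with \<open>|t - c| < e\<close>, for some
  bad \<open>c\<close>. A good time \<open>\<tau>\<close> within \<open>e\<close> of \<open>c\<close> is separated from \<open>c\<close> by a last bad time \<open>c + \<kappa> a\<close>. The a
  priori bound, followed from \<open>\<tau>\<close> back towards that time, shows that the support is bounded on the
  whole gap; therefore the a priori bound can be followed forward from the bad time, where the radius
  is at most \<open>k\<close>, and yields a bound at \<open>\<tau>\<close> that depends on \<open>k\<close> only. Hence \<open>c\<close> is not bad.\<close>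
theorem vorticity_support_locally_bounded:
  obtains n where "\<And>t. 0 \<le> t \<Longrightarrow> t \<le> T0 \<Longrightarrow> vort_within n t"
proof -
  define Bad where "Bad = {t \<in> {0..T0}. \<not> locally_within T0 t}"
  have opn: "open {t. locally_within T0 t}"
    unfolding open_dist
  proof (intro ballI)
    fix t assume "t \<in> {t. locally_within T0 t}"
    then obtain d n where d: "d > 0" "\<forall>\<tau>. 0 \<le> \<tau> \<longrightarrow> \<tau> \<le> T0 \<longrightarrow> \<bar>\<tau> - t\<bar> < d \<longrightarrow> vort_within n \<tau>"
      unfolding locally_within_def by blast
    have "locally_within T0 t'" if "dist t' t < d / 2" for t'
      unfolding locally_within_def
    proof (intro exI conjI allI impI)
      show "d / 2 > 0" using d by simp
      fix \<tau> assume "0 \<le> \<tau>" "\<tau> \<le> T0" "\<bar>\<tau> - t'\<bar> < d / 2"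
      moreover from this have "\<bar>\<tau> - t\<bar> < d" using that by (auto simp: dist_real_def abs_if split: if_splits)
      ultimately show "vort_within n \<tau>" using d(2) by blast
    qed
    then show "\<exists>e>0. \<forall>y. dist y t < e \<longrightarrow> y \<in> {t. locally_within T0 t}" using d(1) by (intro exI[of _ "d / 2"]) auto
  qed
  have "Bad = {0..T0} \<inter> - {t. locally_within T0 t}" by (auto simp: Bad_def)
  then have clB: "closed Bad" using opn by (auto intro!: closed_Int)
  have "Bad = {}"
  proof (rule ccontr)
    assume ne: "Bad \<noteq> {}"
    define E where "E k = {t \<in> Bad. vort_within (real k) t}" for k
    have clE: "closed (E k)" for k
    proof -
      have "closed {t \<in> {0..T0}. om (x, t) = 0}" if "x \<in> \<Omega>" for x
      proof -
        have "continuous_on {0..T0} (\<lambda>t. om (x, t))"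
          by (rule continuous_on_compose2[OF om_continuous]) (use that U_I in \<open>auto intro!: continuous_intros\<close>)
        then show ?thesis
          using continuous_closed_preimage_constant[of "{0..T0}" "\<lambda>t. om (x, t)" 0] by simp
      qed
      then have "closed (\<Inter>x\<in>{x\<in>\<Omega>. norm x > real k}. {t \<in> {0..T0}. om (x, t) = 0})" by (intro closed_INT) auto
      moreover have "E k = Bad \<inter> (\<Inter>x\<in>{x\<in>\<Omega>. norm x > real k}. {t \<in> {0..T0}. om (x, t) = 0})"
        unfolding E_def vort_within_def by (auto simp: Bad_def)
      ultimately show ?thesis using clB by (simp add: closed_Int)
    qed
    have "\<exists>k. \<not> Bad \<subseteq> closure (Bad - E k)"
    proof (rule ccontr)
      assume "\<not> ?thesis"
      then have dense: "Bad \<subseteq> closure (Bad - E k)" for k by blast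
      have "Bad \<subseteq> closure (\<Inter>(range (\<lambda>k. Bad - E k)))"
      proof (rule Baire[OF clB])
        fix S assume "S \<in> range (\<lambda>k. Bad - E k)"
        then obtain k where k: "S = Bad - E k" by blast
        have "openin (top_of_set Bad) (Bad - E k)"
          using clE[of k] by (metis Diff_eq openin_open open_Compl)
        then show "openin (top_of_set Bad) S \<and> Bad \<subseteq> closure S" using k dense by simp
      qed auto
      moreover have "\<Inter>(range (\<lambda>k. Bad - E k)) = {}"
      proof -
        have "\<exists>k. t \<in> E k" if tB: "t \<in> Bad" for t
        proof -
          obtain n where "vort_within n t" using vort_within_exists[of t] tB by (auto simp: Bad_def)
          moreover obtain k where "n \<le> real k" using real_arch_simple by blast
          ultimately show ?thesis using tB vort_within_mono unfolding E_def by blast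
        qed
        then show ?thesis by blast
      qed
      ultimately have "Bad \<subseteq> closure {}" by (simp only:)
      then show False using ne by simp
    qed
    then obtain k c where c: "c \<in> Bad" "c \<notin> closure (Bad - E k)" by blast
    then obtain e where e: "e > 0" "\<And>t. t \<in> Bad - E k \<Longrightarrow> dist t c \<ge> e"
      unfolding closure_approachable by force
    have BadE: "vort_within (real k) t" if "t \<in> Bad" "\<bar>t - c\<bar> < e" for t
      using e(2)[of t] that by (force simp: E_def dist_real_def)
    have cT: "0 \<le> c" "c \<le> T0" using c(1) by (auto simp: Bad_def)
    obtain n' where n': "\<And>\<kappa> s \<delta> N. \<kappa> = 1 \<or> \<kappa> = - 1 \<Longrightarrow> 0 \<le> \<delta> \<Longrightarrow>
      (\<And>\<sigma>. 0 \<le> \<sigma> \<Longrightarrow> \<sigma> \<le> \<delta> \<Longrightarrow> 0 \<le> s + \<kappa> * \<sigma> \<and> s + \<kappa> * \<sigma> \<le> T0 \<and> vort_within N (s + \<kappa> * \<sigma>)) \<Longrightarrow>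
      vort_within (real k) s \<Longrightarrow> vort_within n' (s + \<kappa> * \<delta>)"
      using support_a_priori[of T0 "real k"] by metis
    have "vort_within (max (real k) n') \<tau>" if \<tau>: "0 \<le> \<tau>" "\<tau> \<le> T0" "\<bar>\<tau> - c\<bar> < e" for \<tau>
    proof (cases "\<tau> \<in> Bad")
      case True
      then show ?thesis using vort_within_mono[OF BadE[OF True \<tau>(3)]] by simp
    next
      case False
      define \<kappa> :: real where "\<kappa> = (if \<tau> \<ge> c then 1 else - 1)"
      have \<kappa>: "\<kappa> = 1 \<or> \<kappa> = - 1" and k2: "\<kappa> * \<kappa> = 1" by (auto simp: \<kappa>_def)
      define m where "m = \<bar>\<tau> - c\<bar>"
      have m: "\<tau> = c + \<kappa> * m" "0 \<le> m" "m < e" using \<tau> by (auto simp: m_def \<kappa>_def)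
      have inT: "0 \<le> c + \<kappa> * \<sigma> \<and> c + \<kappa> * \<sigma> \<le> T0" if "0 \<le> \<sigma>" "\<sigma> \<le> m" for \<sigma>
        using that cT \<tau> by (cases "\<tau> \<ge> c") (simp_all add: \<kappa>_def m_def)
      define S where "S = {\<sigma> \<in> {0..m}. c + \<kappa> * \<sigma> \<in> Bad}"
      have "S = {0..m} \<inter> (\<lambda>\<sigma>. c + \<kappa> * \<sigma>) -` Bad" by (auto simp: S_def)
      then have clS: "closed S"
        using continuous_closed_preimage[of "{0..m}" "\<lambda>\<sigma>. c + \<kappa> * \<sigma>" Bad] clB by (auto intro!: continuous_intros)
      have bS: "bdd_above S" "S \<noteq> {}" using c(1) m by (auto simp: S_def)
      define a where "a = Sup S"
      have aS: "a \<in> S" unfolding a_def by (rule closed_contains_Sup[OF bS(2,1) clS])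
      then have a: "0 \<le> a" "a \<le> m" "c + \<kappa> * a \<in> Bad" by (auto simp: S_def)
      have good: "locally_within T0 (c + \<kappa> * \<sigma>)" if "a < \<sigma>" "\<sigma> \<le> m" for \<sigma>
      proof (rule ccontr)
        assume "\<not> ?thesis"
        then have "\<sigma> \<in> S" using that a inT[of \<sigma>] by (auto simp: S_def Bad_def)
        then have "\<sigma> \<le> a" unfolding a_def by (rule cSup_upper[OF _ bS(1)])
        then show False using that by simp
      qed
      have kE: "vort_within (real k) (c + \<kappa> * a)"
        using a m \<kappa> by (intro BadE) (auto simp: abs_mult)
      \<comment> \<open>backward from \<open>\<tau>\<close>: the support is bounded on the gap between the last bad time and \<open>\<tau>\<close>\<close>
      obtain q where q: "vort_within q \<tau>" using vort_within_exists[OF \<tau>(1)] by blast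
      obtain q' where q': "\<And>\<kappa> s \<delta> N. \<kappa> = 1 \<or> \<kappa> = - 1 \<Longrightarrow> 0 \<le> \<delta> \<Longrightarrow>
        (\<And>\<sigma>. 0 \<le> \<sigma> \<Longrightarrow> \<sigma> \<le> \<delta> \<Longrightarrow> 0 \<le> s + \<kappa> * \<sigma> \<and> s + \<kappa> * \<sigma> \<le> T0 \<and> vort_within N (s + \<kappa> * \<sigma>)) \<Longrightarrow>
        vort_within q s \<Longrightarrow> vort_within q' (s + \<kappa> * \<delta>)"
        using support_a_priori[of T0 q] by metis
      have bwd: "vort_within q' (c + \<kappa> * \<sigma>)" if \<sigma>: "a < \<sigma>" "\<sigma> \<le> m" for \<sigma>
      proof -
        have "compact ((\<lambda>\<sigma>. c + \<kappa> * \<sigma>) ` {\<sigma>..m})"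
          by (intro compact_continuous_image continuous_intros) auto
        then obtain N where N: "\<And>t. t \<in> (\<lambda>\<sigma>. c + \<kappa> * \<sigma>) ` {\<sigma>..m} \<Longrightarrow> vort_within N t"
          by (rule compact_within[where ?T0.0=T0]) (use inT good a \<sigma> in auto)
        have eq: "\<tau> + (- \<kappa>) * \<sigma>' = c + \<kappa> * (m - \<sigma>')" for \<sigma>' by (simp add: m algebra_simps)
        have "vort_within q' (\<tau> + (- \<kappa>) * (m - \<sigma>))"
        proof (rule q'[where N=N])
          fix \<sigma>' assume s': "0 \<le> \<sigma>'" "\<sigma>' \<le> m - \<sigma>"
          then show "0 \<le> \<tau> + - \<kappa> * \<sigma>' \<and> \<tau> + - \<kappa> * \<sigma>' \<le> T0 \<and> vort_within N (\<tau> + - \<kappa> * \<sigma>')"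
            unfolding eq using inT[of "m - \<sigma>'"] \<sigma> a by (intro conjI N) auto
        qed (use \<kappa> \<sigma> q in auto)
        then show ?thesis unfolding eq by simp
      qed
      \<comment> \<open>forward from the last bad time, with the bound \<open>n'\<close> that depends on \<open>k\<close> only\<close>
      have "vort_within n' ((c + \<kappa> * a) + \<kappa> * (m - a))"
      proof (rule n'[where N="max (real k) q'"])
        fix \<sigma> assume s: "0 \<le> \<sigma>" "\<sigma> \<le> m - a"
        have eq: "c + \<kappa> * a + \<kappa> * \<sigma> = c + \<kappa> * (a + \<sigma>)" by (simp add: algebra_simps)
        have "vort_within (max (real k) q') (c + \<kappa> * (a + \<sigma>))"
        proof (cases "\<sigma> = 0")
          case True
          then show ?thesis using vort_within_mono[OF kE] by simp
        next
          case False
          then have "vort_within q' (c + \<kappa> * (a + \<sigma>))" using bwd[of "a + \<sigma>"] s by simp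
          then show ?thesis by (rule vort_within_mono) simp
        qed
        then show "0 \<le> c + \<kappa> * a + \<kappa> * \<sigma> \<and> c + \<kappa> * a + \<kappa> * \<sigma> \<le> T0 \<and> vort_within (max (real k) q') (c + \<kappa> * a + \<kappa> * \<sigma>)"
          unfolding eq using inT[of "a + \<sigma>"] s a by auto
      qed (use \<kappa> a kE in auto)
      then have "vort_within n' \<tau>" by (simp add: m algebra_simps)
      then show ?thesis by (rule vort_within_mono) simp
    qed
    then have "locally_within T0 c" unfolding locally_within_def using e(1) by blast
    then show False using c(1) by (simp add: Bad_def)
  qed
  then have "locally_within T0 t" if "t \<in> {0..T0}" for t using that by (auto simp: Bad_def)
  then obtain n where "\<And>t. t \<in> {0..T0} \<Longrightarrow> vort_within n t" using compact_within[of "{0..T0}" T0] by (metis compact_Icc order_refl)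
  then show ?thesis using that by auto
qed

end

section \<open>Holomorphic functions near infinity\<close>

text \<open>In the coordinate \<open>w = 1 / z\<close> the function extends holomorphically to \<open>w = 0\<close> with value 0, so it is
  \<open>w h1(w)\<close> with \<open>h1 = c + w h2\<close>. The maximum principle for \<open>h1\<close> and \<open>h2\<close> yields the bounds in terms
  of the circle \<open>|z| = \<rho>\<close>.\<close>
lemma exterior_expansion:
  fixes F :: "complex \<Rightarrow> complex"
  assumes F: "F holomorphic_on {z. norm z > n}" and n: "n > 0" and lim: "(F \<longlongrightarrow> 0) at_infinity"
    and \<rho>: "\<rho> > n" and M: "\<And>z. norm z = \<rho> \<Longrightarrow> norm (F z) \<le> M"
  obtains c where "\<And>z. norm z \<ge> \<rho> \<Longrightarrow> norm (F z) \<le> M * \<rho> / norm z"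
    "((\<lambda>z. z * F z) \<longlongrightarrow> c) at_infinity"
    "\<And>I. (\<And>r. r > n \<Longrightarrow> contour_integral (circlepath 0 r) F = I) \<Longrightarrow> I = 2 * pi * \<i> * c"
    "\<And>z. c = 0 \<Longrightarrow> norm z \<ge> \<rho> \<Longrightarrow> norm (F z) \<le> M * \<rho>\<^sup>2 / (norm z)\<^sup>2"
proof -
  define R where "R = 1 / n"
  define f where "f w = (if w = 0 then 0 else F (inverse w))" for w
  have Rpos: "R > 0" using n by (simp add: R_def)
  have \<rho>0: "\<rho> > 0" using n \<rho> by simp
  have \<rho>R: "1 / \<rho> < R" unfolding R_def using n \<rho> by (intro divide_strict_left_mono) auto
  have inv: "norm (inverse w) > n" if "w \<in> ball 0 R - {0}" for w :: complex
    using that n by (simp add: norm_inverse R_def divide_inverse less_imp_inverse_less[of "norm w" "inverse n", simplified])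
  have hb: "f holomorphic_on (ball 0 R - {0})"
  proof -
    have "(\<lambda>w. F (inverse w)) holomorphic_on (ball 0 R - {0})"
    proof -
      have "inverse holomorphic_on (ball (0::complex) R - {0})" by (auto intro!: holomorphic_intros)
      moreover have "inverse ` (ball 0 R - {0}) \<subseteq> {z::complex. norm z > n}" using inv by blast
      ultimately show ?thesis
        using holomorphic_on_compose_gen[of inverse "ball 0 R - {0}" F "{z. norm z > n}"] F by (simp add: o_def)
    qed
    then show ?thesis by (rule holomorphic_transform) (simp add: f_def)
  qed
  have cb: "continuous_on (ball 0 R) f"
  proof -
    have "continuous_on (ball 0 R - {0}) f" using hb by (rule holomorphic_on_imp_continuous_on)
    then have "continuous (at w) f" if "w \<in> ball 0 R - {0}" for w
      using that continuous_on_eq_continuous_at[of "ball 0 R - {0}" f] by (auto simp: open_delete)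
    moreover have "continuous (at 0) f"
    proof -
      have "((F \<circ> inverse) \<longlongrightarrow> 0) (at 0)" using lim by (simp add: lim_at_infinity_0)
      then have "(f \<longlongrightarrow> 0) (at 0)"
        by (rule Lim_transform_eventually) (auto simp: eventually_at f_def intro!: exI[of _ 1])
      then show ?thesis by (simp add: continuous_at f_def)
    qed
    ultimately show ?thesis by (intro continuous_at_imp_continuous_on) blast
  qed
  have fh: "f holomorphic_on ball 0 R"
    by (rule no_isolated_singularity[OF cb hb open_ball]) simp
  define c where "c = deriv f 0"
  define h1 where "h1 = (\<lambda>w. if w = 0 then deriv f 0 else (f w - f 0) / (w - 0))"
  have h1h: "h1 holomorphic_on ball 0 R" unfolding h1_def using fh Rpos by (intro pole_lemma) auto
  define h2 where "h2 = (\<lambda>w. if w = 0 then deriv h1 0 else (h1 w - h1 0) / (w - 0))"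
  have h2h: "h2 holomorphic_on ball 0 R" unfolding h2_def using h1h Rpos by (intro pole_lemma) auto
  have f0: "f 0 = 0" by (simp add: f_def)
  have h10: "h1 0 = c" by (simp add: h1_def c_def)
  have Fh1: "F z = h1 (inverse z) / z" if "z \<noteq> 0" for z using that f0 by (simp add: h1_def f_def)
  have h12: "h1 w = c + w * h2 w" for w by (simp add: h2_def h10 h1_def c_def)
  have sub: "cball 0 (1 / \<rho>) \<subseteq> ball (0::complex) R" using \<rho>R by auto
  have mm: "norm (k w) \<le> B" if k: "k holomorphic_on ball 0 R" and B: "\<And>w. norm w = 1 / \<rho> \<Longrightarrow> norm (k w) \<le> B"
    and w: "norm w \<le> 1 / \<rho>" for k B w
  proof (rule maximum_modulus_frontier[of k "cball 0 (1 / \<rho>)"])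
    show "k holomorphic_on interior (cball 0 (1 / \<rho>))" using k sub by (rule holomorphic_on_subset[OF _ order_trans[OF interior_subset]])
    show "continuous_on (closure (cball 0 (1 / \<rho>))) k"
      using holomorphic_on_imp_continuous_on[OF k] sub by (auto intro: continuous_on_subset)
    show "norm (k z) \<le> B" if "z \<in> frontier (cball 0 (1 / \<rho>))" for z
      using that \<rho>0 by (intro B) (simp add: frontier_cball)
  qed (use w in auto)
  have iv: "norm (inverse z) \<le> 1 / \<rho>" if "norm z \<ge> \<rho>" for z :: complex
    using that \<rho>0 by (simp add: norm_inverse divide_inverse le_imp_inverse_le)
  have h1b: "norm (h1 w) = norm (F (inverse w)) * \<rho>" "norm (inverse w) = \<rho>" if "norm w = 1 / \<rho>" for w
  proof -
    have "w \<noteq> 0" using that \<rho>0 by auto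
    then show "norm (h1 w) = norm (F (inverse w)) * \<rho>" using that f0 by (simp add: h1_def f_def norm_divide)
    show "norm (inverse w) = \<rho>" using that by (simp add: norm_inverse)
  qed
  show ?thesis
  proof (rule that[of c])
    fix z :: complex assume z: "norm z \<ge> \<rho>"
    then have z0: "z \<noteq> 0" using \<rho>0 by auto
    have "norm (h1 (inverse z)) \<le> M * \<rho>"
      by (rule mm[OF h1h _ iv[OF z]]) (use h1b M \<rho>0 in \<open>auto intro!: mult_right_mono\<close>)
    then show "norm (F z) \<le> M * \<rho> / norm z" using Fh1[OF z0] by (simp add: norm_divide divide_right_mono)
    assume c0: "c = 0"
    have h2b: "norm (h2 w) \<le> M * \<rho>\<^sup>2" if w: "norm w = 1 / \<rho>" for w
    proof -
      have "h1 w = w * h2 w" using h12 c0 by simp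
      then have "norm (h1 w) = norm w * norm (h2 w)" by (simp add: norm_mult)
      then have "norm (h2 w) = norm (h1 w) * \<rho>" using w \<rho>0 by (simp add: field_simps)
      also have "\<dots> = norm (F (inverse w)) * \<rho> * \<rho>" using h1b(1)[OF w] by simp
      also have "\<dots> \<le> M * \<rho> * \<rho>" using M[OF h1b(2)[OF w]] \<rho>0 by (intro mult_right_mono) auto
      finally show ?thesis by (simp add: power2_eq_square mult.assoc)
    qed
    have "norm (h2 (inverse z)) \<le> M * \<rho>\<^sup>2" by (rule mm[OF h2h h2b iv[OF z]])
    moreover have "F z = h2 (inverse z) / z\<^sup>2" using Fh1[OF z0] h12[of "inverse z"] c0 z0 by (simp add: power2_eq_square field_simps)
    ultimately show "norm (F z) \<le> M * \<rho>\<^sup>2 / (norm z)\<^sup>2" by (simp add: norm_divide norm_power divide_right_mono)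
  next
    have "continuous (at 0) h1"
      using holomorphic_on_imp_continuous_on[OF h1h] Rpos by (simp add: continuous_on_eq_continuous_at)
    then have "(h1 \<longlongrightarrow> c) (at 0)" by (simp add: continuous_at h10)
    then have "(((\<lambda>z. z * F z) \<circ> inverse) \<longlongrightarrow> c) (at 0)"
      by (rule Lim_transform_eventually) (auto simp: eventually_at Fh1 intro!: exI[of _ 1])
    then show "((\<lambda>z. z * F z) \<longlongrightarrow> c) at_infinity" by (simp add: lim_at_infinity_0)
  next
    fix I assume I: "\<And>r. r > n \<Longrightarrow> contour_integral (circlepath 0 r) F = I"
    have "bounded (h2 ` cball 0 (1 / \<rho>))"
      using holomorphic_on_imp_continuous_on[OF h2h] sub
      by (intro compact_imp_bounded compact_continuous_image) (auto intro: continuous_on_subset)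
    then obtain B0 where B0: "\<forall>y\<in>h2 ` cball 0 (1 / \<rho>). norm y \<le> B0" unfolding bounded_iff by blast
    define B where "B = max B0 0"
    have B: "B \<ge> 0" "\<And>w. norm w \<le> 1 / \<rho> \<Longrightarrow> norm (h2 w) \<le> B" using B0 by (force simp: B_def)+
    have est: "norm (I - 2 * pi * \<i> * c) \<le> 2 * pi * B / r" if r: "r \<ge> \<rho>" for r
    proof -
      have r0: "r > 0" "r > n" using r \<rho>0 \<rho> by auto
      have "F contour_integrable_on circlepath 0 r"
        using holomorphic_on_imp_continuous_on[OF F] r0
        by (intro contour_integrable_continuous_circlepath) (auto intro: continuous_on_subset)
      then have "(F has_contour_integral I) (circlepath 0 r)"
        using I[OF r0(2)] has_contour_integral_integral by metis
      moreover have "((\<lambda>z. c / (z - 0)) has_contour_integral (2 * of_real pi * \<i> * c)) (circlepath 0 r)"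
        using Cauchy_integral_circlepath_simple[of "\<lambda>z. c" 0 r 0] r0 by (simp add: mult_ac)
      ultimately have "((\<lambda>z. F z - c / (z - 0)) has_contour_integral (I - 2 * pi * \<i> * c)) (circlepath 0 r)"
        using has_contour_integral_diff by (fastforce simp: mult_ac)
      then have "norm (I - 2 * pi * \<i> * c) \<le> B / r\<^sup>2 * (2 * pi * r)"
      proof (rule has_contour_integral_bound_circlepath)
        fix z :: complex assume z: "norm (z - 0) = r"
        then have z0: "z \<noteq> 0" "norm z \<ge> \<rho>" using r0 r by auto
        have "F z - c / (z - 0) = h2 (inverse z) / z\<^sup>2"
          using Fh1[OF z0(1)] h12[of "inverse z"] z0(1) by (simp add: power2_eq_square field_simps)
        then show "norm (F z - c / (z - 0)) \<le> B / r\<^sup>2"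
          using B(2)[OF iv[OF z0(2)]] z by (simp add: norm_divide norm_power divide_right_mono)
      qed (use B r0 in auto)
      then show ?thesis using r0 by (simp add: power2_eq_square mult_ac)
    qed
    have "((\<lambda>r. 2 * pi * B / r) \<longlongrightarrow> 0) at_top" by real_asymp
    then have "norm (I - 2 * pi * \<i> * c) \<le> 0"
    proof (rule tendsto_lowerbound)
      show "\<forall>\<^sub>F r in at_top. norm (I - 2 * pi * \<i> * c) \<le> 2 * pi * B / r"
        using eventually_ge_at_top[of \<rho>] by eventually_elim (rule est)
    qed simp
    then show "I = 2 * pi * \<i> * c" by simp
  qed
qed

section \<open>Circulation\<close>

context euler_exterior begin

text \<open>Green's theorem and \<open>tangential_integral\<close> are about fields on the whole plane: the extension \<open>g\<close> is
  multiplied by a cutoff that is 1 on the part of the closed domain within \<open>\<rho>\<close>.\<close>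
lemma plane_extension:
  assumes t: "t \<ge> 0"
  obtains W DW rW where "C1_on W DW UNIV" "\<And>x. norm x > rW \<Longrightarrow> W x = 0"
    "\<And>x. x \<in> \<Omega> \<union> \<Gamma> \<Longrightarrow> norm x \<le> \<rho> \<Longrightarrow> W x = u t x"
    "\<And>x v. x \<in> \<Omega> \<Longrightarrow> norm x < \<rho> \<Longrightarrow> DW x v = Dg (x, t) (v, 0)"
proof -
  define S where "S = {x. (x, t) \<in> U}"
  have S: "open S"
  proof -
    have "S = (\<lambda>x. (x, t)) -` U" by (auto simp: S_def)
    then show ?thesis using open_U by (auto intro!: open_vimage continuous_intros)
  qed
  define K where "K = (\<Omega> \<union> \<Gamma>) \<inter> cball 0 \<rho>"
  have K: "compact K" unfolding K_def using closed_Omega_Gamma by (intro closed_Int_compact) auto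
  have KS: "K \<subseteq> S" using U_sup t closure_Omega by (auto simp: K_def S_def)
  obtain \<eta> \<eta>' L where \<eta>: "C1_on \<eta> \<eta>' UNIV" "\<And>x. x \<in> K \<Longrightarrow> \<eta> x = (1::real)" "compact L" "L \<subseteq> S" "\<And>x. x \<notin> L \<Longrightarrow> \<eta> x = 0"
    using exists_C1_cutoff[OF K S KS] by metis
  define W where "W = (\<lambda>x. if x \<in> S then \<eta> x *\<^sub>R g (x, t) else 0)"
  define DW where "DW = (\<lambda>x v. if x \<in> S then \<eta> x *\<^sub>R Dg (x, t) (v, 0) + \<eta>' x v *\<^sub>R g (x, t) else 0)"
  have "C1_on (\<lambda>x. \<eta> x *\<^sub>R g (x, t)) (\<lambda>x v. \<eta> x *\<^sub>R Dg (x, t) (v, 0) + \<eta>' x v *\<^sub>R g (x, t)) S"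
    using C1_on_slice[OF C1_g, of t] by (intro C1_on_scaleR C1_on_subset[OF \<eta>(1)]) (auto simp: S_def)
  then have W: "C1_on W DW UNIV"
    unfolding W_def DW_def
    by (rule C1_on_extend_zero[OF _ S compact_imp_closed[OF \<eta>(3)] \<eta>(4)]) (simp add: \<eta>(5))
  obtain rW where rW: "\<forall>x\<in>L. norm x \<le> rW" using compact_imp_bounded[OF \<eta>(3)] unfolding bounded_iff by blast
  have Wu: "W x = u t x" if "x \<in> \<Omega> \<union> \<Gamma>" "norm x \<le> \<rho>" for x
  proof -
    have "x \<in> K" using that by (simp add: K_def)
    then show ?thesis using KS \<eta>(2) g_eq[of x t] that t closure_Omega by (auto simp: W_def)
  qed
  show ?thesis
  proof (rule that[OF W _ Wu])
    show "W x = 0" if "norm x > rW" for x using rW that \<eta>(5)[of x] by (force simp: W_def)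
    fix x v assume x: "x \<in> \<Omega>" "norm x < \<rho>"
    show "DW x v = Dg (x, t) (v, 0)"
      by (rule C1_on_derivative_eqI[OF C1_on_subset[OF W] C1_on_subset[OF C1_u[OF t]], of "\<Omega> \<inter> ball 0 \<rho>"])
         (use x Wu open_Omega in auto)
  qed
qed

lemma winding_integral:
  assumes "w \<notin> \<Gamma>"
  shows "integral {0..1} (\<lambda>s. dloop s / (\<gamma> s - w)) = 2 * pi * \<i> * indicator (inside \<Gamma>) w"
proof -
  have vp: "valid_path \<gamma>"
  proof -
    have "\<gamma> C1_differentiable_on {0..1}"
      unfolding C1_differentiable_on_def using loop_deriv loop_cont(2) by (intro exI[of _ dloop]) auto
    then show ?thesis by (simp add: valid_path_def C1_differentiable_imp_piecewise)
  qed
  have w: "w \<notin> path_image \<gamma>" using assms by (simp add: path_image_Gamma)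
  have "integral {0..1} (\<lambda>s. dloop s / (\<gamma> s - w)) = contour_integral \<gamma> (\<lambda>z. 1 / (z - w))"
    unfolding contour_integral_integral by (simp add: dloop_def)
  also have "\<dots> = 2 * pi * \<i> * winding_number \<gamma> w"
    using winding_number_valid_path[OF vp w] by simp
  also have "winding_number \<gamma> w = indicator (inside \<Gamma>) w"
  proof (cases "w \<in> inside \<Gamma>")
    case True
    then show ?thesis using winding by (simp add: path_image_Gamma)
  next
    case False
    then have "w \<in> outside (path_image \<gamma>)"
      using assms inside_Un_outside[of "path_image \<gamma>"] unfolding path_image_Gamma by blast
    then have "winding_number \<gamma> w = 0"
      using valid_path_imp_path[OF vp] closed_loop by (intro winding_number_zero_in_outside) auto
    then show ?thesis using False by simp
  qed
  finally show ?thesis .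
qed

lemma dot_complex: "Re (cnj a * b) = a \<bullet> b" "Im (cnj a * b) = - (a \<bullet> (\<i> * b))"
  by (simp_all add: inner_complex_def)

lemma tangent_u: "t \<ge> 0 \<Longrightarrow> u t (\<gamma> s) \<bullet> (\<i> * dloop s) = 0"
proof -
  assume "t \<ge> 0"
  then have "u t (\<gamma> s) \<bullet> unit_normal \<gamma> s = 0" using euler unfolding smooth_euler_solution_def by blast
  then have "inverse (norm (\<i> * dloop s)) * (u t (\<gamma> s) \<bullet> (\<i> * dloop s)) = 0"
    by (simp add: unit_normal_def sgn_div_norm dloop_def)
  then show ?thesis using loop_regular[of s] by simp
qed

text \<open>Green's theorem for the circle minus Green's theorem for \<open>\<gamma>\<close>. In the difference only the region
  between the two loops counts; there \<open>2 i dbar (cnj u)\<close> is the vorticity. Along the curve \<open>cnj u d\<gamma>\<close>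
  is real because the velocity is tangent.\<close>
lemma far_circulation:
  assumes t: "t \<ge> 0" and R: "vort_within R t" and \<rho>: "\<rho> > R" "\<rho> > r0"
  shows "contour_integral (circlepath 0 \<rho>) (\<lambda>z. cnj (u t z)) =
     complex_of_real (circulation \<gamma> (u t) + (LINT x:\<Omega>|lborel. curl (u t) x))"
proof -
  obtain W DW rW where W: "C1_on W DW UNIV" "\<And>x. norm x > rW \<Longrightarrow> W x = 0"
    "\<And>x. x \<in> \<Omega> \<union> \<Gamma> \<Longrightarrow> norm x \<le> \<rho> \<Longrightarrow> W x = u t x"
    "\<And>x v. x \<in> \<Omega> \<Longrightarrow> norm x < \<rho> \<Longrightarrow> DW x v = Dg (x, t) (v, 0)"
    using plane_extension[OF t, of \<rho>] by metis
  let ?f = "\<lambda>x. cnj (W x)" and ?D = "\<lambda>x v. cnj (DW x v)"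
  have f: "C1_on ?f ?D UNIV" by (rule C1_on_linear_comp[OF bounded_linear_cnj W(1)])
  have f0: "?f x = 0" if "norm x > rW" for x using W(2)[OF that] by simp
  have \<rho>0: "\<rho> > 0" using \<rho> r0(1) by simp
  have far: "x \<in> \<Omega>" if "norm x \<ge> \<rho>" for x using that \<rho> r0(2) by simp
  have Gin: "norm x < \<rho>" if "x \<notin> \<Omega>" for x using far[of x] that by force
  have Wg: "W (\<gamma> s) = u t (\<gamma> s)" if s: "s \<in> {0..1}" for s
  proof (rule W(3))
    have "\<gamma> s \<notin> \<Omega>" using Omega_Gamma s by blast
    then show "norm (\<gamma> s) \<le> \<rho>" using Gin[of "\<gamma> s"] by simp
  qed (use s in auto)
  have [measurable]: "inside \<Gamma> \<in> sets borel"
    using compact_Gamma by (intro borel_open open_inside compact_imp_closed)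
  have c1: "integral {0..1} (\<lambda>s. ?f (circlepath 0 \<rho> s) * circ_deriv \<rho> s) = 2 * \<i> * (LINT w|lborel. dbar ?D w * indicator (ball 0 \<rho>) w)"
    by (rule Green_winding[OF f f0 circlepath_has_vector_derivative continuous_on_circ_deriv _ circle_winding[OF \<rho>0]])
       (auto intro!: borel_measurable_indicator)
  have c2: "integral {0..1} (\<lambda>s. ?f (\<gamma> s) * dloop s) = 2 * \<i> * (LINT w|lborel. dbar ?D w * indicator (inside \<Gamma>) w)"
    by (rule Green_winding[OF f f0 loop_deriv loop_cont(2) _ winding_integral])
       (auto intro!: borel_measurable_indicator)
  have dc: "continuous_on UNIV (dbar ?D)" by (rule continuous_on_dbar[OF f])
  have "dbar ?D w = 0" if "norm w > rW" for w
    using C1_on_deriv_zero_outside[OF f f0 that] by (simp add: dbar_def)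
  then have di: "integrable lborel (dbar ?D)" by (rule integrable_continuous_bounded_support[OF dc])
  have ii: "integrable lborel (\<lambda>w. dbar ?D w * indicator A w)" if "A \<in> sets borel" for A :: "complex set"
  proof -
    have "(\<lambda>w. dbar ?D w * indicator A w) = (\<lambda>w. indicator A w *\<^sub>R dbar ?D w)" by (auto simp: indicator_def)
    then show ?thesis using integrable_mult_indicator[OF _ di, of A] that by simp
  qed
  have "(LINT w|lborel. dbar ?D w * indicator (ball 0 \<rho>) w) - (LINT w|lborel. dbar ?D w * indicator (inside \<Gamma>) w)
     = (LINT w|lborel. dbar ?D w * indicator (ball 0 \<rho>) w - dbar ?D w * indicator (inside \<Gamma>) w)"
    by (rule Bochner_Integration.integral_diff[symmetric]) (auto intro!: ii)
  also have "\<dots> = (LINT w|lborel. (- \<i> / 2) * complex_of_real (indicator \<Omega> w * curl (u t) w))"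
  proof (rule integral_cong_AE)
    show "(\<lambda>w. dbar ?D w * indicator (ball 0 \<rho>) w - dbar ?D w * indicator (inside \<Gamma>) w) \<in> borel_measurable lborel"
      using ii[THEN borel_measurable_integrable] by (intro borel_measurable_diff) auto
    have "continuous_on \<Omega> (\<lambda>w. om (w, t))"
      by (rule continuous_on_compose2[OF om_continuous]) (use U_I t in \<open>auto intro!: continuous_intros\<close>)
    then have "(\<lambda>w. indicator \<Omega> w *\<^sub>R om (w, t)) \<in> borel_measurable borel"
      using open_Omega by (intro borel_measurable_continuous_on_indicator) auto
    moreover have "(\<lambda>w. indicator \<Omega> w *\<^sub>R om (w, t)) = (\<lambda>w. indicator \<Omega> w * curl (u t) w)"
      using partials_u(3) t by (auto simp: indicator_def fun_eq_iff)
    ultimately have [measurable]: "(\<lambda>w. indicator \<Omega> w * curl (u t) w) \<in> borel_measurable borel" by simp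
    show "(\<lambda>w. (- \<i> / 2) * complex_of_real (indicator \<Omega> w * curl (u t) w)) \<in> borel_measurable lborel" by measurable
    show "AE w in lborel. dbar ?D w * indicator (ball 0 \<rho>) w - dbar ?D w * indicator (inside \<Gamma>) w
        = (- \<i> / 2) * complex_of_real (indicator \<Omega> w * curl (u t) w)"
      using AE_not_in[OF negligible_C1_curve[OF loop_deriv]]
    proof eventually_elim
      case (elim w)
      show ?case
      proof (cases "w \<in> \<Omega>")
        case True
        then have ni: "w \<notin> inside \<Gamma>" using inside_Int_outside[of "path_image \<gamma>"] unfolding path_image_Gamma by blast
        show ?thesis
        proof (cases "norm w < \<rho>")
          case wr: True
          have "dbar ?D w = - \<i> * of_real (om (w, t)) / 2"
            using dbar_cnj_u[OF True t] W(4)[OF True wr] by (simp add: dbar_def)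
          then show ?thesis using True ni wr partials_u(3)[OF True t] by simp
        next
          case False
          then have "om (w, t) = 0" using R True \<rho> by (simp add: vort_within_def)
          then show ?thesis using True ni False partials_u(3)[OF True t] by simp
        qed
      next
        case False
        then have "w \<in> inside \<Gamma>" using elim inside_Un_outside[of "path_image \<gamma>"] unfolding path_image_Gamma by blast
        then show ?thesis using False Gin[OF False] by simp
      qed
    qed
  qed
  also have "\<dots> = (- \<i> / 2) * complex_of_real (LINT w|lborel. indicator \<Omega> w * curl (u t) w)"
    by (simp only: integral_mult_right_zero integral_complex_of_real)
  finally have fin: "(LINT w|lborel. dbar ?D w * indicator (ball 0 \<rho>) w) - (LINT w|lborel. dbar ?D w * indicator (inside \<Gamma>) w)
     = (- \<i> / 2) * complex_of_real (LINT w|lborel. indicator \<Omega> w * curl (u t) w)" .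
  have "integral {0..1} (\<lambda>s. ?f (circlepath 0 \<rho> s) * circ_deriv \<rho> s) - integral {0..1} (\<lambda>s. ?f (\<gamma> s) * dloop s)
     = complex_of_real (LINT w|lborel. indicator \<Omega> w * curl (u t) w)"
    unfolding c1 c2 right_diff_distrib[symmetric] fin by simp
  then have "integral {0..1} (\<lambda>s. ?f (circlepath 0 \<rho> s) * circ_deriv \<rho> s) = integral {0..1} (\<lambda>s. ?f (\<gamma> s) * dloop s)
     + complex_of_real (LINT w|lborel. indicator \<Omega> w * curl (u t) w)"
    by (simp only: diff_eq_eq add.commute)
  also have "integral {0..1} (\<lambda>s. ?f (\<gamma> s) * dloop s) = integral {0..1} (\<lambda>s. complex_of_real (u t (\<gamma> s) \<bullet> dloop s))"
  proof (rule integral_cong)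
    fix s :: real assume s: "s \<in> {0..1}"
    then have "W (\<gamma> s) = u t (\<gamma> s)" by (rule Wg)
    then show "?f (\<gamma> s) * dloop s = complex_of_real (u t (\<gamma> s) \<bullet> dloop s)"
      using dot_complex[of "u t (\<gamma> s)" "dloop s"] tangent_u[OF t, of s] by (simp add: complex_eq_iff)
  qed
  also have "\<dots> = complex_of_real (circulation \<gamma> (u t))"
  proof -
    have "continuous_on {0..1} (\<lambda>s. W (\<gamma> s) \<bullet> dloop s)"
      by (intro continuous_intros loop_cont continuous_on_compose2[OF C1_on_continuous[OF W(1)]]) auto
    then have "continuous_on {0..1} (\<lambda>s. u t (\<gamma> s) \<bullet> dloop s)"
      by (rule continuous_on_eq) (simp add: Wg)
    then show ?thesis
      using integral_linear[OF integrable_continuous_interval bounded_linear_of_real[where 'a=complex]]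
      by (simp add: circulation_def dloop_def o_def)
  qed
  also have "integral {0..1} (\<lambda>s. ?f (circlepath 0 \<rho> s) * circ_deriv \<rho> s) = integral {0..1} (\<lambda>s. cnj (u t (circlepath 0 \<rho> s)) * circ_deriv \<rho> s)"
  proof (rule integral_cong)
    fix s :: real
    have "norm (circlepath 0 \<rho> s) = \<rho>" using \<rho>0 by (simp add: circlepath norm_mult)
    then show "?f (circlepath 0 \<rho> s) * circ_deriv \<rho> s = cnj (u t (circlepath 0 \<rho> s)) * circ_deriv \<rho> s"
      using far by (simp add: W(3))
  qed
  also have "\<dots> = contour_integral (circlepath 0 \<rho>) (\<lambda>z. cnj (u t z))" by (rule integral_circlepath)
  finally show ?thesis by (simp add: set_lebesgue_integral_def)
qed

end

section \<open>Asymptotics of the velocity\<close>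

lemma limit_zero_of_coefficient:
  fixes F :: "complex \<Rightarrow> complex"
  assumes "((\<lambda>z. z * F z) \<longlongrightarrow> c) at_infinity"
  shows "(F \<longlongrightarrow> 0) at_infinity"
proof -
  have "((\<lambda>z. (z * F z) * inverse z) \<longlongrightarrow> c * 0) at_infinity"
    by (intro tendsto_mult assms tendsto_inverse_0)
  then have "((\<lambda>z. (z * F z) * inverse z) \<longlongrightarrow> 0) at_infinity" by simp
  moreover have "\<forall>\<^sub>F z in at_infinity. (z * F z) * inverse z = F z"
    unfolding eventually_at_infinity
  proof (intro exI[of _ 1] allI impI)
    fix z :: complex assume "1 \<le> norm z"
    then have "z \<noteq> 0" by auto
    then show "(z * F z) * inverse z = F z" by simp
  qed
  ultimately show ?thesis by (rule Lim_transform_eventually)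
qed

lemma exterior_decay:
  assumes "F holomorphic_on {z. norm z > n}" "n > 0" "(F \<longlongrightarrow> 0) at_infinity"
    and "\<rho> > n" "\<And>z. norm z = \<rho> \<Longrightarrow> norm (F z) \<le> M" and z: "norm z \<ge> \<rho>"
  shows "norm (F z) \<le> M * \<rho> / norm z"
proof (rule exterior_expansion[OF assms(1-5)])
  assume "\<And>z. norm z \<ge> \<rho> \<Longrightarrow> norm (F z) \<le> M * \<rho> / norm z"
  then show ?thesis using z .
qed

lemma exterior_quadratic_decay:
  assumes F: "F holomorphic_on {z. norm z > n}" and n: "n > 0" and l: "((\<lambda>z. z * F z) \<longlongrightarrow> 0) at_infinity"
    and \<rho>: "\<rho> > n" and M: "\<And>z. norm z = \<rho> \<Longrightarrow> norm (F z) \<le> M" and z: "norm z \<ge> \<rho>"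
  shows "norm (F z) \<le> M * \<rho>\<^sup>2 / (norm z)\<^sup>2"
proof (rule exterior_expansion[OF F n limit_zero_of_coefficient[OF l] \<rho> M])
  fix c
  assume c: "((\<lambda>z. z * F z) \<longlongrightarrow> c) at_infinity"
    and d: "\<And>z. c = 0 \<Longrightarrow> norm z \<ge> \<rho> \<Longrightarrow> norm (F z) \<le> M * \<rho>\<^sup>2 / (norm z)\<^sup>2"
  have "c = 0" using tendsto_unique[OF trivial_limit_at_infinity c l] .
  then show ?thesis using z by (rule d)
qed

lemma exterior_coefficient:
  assumes "F holomorphic_on {z. norm z > n}" "n > 0" "(F \<longlongrightarrow> 0) at_infinity"
    and "\<rho> > n" "\<And>z. norm z = \<rho> \<Longrightarrow> norm (F z) \<le> M"
    and I: "\<And>r. r > n \<Longrightarrow> contour_integral (circlepath 0 r) F = I"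
  shows "((\<lambda>z. z * F z) \<longlongrightarrow> I / (2 * pi * \<i>)) at_infinity"
proof (rule exterior_expansion[OF assms(1-5)])
  fix c
  assume c: "((\<lambda>z. z * F z) \<longlongrightarrow> c) at_infinity"
    and d: "\<And>I. (\<And>r. r > n \<Longrightarrow> contour_integral (circlepath 0 r) F = I) \<Longrightarrow> I = 2 * pi * \<i> * c"
  have "I = 2 * pi * \<i> * c" by (rule d[OF I])
  then show ?thesis using c by simp
qed

context euler_exterior begin

lemma u_holomorphic:
  assumes t: "t \<ge> 0" and n: "vort_within n t" "n \<ge> r0"
  shows "(\<lambda>z. cnj (u t z)) holomorphic_on {z. norm z > n}"
proof -
  have op: "open {z::complex. norm z > n}" by (intro open_Collect_less continuous_intros)
  have "((\<lambda>z. cnj (u t z)) has_field_derivative cnj (G1 (z, t))) (at z)" if z: "norm z > n" for z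
  proof -
    have x: "z \<in> \<Omega>" using z n r0(2) by simp
    have d: "((\<lambda>x. cnj (u t x)) has_derivative (\<lambda>v. cnj (Dg (z, t) (v, 0)))) (at z)"
      using C1_onD[OF C1_cnj_u[OF t] x] .
    have o: "Im (G1 (z, t)) = Re (G2 (z, t))" using n z x by (simp add: vort_within_def om_def)
    have b: "Im (G2 (z, t)) = - Re (G1 (z, t))" using div_zero[OF x t] by linarith
    have "cnj (Dg (z, t) (v, 0)) = cnj (G1 (z, t)) * v" for v
      using o b Dg_expand[OF U_I[OF x t], of v 0] by (simp add: complex_eq_iff algebra_simps)
    then show ?thesis using d by (simp add: has_field_derivative_def)
  qed
  then show ?thesis using op by (auto simp: holomorphic_on_open)
qed

definition "\<alpha> = harmonic_coeff \<gamma> u"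

abbreviation "H \<equiv> harmonic_field T"

lemma T_facts: "T holomorphic_on \<Omega>" "x \<in> \<Omega> \<Longrightarrow> norm (T x) > 1"
  and T_bounded: "bounded (deriv T ` \<Omega>)"
proof -
  show "T holomorphic_on \<Omega>" "bounded (deriv T ` \<Omega>)" using conformal unfolding exterior_conformal_map_def by blast+
  have "bij_betw T \<Omega> {z. norm z > 1}" using conformal unfolding exterior_conformal_map_def by blast
  then show "x \<in> \<Omega> \<Longrightarrow> norm (T x) > 1" unfolding bij_betw_def by auto
qed

text \<open>\<open>cnj H\<close> is the complex derivative of \<open>(2 \<pi> i)\<^sup>-\<^sup>1 log T\<close>, whose imaginary part is minus the stream
  function of \<open>H\<close>.\<close>
lemma cnj_H:
  assumes x: "x \<in> \<Omega>"
  shows "cnj (H x) = deriv T x / (2 * pi * \<i> * T x)"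
proof -
  have T1: "norm (T x) > 1" by (rule T_facts(2)[OF x])
  then have T0: "T x \<noteq> 0" by auto
  have dT: "(T has_field_derivative deriv T x) (at x)"
    using T_facts(1) x open_Omega by (simp add: holomorphic_derivI)
  define q where "q = deriv T x / T x"
  have n: "((\<lambda>y. norm (T y)) has_derivative (\<lambda>v. (deriv T x * v) \<bullet> sgn (T x))) (at x)"
    using has_derivative_compose[OF dT[unfolded has_field_derivative_def] has_derivative_norm[OF T0]] by simp
  have "((\<lambda>y. ln (norm (T y))) has_derivative (\<lambda>v. (deriv T x * v) \<bullet> sgn (T x) * (1 / norm (T x)))) (at x)"
    using has_derivative_compose[OF n DERIV_ln[of "norm (T x)", unfolded has_field_derivative_def]] T0
    by (simp add: divide_inverse mult.commute)
  also have "(\<lambda>v. (deriv T x * v) \<bullet> sgn (T x) * (1 / norm (T x))) = (\<lambda>v. Re (q * v))"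
  proof
    fix v
    have "(deriv T x * v) \<bullet> sgn (T x) * (1 / norm (T x)) = ((deriv T x * v) \<bullet> T x) / (norm (T x))\<^sup>2"
      by (simp add: sgn_div_norm power2_eq_square divide_inverse)
    also have "\<dots> = Re ((deriv T x * v) * cnj (T x)) / (norm (T x))\<^sup>2"
      by (simp add: inner_complex_def)
    also have "\<dots> = Re ((deriv T x * v) * cnj (T x) / complex_of_real ((norm (T x))\<^sup>2))"
      by (simp only: Re_divide_of_real)
    also have "(deriv T x * v) * cnj (T x) / complex_of_real ((norm (T x))\<^sup>2) = q * v"
      using T0 unfolding complex_norm_square q_def by (simp add: field_simps)
    finally show "(deriv T x * v) \<bullet> sgn (T x) * (1 / norm (T x)) = Re (q * v)" .
  qed
  finally have fd: "frechet_derivative (\<lambda>y. ln (norm (T y))) (at x) = (\<lambda>v. Re (q * v))"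
    using frechet_derivative_at by metis
  have "H x = (1 / (2 * pi)) *\<^sub>R Complex (Im q) (Re q)"
    by (simp add: harmonic_field_def perp_grad_def partial1_def partial2_def fd)
  then have "cnj (H x) = q / (2 * pi * \<i>)"
    by (simp add: complex_eq_iff Re_divide Im_divide power2_eq_square)
  then show ?thesis using T0 by (simp add: q_def field_simps)
qed

lemma cnj_H_holomorphic: "(\<lambda>x. cnj (H x)) holomorphic_on \<Omega>"
proof -
  have "(\<lambda>x. deriv T x / (2 * pi * \<i> * T x)) holomorphic_on \<Omega>"
  proof (rule holomorphic_on_divide[OF holomorphic_deriv[OF T_facts(1) open_Omega] holomorphic_on_mult[OF holomorphic_on_const T_facts(1)]])
    fix z assume "z \<in> \<Omega>"
    then have "T z \<noteq> 0" using T_facts(2)[of z] by auto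
    then show "2 * pi * \<i> * T z \<noteq> 0" by simp
  qed
  then show ?thesis by (rule holomorphic_transform) (simp add: cnj_H)
qed

lemma H_continuous: "continuous_on \<Omega> H"
  using continuous_on_cnj[OF holomorphic_on_imp_continuous_on[OF cnj_H_holomorphic]] by simp

lemma H_bounded: obtains B where "B \<ge> 0" "\<And>x. x \<in> \<Omega> \<Longrightarrow> norm (H x) \<le> B"
proof -
  obtain B where B: "\<And>x. x \<in> \<Omega> \<Longrightarrow> norm (deriv T x) \<le> B" using T_bounded unfolding bounded_iff by blast
  have "norm (H x) \<le> max B 0" if x: "x \<in> \<Omega>" for x
  proof -
    have T1: "norm (T x) > 1" by (rule T_facts(2)[OF x])
    have "2 * pi * norm (T x) \<ge> 1 * 1" using T1 pi_gt3 by (intro mult_mono) auto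
    have "norm (H x) = norm (cnj (H x))" by simp
    also have "\<dots> = norm (deriv T x) / (2 * pi * norm (T x))" by (simp add: cnj_H[OF x] norm_divide norm_mult)
    also have "\<dots> \<le> norm (deriv T x) / 1"
      using \<open>2 * pi * norm (T x) \<ge> 1 * 1\<close> by (intro divide_left_mono) auto
    finally show ?thesis using B[OF x] by simp
  qed
  then show ?thesis by (intro that[of "max B 0"]) auto
qed

text \<open>Insert \<open>T z = \<beta> z + h z\<close>: both \<open>h z / z\<close> and \<open>h' z\<close> tend to 0, and \<open>\<beta>\<close> cancels.\<close>
lemma H_limit: "((\<lambda>z. z * cnj (H z)) \<longlongrightarrow> 1 / (2 * pi * \<i>)) at_infinity"
proof -
  obtain \<beta> h C where h: "\<beta> > 0" "h holomorphic_on \<Omega>" "bounded (h ` \<Omega>)"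
    "\<And>z. z \<in> \<Omega> \<Longrightarrow> T z = complex_of_real \<beta> * z + h z"
    "\<And>z. z \<in> \<Omega> \<Longrightarrow> cmod z ^ 2 * cmod (deriv h z) \<le> C"
    using conformal unfolding exterior_conformal_map_def by blast
  obtain Bh where Bh: "\<And>z. z \<in> \<Omega> \<Longrightarrow> norm (h z) \<le> Bh" using h(3) unfolding bounded_iff by blast
  have inv0: "((\<lambda>z::complex. 1 / norm z) \<longlongrightarrow> 0) at_infinity"
    using tendsto_norm[OF tendsto_inverse_0[where 'a=complex]] by (simp add: norm_inverse divide_inverse)
  have ev: "\<forall>\<^sub>F z in at_infinity. norm z \<ge> max 1 r0" unfolding eventually_at_infinity by blast
  have l1: "((\<lambda>z. h z / z) \<longlongrightarrow> 0) at_infinity"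
  proof (rule Lim_null_comparison)
    show "\<forall>\<^sub>F z in at_infinity. norm (h z / z) \<le> Bh * (1 / norm z)"
      using ev by eventually_elim (use Bh r0(2) in \<open>auto simp: norm_divide intro!: divide_right_mono\<close>)
    show "((\<lambda>z::complex. Bh * (1 / norm z)) \<longlongrightarrow> 0) at_infinity" using tendsto_mult_left[OF inv0, of Bh] by simp
  qed
  have l2: "((\<lambda>z. deriv h z) \<longlongrightarrow> 0) at_infinity"
  proof (rule Lim_null_comparison)
    show "\<forall>\<^sub>F z in at_infinity. norm (deriv h z) \<le> \<bar>C\<bar> * (1 / norm z)"
      using ev
    proof eventually_elim
      case (elim z)
      then have "z \<in> \<Omega>" "norm z \<ge> 1" using r0(2) by auto
      then have "norm z * norm (deriv h z) \<le> norm z ^ 2 * norm (deriv h z)"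
        by (intro mult_right_mono) (auto simp: self_le_power)
      also have "\<dots> \<le> \<bar>C\<bar>" using h(5)[OF \<open>z \<in> \<Omega>\<close>] by simp
      finally have le: "norm z * norm (deriv h z) \<le> \<bar>C\<bar>" .
      have "0 < norm z" using \<open>norm z \<ge> 1\<close> by linarith
      from pos_le_divide_eq[OF this, of "norm (deriv h z)" "\<bar>C\<bar>"] le show ?case by (simp add: mult.commute)
    qed
    show "((\<lambda>z::complex. \<bar>C\<bar> * (1 / norm z)) \<longlongrightarrow> 0) at_infinity" using tendsto_mult_left[OF inv0, of "\<bar>C\<bar>"] by simp
  qed
  have "((\<lambda>z. (of_real \<beta> + deriv h z) / (2 * pi * \<i> * (of_real \<beta> + h z / z))) \<longlongrightarrow> (of_real \<beta> + 0) / (2 * pi * \<i> * (of_real \<beta> + 0))) at_infinity"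
    using h(1) by (intro tendsto_intros l1 l2) auto
  then have "((\<lambda>z. (of_real \<beta> + deriv h z) / (2 * pi * \<i> * (of_real \<beta> + h z / z))) \<longlongrightarrow> 1 / (2 * pi * \<i>)) at_infinity"
    using h(1) by simp
  then show ?thesis
  proof (rule Lim_transform_eventually)
    show "\<forall>\<^sub>F z in at_infinity. (of_real \<beta> + deriv h z) / (2 * pi * \<i> * (of_real \<beta> + h z / z)) = z * cnj (H z)"
      using ev
    proof eventually_elim
      case (elim z)
      then have z: "z \<in> \<Omega>" "z \<noteq> 0" using r0(2) by auto
      have "deriv T z = of_real \<beta> + deriv h z"
      proof -
        have "((\<lambda>z. of_real \<beta> * z + h z) has_field_derivative of_real \<beta> + deriv h z) (at z)"
          using holomorphic_derivI[OF h(2) open_Omega z(1)] by (auto intro!: derivative_eq_intros)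
        then have "(T has_field_derivative of_real \<beta> + deriv h z) (at z)"
          by (rule has_field_derivative_transform_within_open[OF _ open_Omega z(1)]) (simp add: h(4))
        then show ?thesis by (rule DERIV_imp_deriv)
      qed
      then have "z * cnj (H z) = z * (of_real \<beta> + deriv h z) / (2 * pi * \<i> * T z)" by (simp add: cnj_H[OF z(1)])
      also have "T z = z * (of_real \<beta> + h z / z)" using z h(4)[OF z(1)] by (simp add: field_simps)
      also have "z * (of_real \<beta> + deriv h z) / (2 * pi * \<i> * (z * (of_real \<beta> + h z / z)))
         = (of_real \<beta> + deriv h z) / (2 * pi * \<i> * (of_real \<beta> + h z / z))"
        using mult_divide_mult_cancel_left[OF z(2), of "of_real \<beta> + deriv h z" "2 * pi * \<i> * (of_real \<beta> + h z / z)"]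
        by (simp only: mult_ac)
      finally show ?case by simp
    qed
  qed
qed

text \<open>The field \<open>cnj H - 1 / (2 \<pi> i z)\<close> has coefficient 0 at infinity, so it decays quadratically.\<close>
lemma H_expansion:
  obtains C where "C \<ge> 0" "\<And>z. norm z \<ge> RA \<Longrightarrow> norm (cnj (H z)) \<le> C / norm z"
    "\<And>z. norm z \<ge> RA \<Longrightarrow> norm (cnj (H z) - 1 / (2 * pi * \<i> * z)) \<le> C / (norm z)\<^sup>2"
proof -
  obtain B where B: "B \<ge> 0" "\<And>x. x \<in> \<Omega> \<Longrightarrow> norm (H x) \<le> B" using H_bounded by metis
  have sub: "{z. norm z > r0} \<subseteq> \<Omega>" using r0(2) by auto
  have Hh: "(\<lambda>z. cnj (H z)) holomorphic_on {z. norm z > r0}" using cnj_H_holomorphic sub by (rule holomorphic_on_subset)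
  define M where "M = B + 1"
  have M: "norm (cnj (H z)) \<le> M" "norm (cnj (H z) - 1 / (2 * pi * \<i> * z)) \<le> M" if "norm z = RA" for z
  proof -
    have z: "z \<in> \<Omega>" "norm z \<ge> 1" using that r0 by (auto simp: RA_def)
    have "norm (1 / (2 * pi * \<i> * z)) \<le> 1"
    proof -
      have "1 * 1 \<le> 2 * pi * norm z" using z pi_gt3 by (intro mult_mono) auto
      then show ?thesis by (simp add: norm_divide norm_mult divide_le_eq)
    qed
    then show "norm (cnj (H z) - 1 / (2 * pi * \<i> * z)) \<le> M"
      using B(2)[OF z(1)] norm_triangle_ineq4[of "cnj (H z)" "1 / (2 * pi * \<i> * z)"] by (simp add: M_def)
    show "norm (cnj (H z)) \<le> M" using B(2)[OF z(1)] by (simp add: M_def)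
  qed
  have 1: "norm (cnj (H z)) \<le> M * RA / norm z" if "norm z \<ge> RA" for z
    by (rule exterior_decay[OF Hh r0(1) limit_zero_of_coefficient[OF H_limit] RAB(1) M(1) that])
  have l: "((\<lambda>z. z * (cnj (H z) - 1 / (2 * pi * \<i> * z))) \<longlongrightarrow> 0) at_infinity"
  proof -
    have "((\<lambda>z. z * cnj (H z) - 1 / (2 * pi * \<i>)) \<longlongrightarrow> 1 / (2 * pi * \<i>) - 1 / (2 * pi * \<i>)) at_infinity"
      by (intro tendsto_diff H_limit tendsto_const)
    then have "((\<lambda>z. z * cnj (H z) - 1 / (2 * pi * \<i>)) \<longlongrightarrow> 0) at_infinity" by simp
    moreover have "\<forall>\<^sub>F z in at_infinity. z * cnj (H z) - 1 / (2 * pi * \<i>) = z * (cnj (H z) - 1 / (2 * pi * \<i> * z))"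
      unfolding eventually_at_infinity
    proof (intro exI[of _ 1] allI impI)
      fix z :: complex assume "1 \<le> norm z"
      then have "z \<noteq> 0" by auto
      then show "z * cnj (H z) - 1 / (2 * pi * \<i>) = z * (cnj (H z) - 1 / (2 * pi * \<i> * z))"
        by (simp add: right_diff_distrib)
    qed
    ultimately show ?thesis by (rule Lim_transform_eventually)
  qed
  have hol: "(\<lambda>z. cnj (H z) - 1 / (2 * pi * \<i> * z)) holomorphic_on {z. norm z > r0}"
    using r0(1) by (intro holomorphic_intros Hh) auto
  have 2: "norm (cnj (H z) - 1 / (2 * pi * \<i> * z)) \<le> M * RA\<^sup>2 / (norm z)\<^sup>2" if "norm z \<ge> RA" for z
    by (rule exterior_quadratic_decay[OF hol r0(1) l RAB(1) M(2) that])
  have MR: "M * RA \<le> max (M * RA) (M * RA\<^sup>2)" "M * RA\<^sup>2 \<le> max (M * RA) (M * RA\<^sup>2)" by auto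
  show ?thesis
  proof (rule that[of "max (M * RA) (M * RA\<^sup>2)"])
    show "0 \<le> max (M * RA) (M * RA\<^sup>2)" using B(1) RAB by (simp add: M_def le_max_iff_disj)
    show "norm (cnj (H z)) \<le> max (M * RA) (M * RA\<^sup>2) / norm z" if "norm z \<ge> RA" for z
      using order_trans[OF 1[OF that] divide_right_mono[OF MR(1) norm_ge_zero]] .
    show "norm (cnj (H z) - 1 / (2 * pi * \<i> * z)) \<le> max (M * RA) (M * RA\<^sup>2) / (norm z)\<^sup>2" if "norm z \<ge> RA" for z
      using order_trans[OF 2[OF that] divide_right_mono[OF MR(2) zero_le_power2]] .
  qed
qed

text \<open>The Bernoulli function of the flow.\<close>
definition "Bern t x = p t x + (u t x \<bullet> u t x) / 2"
definition "DBern t x v = Dp (x, t) (v, 0) + u t x \<bullet> Dg (x, t) (v, 0)"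

lemma C1_Bern: "t > 0 \<Longrightarrow> C1_on (Bern t) (DBern t) \<Omega>"
proof -
  assume t: "t > 0"
  have "C1_on (\<lambda>x. p t x + inverse 2 * (u t x \<bullet> u t x)) (\<lambda>x v. Dp (x, t) (v, 0) + inverse 2 * (u t x \<bullet> Dg (x, t) (v, 0) + Dg (x, t) (v, 0) \<bullet> u t x)) \<Omega>"
    using t by (intro C1_on_add C1_p_slice C1_on_linear_comp[OF bounded_linear_mult_right] C1_on_inner C1_u) auto
  moreover have "(\<lambda>x. p t x + inverse 2 * (u t x \<bullet> u t x)) = Bern t"
    by (rule ext) (simp add: Bern_def)
  moreover have "(\<lambda>x v. Dp (x, t) (v, 0) + inverse 2 * (u t x \<bullet> Dg (x, t) (v, 0) + Dg (x, t) (v, 0) \<bullet> u t x)) = DBern t"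
  proof (intro ext)
    fix x v
    show "Dp (x, t) (v, 0) + inverse 2 * (u t x \<bullet> Dg (x, t) (v, 0) + Dg (x, t) (v, 0) \<bullet> u t x) = DBern t x v"
      using inner_commute[of "Dg (x, t) (v, 0)" "u t x"] by (simp add: DBern_def)
  qed
  ultimately show ?thesis by (simp only:)
qed

lemma Dp_expand: "x \<in> \<Omega> \<Longrightarrow> t > 0 \<Longrightarrow> Dp (x, t) (v, 0) = Re v * P1 (x, t) + Im v * P2 (x, t)"
proof -
  assume "x \<in> \<Omega>" "t > 0"
  then have l: "linear (Dp (x, t))" using C1_onD[OF C1_p(1), of "(x, t)"] has_derivative_linear by blast
  have "(v, 0::real) = Re v *\<^sub>R (1, 0) + Im v *\<^sub>R (\<i>, 0)" by (simp add: complex_eq_iff)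
  then show ?thesis unfolding P1_def P2_def
    by (simp only: linear_add[OF l] linear_scale[OF l] real_scaleR_def)
qed

text \<open>The momentum equation in rotational form. The vorticity term is orthogonal to the velocity, and
  absent outside the support of the vorticity.\<close>
lemma DBern_eq:
  assumes x: "x \<in> \<Omega>" and t: "t > 0"
  shows "DBern t x v = - (Gt (x, t) \<bullet> v) + om (x, t) * (Im (u t x) * Re v - Re (u t x) * Im v)"
proof -
  have g: "g (x, t) = u t x" using g_eq[of x t] x t closure_subset[of \<Omega>] by auto
  have "(x, t) \<in> V" using x t by simp
  note m = momentum[OF this]
  have e: "Re (Gt (x, t)) + Re (u t x) * Re (G1 (x, t)) + Im (u t x) * Re (G2 (x, t)) = - P1 (x, t)"
    "Im (Gt (x, t)) + Re (u t x) * Im (G1 (x, t)) + Im (u t x) * Im (G2 (x, t)) = - P2 (x, t)"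
    using arg_cong[OF m, of Re] arg_cong[OF m, of Im] g by simp_all
  have P: "P1 (x, t) = - (Re (Gt (x, t)) + Re (u t x) * Re (G1 (x, t)) + Im (u t x) * Re (G2 (x, t)))"
    "P2 (x, t) = - (Im (Gt (x, t)) + Re (u t x) * Im (G1 (x, t)) + Im (u t x) * Im (G2 (x, t)))"
    using e by linarith+
  have ut: "(x, t) \<in> U" using U_I[OF x] t by simp
  show ?thesis
    unfolding DBern_def Dp_expand[OF x t] Dg_expand[OF ut] P om_def inner_complex_def
    by (simp add: algebra_simps)
qed

text \<open>By \<open>far_circulation\<close> the left side is the circulation over a circle that encloses the vorticity
  during the whole time interval. On this circle \<open>u\<^sub>t\<close> is minus the gradient of the Bernoulli
  function, a single-valued function, so its integral around the circle is 0.\<close>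
lemma circulation_conserved:
  assumes t: "t \<ge> 0"
  shows "circulation \<gamma> (u t) + (LINT x:\<Omega>|lborel. curl (u t) x) = \<alpha>"
proof (cases "t = 0")
  case True
  then show ?thesis by (simp add: \<alpha>_def harmonic_coeff_def)
next
  case False
  then have t0: "t > 0" using t by simp
  obtain n where n: "\<And>\<tau>. 0 \<le> \<tau> \<Longrightarrow> \<tau> \<le> t \<Longrightarrow> vort_within n \<tau>" using vorticity_support_locally_bounded[of t] by metis
  define \<rho> where "\<rho> = max n r0 + 1"
  have \<rho>: "\<rho> > n" "\<rho> > r0" "\<rho> > 0" using r0(1) by (auto simp: \<rho>_def)
  define c where "c = circlepath 0 \<rho>"
  have cn: "norm (c s) = \<rho>" for s using \<rho> by (simp add: c_def circlepath norm_mult)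
  have cO: "c s \<in> \<Omega>" for s using r0(2) \<rho> cn by simp
  have cc: "continuous_on S c" for S
    unfolding c_def using circlepath_has_vector_derivative by (meson continuous_at_imp_continuous_on has_vector_derivative_continuous)
  define f where "f \<tau> = integral {0..1} (\<lambda>s. g (c s, \<tau>) \<bullet> circ_deriv \<rho> s)" for \<tau>
  have csnd: "continuous_on A (\<lambda>x. c (snd x))" "continuous_on A (\<lambda>x. circ_deriv \<rho> (snd x))" for A :: "(real \<times> real) set"
    by (rule continuous_on_compose2[OF cc[of UNIV]] continuous_on_compose2[OF continuous_on_circ_deriv[of UNIV]];
        auto intro!: continuous_intros)+
  have gcont: "continuous_on ({0..} \<times> {0..1}) (\<lambda>(\<tau>, s). g (c s, \<tau>) \<bullet> circ_deriv \<rho> s)"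
    unfolding split_beta using cO U_I
    by (intro continuous_intros csnd continuous_on_compose2[OF g_continuous]) auto
  have Gcont: "continuous_on ({0..} \<times> {0..1}) (\<lambda>(\<tau>, s). Gt (c s, \<tau>) \<bullet> circ_deriv \<rho> s)"
    unfolding split_beta using cO U_I
    by (intro continuous_intros csnd continuous_on_compose2[OF C1_on_continuous[OF C1_G(3)]]) auto
  have fa: "f \<tau> = circulation \<gamma> (u \<tau>) + (LINT x:\<Omega>|lborel. curl (u \<tau>) x)" if \<tau>: "0 \<le> \<tau>" "\<tau> \<le> t" for \<tau>
  proof -
    have gu: "g (c s, \<tau>) = u \<tau> (c s)" for s using g_eq[of "c s" \<tau>] \<tau> cO[of s] closure_subset[of \<Omega>] by auto
    have con: "continuous_on {0..1} (\<lambda>s. cnj (g (c s, \<tau>)) * circ_deriv \<rho> s)"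
      using cO U_I \<tau> by (intro continuous_intros continuous_on_compose2[OF g_continuous] cc continuous_on_circ_deriv) auto
    have "integral {0..1} (\<lambda>s. cnj (g (c s, \<tau>)) * circ_deriv \<rho> s) = contour_integral c (\<lambda>z. cnj (u \<tau> z))"
      using integral_circlepath[of "\<lambda>z. cnj (u \<tau> z)" \<rho>] by (simp add: c_def[symmetric] gu)
    also have "\<dots> = complex_of_real (circulation \<gamma> (u \<tau>) + (LINT x:\<Omega>|lborel. curl (u \<tau>) x))"
      unfolding c_def by (rule far_circulation[OF \<tau>(1) n[OF \<tau>] \<rho>(1,2)])
    finally have "Re (integral {0..1} (\<lambda>s. cnj (g (c s, \<tau>)) * circ_deriv \<rho> s)) = circulation \<gamma> (u \<tau>) + (LINT x:\<Omega>|lborel. curl (u \<tau>) x)"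
      by simp
    moreover have "Re (integral {0..1} (\<lambda>s. cnj (g (c s, \<tau>)) * circ_deriv \<rho> s)) = f \<tau>"
      using integral_linear[OF integrable_continuous_interval[OF con] bounded_linear_Re]
      by (simp add: f_def o_def dot_complex(1)[symmetric])
    ultimately show ?thesis by simp
  qed
  have "f t = f 0"
  proof (rule DERIV_isconst_end[OF t0])
    have "continuous_on {0..} f"
      unfolding f_def using integral_continuous_on_param[of "{0..}" 0 1 "\<lambda>\<tau> s. g (c s, \<tau>) \<bullet> circ_deriv \<rho> s"] gcont
      by (simp add: cbox_interval)
    then show "continuous_on {0..t} f" by (rule continuous_on_subset) auto
    fix \<tau> assume \<tau>: "0 < \<tau>" "\<tau> < t"
    have sub: "{0<..<t} \<times> {0..1} \<subseteq> {0..} \<times> {0..1::real}" by auto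
    have "((\<lambda>\<tau>. integral (cbox 0 1) (\<lambda>s. g (c s, \<tau>) \<bullet> circ_deriv \<rho> s)) has_vector_derivative
        integral (cbox 0 1) (\<lambda>s. Gt (c s, \<tau>) \<bullet> circ_deriv \<rho> s)) (at \<tau> within {0<..<t})"
    proof (rule leibniz_rule_vector_derivative)
      fix \<tau>' and s :: real assume a: "\<tau>' \<in> {0<..<t}" "s \<in> cbox 0 1"
      have y: "(c s, 0) + \<tau>' *\<^sub>R (0, 1) \<in> U" using U_I cO a by simp
      have "((\<lambda>\<tau>. g ((c s, 0) + \<tau> *\<^sub>R (0, 1))) has_vector_derivative Dg ((c s, 0) + \<tau>' *\<^sub>R (0, 1)) (0, 1)) (at \<tau>')"
        by (rule C1_on_line_deriv[OF C1_g y])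
      then have "((\<lambda>\<tau>. g (c s, \<tau>)) has_vector_derivative Gt (c s, \<tau>')) (at \<tau>')" by (simp add: Gt_def)
      then have "((\<lambda>\<tau>. g (c s, \<tau>) \<bullet> circ_deriv \<rho> s) has_vector_derivative Gt (c s, \<tau>') \<bullet> circ_deriv \<rho> s) (at \<tau>')"
        by (rule bounded_linear.has_vector_derivative[OF bounded_linear_inner_left])
      then show "((\<lambda>\<tau>. g (c s, \<tau>) \<bullet> circ_deriv \<rho> s) has_vector_derivative Gt (c s, \<tau>') \<bullet> circ_deriv \<rho> s) (at \<tau>' within {0<..<t})"
        by (rule has_vector_derivative_at_within)
    next
      fix \<tau>' assume a: "\<tau>' \<in> {0<..<t}"
      show "(\<lambda>s. g (c s, \<tau>') \<bullet> circ_deriv \<rho> s) integrable_on cbox 0 1"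
        using cO U_I a unfolding cbox_interval
        by (intro integrable_continuous_interval continuous_intros continuous_on_compose2[OF g_continuous] cc continuous_on_circ_deriv) auto
    next
      show "continuous_on ({0<..<t} \<times> cbox 0 1) (\<lambda>(\<tau>, s). Gt (c s, \<tau>) \<bullet> circ_deriv \<rho> s)"
        using continuous_on_subset[OF Gcont sub] by (simp add: cbox_interval)
    qed (use \<tau> in auto)
    then have fd: "(f has_real_derivative integral {0..1} (\<lambda>s. Gt (c s, \<tau>) \<bullet> circ_deriv \<rho> s)) (at \<tau>)"
      using \<tau> at_within_open[of \<tau> "{0<..<t}"]
      by (simp add: f_def[abs_def] cbox_interval has_real_derivative_iff_has_vector_derivative)
    have "((\<lambda>s. DBern \<tau> (c s) (circ_deriv \<rho> s)) has_integral (Bern \<tau> (c 1) - Bern \<tau> (c 0))) {0..1}"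
    proof (rule fundamental_theorem_of_calculus)
      fix s :: real
      have d: "(Bern \<tau> has_derivative DBern \<tau> (c s)) (at (c s))" using C1_onD[OF C1_Bern[OF \<tau>(1)] cO] .
      have "((\<lambda>s. Bern \<tau> (c s)) has_derivative (\<lambda>h. DBern \<tau> (c s) (h *\<^sub>R circ_deriv \<rho> s))) (at s)"
        using has_derivative_compose[OF circlepath_has_vector_derivative[of \<rho> s, unfolded has_vector_derivative_def c_def[symmetric]] d] .
      then have "((\<lambda>s. Bern \<tau> (c s)) has_vector_derivative DBern \<tau> (c s) (circ_deriv \<rho> s)) (at s)"
        by (simp add: has_vector_derivative_def linear_scale[OF has_derivative_linear[OF d]])
      then show "((\<lambda>s. Bern \<tau> (c s)) has_vector_derivative DBern \<tau> (c s) (circ_deriv \<rho> s)) (at s within {0..1})"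
        by (rule has_vector_derivative_at_within)
    qed simp
    moreover have "c 1 = c 0" unfolding c_def using pathfinish_circlepath[of 0 \<rho>] pathstart_circlepath[of 0 \<rho>] by (simp add: pathfinish_def pathstart_def)
    moreover have "DBern \<tau> (c s) (circ_deriv \<rho> s) = - (Gt (c s, \<tau>) \<bullet> circ_deriv \<rho> s)" for s
    proof -
      have "om (c s, \<tau>) = 0" using n[of \<tau>] \<tau> cO[of s] cn[of s] \<rho>(1) by (simp add: vort_within_def)
      then show ?thesis using DBern_eq[OF cO \<tau>(1)] by simp
    qed
    ultimately have "((\<lambda>s. - (Gt (c s, \<tau>) \<bullet> circ_deriv \<rho> s)) has_integral 0) {0..1}" by simp
    then have "integral {0..1} (\<lambda>s. - (Gt (c s, \<tau>) \<bullet> circ_deriv \<rho> s)) = 0" by (rule integral_unique)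
    then have "integral {0..1} (\<lambda>s. Gt (c s, \<tau>) \<bullet> circ_deriv \<rho> s) = 0" by simp
    then show "(f has_real_derivative 0) (at \<tau>)" using fd by simp
  qed
  then show ?thesis using fa[of t] fa[of 0] t by (simp add: \<alpha>_def harmonic_coeff_def)
qed

text \<open>All estimates come from the expansion of \<open>cnj u\<close> at infinity, with constants taken from one circle
  on which \<open>u\<close> and \<open>u\<^sub>t\<close> are bounded on the compact time interval. \<open>u\<close> and \<open>\<alpha> H\<close> share the coefficient
  of \<open>1 / z\<close>, whence the quadratic decay of the difference. The radial component gains one order
  because the leading coefficient \<open>\<alpha> / (2 \<pi> i)\<close> is imaginary. For the time derivative the decay is
  applied to difference quotients.\<close>
lemma far_field_estimates:
  assumes T0: "T0 > 0"
  obtains \<rho>0 C where "\<rho>0 > RA" "C \<ge> 0" "\<And>t. 0 \<le> t \<Longrightarrow> t \<le> T0 \<Longrightarrow> vort_within \<rho>0 t"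
    "\<And>t x. 0 \<le> t \<Longrightarrow> t \<le> T0 \<Longrightarrow> norm x \<ge> \<rho>0 \<Longrightarrow> norm (u t x) \<le> C / norm x"
    "\<And>t x. 0 \<le> t \<Longrightarrow> t \<le> T0 \<Longrightarrow> norm x \<ge> \<rho>0 \<Longrightarrow> norm (u t x - \<alpha> *\<^sub>R H x) \<le> C / (norm x)\<^sup>2"
    "\<And>t x. 0 \<le> t \<Longrightarrow> t \<le> T0 \<Longrightarrow> norm x \<ge> \<rho>0 \<Longrightarrow> \<bar>x \<bullet> u t x\<bar> \<le> C / norm x"
    "\<And>t x. 0 < t \<Longrightarrow> t < T0 \<Longrightarrow> norm x \<ge> \<rho>0 \<Longrightarrow> norm (Gt (x, t)) \<le> C / norm x"
    "\<And>x. norm x \<ge> \<rho>0 \<Longrightarrow> norm (H x) \<le> C / norm x"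
proof -
  obtain n0 where n0: "\<And>t. 0 \<le> t \<Longrightarrow> t \<le> T0 \<Longrightarrow> vort_within n0 t" using vorticity_support_locally_bounded[of T0] by metis
  define n where "n = max n0 RA"
  define \<rho> where "\<rho> = n + 1"
  have n: "n \<ge> RA" "n \<ge> r0" "n > 0" using RAB by (auto simp: n_def)
  have nn: "vort_within n t" if "0 \<le> t" "t \<le> T0" for t using vort_within_mono[OF n0[OF that], of n] by (simp add: n_def)
  have \<rho>: "\<rho> > n" "\<rho> > RA" "\<rho> > 0" "\<rho> \<ge> r0" using n by (auto simp: \<rho>_def)
  obtain CH where CH: "CH \<ge> 0" "\<And>z. norm z \<ge> RA \<Longrightarrow> norm (cnj (H z)) \<le> CH / norm z"
    "\<And>z. norm z \<ge> RA \<Longrightarrow> norm (cnj (H z) - 1 / (2 * pi * \<i> * z)) \<le> CH / (norm z)\<^sup>2" using H_expansion by metis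
  obtain Mu where Mu: "Mu \<ge> 0" "\<And>x t. \<rho> \<le> norm x \<Longrightarrow> norm x \<le> \<rho> \<Longrightarrow> 0 \<le> t \<Longrightarrow> t \<le> T0 \<Longrightarrow> norm (g (x, t)) \<le> Mu"
    using bounded_on_annulus[OF g_continuous, of \<rho> \<rho> T0] \<rho> by auto
  obtain Mt where Mt: "Mt \<ge> 0" "\<And>x t. \<rho> \<le> norm x \<Longrightarrow> norm x \<le> \<rho> \<Longrightarrow> 0 \<le> t \<Longrightarrow> t \<le> T0 \<Longrightarrow> norm (Gt (x, t)) \<le> Mt"
    using bounded_on_annulus[OF C1_on_continuous[OF C1_G(3)], of \<rho> \<rho> T0] \<rho> by auto
  have Om: "x \<in> \<Omega>" "x \<in> closure \<Omega>" if "norm x \<ge> \<rho>" for x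
    using that \<rho> r0(2)[of x] closure_subset[of \<Omega>] by auto
  have gu: "g (x, t) = u t x" if "norm x \<ge> \<rho>" "t \<ge> 0" for x t using g_eq[OF Om(2)[OF that(1)] that(2)] .
  have lim: "((\<lambda>z. cnj (u t z)) \<longlongrightarrow> 0) at_infinity" if "t \<ge> 0" for t
    using euler that tendsto_cnj[of "u t" 0 at_infinity] unfolding smooth_euler_solution_def by simp
  have bu: "norm (cnj (u t z)) \<le> Mu" if "norm z = \<rho>" "0 \<le> t" "t \<le> T0" for t z
    using Mu(2)[of z t] gu[of z t] that by simp
  have E1: "norm (u t z) \<le> Mu * \<rho> / norm z" if t: "0 \<le> t" "t \<le> T0" and z: "norm z \<ge> \<rho>" for t z
  proof -
    have "norm (cnj (u t z)) \<le> Mu * \<rho> / norm z"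
      by (rule exterior_decay[OF u_holomorphic[OF t(1) nn[OF t] n(2)] n(3) lim[OF t(1)] \<rho>(1) bu[OF _ t] z])
    then show ?thesis by simp
  qed
  have coef: "((\<lambda>z. z * cnj (u t z)) \<longlongrightarrow> \<alpha> / (2 * pi * \<i>)) at_infinity" if t: "0 \<le> t" "t \<le> T0" for t
  proof -
    have "contour_integral (circlepath 0 r) (\<lambda>z. cnj (u t z)) = complex_of_real \<alpha>" if "r > n" for r
      using far_circulation[OF t(1) nn[OF t] that] that n(2) circulation_conserved[OF t(1)] by simp
    from exterior_coefficient[OF u_holomorphic[OF t(1) nn[OF t] n(2)] n(3) lim[OF t(1)] \<rho>(1) bu[OF _ t] this]
    show ?thesis .
  qed
  \<comment> \<open>a bound for \<open>u - \<alpha> H\<close> on the circle of radius \<open>\<rho>\<close>\<close>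
  define M2 where "M2 = Mu + \<bar>\<alpha>\<bar> * (CH / \<rho>)"
  have E2: "norm (u t z - \<alpha> *\<^sub>R H z) \<le> M2 * \<rho>\<^sup>2 / (norm z)\<^sup>2" if t: "0 \<le> t" "t \<le> T0" and z: "norm z \<ge> \<rho>" for t z
  proof -
    let ?F = "\<lambda>z. cnj (u t z) - of_real \<alpha> * cnj (H z)"
    have hol: "?F holomorphic_on {z. norm z > n}"
      using n(2) r0(2) by (intro holomorphic_intros u_holomorphic t nn holomorphic_on_subset[OF cnj_H_holomorphic]) auto
    have "((\<lambda>z. z * cnj (u t z) - of_real \<alpha> * (z * cnj (H z))) \<longlongrightarrow> \<alpha> / (2 * pi * \<i>) - of_real \<alpha> * (1 / (2 * pi * \<i>))) at_infinity"
      by (intro tendsto_intros coef t H_limit)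
    then have l: "((\<lambda>z. z * ?F z) \<longlongrightarrow> 0) at_infinity" by (simp add: algebra_simps)
    have b: "norm (?F z) \<le> M2" if "norm z = \<rho>" for z
    proof -
      have "norm (of_real \<alpha> * cnj (H z)) \<le> \<bar>\<alpha>\<bar> * (CH / \<rho>)"
        unfolding norm_mult norm_of_real by (rule mult_left_mono) (use CH(2)[of z] that \<rho> in auto)
      then show ?thesis using norm_triangle_ineq4[of "cnj (u t z)" "of_real \<alpha> * cnj (H z)"] bu[OF that t] by (simp add: M2_def)
    qed
    have "norm (?F z) \<le> M2 * \<rho>\<^sup>2 / (norm z)\<^sup>2"
      by (rule exterior_quadratic_decay[OF hol n(3) l \<rho>(1) b z])
    moreover have "?F z = cnj (u t z - \<alpha> *\<^sub>R H z)" by (simp add: scaleR_conv_of_real)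
    ultimately show ?thesis by (simp only: complex_mod_cnj)
  qed
  have E3: "\<bar>z \<bullet> u t z\<bar> \<le> (M2 * \<rho>\<^sup>2 + \<bar>\<alpha>\<bar> * CH) / norm z" if t: "0 \<le> t" "t \<le> T0" and z: "norm z \<ge> \<rho>" for t z
  proof -
    have z0: "z \<noteq> 0" "norm z > 0" using z \<rho> by auto
    have "\<bar>z \<bullet> (u t z - \<alpha> *\<^sub>R H z)\<bar> \<le> norm z * (M2 * \<rho>\<^sup>2 / (norm z)\<^sup>2)"
      by (intro order_trans[OF Cauchy_Schwarz_ineq2] mult_left_mono E2 t z) auto
    then have 1: "\<bar>z \<bullet> (u t z - \<alpha> *\<^sub>R H z)\<bar> \<le> M2 * \<rho>\<^sup>2 / norm z" using z0 by (simp add: power2_eq_square)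
    have "z \<bullet> H z = Re (z * cnj (H z))" by (simp add: inner_complex_def)
    also have "\<dots> = Re (z * (cnj (H z) - 1 / (2 * pi * \<i> * z)))"
    proof -
      have "z * (1 / (2 * pi * \<i> * z)) = 1 / (2 * pi * \<i>)" using z0 by simp
      moreover have "Re (1 / (2 * pi * \<i>)) = 0" by (simp add: Re_divide)
      ultimately show ?thesis by (simp only: right_diff_distrib minus_complex.sel)
    qed
    also have "\<bar>\<dots>\<bar> \<le> norm z * (CH / (norm z)\<^sup>2)"
    proof (rule order_trans[OF abs_Re_le_cmod])
      show "norm (z * (cnj (H z) - 1 / (2 * pi * \<i> * z))) \<le> norm z * (CH / (norm z)\<^sup>2)"
        unfolding norm_mult by (rule mult_left_mono[OF CH(3)]) (use z \<rho> in auto)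
    qed
    finally have "\<bar>z \<bullet> H z\<bar> \<le> CH / norm z" using z0 by (simp add: power2_eq_square)
    then have "\<bar>\<alpha>\<bar> * \<bar>z \<bullet> H z\<bar> \<le> \<bar>\<alpha>\<bar> * (CH / norm z)" by (intro mult_left_mono) auto
    moreover have "z \<bullet> u t z = z \<bullet> (u t z - \<alpha> *\<^sub>R H z) + \<alpha> * (z \<bullet> H z)" by (simp add: inner_diff_right)
    ultimately show ?thesis using 1 abs_triangle_ineq[of "z \<bullet> (u t z - \<alpha> *\<^sub>R H z)" "\<alpha> * (z \<bullet> H z)"]
      by (simp add: abs_mult add_divide_distrib)
  qed
  have E4: "norm (Gt (z, t)) \<le> Mt * \<rho> / norm z" if t: "0 < t" "t < T0" and z: "norm z \<ge> \<rho>" for t z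
  proof -
    have inc: "norm (u (t + h) w - u t w) \<le> Mt * h" if h: "0 < h" "h < T0 - t" and w: "norm w = \<rho>" for h w
    proof -
      have "norm (u (t + h) w - u t w) \<le> Mt * norm (t + h - t)"
      proof (rule differentiable_bound[of "{t..t + h}" "\<lambda>\<tau>. u \<tau> w" "\<lambda>\<tau> k. k *\<^sub>R Gt (w, \<tau>)"])
        fix \<tau> assume \<tau>: "\<tau> \<in> {t..t + h}"
        have "((\<lambda>\<tau>. u \<tau> w) has_vector_derivative Gt (w, \<tau>)) (at \<tau>)"
          using time_derivative[of w \<tau>] Om(2)[of w] w \<tau> t by simp
        then show "((\<lambda>\<tau>. u \<tau> w) has_derivative (\<lambda>k. k *\<^sub>R Gt (w, \<tau>))) (at \<tau> within {t..t + h})"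
          by (simp add: has_vector_derivative_def has_derivative_at_withinI)
        show "onorm (\<lambda>k. k *\<^sub>R Gt (w, \<tau>)) \<le> Mt"
          using Mt(2)[of w \<tau>] w \<tau> t h by (simp add: onorm_scaleR_left onorm_id bounded_linear_ident)
      qed (use h in auto)
      then show ?thesis using h by simp
    qed
    have q: "norm ((1 / h) *\<^sub>R (u (t + h) z - u t z)) \<le> Mt * \<rho> / norm z" if h: "0 < h" "h < T0 - t" for h
    proof -
      let ?F = "\<lambda>z. cnj (u (t + h) z) - cnj (u t z)"
      have th: "0 \<le> t" "t \<le> T0" "0 \<le> t + h" "t + h \<le> T0" using t h by auto
      have hol: "?F holomorphic_on {z. norm z > n}"
        by (intro holomorphic_intros u_holomorphic nn n th)
      have l: "(?F \<longlongrightarrow> 0) at_infinity" using tendsto_diff[OF lim[OF th(3)] lim[OF th(1)]] by simp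
      have b: "norm (?F w) \<le> Mt * h" if "norm w = \<rho>" for w
      proof -
        have "?F w = cnj (u (t + h) w - u t w)" by simp
        then show ?thesis using inc[OF h that] by (simp only: complex_mod_cnj)
      qed
      have "norm (?F z) \<le> (Mt * h) * \<rho> / norm z"
        by (rule exterior_decay[OF hol n(3) l \<rho>(1) b z])
      moreover have "?F z = cnj (u (t + h) z - u t z)" by simp
      ultimately have "norm (u (t + h) z - u t z) \<le> (Mt * h) * \<rho> / norm z" by (simp only: complex_mod_cnj)
      then have "(1 / h) * norm (u (t + h) z - u t z) \<le> (1 / h) * ((Mt * h) * \<rho> / norm z)"
        using h by (intro mult_left_mono) auto
      also have "\<dots> = Mt * \<rho> / norm z" using h by simp
      finally show ?thesis using h by (simp only: norm_scaleR real_norm_def) simp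
    qed
    define h where "h k = (T0 - t) / real (k + 2)" for k
    have h: "0 < h k" "h k < T0 - t" for k using t by (auto simp: h_def divide_less_eq)
    have h0: "h \<longlonglongrightarrow> 0" unfolding h_def by real_asymp
    have "((\<lambda>\<tau>. u \<tau> z) has_vector_derivative Gt (z, t)) (at t)" using time_derivative[OF Om(2)[OF z] t(1)] .
    then have "((\<lambda>k. norm (u (t + k) z - u t z - k *\<^sub>R Gt (z, t)) / norm k) \<longlongrightarrow> 0) (at 0)"
      unfolding has_vector_derivative_def has_derivative_at by simp
    moreover have "filterlim h (at 0) sequentially"
      using h0 h(1) by (simp add: filterlim_at) (metis (mono_tags) eventuallyI less_irrefl)
    ultimately have "(\<lambda>k. norm (u (t + h k) z - u t z - h k *\<^sub>R Gt (z, t)) / norm (h k)) \<longlonglongrightarrow> 0"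
      by (rule filterlim_compose)
    moreover have "norm (u (t + h k) z - u t z - h k *\<^sub>R Gt (z, t)) / norm (h k) \<ge> norm (Gt (z, t)) - Mt * \<rho> / norm z" for k
    proof -
      have "(1 / h k) *\<^sub>R (u (t + h k) z - u t z - h k *\<^sub>R Gt (z, t)) = (1 / h k) *\<^sub>R (u (t + h k) z - u t z) - Gt (z, t)"
        using h(1)[of k] by (simp add: scaleR_right_diff_distrib)
      then have "norm (u (t + h k) z - u t z - h k *\<^sub>R Gt (z, t)) / norm (h k) = norm ((1 / h k) *\<^sub>R (u (t + h k) z - u t z) - Gt (z, t))"
        by (metis norm_scaleR norm_divide norm_one divide_inverse mult.commute mult.left_neutral norm_inverse real_norm_def)
      then show ?thesis using q[OF h(1,2), of k] norm_triangle_ineq3[of "(1 / h k) *\<^sub>R (u (t + h k) z - u t z)" "Gt (z, t)"] by linarith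
    qed
    ultimately have "norm (Gt (z, t)) - Mt * \<rho> / norm z \<le> 0"
      by (intro tendsto_lowerbound) (auto intro!: always_eventually)
    then show ?thesis by simp
  qed
  define C where "C = max (Mu * \<rho>) (max (M2 * \<rho>\<^sup>2 + \<bar>\<alpha>\<bar> * CH) (max (Mt * \<rho>) CH))"
  have le: "Mu * \<rho> \<le> C" "M2 * \<rho>\<^sup>2 + \<bar>\<alpha>\<bar> * CH \<le> C" "Mt * \<rho> \<le> C" "CH \<le> C" by (auto simp: C_def)
  have le2: "M2 * \<rho>\<^sup>2 \<le> C"
  proof -
    have "0 \<le> \<bar>\<alpha>\<bar> * CH" using CH by simp
    then show ?thesis using le(2) by linarith
  qed
  show ?thesis
  proof (rule that[of \<rho> C])
    show "C \<ge> 0" using CH(1) le(4) by simp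
    show "vort_within \<rho> t" if "0 \<le> t" "t \<le> T0" for t using vort_within_mono[OF nn[OF that]] \<rho>(1) by simp
    fix x :: complex assume x: "norm x \<ge> \<rho>"
    show "norm (H x) \<le> C / norm x"
      using CH(2)[of x] x \<rho> divide_right_mono[OF le(4) norm_ge_zero[of x]] by simp
    fix t
    show "norm (u t x) \<le> C / norm x" if t: "0 \<le> t" "t \<le> T0"
      using order_trans[OF E1[OF t x] divide_right_mono[OF le(1) norm_ge_zero]] .
    show "norm (u t x - \<alpha> *\<^sub>R H x) \<le> C / (norm x)\<^sup>2" if t: "0 \<le> t" "t \<le> T0"
      using order_trans[OF E2[OF t x] divide_right_mono[OF le2 zero_le_power2]] .
    show "\<bar>x \<bullet> u t x\<bar> \<le> C / norm x" if t: "0 \<le> t" "t \<le> T0"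
      using order_trans[OF E3[OF t x] divide_right_mono[OF le(2) norm_ge_zero]] .
    show "norm (Gt (x, t)) \<le> C / norm x" if t: "0 < t" "t < T0"
      using order_trans[OF E4[OF t x] divide_right_mono[OF le(3) norm_ge_zero]] .
  qed (use \<rho> in auto)
qed

end

section \<open>Conservation of the energy\<close>

text \<open>Differentiation under the integral sign, by the mean value inequality and dominated convergence.\<close>
lemma has_real_derivative_integral:
  fixes f :: "real \<Rightarrow> 'a \<Rightarrow> real"
  assumes t: "t \<in> {a<..<b}"
    and d: "\<And>\<tau> x. \<tau> \<in> {a<..<b} \<Longrightarrow> x \<in> space M \<Longrightarrow> ((\<lambda>\<tau>. f \<tau> x) has_real_derivative f' \<tau> x) (at \<tau>)"
    and w: "\<And>\<tau> x. \<tau> \<in> {a<..<b} \<Longrightarrow> x \<in> space M \<Longrightarrow> \<bar>f' \<tau> x\<bar> \<le> w x" "integrable M w"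
    and i: "\<And>\<tau>. \<tau> \<in> {a<..<b} \<Longrightarrow> integrable M (f \<tau>)"
  shows "((\<lambda>\<tau>. LINT x|M. f \<tau> x) has_real_derivative (LINT x|M. f' t x)) (at t)"
  unfolding DERIV_def tendsto_at_iff_sequentially
proof (intro allI impI)
  fix X :: "nat \<Rightarrow> real" assume X: "\<forall>i. X i \<in> UNIV - {0}" "X \<longlonglongrightarrow> 0"
  have tX: "(\<lambda>i. t + X i) \<longlonglongrightarrow> t + 0" by (intro tendsto_intros X)
  then have "\<forall>\<^sub>F i in sequentially. t + X i \<in> {a<..<b}"
    using t by (intro topological_tendstoD) auto
  then obtain N where N: "\<And>i. i \<ge> N \<Longrightarrow> t + X i \<in> {a<..<b}" unfolding eventually_sequentially by blast
  define s where "s i x = (f (t + X (i + N)) x - f t x) / X (i + N)" for i x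
  have sm: "s i \<in> borel_measurable M" for i
    unfolding s_def using i[OF N[of "i + N"]] i[OF t] by (intro borel_measurable_divide borel_measurable_diff) auto
  have lim: "(\<lambda>i. s i x) \<longlonglongrightarrow> f' t x" if x: "x \<in> space M" for x
  proof -
    have "((\<lambda>h. (f (t + h) x - f t x) / h) \<longlongrightarrow> f' t x) (at 0)" using d[OF t x] by (simp add: DERIV_def)
    moreover have "filterlim X (at 0) sequentially" using X by (simp add: filterlim_at)
    ultimately have "(\<lambda>i. (f (t + X i) x - f t x) / X i) \<longlonglongrightarrow> f' t x" by (rule filterlim_compose)
    then show ?thesis unfolding s_def by (rule LIMSEQ_ignore_initial_segment)
  qed
  have f'm: "f' t \<in> borel_measurable M" by (rule borel_measurable_LIMSEQ_metric[OF sm lim])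
  have sb: "\<bar>s i x\<bar> \<le> w x" if x: "x \<in> space M" for i x
  proof -
    let ?y = "t + X (i + N)"
    have y: "?y \<in> {a<..<b}" using N by simp
    have "norm (f ?y x - f t x) \<le> w x * norm (?y - t)"
    proof (rule differentiable_bound[of "{a<..<b}" "\<lambda>\<tau>. f \<tau> x" "\<lambda>\<tau> h. f' \<tau> x * h"])
      fix \<tau> assume \<tau>: "\<tau> \<in> {a<..<b}"
      show "((\<lambda>\<tau>. f \<tau> x) has_derivative (\<lambda>h. f' \<tau> x * h)) (at \<tau> within {a<..<b})"
        using d[OF \<tau> x] by (simp add: has_field_derivative_def has_derivative_at_withinI)
      show "onorm (\<lambda>h. f' \<tau> x * h) \<le> w x"
        by (rule onorm_le) (use w(1)[OF \<tau> x] in \<open>auto simp: abs_mult intro!: mult_right_mono\<close>)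
    qed (use y t in auto)
    then show ?thesis using X(1) by (simp add: s_def divide_le_eq)
  qed
  have "(\<lambda>i. LINT x|M. s i x) \<longlonglongrightarrow> (LINT x|M. f' t x)"
    by (rule integral_dominated_convergence[OF f'm sm w(2)]) (use lim sb in auto)
  moreover have "(LINT x|M. s i x) = ((\<lambda>h. ((LINT x|M. f (t + h) x) - (LINT x|M. f t x)) / h) \<circ> X) (i + N)" for i
    unfolding s_def using i[OF N[of "i + N"]] i[OF t] by simp
  ultimately have "(\<lambda>i. ((\<lambda>h. ((LINT x|M. f (t + h) x) - (LINT x|M. f t x)) / h) \<circ> X) (i + N)) \<longlonglongrightarrow> (LINT x|M. f' t x)"
    by (simp only:)
  then show "((\<lambda>h. ((LINT x|M. f (t + h) x) - (LINT x|M. f t x)) / h) \<circ> X) \<longlonglongrightarrow> (LINT x|M. f' t x)"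
    by (rule LIMSEQ_offset)
qed

context euler_exterior begin

lemma gamma_in_Gamma: "\<gamma> s \<in> \<Gamma>"
proof -
  have n: "\<gamma> (s + real n) = \<gamma> s" for s n
    by (induction n) (use periodic in \<open>auto simp: add.assoc[symmetric] add.commute[of 1]\<close>)
  have "\<gamma> (frac s) = \<gamma> s"
  proof (cases "\<lfloor>s\<rfloor> \<ge> 0")
    case True
    then show ?thesis using n[of "frac s" "nat \<lfloor>s\<rfloor>"] by (simp add: frac_def)
  next
    case False
    then show ?thesis using n[of s "nat (- \<lfloor>s\<rfloor>)"] by (simp add: frac_def)
  qed
  moreover have "frac s \<in> {0..1}" using frac_ge_0[of s] frac_lt_1[of s] by simp
  ultimately show ?thesis by (metis imageI)
qed

abbreviation "dens t x \<equiv> energy_density \<gamma> T u t x"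

lemma dens_eq: "dens t x = u t x \<bullet> u t x - \<alpha>\<^sup>2 * (H x \<bullet> H x)"
  unfolding energy_density_def Let_def \<alpha>_def[symmetric] power2_norm_eq_inner
  by (simp add: inner_diff_left inner_diff_right inner_commute[of "u t x" "H x"] power2_eq_square algebra_simps)

lemma dens_continuous: "t \<ge> 0 \<Longrightarrow> continuous_on \<Omega> (dens t)"
  unfolding dens_eq[abs_def] by (intro continuous_intros H_continuous C1_on_continuous[OF C1_u])

lemma bounded_near:
  fixes f :: "complex \<times> real \<Rightarrow> 'b::real_normed_vector"
  assumes "continuous_on U f"
  obtains M where "M \<ge> 0" "\<And>x t. x \<in> \<Omega> \<Longrightarrow> norm x \<le> b \<Longrightarrow> 0 \<le> t \<Longrightarrow> t \<le> T0 \<Longrightarrow> norm (f (x, t)) \<le> M"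
proof -
  define Q where "Q = closure \<Omega> \<inter> cball 0 b"
  have "compact (Q \<times> {0..T0})" unfolding Q_def by (intro compact_Times closed_Int_compact) auto
  moreover have "Q \<times> {0..T0} \<subseteq> U" using U_sup by (force simp: Q_def)
  ultimately have "bounded (f ` (Q \<times> {0..T0}))"
    by (intro compact_imp_bounded compact_continuous_image continuous_on_subset[OF assms])
  then obtain M where M: "\<forall>y\<in>f ` (Q \<times> {0..T0}). norm y \<le> M" unfolding bounded_iff by blast
  have "norm (f (x, t)) \<le> max M 0" if "x \<in> \<Omega>" "norm x \<le> b" "0 \<le> t" "t \<le> T0" for x t
  proof -
    have "x \<in> closure \<Omega>" using that closure_subset[of \<Omega>] by blast
    then have "norm (f (x, t)) \<le> M" using M that by (auto simp: Q_def)
    then show ?thesis by simp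
  qed
  then show ?thesis by (intro that[of "max M 0"]) auto
qed

lemma g_eq_Omega: "x \<in> \<Omega> \<Longrightarrow> t \<ge> 0 \<Longrightarrow> g (x, t) = u t x"
  using g_eq[of x t] closure_subset[of \<Omega>] by auto

text \<open>Near the curve the density is bounded; far out \<open>|v|\<^sup>2 + 2 |\<alpha>| |H| |v| = O(1/|x|\<^sup>3)\<close>, which is
  integrable in the plane.\<close>
lemma dens_dominated:
  assumes "T0 > 0"
  obtains w where "integrable lborel w" "\<And>t x. 0 \<le> t \<Longrightarrow> t \<le> T0 \<Longrightarrow> x \<in> \<Omega> \<Longrightarrow> \<bar>dens t x\<bar> \<le> w x" "\<And>x. w x \<ge> 0"
proof -
  obtain \<rho>0 C where \<rho>0: "\<rho>0 > RA" and C0: "C \<ge> 0" and vw: "\<And>t. 0 \<le> t \<Longrightarrow> t \<le> T0 \<Longrightarrow> vort_within \<rho>0 t"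
    and "\<And>t x. 0 \<le> t \<Longrightarrow> t \<le> T0 \<Longrightarrow> norm x \<ge> \<rho>0 \<Longrightarrow> norm (u t x) \<le> C / norm x"
    and CH: "\<And>t x. 0 \<le> t \<Longrightarrow> t \<le> T0 \<Longrightarrow> norm x \<ge> \<rho>0 \<Longrightarrow> norm (u t x - \<alpha> *\<^sub>R H x) \<le> C / (norm x)\<^sup>2"
    and Cx: "\<And>t x. 0 \<le> t \<Longrightarrow> t \<le> T0 \<Longrightarrow> norm x \<ge> \<rho>0 \<Longrightarrow> \<bar>x \<bullet> u t x\<bar> \<le> C / norm x"
    and Ct: "\<And>t x. 0 < t \<Longrightarrow> t < T0 \<Longrightarrow> norm x \<ge> \<rho>0 \<Longrightarrow> norm (Gt (x, t)) \<le> C / norm x"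
    and HH: "\<And>x. norm x \<ge> \<rho>0 \<Longrightarrow> norm (H x) \<le> C / norm x"
    by (fact far_field_estimates[OF assms])
  note C = C0 CH HH
  obtain M where M: "M \<ge> 0" "\<And>x t. x \<in> \<Omega> \<Longrightarrow> norm x \<le> \<rho>0 \<Longrightarrow> 0 \<le> t \<Longrightarrow> t \<le> T0 \<Longrightarrow> norm (g (x, t)) \<le> M"
    by (fact bounded_near[OF g_continuous, of \<rho>0 T0])
  obtain B where B: "B \<ge> 0" "\<And>x. x \<in> \<Omega> \<Longrightarrow> norm (H x) \<le> B" using H_bounded by metis
  have r1: "\<rho>0 > 1" using \<rho>0 r0(1) by (simp add: RA_def)
  define w where "w x = (M\<^sup>2 + \<alpha>\<^sup>2 * B\<^sup>2) * indicator (cball 0 \<rho>0) x +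
    (C\<^sup>2 + 2 * \<bar>\<alpha>\<bar> * C\<^sup>2) * (indicator {x. 1 \<le> cmod x} x / cmod x ^ 3)" for x :: complex
  have c0: "M\<^sup>2 + \<alpha>\<^sup>2 * B\<^sup>2 \<ge> 0" "C\<^sup>2 + 2 * \<bar>\<alpha>\<bar> * C\<^sup>2 \<ge> 0" by auto
  show ?thesis
  proof (rule that[of w])
    show "integrable lborel w"
      unfolding w_def[abs_def]
      by (intro Bochner_Integration.integrable_add integrable_mult_right integrable_inverse_cube integrable_real_indicator)
         (auto intro!: emeasure_bounded_finite[unfolded infinity_ennreal_def])
    show "w x \<ge> 0" for x unfolding w_def using c0 by (intro add_nonneg_nonneg mult_nonneg_nonneg) auto
    fix t x assume t: "0 \<le> t" "t \<le> T0" and x: "x \<in> \<Omega>"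
    show "\<bar>dens t x\<bar> \<le> w x"
    proof (cases "norm x \<le> \<rho>0")
      case True
      have "\<bar>dens t x\<bar> \<le> \<bar>u t x \<bullet> u t x\<bar> + \<bar>\<alpha>\<^sup>2 * (H x \<bullet> H x)\<bar>" unfolding dens_eq by (rule abs_triangle_ineq4)
      also have "\<dots> = (norm (u t x))\<^sup>2 + \<alpha>\<^sup>2 * (norm (H x))\<^sup>2" by (simp add: power2_norm_eq_inner)
      also have "\<dots> \<le> M\<^sup>2 + \<alpha>\<^sup>2 * B\<^sup>2"
        using M(2)[OF x True t] B(2)[OF x] g_eq_Omega[OF x t(1)] by (intro add_mono mult_left_mono power_mono) auto
      also have "\<dots> \<le> w x" unfolding w_def using True c0 by simp
      finally show ?thesis .
    next
      case False
      then have n: "norm x \<ge> \<rho>0" "norm x \<ge> 1" "norm x > 0" using r1 by linarith+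
      let ?v = "u t x - \<alpha> *\<^sub>R H x"
      have "\<bar>dens t x\<bar> \<le> (norm ?v)\<^sup>2 + 2 * \<bar>\<alpha>\<bar> * (norm (H x) * norm ?v)"
      proof -
        have "\<bar>dens t x\<bar> = \<bar>(norm ?v)\<^sup>2 + 2 * \<alpha> * (H x \<bullet> ?v)\<bar>" by (simp add: energy_density_def Let_def \<alpha>_def)
        also have "\<dots> \<le> (norm ?v)\<^sup>2 + 2 * \<bar>\<alpha>\<bar> * \<bar>H x \<bullet> ?v\<bar>"
          by (rule order_trans[OF abs_triangle_ineq]) (simp add: abs_mult)
        also have "\<dots> \<le> (norm ?v)\<^sup>2 + 2 * \<bar>\<alpha>\<bar> * (norm (H x) * norm ?v)"
          by (intro add_left_mono mult_left_mono Cauchy_Schwarz_ineq2) auto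
        finally show ?thesis .
      qed
      also have "\<dots> \<le> (C / (norm x)\<^sup>2)\<^sup>2 + 2 * \<bar>\<alpha>\<bar> * (C / norm x * (C / (norm x)\<^sup>2))"
        by (intro add_mono mult_left_mono mult_mono power_mono C t n) (use C(1) in auto)
      also have "\<dots> = C\<^sup>2 / norm x ^ 4 + 2 * \<bar>\<alpha>\<bar> * C\<^sup>2 / norm x ^ 3"
        by (simp add: power_divide power2_eq_square power3_eq_cube power4_eq_xxxx mult.assoc)
      also have "C\<^sup>2 / norm x ^ 4 \<le> C\<^sup>2 / norm x ^ 3"
        using n by (intro divide_left_mono power_increasing mult_pos_pos zero_less_power) auto
      finally have "\<bar>dens t x\<bar> \<le> C\<^sup>2 / norm x ^ 3 + 2 * \<bar>\<alpha>\<bar> * C\<^sup>2 / norm x ^ 3" by simp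
      also have "\<dots> = w x" using False n(2) by (simp add: w_def add_divide_distrib[symmetric] algebra_simps)
      finally show ?thesis .
    qed
  qed
qed

lemma dens_measurable: "t \<ge> 0 \<Longrightarrow> (\<lambda>x. indicator \<Omega> x *\<^sub>R dens t x) \<in> borel_measurable borel"
  using open_Omega by (intro borel_measurable_continuous_on_indicator dens_continuous) auto

lemma dens_integrable:
  assumes t: "t \<ge> 0"
  shows "integrable lborel (\<lambda>x. indicator \<Omega> x *\<^sub>R dens t x)"
proof -
  obtain w where w: "integrable lborel w" "\<And>s x. 0 \<le> s \<Longrightarrow> s \<le> t + 1 \<Longrightarrow> x \<in> \<Omega> \<Longrightarrow> \<bar>dens s x\<bar> \<le> w x" "\<And>x. w x \<ge> 0"
    using dens_dominated[of "t + 1"] t by (metis add_nonneg_pos zero_less_one)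
  show ?thesis
  proof (rule Bochner_Integration.integrable_bound[OF w(1)])
    show "AE x in lborel. norm (indicator \<Omega> x *\<^sub>R dens t x) \<le> norm (w x)"
      using w(2)[of t] w(3) t by (intro AE_I2) (auto simp: indicator_def)
  qed (use dens_measurable[OF t] in simp)
qed

definition "E_loc \<rho> t = (LINT x|lborel. indicator \<Omega> x * (bump 0 \<rho> x * dens t x))"

lemma bump_continuous: "continuous_on S (bump a r)"
  using C1_on_continuous[OF C1_on_bump] .

lemma E_loc_integrable:
  assumes t: "t \<ge> 0"
  shows "integrable lborel (\<lambda>x. indicator \<Omega> x * (bump 0 \<rho> x * dens t x))"
proof (rule Bochner_Integration.integrable_bound[OF dens_integrable[OF t]])
  have "(\<lambda>x. indicator \<Omega> x *\<^sub>R (bump 0 \<rho> x * dens t x)) \<in> borel_measurable borel"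
    using open_Omega t by (intro borel_measurable_continuous_on_indicator continuous_on_mult bump_continuous dens_continuous) auto
  then show "(\<lambda>x. indicator \<Omega> x * (bump 0 \<rho> x * dens t x)) \<in> borel_measurable lborel" by simp
  show "AE x in lborel. norm (indicator \<Omega> x * (bump 0 \<rho> x * dens t x)) \<le> norm (indicator \<Omega> x *\<^sub>R dens t x)"
  proof (rule AE_I2)
    fix x
    have "bump 0 \<rho> x * \<bar>dens t x\<bar> \<le> 1 * \<bar>dens t x\<bar>" using bump_bounds[of 0 \<rho> x] by (intro mult_right_mono) auto
    then show "norm (indicator \<Omega> x * (bump 0 \<rho> x * dens t x)) \<le> norm (indicator \<Omega> x *\<^sub>R dens t x)"
      using bump_bounds[of 0 \<rho> x] by (simp add: abs_mult indicator_def)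
  qed
qed

lemma E_loc_limit:
  assumes t: "t \<ge> 0"
  shows "(\<lambda>n. E_loc (real (Suc n)) t) \<longlonglongrightarrow> generalized_energy \<gamma> T u t"
  unfolding E_loc_def generalized_energy_def set_lebesgue_integral_def
proof (rule integral_dominated_convergence[where w="\<lambda>x. norm (indicator \<Omega> x *\<^sub>R dens t x)"])
  show "integrable lborel (\<lambda>x. norm (indicator \<Omega> x *\<^sub>R dens t x))" by (intro integrable_norm dens_integrable t)
  show "(\<lambda>x. indicator \<Omega> x *\<^sub>R dens t x) \<in> borel_measurable lborel" using dens_measurable[OF t] by simp
  fix n
  show "(\<lambda>x. indicator \<Omega> x * (bump 0 (real (Suc n)) x * dens t x)) \<in> borel_measurable lborel"
    using E_loc_integrable[OF t] by (rule borel_measurable_integrable)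
  show "AE x in lborel. norm (indicator \<Omega> x * (bump 0 (real (Suc n)) x * dens t x)) \<le> norm (indicator \<Omega> x *\<^sub>R dens t x)"
  proof (rule AE_I2)
    fix x
    have "bump 0 (real (Suc n)) x * \<bar>dens t x\<bar> \<le> 1 * \<bar>dens t x\<bar>" using bump_bounds by (intro mult_right_mono) auto
    then show "norm (indicator \<Omega> x * (bump 0 (real (Suc n)) x * dens t x)) \<le> norm (indicator \<Omega> x *\<^sub>R dens t x)"
      using bump_bounds[of 0 "real (Suc n)" x] by (simp add: abs_mult indicator_def)
  qed
next
  show "AE x in lborel. (\<lambda>n. indicator \<Omega> x * (bump 0 (real (Suc n)) x * dens t x)) \<longlonglongrightarrow> indicator \<Omega> x *\<^sub>R dens t x"
  proof (rule AE_I2)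
    fix x :: complex
    obtain N where N: "norm x \<le> real N" using real_arch_simple by blast
    have "indicator \<Omega> x * (bump 0 (real (Suc n)) x * dens t x) = indicator \<Omega> x *\<^sub>R dens t x" if "n \<ge> N" for n
      using bump_eq1[of "real (Suc n)" x 0] N that by simp
    then show "(\<lambda>n. indicator \<Omega> x * (bump 0 (real (Suc n)) x * dens t x)) \<longlonglongrightarrow> indicator \<Omega> x *\<^sub>R dens t x"
      by (intro tendsto_eventually) (auto simp: eventually_sequentially)
  qed
qed

text \<open>Join \<open>\<rho>\<close> to \<open>x\<close> by the exponential of a segment. In logarithmic coordinates the bound \<open>C / |x|\<close> on
  the gradient becomes the constant \<open>C\<close>, and the segment has length at most \<open>ln 2 + \<pi> < 5\<close>; it stays
  outside the disc of radius \<open>\<rho>\<close> because the modulus increases along it.\<close>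
lemma Bern_oscillation:
  assumes t: "t > 0" and \<rho>: "\<rho> > 0" "\<rho> \<ge> RA" and n: "vort_within n t" "n < \<rho>"
    and C: "\<And>x. norm x \<ge> \<rho> \<Longrightarrow> norm (Gt (x, t)) \<le> C / norm x"
    and x: "\<rho> \<le> norm x" "norm x \<le> 2 * \<rho>"
  shows "\<bar>Bern t x - Bern t (of_real \<rho>)\<bar> \<le> 5 * C"
proof -
  have x0: "x \<noteq> 0" using x \<rho> by auto
  define L where "L = Ln x - of_real (ln \<rho>)"
  define \<sigma> where "\<sigma> s = exp (of_real (ln \<rho>) + of_real s * L)" for s :: real
  have ReL: "Re L = ln (norm x) - ln \<rho>" using x0 by (simp add: L_def)
  have ReL0: "0 \<le> Re L" "Re L \<le> 1"
  proof -
    have "ln \<rho> \<le> ln (norm x)" using x x0 \<rho> by (subst ln_le_cancel_iff) auto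
    then show "0 \<le> Re L" using ReL by simp
    have "ln (norm x) \<le> ln (2 * \<rho>)" using x x0 \<rho> by (subst ln_le_cancel_iff) auto
    also have "\<dots> = ln 2 + ln \<rho>" using \<rho> by (simp add: ln_mult)
    also have "ln 2 \<le> (1::real)" using ln_2_less_1 by simp
    finally show "Re L \<le> 1" using ReL by simp
  qed
  have nL: "norm L \<le> 5"
  proof -
    have "\<bar>Im L\<bar> \<le> pi" using x0 Im_Ln_le_pi[of x] mpi_less_Im_Ln[of x] by (simp add: L_def)
    then show ?thesis using cmod_le[of L] ReL0 pi_less_4 by linarith
  qed
  have n\<sigma>: "norm (\<sigma> s) \<ge> \<rho>" if "0 \<le> s" for s
  proof -
    have "norm (\<sigma> s) = exp (ln \<rho> + s * Re L)" by (simp add: \<sigma>_def norm_exp_eq_Re)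
    also have "\<dots> \<ge> exp (ln \<rho>)" using that ReL0 by simp
    finally show ?thesis using \<rho> by simp
  qed
  have \<sigma>O: "\<sigma> s \<in> \<Omega>" if "0 \<le> s" for s using n\<sigma>[OF that] \<rho> RAB r0(2) by simp
  have e: "\<sigma> 1 = x" "\<sigma> 0 = of_real \<rho>"
    using x0 \<rho> by (simp_all add: \<sigma>_def L_def exp_of_real)
  have "norm (Bern t (\<sigma> 1) - Bern t (\<sigma> 0)) \<le> (5 * C) * norm (1 - 0 :: real)"
  proof (rule differentiable_bound[of "{0..1::real}" "\<lambda>s. Bern t (\<sigma> s)" "\<lambda>s h. h *\<^sub>R DBern t (\<sigma> s) (\<sigma> s * L)"])
    fix s :: real assume s: "s \<in> {0..1}"
    then have s0: "0 \<le> s" by simp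
    have \<sigma>d: "(\<sigma> has_derivative (\<lambda>h. h *\<^sub>R (\<sigma> s * L))) (at s)"
    proof -
      have "(\<sigma> has_vector_derivative (\<sigma> s * L)) (at s)"
      proof -
        have "((\<lambda>z. exp (of_real (ln \<rho>) + z * L)) has_field_derivative \<sigma> s * L) (at (of_real s))"
          unfolding \<sigma>_def by (auto intro!: derivative_eq_intros)
        from has_vector_derivative_real_field[OF this] show ?thesis by (simp add: \<sigma>_def[abs_def])
      qed
      then show ?thesis by (simp add: has_vector_derivative_def)
    qed
    have d: "(Bern t has_derivative DBern t (\<sigma> s)) (at (\<sigma> s))" using C1_onD[OF C1_Bern[OF t] \<sigma>O[OF s0]] .
    have "((\<lambda>s. Bern t (\<sigma> s)) has_derivative (\<lambda>h. h *\<^sub>R DBern t (\<sigma> s) (\<sigma> s * L))) (at s)"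
      using has_derivative_compose[OF \<sigma>d d] linear_scale[OF has_derivative_linear[OF d]] by simp
    then show "((\<lambda>s. Bern t (\<sigma> s)) has_derivative (\<lambda>h. h *\<^sub>R DBern t (\<sigma> s) (\<sigma> s * L))) (at s within {0..1})"
      by (rule has_derivative_at_withinI)
    have "om (\<sigma> s, t) = 0" using n n\<sigma>[OF s0] \<sigma>O[OF s0] by (simp add: vort_within_def)
    then have "\<bar>DBern t (\<sigma> s) (\<sigma> s * L)\<bar> = \<bar>Gt (\<sigma> s, t) \<bullet> (\<sigma> s * L)\<bar>" using DBern_eq[OF \<sigma>O[OF s0] t] by simp
    also have "\<dots> \<le> norm (Gt (\<sigma> s, t)) * norm (\<sigma> s * L)" by (rule Cauchy_Schwarz_ineq2)
    also have "\<dots> \<le> C / norm (\<sigma> s) * norm (\<sigma> s * L)" by (intro mult_right_mono C n\<sigma> s0) auto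
    also have "\<dots> = C * norm L" using order.strict_trans2[OF \<rho>(1) n\<sigma>[OF s0]] by (simp add: norm_mult)
    also have "\<dots> \<le> C * 5"
    proof (rule mult_left_mono[OF nL])
      have "0 \<le> C / norm (\<sigma> s)" using order_trans[OF norm_ge_zero C[OF n\<sigma>[OF s0]]] .
      then show "0 \<le> C" using order.strict_trans2[OF \<rho>(1) n\<sigma>[OF s0]] by (simp add: zero_le_divide_iff)
    qed
    finally show "onorm (\<lambda>h. h *\<^sub>R DBern t (\<sigma> s) (\<sigma> s * L)) \<le> 5 * C"
      by (intro onorm_le) (simp add: abs_mult mult.commute mult_left_mono)
  qed auto
  then show ?thesis by (simp add: e)
qed

text \<open>Differentiating under the integral gives the integral of \<open>2 bump (u \<bullet> u\<^sub>t) = - 2 bump (u \<bullet> \<nabla>B)\<close>. By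
  \<open>tangential_integral\<close> this equals the integral of \<open>2 q (u \<bullet> \<nabla>bump)\<close> where \<open>q = B - B(\<rho>)\<close>. There
  \<open>|q| \<le> 5 C\<close>, and \<open>u \<bullet> \<nabla>bump\<close> involves only the radial velocity and is at most \<open>3 C / \<rho>\<^sup>3\<close>; the
  annulus is contained in a disc of area \<open>9 \<pi> \<rho>\<^sup>2\<close>.\<close>
lemma E_loc_derivative_bound:
  assumes T0: "T0 > 0"
  obtains K \<rho>1 where "K \<ge> 0" "\<rho>1 > 0"
    "\<And>\<rho> t. \<rho> \<ge> \<rho>1 \<Longrightarrow> t \<in> {0<..<T0} \<Longrightarrow> \<exists>d. (E_loc \<rho> has_real_derivative d) (at t) \<and> \<bar>d\<bar> \<le> K / \<rho>"
proof -
  obtain \<rho>0 C where \<rho>0: "\<rho>0 > RA" and C: "C \<ge> 0" and vw: "\<And>t. 0 \<le> t \<Longrightarrow> t \<le> T0 \<Longrightarrow> vort_within \<rho>0 t"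
    and "\<And>t x. 0 \<le> t \<Longrightarrow> t \<le> T0 \<Longrightarrow> norm x \<ge> \<rho>0 \<Longrightarrow> norm (u t x) \<le> C / norm x"
    and CH: "\<And>t x. 0 \<le> t \<Longrightarrow> t \<le> T0 \<Longrightarrow> norm x \<ge> \<rho>0 \<Longrightarrow> norm (u t x - \<alpha> *\<^sub>R H x) \<le> C / (norm x)\<^sup>2"
    and Cx: "\<And>t x. 0 \<le> t \<Longrightarrow> t \<le> T0 \<Longrightarrow> norm x \<ge> \<rho>0 \<Longrightarrow> \<bar>x \<bullet> u t x\<bar> \<le> C / norm x"
    and Ct: "\<And>t x. 0 < t \<Longrightarrow> t < T0 \<Longrightarrow> norm x \<ge> \<rho>0 \<Longrightarrow> norm (Gt (x, t)) \<le> C / norm x"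
    and HH: "\<And>x. norm x \<ge> \<rho>0 \<Longrightarrow> norm (H x) \<le> C / norm x"
    by (fact far_field_estimates[OF T0])
  have \<rho>0p: "\<rho>0 > 0" using \<rho>0 RAB by simp
  show ?thesis
  proof (rule that[of "270 * pi * C\<^sup>2" "\<rho>0 + 1"])
    fix \<rho> t assume \<rho>: "\<rho> \<ge> \<rho>0 + 1" and tt: "t \<in> {0<..<T0}"
    have t: "0 < t" "t < T0" "0 \<le> t" "t \<le> T0" using tt by auto
    have \<rho>p: "\<rho> > 0" "\<rho> > \<rho>0" using \<rho> \<rho>0p by auto
    let ?b = "bump 0 \<rho> :: complex \<Rightarrow> real"
    obtain Mu where Mu: "Mu \<ge> 0" "\<And>x t. x \<in> \<Omega> \<Longrightarrow> norm x \<le> 2 * \<rho> \<Longrightarrow> 0 \<le> t \<Longrightarrow> t \<le> T0 \<Longrightarrow> norm (g (x, t)) \<le> Mu"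
      by (fact bounded_near[OF g_continuous, of "2 * \<rho>" T0])
    obtain Mt where Mt: "Mt \<ge> 0" "\<And>x t. x \<in> \<Omega> \<Longrightarrow> norm x \<le> 2 * \<rho> \<Longrightarrow> 0 \<le> t \<Longrightarrow> t \<le> T0 \<Longrightarrow> norm (Gt (x, t)) \<le> Mt"
      by (fact bounded_near[OF C1_on_continuous[OF C1_G(3)], of "2 * \<rho>" T0])
    have uGt: "\<bar>u \<tau> x \<bullet> Gt (x, \<tau>)\<bar> \<le> Mu * Mt" if "x \<in> \<Omega>" "norm x \<le> 2 * \<rho>" "0 \<le> \<tau>" "\<tau> \<le> T0" for x \<tau>
    proof -
      have "\<bar>u \<tau> x \<bullet> Gt (x, \<tau>)\<bar> \<le> norm (u \<tau> x) * norm (Gt (x, \<tau>))" by (rule Cauchy_Schwarz_ineq2)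
      also have "\<dots> \<le> Mu * Mt" using Mu(2)[OF that] Mt(2)[OF that] g_eq_Omega[OF that(1,3)] Mu(1) by (intro mult_mono) auto
      finally show ?thesis .
    qed
    define f' where "f' \<tau> x = indicator \<Omega> x * (?b x * (2 * (u \<tau> x \<bullet> Gt (x, \<tau>))))" for \<tau> x
    have der: "(E_loc \<rho> has_real_derivative (LINT x|lborel. f' t x)) (at t)"
      unfolding E_loc_def[abs_def]
    proof (rule has_real_derivative_integral[OF tt, where w="\<lambda>x. 2 * (Mu * Mt) * indicator (cball 0 (2 * \<rho>)) x"])
      fix \<tau> x assume \<tau>: "\<tau> \<in> {0<..<T0}"
      show "((\<lambda>\<tau>. indicator \<Omega> x * (?b x * dens \<tau> x)) has_real_derivative f' \<tau> x) (at \<tau>)"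
      proof (cases "x \<in> \<Omega>")
        case True
        have "x \<in> closure \<Omega>" using True closure_subset by blast
        then have ud: "((\<lambda>\<tau>. u \<tau> x) has_derivative (\<lambda>h. h *\<^sub>R Gt (x, \<tau>))) (at \<tau>)"
          using time_derivative[of x \<tau>] \<tau> by (simp add: has_vector_derivative_def)
        have "((\<lambda>\<tau>. u \<tau> x \<bullet> u \<tau> x) has_real_derivative 2 * (u \<tau> x \<bullet> Gt (x, \<tau>))) (at \<tau>)"
          unfolding has_field_derivative_def
          using has_derivative_inner[OF ud ud] by (rule has_derivative_eq_rhs) (simp add: fun_eq_iff inner_commute)
        then have "((\<lambda>\<tau>. dens \<tau> x) has_real_derivative 2 * (u \<tau> x \<bullet> Gt (x, \<tau>)) - 0) (at \<tau>)"
          unfolding dens_eq by (intro DERIV_diff DERIV_const)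
        then show ?thesis unfolding f'_def by (intro DERIV_cmult) simp
      qed (simp add: f'_def)
      show "\<bar>f' \<tau> x\<bar> \<le> 2 * (Mu * Mt) * indicator (cball 0 (2 * \<rho>)) x"
      proof (cases "x \<in> \<Omega> \<and> norm x \<le> 2 * \<rho>")
        case True
        then have "\<bar>u \<tau> x \<bullet> Gt (x, \<tau>)\<bar> \<le> Mu * Mt" using uGt[of x \<tau>] \<tau> by auto
        then have "\<bar>?b x\<bar> * \<bar>2 * (u \<tau> x \<bullet> Gt (x, \<tau>))\<bar> \<le> 1 * (2 * (Mu * Mt))"
          using bump_bounds[of 0 \<rho> x] by (intro mult_mono) auto
        then show ?thesis using True by (simp add: f'_def abs_mult)
      next
        case False
        then have "f' \<tau> x = 0" using bump_eq0[OF \<rho>p(1), of x 0] by (auto simp: f'_def)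
        then show ?thesis using Mu(1) Mt(1) by simp
      qed
      show "integrable lborel (\<lambda>x. indicator \<Omega> x * (?b x * dens \<tau> x))" using E_loc_integrable \<tau> by simp
    next
      show "integrable lborel (\<lambda>x::complex. 2 * (Mu * Mt) * indicator (cball 0 (2 * \<rho>)) x)"
        by (intro integrable_mult_right integrable_real_indicator) (auto intro!: emeasure_bounded_finite[unfolded infinity_ennreal_def])
    qed
    obtain W DW rW where W: "C1_on W DW UNIV" "\<And>x. norm x > rW \<Longrightarrow> W x = 0"
      "\<And>x. x \<in> \<Omega> \<union> \<Gamma> \<Longrightarrow> norm x \<le> 2 * \<rho> + 1 \<Longrightarrow> W x = u t x"
      "\<And>x v. x \<in> \<Omega> \<Longrightarrow> norm x < 2 * \<rho> + 1 \<Longrightarrow> DW x v = Dg (x, t) (v, 0)"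
      by (fact plane_extension[OF t(3), of "2 * \<rho> + 1"])
    have Wu: "W x = u t x" if "x \<in> \<Omega>" "norm x \<le> 2 * \<rho>" for x using W(3)[of x] that by simp
    define q where "q x = Bern t x - Bern t (of_real \<rho>)" for x
    have osc: "\<bar>q x\<bar> \<le> 5 * C" if "\<rho> \<le> norm x" "norm x \<le> 2 * \<rho>" for x
      unfolding q_def
      by (rule Bern_oscillation[OF t(1) \<rho>p(1) _ vw[OF t(3,4)] \<rho>p(2) Ct[OF t(1,2)] that]) (use \<rho> \<rho>0 in auto)
    have ann: "\<rho> \<le> norm x \<and> norm x \<le> 2 * \<rho>" if "bump' 0 \<rho> x v \<noteq> 0" for x v :: complex
      using bump'_zero[OF \<rho>p(1), of x 0 v] that by (cases "norm x \<le> \<rho> \<or> 2 * \<rho> \<le> norm x") auto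
    have uDB: "DBern t x (u t x) = - (u t x \<bullet> Gt (x, t))" if "x \<in> \<Omega>" for x
      using DBern_eq[OF that t(1), of "u t x"] by (simp add: inner_commute)
    have tang: "(LINT x:\<Omega>|lborel. ?b x * DBern t x (W x) + q x * bump' 0 \<rho> x (W x)) = 0"
    proof (rule tangential_integral[OF open_Omega Omega_Gamma closed_Omega_Gamma W(1,2), where \<rho>="2 * \<rho>" and B="max (5 * C) (Mu * Mt)"])
      show "Re (DW x 1) + Im (DW x \<i>) = 0" if "x \<in> \<Omega>" "norm x \<le> 2 * \<rho>" for x
        using div_zero[OF that(1) t(3)] W(4)[of x] that by (simp add: G1_def G2_def)
      show "W (\<gamma> s) \<bullet> (\<i> * dloop s) = 0" for s
      proof -
        have gG: "\<gamma> s \<in> \<Gamma>" by (rule gamma_in_Gamma)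
        have "\<gamma> s \<notin> \<Omega>" using Omega_Gamma gG by blast
        then have "norm (\<gamma> s) < r0" using r0(2)[of "\<gamma> s"] by force
        then have "norm (\<gamma> s) \<le> 2 * \<rho> + 1" using \<rho> \<rho>0 RAB by linarith
        then have "W (\<gamma> s) = u t (\<gamma> s)" by (intro W(3) UnI2 gG)
        then show ?thesis using tangent_u[OF t(3)] by simp
      qed
      show "C1_on ?b (bump' 0 \<rho>) UNIV" by (rule C1_on_bump)
      show "?b x = 0" if "norm x > 2 * \<rho>" for x using bump_eq0[OF \<rho>p(1), of x 0] that by simp
      have "C1_on q (\<lambda>x v. DBern t x v - 0) \<Omega>"
        unfolding q_def[abs_def] by (intro C1_on_diff C1_Bern t C1_on_const)
      then show "C1_on q (DBern t) \<Omega>" by simp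
      show "\<bar>q x\<bar> \<le> max (5 * C) (Mu * Mt)" if "bump' 0 \<rho> x (W x) \<noteq> 0" for x
        using osc ann[OF that] by (simp add: max.coboundedI1)
      show "\<bar>DBern t x (W x)\<bar> \<le> max (5 * C) (Mu * Mt)" if "x \<in> \<Omega>" "norm x \<le> 2 * \<rho>" for x
        using uGt[OF that t(3,4)] uDB[OF that(1)] Wu[OF that] by (simp add: max.coboundedI2)
      show "0 \<le> max (5 * C) (Mu * Mt)" using C by (simp add: max.coboundedI1)
    qed
    have DWc: "continuous_on \<Omega> (\<lambda>x. bump' 0 \<rho> x (W x))"
      by (rule continuous_on_C1_apply[OF C1_on_bump[of 0 \<rho> UNIV] continuous_on_id _ continuous_on_subset[OF C1_on_continuous[OF W(1)]]]) auto
    have qc: "continuous_on \<Omega> q" unfolding q_def using C1_on_continuous[OF C1_Bern[OF t(1)]] by (intro continuous_intros)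
    define k where "k x = indicator \<Omega> x * (q x * bump' 0 \<rho> x (W x))" for x
    have km: "k \<in> borel_measurable borel"
      using borel_measurable_continuous_on_indicator[of \<Omega> "\<lambda>x. q x * bump' 0 \<rho> x (W x)"] open_Omega qc DWc
      unfolding k_def[abs_def] by (simp add: continuous_on_mult)
    have kb: "\<bar>k x\<bar> \<le> 15 * C\<^sup>2 / \<rho> ^ 3 * indicator (ball 0 (3 * \<rho>)) x" for x
    proof (cases "x \<in> \<Omega> \<and> bump' 0 \<rho> x (W x) \<noteq> 0")
      case True
      then have x: "\<rho> \<le> norm x" "norm x \<le> 2 * \<rho>" "x \<in> \<Omega>" using ann by auto
      have "\<bar>2 * (x \<bullet> W x) / (3 * \<rho>\<^sup>2)\<bar> = 2 * \<bar>x \<bullet> u t x\<bar> / (3 * \<rho>\<^sup>2)" using Wu[OF x(3,2)] by (simp add: abs_mult)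
      also have "\<dots> \<le> 2 * (C / \<rho>) / (3 * \<rho>\<^sup>2)"
      proof -
        have "\<bar>x \<bullet> u t x\<bar> \<le> C / norm x" using Cx[OF t(3,4)] x \<rho>p by simp
        also have "\<dots> \<le> C / \<rho>" using x C \<rho>p by (intro divide_left_mono mult_pos_pos) auto
        finally show ?thesis by (intro divide_right_mono mult_left_mono) auto
      qed
      finally have "\<bar>bump' 0 \<rho> x (W x)\<bar> \<le> 4 * (2 * (C / \<rho>) / (3 * \<rho>\<^sup>2))"
        unfolding bump'_def abs_mult[of "step' _"] by (intro mult_mono abs_step'_le) auto
      also have "\<dots> = (8 / 3) * (C / \<rho> ^ 3)" by (simp add: power2_eq_square power3_eq_cube)
      also have "\<dots> \<le> 3 * (C / \<rho> ^ 3)" using C \<rho>p by (intro mult_right_mono) auto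
      finally have "\<bar>q x\<bar> * \<bar>bump' 0 \<rho> x (W x)\<bar> \<le> (5 * C) * (3 * (C / \<rho> ^ 3))"
        using osc[OF x(1,2)] C by (intro mult_mono) auto
      also have "\<dots> = 15 * C\<^sup>2 / \<rho> ^ 3" by (simp add: power2_eq_square)
      finally show ?thesis using x \<rho>p by (simp add: k_def abs_mult)
    next
      case False
      then have "k x = 0" by (auto simp: k_def)
      then show ?thesis using \<rho>p by simp
    qed
    have bi: "integrable lborel (\<lambda>x::complex. 15 * C\<^sup>2 / \<rho> ^ 3 * indicator (ball 0 (3 * \<rho>)) x)"
      by (intro integrable_mult_right integrable_real_indicator) (auto intro!: emeasure_bounded_finite[unfolded infinity_ennreal_def])
    have ki: "integrable lborel k"
      by (rule Bochner_Integration.integrable_bound[OF bi]) (use km kb \<rho>p in \<open>auto intro!: AE_I2 simp: abs_mult\<close>)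
    have kI: "\<bar>LINT x|lborel. k x\<bar> \<le> 135 * pi * C\<^sup>2 / \<rho>"
    proof -
      have "\<bar>LINT x|lborel. k x\<bar> \<le> (LINT x|lborel. \<bar>k x\<bar>)" by (rule integral_abs_bound)
      also have "\<dots> \<le> (LINT x|lborel. 15 * C\<^sup>2 / \<rho> ^ 3 * indicator (ball (0::complex) (3 * \<rho>)) x)"
        using ki bi kb by (intro integral_mono) auto
      also have "\<dots> = 15 * C\<^sup>2 / \<rho> ^ 3 * (pi * (3 * \<rho>)\<^sup>2)"
        using emeasure_ball_complex[of "3 * \<rho>" 0] \<rho>p by (simp add: measure_def)
      also have "\<dots> = 135 * pi * C\<^sup>2 / \<rho>" using \<rho>p by (simp add: power2_eq_square power3_eq_cube)
      finally show ?thesis .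
    qed
    have "(LINT x|lborel. f' t x) = (LINT x|lborel. 2 * k x - 2 * (indicator \<Omega> x *\<^sub>R (?b x * DBern t x (W x) + q x * bump' 0 \<rho> x (W x))))"
    proof (rule Bochner_Integration.integral_cong[OF refl])
      fix x
      show "f' t x = 2 * k x - 2 * (indicator \<Omega> x *\<^sub>R (?b x * DBern t x (W x) + q x * bump' 0 \<rho> x (W x)))"
      proof (cases "x \<in> \<Omega> \<and> norm x \<le> 2 * \<rho>")
        case True
        then show ?thesis using Wu[of x] uDB[of x] by (simp add: f'_def k_def algebra_simps)
      next
        case False
        then show ?thesis using bump_eq0[OF \<rho>p(1), of x 0] by (auto simp: f'_def k_def)
      qed
    qed
    also have "\<dots> = 2 * (LINT x|lborel. k x) - 2 * (LINT x|lborel. indicator \<Omega> x *\<^sub>R (?b x * DBern t x (W x) + q x * bump' 0 \<rho> x (W x)))"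
    proof -
      have "integrable lborel (\<lambda>x. indicator \<Omega> x *\<^sub>R (?b x * DBern t x (W x) + q x * bump' 0 \<rho> x (W x)))"
      proof -
        have "(\<lambda>x. indicator \<Omega> x *\<^sub>R (?b x * DBern t x (W x))) \<in> borel_measurable borel"
          using open_Omega by (intro borel_measurable_continuous_on_indicator continuous_on_mult bump_continuous
            continuous_on_C1_apply[OF C1_Bern[OF t(1)] continuous_on_id] continuous_on_subset[OF C1_on_continuous[OF W(1)]]) auto
        then have m: "(\<lambda>x. indicator \<Omega> x * (?b x * DBern t x (W x))) \<in> borel_measurable lborel" by simp
        have "integrable lborel (\<lambda>x. indicator \<Omega> x * (?b x * DBern t x (W x)))"
        proof (rule Bochner_Integration.integrable_bound[OF _ m])
          show "integrable lborel (\<lambda>x::complex. Mu * Mt * indicator (cball 0 (2 * \<rho>)) x)"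
            by (intro integrable_mult_right integrable_real_indicator) (auto intro!: emeasure_bounded_finite[unfolded infinity_ennreal_def])
          show "AE x in lborel. norm (indicator \<Omega> x * (?b x * DBern t x (W x))) \<le> norm (Mu * Mt * indicator (cball 0 (2 * \<rho>)) x)"
          proof (rule AE_I2)
            fix x
            show "norm (indicator \<Omega> x * (?b x * DBern t x (W x))) \<le> norm (Mu * Mt * indicator (cball 0 (2 * \<rho>)) x)"
            proof (cases "x \<in> \<Omega> \<and> norm x \<le> 2 * \<rho>")
              case True
              then have "\<bar>DBern t x (W x)\<bar> \<le> Mu * Mt" using uGt[of x t] t uDB[of x] Wu[of x] by simp
              then have "\<bar>?b x\<bar> * \<bar>DBern t x (W x)\<bar> \<le> 1 * (Mu * Mt)"
                using bump_bounds[of 0 \<rho> x] by (intro mult_mono) auto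
              then show ?thesis using True Mu(1) Mt(1) by (simp add: abs_mult)
            next
              case False
              then show ?thesis using bump_eq0[OF \<rho>p(1), of x 0] by (auto simp: indicator_def)
            qed
          qed
        qed
        from Bochner_Integration.integrable_add[OF this ki] show ?thesis
          by (simp add: k_def distrib_left)
      qed
      then show ?thesis using ki by simp
    qed
    also have "\<dots> = 2 * (LINT x|lborel. k x)" using tang by (simp add: set_lebesgue_integral_def)
    finally have "\<bar>LINT x|lborel. f' t x\<bar> \<le> 270 * pi * C\<^sup>2 / \<rho>" using kI by simp
    then show "\<exists>d. (E_loc \<rho> has_real_derivative d) (at t) \<and> \<bar>d\<bar> \<le> 270 * pi * C\<^sup>2 / \<rho>" using der by blast
  qed (use \<rho>0p in auto)
qed

text \<open>The derivative bound holds at positive times only, because the momentum equation is imposed there;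
  continuity at time 0 links the two.\<close>
lemma E_loc_continuous_0:
  assumes t: "t > 0"
  shows "(\<lambda>n. E_loc \<rho> (t / real (n + 2))) \<longlonglongrightarrow> E_loc \<rho> 0"
proof -
  obtain w where w: "integrable lborel w" "\<And>s x. 0 \<le> s \<Longrightarrow> s \<le> t \<Longrightarrow> x \<in> \<Omega> \<Longrightarrow> \<bar>dens s x\<bar> \<le> w x" "\<And>x. w x \<ge> 0"
    using dens_dominated[OF t] by metis
  define s where "s n = t / real (n + 2)" for n
  have s: "0 \<le> s n" "s n \<le> t" for n
  proof -
    show "0 \<le> s n" using t by (simp add: s_def)
    have "t * 1 \<le> t * real (n + 2)" using t by (intro mult_left_mono) auto
    then show "s n \<le> t" by (simp add: s_def divide_le_eq)
  qed
  have s0: "s \<longlonglongrightarrow> 0" unfolding s_def by real_asymp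
  have "(\<lambda>n. E_loc \<rho> (s n)) \<longlonglongrightarrow> E_loc \<rho> 0"
    unfolding E_loc_def
  proof (rule integral_dominated_convergence[OF _ _ w(1)])
    show "(\<lambda>x. indicator \<Omega> x * (bump 0 \<rho> x * dens 0 x)) \<in> borel_measurable lborel"
      "(\<lambda>x. indicator \<Omega> x * (bump 0 \<rho> x * dens (s n) x)) \<in> borel_measurable lborel" for n
      using E_loc_integrable s by (auto intro: borel_measurable_integrable)
    show "AE x in lborel. norm (indicator \<Omega> x * (bump 0 \<rho> x * dens (s n) x)) \<le> w x" for n
    proof (rule AE_I2)
      fix x
      have "bump 0 \<rho> x * \<bar>dens (s n) x\<bar> \<le> 1 * \<bar>dens (s n) x\<bar>" using bump_bounds[of 0 \<rho> x] by (intro mult_right_mono) auto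
      then show "norm (indicator \<Omega> x * (bump 0 \<rho> x * dens (s n) x)) \<le> w x"
        using w(2)[OF s, of x n] w(3)[of x] bump_bounds[of 0 \<rho> x] by (cases "x \<in> \<Omega>") (simp_all add: abs_mult)
    qed
    show "AE x in lborel. (\<lambda>n. indicator \<Omega> x * (bump 0 \<rho> x * dens (s n) x)) \<longlonglongrightarrow> indicator \<Omega> x * (bump 0 \<rho> x * dens 0 x)"
    proof (rule AE_I2)
      fix x
      show "(\<lambda>n. indicator \<Omega> x * (bump 0 \<rho> x * dens (s n) x)) \<longlonglongrightarrow> indicator \<Omega> x * (bump 0 \<rho> x * dens 0 x)"
      proof (cases "x \<in> \<Omega>")
        case True
        have "(\<lambda>n. (x, s n)) \<longlonglongrightarrow> (x, 0)" by (intro tendsto_intros s0)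
        then have "(\<lambda>n. g (x, s n)) \<longlonglongrightarrow> g (x, 0)"
          using U_I[OF True] s by (intro continuous_on_tendsto_compose[OF g_continuous]) auto
        then have "(\<lambda>n. u (s n) x) \<longlonglongrightarrow> u 0 x" using g_eq_Omega[OF True] s by simp
        then show ?thesis unfolding dens_eq by (intro tendsto_intros)
      qed simp
    qed
  qed
  then show ?thesis by (simp add: s_def)
qed

theorem energy_conserved:
  assumes t: "t \<ge> 0"
  shows "generalized_energy \<gamma> T u t = generalized_energy \<gamma> T u 0"
proof (cases "t = 0")
  case False
  then have t0: "t > 0" using t by simp
  then have "t + 1 > 0" by simp
  then obtain K \<rho>1 where K: "K \<ge> 0" "\<rho>1 > 0"
    "\<And>\<rho> t'. \<rho> \<ge> \<rho>1 \<Longrightarrow> t' \<in> {0<..<t + 1} \<Longrightarrow> \<exists>d. (E_loc \<rho> has_real_derivative d) (at t') \<and> \<bar>d\<bar> \<le> K / \<rho>"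
    using E_loc_derivative_bound[of "t + 1"] by metis
  have est: "\<bar>E_loc \<rho> t - E_loc \<rho> 0\<bar> \<le> K / \<rho> * t" if \<rho>: "\<rho> \<ge> \<rho>1" for \<rho>
  proof -
    obtain d where d: "\<And>t'. t' \<in> {0<..<t + 1} \<Longrightarrow> (E_loc \<rho> has_real_derivative d t') (at t') \<and> \<bar>d t'\<bar> \<le> K / \<rho>"
      using K(3)[OF \<rho>] by metis
    have "\<bar>E_loc \<rho> t - E_loc \<rho> (t / real (n + 2))\<bar> \<le> K / \<rho> * t" for n
    proof -
      let ?s = "t / real (n + 2)"
      have s: "0 < ?s" "?s \<le> t"
      proof -
        show "0 < ?s" using t0 by simp
        have "t * 1 \<le> t * real (n + 2)" using t by (intro mult_left_mono) auto
        then show "?s \<le> t" by (simp add: divide_le_eq)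
      qed
      have "norm (E_loc \<rho> t - E_loc \<rho> ?s) \<le> K / \<rho> * norm (t - ?s)"
      proof (rule differentiable_bound[of "{?s..t}" _ "\<lambda>\<tau> h. d \<tau> * h"])
        fix \<tau> assume \<tau>: "\<tau> \<in> {?s..t}"
        then have \<tau>': "\<tau> \<in> {0<..<t + 1}" using s by auto
        show "(E_loc \<rho> has_derivative (\<lambda>h. d \<tau> * h)) (at \<tau> within {?s..t})"
          using d[OF \<tau>'] by (simp add: has_field_derivative_def has_derivative_at_withinI)
        show "onorm (\<lambda>h. d \<tau> * h) \<le> K / \<rho>"
        proof (rule onorm_le)
          fix h show "norm (d \<tau> * h) \<le> K / \<rho> * norm h"
            unfolding norm_mult using d[OF \<tau>'] by (intro mult_right_mono) auto
        qed
      qed (use s in auto)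
      also have "\<dots> \<le> K / \<rho> * t"
        using s K \<rho> by (intro mult_left_mono) auto
      finally show ?thesis by simp
    qed
    moreover have "(\<lambda>n. \<bar>E_loc \<rho> t - E_loc \<rho> (t / real (n + 2))\<bar>) \<longlonglongrightarrow> \<bar>E_loc \<rho> t - E_loc \<rho> 0\<bar>"
      by (intro tendsto_intros E_loc_continuous_0 t0)
    ultimately show ?thesis by (intro LIMSEQ_le_const2[of _ _ "K / \<rho> * t"]) auto
  qed
  have "(\<lambda>n. \<bar>E_loc (real (Suc n)) t - E_loc (real (Suc n)) 0\<bar>) \<longlonglongrightarrow> \<bar>generalized_energy \<gamma> T u t - generalized_energy \<gamma> T u 0\<bar>"
    by (intro tendsto_intros E_loc_limit t) auto
  moreover have "(\<lambda>n. K / real (Suc n) * t) \<longlonglongrightarrow> 0" by real_asymp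
  moreover have "\<exists>N. \<forall>n\<ge>N. \<bar>E_loc (real (Suc n)) t - E_loc (real (Suc n)) 0\<bar> \<le> K / real (Suc n) * t"
  proof -
    obtain N where N: "\<rho>1 \<le> real N" using real_arch_simple by blast
    have "\<bar>E_loc (real (Suc n)) t - E_loc (real (Suc n)) 0\<bar> \<le> K / real (Suc n) * t" if "n \<ge> N" for n
      by (rule est) (use N that in linarith)
    then show ?thesis by blast
  qed
  ultimately have "\<bar>generalized_energy \<gamma> T u t - generalized_energy \<gamma> T u 0\<bar> \<le> 0" by (rule LIMSEQ_le)
  then show ?thesis by simp
qed simp

end

theorem proposition5:
  fixes \<gamma> :: "real \<Rightarrow> complex"
    and T :: "complex \<Rightarrow> complex"
    and u :: "real \<Rightarrow> complex \<Rightarrow> complex"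
    and p :: "real \<Rightarrow> complex \<Rightarrow> real"
  assumes "smooth_jordan_curve \<gamma>"
    and "exterior_conformal_map \<gamma> T"
    and "smooth_euler_solution \<gamma> u p"
    and "compactly_supported_vorticity \<gamma> u"
  shows "\<forall>t\<ge>0. set_integrable lborel (exterior \<gamma>) (energy_density \<gamma> T u t) \<and>
               generalized_energy \<gamma> T u t = generalized_energy \<gamma> T u 0"
proof -
  interpret euler_exterior \<gamma> T u p using assms by unfold_locales
  show ?thesis
  proof (intro allI impI conjI)
    fix t :: real assume t: "t \<ge> 0"
    show "set_integrable lborel (exterior \<gamma>) (energy_density \<gamma> T u t)"
      unfolding set_integrable_def by (rule dens_integrable[OF t])
    show "generalized_energy \<gamma> T u t = generalized_energy \<gamma> T u 0" by (rule energy_conserved[OF t])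
  qed
qed

end
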